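(* Let $\mathbb{F}$ be an infinite field, let $n$ be a positive integer, and let $H\leq G\leq \mathrm{GL}(n,\mathbb{F})$, where $G$ is finitely generated and of finite Prüfer rank. Then $|G:H|$ is finite if and only if $\mathrm{h}(H)=\mathrm{h}(G)$.
   Context: A group $G$ has finite Prüfer rank $\mathrm{rk}(G)$ if each finitely generated subgroup of $G$ can be generated by $\mathrm{rk}(G)$ elements, and $\mathrm{rk}(G)$ is the least such integer. A group has finite torsion-free rank if it has a subnormal series of finite length whose factors are either periodic (torsion) or infinite cyclic; the number $\mathrm{h}(G)$ of infinite cyclic factors in such a series is the Hirsch number, or torsion-free rank, of $G$ (independent of the series). A linear group of finite Prüfer rank is solvable-by-finite, and a solvable-by-finite group of finite Prüfer rank has finite torsion-free rank, so $\mathrm{h}(G)$ and $\mathrm{h}(H)$ are defined. *)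

theory Defs
  imports "HOL-Algebra.Elementary_Groups" "Jordan_Normal_Form.Matrix"
begin

definition GL :: "nat \<Rightarrow> 'f::field mat monoid"
  where "GL n = units_of (ring_mat TYPE('f) n ())"

definition finitely_generated_group :: "('a, 'b) monoid_scheme \<Rightarrow> bool"
  where "finitely_generated_group G \<longleftrightarrow>
    (\<exists>S. finite S \<and> S \<subseteq> carrier G \<and> generate G S = carrier G)"

text \<open>The least \<open>r\<close> below is the rank. A generating set has at most (rather than exactly) \<open>r\<close>
  members because \<open>r\<close> generators need not be distinct.\<close>

definition finite_Pruefer_rank :: "('a, 'b) monoid_scheme \<Rightarrow> bool"
  where "finite_Pruefer_rank G \<longleftrightarrow>
    (\<exists>r::nat. \<forall>K. subgroup K G \<and> finitely_generated_group (G\<lparr>carrier := K\<rparr>) \<longrightarrow>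
      (\<exists>S. finite S \<and> card S \<le> r \<and> S \<subseteq> K \<and> generate G S = K))"

definition periodic_group :: "('a, 'b) monoid_scheme \<Rightarrow> bool"
  where "periodic_group G \<longleftrightarrow>
    (\<forall>x\<in>carrier G. \<exists>k::nat. k > 0 \<and> x [^]\<^bsub>G\<^esub> k = \<one>\<^bsub>G\<^esub>)"

definition infinite_cyclic_group :: "('a, 'b) monoid_scheme \<Rightarrow> bool"
  where "infinite_cyclic_group G \<longleftrightarrow> cyclic_group G \<and> infinite (carrier G)"

definition series_factor :: "('a, 'b) monoid_scheme \<Rightarrow> (nat \<Rightarrow> 'a set) \<Rightarrow> nat \<Rightarrow> 'a set monoid"
  where "series_factor G N i = (G\<lparr>carrier := N (Suc i)\<rparr>) Mod (N i)"

text \<open>Only the values \<open>N 0, \<dots>, N m\<close> matter.\<close>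

definition torsion_free_rank_series :: "('a, 'b) monoid_scheme \<Rightarrow> nat \<Rightarrow> (nat \<Rightarrow> 'a set) \<Rightarrow> bool"
  where "torsion_free_rank_series G m N \<longleftrightarrow>
    N 0 = {\<one>\<^bsub>G\<^esub>} \<and> N m = carrier G \<and>
    (\<forall>i\<le>m. subgroup (N i) G) \<and>
    (\<forall>i<m. N i \<lhd> G\<lparr>carrier := N (Suc i)\<rparr> \<and>
      (periodic_group (series_factor G N i) \<or> infinite_cyclic_group (series_factor G N i)))"

text \<open>The number of infinite cyclic factors is the same in all such series, so the description
  determines a number as soon as some series exists; it is unspecified for groups
  not of finite torsion-free rank.\<close>

definition Hirsch_number :: "('a, 'b) monoid_scheme \<Rightarrow> nat"
  where "Hirsch_number G =
    (THE h. \<exists>m N. torsion_free_rank_series G m N \<and>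
       h = card {i. i < m \<and> infinite_cyclic_group (series_factor G N i)})"

end

theory Submission
  imports
    Defs
    "HOL-Algebra.Sylow"
    "HOL-Algebra.Zassenhaus"
    "HOL-Algebra.Algebraic_Closure_Type"
    "HOL-Number_Theory.Cong"
    "HOL-Library.Function_Algebras"
    "Berlekamp_Zassenhaus.Finite_Field"
begin

text \<open>
  Let \<open>G\<close> be finitely generated, linear of degree \<open>n\<close> and of rank \<open>r\<close>. Then \<open>G\<close> is residually a finite
  linear group of degree \<open>n\<close>, as its entries generate a domain whose nonzero elements survive in finite
  fields. A Sylow \<open>l\<close>-subgroup of a finite quotient of \<open>G\<close> has at most \<open>l\<^sup>r\<close> characters of order \<open>l\<close>; where
  this number is maximal, Tate's theorem yields a normal subgroup \<open>V\<close> of finite index all of whose finite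
  quotients retract onto Sylow \<open>l\<close>-subgroups with kernel of order prime to \<open>l\<close>, for all primes \<open>l \<le> n\<close>
  at once. A finite linear group of degree \<open>n\<close> with such retractions has derived length at most \<open>4n + 1\<close>: its
  \<open>l\<close>-subgroups have derived length at most \<open>2n\<close>, and Burnside's transfer theorem shows that the derived
  subgroup of the common kernel of the retractions, which has order coprime to \<open>n!\<close>, is a \<open>p\<close>-group
  in characteristic \<open>p\<close>. Hence \<open>V\<close> is solvable.

  Refine the derived series of \<open>V\<close> to a series of \<open>G\<close> with torsion and infinite cyclic factors. Intersecting
  it with \<open>H\<close> shows that \<open>h(H) = h(G)\<close> iff \<open>H\<close> meets every infinite cyclic factor, which is clear if \<open>|G:H|\<close> is
  finite. Conversely, it makes \<open>B/A(H \<inter> B)\<close> a torsion group for consecutive terms \<open>A \<le> B\<close> of the derived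
  series of \<open>V\<close>. If \<open>BH\<close> has finite index, then it is finitely generated, so this torsion group has finite
  exponent, hence is finite by the rank condition, and \<open>AH\<close> has finite index too. Descend from \<open>V\<close> to \<open>1\<close>.
\<close>

text \<open>What shapes the argument is uniformity. Triviality of a derived term of V is only seen
  in finite quotients, so one bound on the derived length has to hold in all reductions, and V has
  to be fixed before any reduction is chosen; this is why Tate's theorem is fed by a count of
  characters that is maximal over all finite quotients. The primes l \<le> n are singled out because
  a group acting on n-space permutes at most n weights of an abelian normal subgroup, and an order
  coprime to n! forces it to fix each of them. The constant 4n + 1 is 2n + 1 + 2n: down to the
  common kernel of the retractions, to its derived subgroup, to 1. The rank enters three times: as
  the bound p^r on characters, as a bound on the infinite cyclic factors of an abelian section, and
  in bounding abelian sections of finite exponent. Linear actions are studied on sections W/U by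
  congruences modulo U, and sections of p-groups by commutators modulo N, so that those inductions
  stay in the ambient space or group.\<close>

hide_const (open) Divisibility.prime Polynomials.degree Polynomials.lead_coeff up_ring.coeff up_ring.monom
  module.smult
no_notation Polynomials.var (\<open>X\<index>\<close>)

subsection \<open>Finite \<open>p\<close>-groups and Sylow subgroups\<close>

context group begin

abbreviation conj_by :: "'a \<Rightarrow> 'a \<Rightarrow> 'a"
  where "conj_by g x \<equiv> g \<otimes> x \<otimes> inv g"

abbreviation commutator :: "'a \<Rightarrow> 'a \<Rightarrow> 'a"
  where "commutator x y \<equiv> x \<otimes> y \<otimes> inv x \<otimes> inv y"

lemma inv_mult_cancel [simp]:
  "\<lbrakk>x \<in> carrier G; y \<in> carrier G\<rbrakk> \<Longrightarrow> inv x \<otimes> (x \<otimes> y) = y"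
  "\<lbrakk>x \<in> carrier G; y \<in> carrier G\<rbrakk> \<Longrightarrow> x \<otimes> (inv x \<otimes> y) = y"
  by (simp_all add: m_assoc [symmetric])

text \<open>Orbit-stabiliser: the fibres of \<open>\<lambda>g. \<phi> g x\<close> over the orbit are
  left translates of the stabiliser. The action laws are asked for at \<open>x\<close> only, because
  later \<open>\<phi>\<close> acts on a set of cosets and not on its whole type.\<close>

lemma card_orbit_dvd:
  assumes P: "subgroup P G" "finite P"
    and one: "\<phi> \<one> x = x"
    and mult: "\<And>g h. g \<in> P \<Longrightarrow> h \<in> P \<Longrightarrow> \<phi> (g \<otimes> h) x = \<phi> g (\<phi> h x)"
  shows "card P = card ((\<lambda>g. \<phi> g x) ` P) * card {g \<in> P. \<phi> g x = x}"
proof -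
  interpret P: subgroup P G by fact
  let ?O = "(\<lambda>g. \<phi> g x) ` P"
  have fib: "card {g \<in> P. \<phi> g x = y} = card {g \<in> P. \<phi> g x = x}" if y: "y \<in> ?O" for y
  proof -
    obtain h where h: "h \<in> P" "y = \<phi> h x" using y by auto
    have hi: "\<phi> (inv h) (\<phi> h x) = x" using mult[of "inv h" h] h one by simp
    have "bij_betw (\<lambda>g. h \<otimes> g) {g \<in> P. \<phi> g x = x} {g \<in> P. \<phi> g x = y}"
    proof (rule bij_betw_byWitness[where f' = "\<lambda>g. inv h \<otimes> g"])
      show "(\<otimes>) h ` {g \<in> P. \<phi> g x = x} \<subseteq> {g \<in> P. \<phi> g x = y}" using h by (auto simp: mult)
      show "(\<otimes>) (inv h) ` {g \<in> P. \<phi> g x = y} \<subseteq> {g \<in> P. \<phi> g x = x}" using h hi by (auto simp: mult)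
    qed (use h in auto)
    then show ?thesis by (simp add: bij_betw_same_card)
  qed
  have "card P = (\<Sum>y\<in>?O. card {g \<in> P. \<phi> g x = y})"
    using sum.image_gen[OF P(2), of "\<lambda>_. 1::nat" "\<lambda>g. \<phi> g x"] by simp
  also have "\<dots> = (\<Sum>y\<in>?O. card {g \<in> P. \<phi> g x = x})" using fib by simp
  finally show ?thesis by simp
qed

text \<open>A non-trivial orbit has size a power of \<open>p\<close> other than 1, hence divisible
  by \<open>p\<close>; removing one such orbit changes neither the fixed points nor the size modulo
  \<open>p\<close>.\<close>

lemma p_group_fixed_points:
  assumes P: "subgroup P G" "card P = p ^ a" and p: "prime (p::nat)" and fin: "finite \<Xi>"
    and cl: "\<And>g x. g \<in> P \<Longrightarrow> x \<in> \<Xi> \<Longrightarrow> \<phi> g x \<in> \<Xi>"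
    and one: "\<And>x. x \<in> \<Xi> \<Longrightarrow> \<phi> \<one> x = x"
    and mult: "\<And>g h x. g \<in> P \<Longrightarrow> h \<in> P \<Longrightarrow> x \<in> \<Xi> \<Longrightarrow> \<phi> (g \<otimes> h) x = \<phi> g (\<phi> h x)"
  shows "card {x \<in> \<Xi>. \<forall>g\<in>P. \<phi> g x = x} mod p = card \<Xi> mod p"
  using fin cl one mult
proof (induction "card \<Xi>" arbitrary: \<Xi> rule: less_induct)
  case less
  interpret P: subgroup P G by fact
  have "finite P" using P(2) p by (metis card.infinite not_prime_0 power_not_zero)
  show ?case
  proof (cases "\<forall>x\<in>\<Xi>. \<forall>g\<in>P. \<phi> g x = x")
    case True
    then have "{x \<in> \<Xi>. \<forall>g\<in>P. \<phi> g x = x} = \<Xi>" by auto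
    then show ?thesis by simp
  next
    case False
    then obtain x g0 where x: "x \<in> \<Xi>" "g0 \<in> P" "\<phi> g0 x \<noteq> x" by auto
    let ?O = "(\<lambda>g. \<phi> g x) ` P"
    have O: "?O \<subseteq> \<Xi>" "x \<in> ?O" "finite ?O"
      using less.prems x \<open>finite P\<close> by (auto intro!: image_eqI[of _ _ \<one>])
    have "card P = card ?O * card {g \<in> P. \<phi> g x = x}"
      by (rule card_orbit_dvd) (use less.prems x P \<open>finite P\<close> in auto)
    then have "card ?O dvd p ^ a" using P(2) by (metis dvd_triv_left)
    moreover have "card ?O \<noteq> 1"
      by (metis O(2) card_1_singletonE imageI singletonD x(2,3))
    ultimately have pO: "p dvd card ?O"
      by (metis divides_primepow_nat p dvd_power gr0I power_0)
    \<comment> \<open>The orbit is invariant in both directions, so its complement is again closed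
      under the action and the induction hypothesis applies to it.\<close>
    have inv: "\<phi> g y \<in> ?O \<longleftrightarrow> y \<in> ?O" if "g \<in> P" "y \<in> \<Xi>" for g y
    proof
      assume "\<phi> g y \<in> ?O"
      then obtain h where h: "h \<in> P" "\<phi> g y = \<phi> h x" by auto
      have "y = \<phi> (inv g \<otimes> g) y" using that less.prems(3) by simp
      also have "\<dots> = \<phi> (inv g) (\<phi> h x)" using that less.prems(4)[of "inv g" g y] h by simp
      also have "\<dots> = \<phi> (inv g \<otimes> h) x" using that h x less.prems(4)[of "inv g" h x] by simp
      finally show "y \<in> ?O" using that h by auto
    next
      assume "y \<in> ?O"
      then obtain h where h: "h \<in> P" "y = \<phi> h x" by auto
      then have "\<phi> g y = \<phi> (g \<otimes> h) x" using that x less.prems(4)[of g h x] by simp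
      then show "\<phi> g y \<in> ?O" using that h by auto
    qed
    let ?R = "\<Xi> - ?O"
    have "card {x \<in> ?R. \<forall>g\<in>P. \<phi> g x = x} mod p = card ?R mod p"
    proof (rule less.hyps)
      show "card ?R < card \<Xi>" using O less.prems(1) by (metis Diff_iff x(1) card_Diff1_less card_mono finite_Diff
          Diff_subset psubset_card_mono psubsetI)
    qed (use less.prems inv in auto)
    moreover have "{x \<in> ?R. \<forall>g\<in>P. \<phi> g x = x} = {x \<in> \<Xi>. \<forall>g\<in>P. \<phi> g x = x}"
    proof -
      have "y \<notin> ?O" if y: "y \<in> \<Xi>" "\<forall>g\<in>P. \<phi> g y = y" for y
      proof
        assume "y \<in> ?O"
        then obtain h where h: "h \<in> P" "y = \<phi> h x" by auto
        have "x = \<phi> (inv h \<otimes> h) x" using x h less.prems(3) by simp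
        also have "\<dots> = \<phi> (inv h) y" using x h less.prems(4)[of "inv h" h x] by simp
        also have "\<dots> = y" using y h by simp
        finally show False using x y by auto
      qed
      then show ?thesis by auto
    qed
    moreover have "card \<Xi> = card ?R + card ?O"
      using O less.prems(1) by (metis card_Diff_subset card_mono le_add_diff_inverse2)
    ultimately show ?thesis using pO by auto
  qed
qed

section \<open>Normal sections of finite p-groups\<close>

definition normalized_by :: "'a set \<Rightarrow> 'a set \<Rightarrow> bool"
  where "normalized_by P N \<longleftrightarrow> (\<forall>g\<in>P. \<forall>n\<in>N. conj_by g n \<in> N)"

lemma normalized_byD: "\<lbrakk>normalized_by P N; g \<in> P; n \<in> N\<rbrakk> \<Longrightarrow> conj_by g n \<in> N"
  by (simp add: normalized_by_def)

lemma subgroup_mult_eq: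
  assumes "subgroup N G" "x \<in> N" "y \<in> carrier G"
  shows "x \<otimes> y \<in> N \<longleftrightarrow> y \<in> N" "y \<otimes> x \<in> N \<longleftrightarrow> y \<in> N"
proof -
  have x: "x \<in> carrier G" "inv x \<in> N"
    using assms subgroup.mem_carrier subgroup.m_inv_closed by fast+
  have "y \<in> N" if "x \<otimes> y \<in> N"
    using subgroup.m_closed[OF assms(1) x(2) that] assms(3) x(1) by simp
  moreover have "y \<in> N" if "y \<otimes> x \<in> N"
    using subgroup.m_closed[OF assms(1) that x(2)] assms(3) x(1) by (simp add: m_assoc)
  ultimately show "x \<otimes> y \<in> N \<longleftrightarrow> y \<in> N" "y \<otimes> x \<in> N \<longleftrightarrow> y \<in> N"
    using assms subgroup.m_closed[OF assms(1)] by blast+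
qed

lemma subgroup_finiteI:
  assumes "H \<subseteq> carrier G" "finite H" "\<one> \<in> H" "\<And>x y. x \<in> H \<Longrightarrow> y \<in> H \<Longrightarrow> x \<otimes> y \<in> H"
  shows "subgroup H G"
proof (rule subgroupI)
  show "inv x \<in> H" if x: "x \<in> H" for x
  proof -
    have "(\<otimes>) x ` H \<subseteq> H" using assms x by auto
    moreover have "inj_on ((\<otimes>) x) H"
      using assms(1) x by (intro inj_onI) (metis inv_mult_cancel(1) subsetD)
    ultimately have "(\<otimes>) x ` H = H" using assms(2) by (simp add: endo_inj_surj)
    then obtain y where "y \<in> H" "x \<otimes> y = \<one>" using assms(3) by (metis imageE)
    then have "inv x = y" using assms(1) x inv_mult_cancel(1)[of x y] by (simp add: subset_iff)
    then show ?thesis using \<open>y \<in> H\<close> by simp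
  qed
qed (use assms in auto)

text \<open>Closure under products is the identity
  \<open>[x x', y] = (x [x', y] x^-1) [x, y]\<close>, in which \<open>N\<close> absorbs the
  conjugate.\<close>

lemma commutator_mod_subgroup:
  assumes P: "subgroup P G" and N: "subgroup N G" and nb: "normalized_by P N" and y: "y \<in> P"
  shows "subgroup {x \<in> P. commutator x y \<in> N} G"
proof -
  interpret P: subgroup P G by fact
  interpret N: subgroup N G by fact
  show ?thesis
  proof (rule subgroupI)
    show "{x \<in> P. commutator x y \<in> N} \<noteq> {}"
      using y by (auto intro!: exI[of _ \<one>])
  next
    fix x assume "x \<in> {x \<in> P. commutator x y \<in> N}"
    then have x: "x \<in> P" "commutator x y \<in> N" by auto
    have "inv x \<otimes> inv (commutator x y) \<otimes> inv (inv x) \<in> N"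
      by (rule normalized_byD[OF nb]) (use x in auto)
    moreover have "inv x \<otimes> inv (commutator x y) \<otimes> inv (inv x) = inv x \<otimes> y \<otimes> inv (inv x) \<otimes> inv y"
      using x(1) y by (simp add: m_assoc inv_mult_group)
    ultimately show "inv x \<in> {x \<in> P. commutator x y \<in> N}" using x by simp
  next
    fix x x' assume "x \<in> {x \<in> P. commutator x y \<in> N}" "x' \<in> {x \<in> P. commutator x y \<in> N}"
    then have x: "x \<in> P" "commutator x y \<in> N" and x': "x' \<in> P" "commutator x' y \<in> N" by auto
    have "(conj_by x (commutator x' y)) \<otimes> (commutator x y) \<in> N"
      using normalized_byD[OF nb x(1) x'(2)] x(2) by simp
    moreover have "(conj_by x (commutator x' y)) \<otimes> (commutator x y) 
       = commutator (x \<otimes> x') y"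
      using x(1) x'(1) y by (simp add: m_assoc inv_mult_group)
    ultimately show "x \<otimes> x' \<in> {x \<in> P. commutator x y \<in> N}" using x x' by simp
  qed (use P.subset in auto)
qed

lemma commutator_mod_sym:
  assumes "subgroup N G" "x \<in> carrier G" "y \<in> carrier G"
  shows "commutator x y \<in> N \<longleftrightarrow> commutator y x \<in> N"
proof -
  have "inv (commutator x y) = commutator y x" "inv (commutator y x) = commutator x y"
    using assms by (simp_all add: m_assoc inv_mult_group)
  then show ?thesis using subgroup.m_inv_closed[OF assms(1)] by metis
qed

text \<open>For \<open>N\<close> normal in \<open>P\<close> this is the preimage in \<open>P\<close>
  of the centre of \<open>P/N\<close>.\<close>

definition centre_mod :: "'a set \<Rightarrow> 'a set \<Rightarrow> 'a set"
  where "centre_mod P N = {x \<in> P. \<forall>y\<in>P. commutator x y \<in> N}"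

lemma subgroup_Inter_family:
  assumes "I \<noteq> {}" "\<And>i. i \<in> I \<Longrightarrow> subgroup (H i) G"
  shows "subgroup (\<Inter>i\<in>I. H i) G"
  using subgroups_Inter[of "H ` I"] assms by auto

lemma centre_mod:
  assumes P: "subgroup P G" and N: "subgroup N G" and nb: "normalized_by P N" and NP: "N \<subseteq> P"
  shows "subgroup (centre_mod P N) G" "N \<subseteq> centre_mod P N" "normalized_by P (centre_mod P N)"
proof -
  interpret P: subgroup P G by fact
  interpret N: subgroup N G by fact
  have "centre_mod P N = (\<Inter>y\<in>P. {x \<in> P. commutator x y \<in> N})"
    by (auto simp: centre_mod_def dest: bspec[OF _ P.one_closed])
  moreover have "P \<noteq> {}" using P.one_closed by blast
  ultimately show "subgroup (centre_mod P N) G"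
    by (simp only:) (intro subgroup_Inter_family commutator_mod_subgroup[OF P N nb])
  show "N \<subseteq> centre_mod P N"
  proof
    fix n assume n: "n \<in> N"
    have "commutator n y \<in> N" if y: "y \<in> P" for y
    proof -
      have "n \<otimes> (y \<otimes> inv n \<otimes> inv y) \<in> N" using normalized_byD[OF nb y N.m_inv_closed[OF n]] n by simp
      then show ?thesis using n y by (simp add: m_assoc)
    qed
    then show "n \<in> centre_mod P N" using n NP by (auto simp: centre_mod_def)
  qed
  show "normalized_by P (centre_mod P N)"
    unfolding normalized_by_def
  proof (intro ballI)
    fix g x assume g: "g \<in> P" and x: "x \<in> centre_mod P N"
    have xP: "x \<in> P" using x by (simp add: centre_mod_def)
    have "conj_by g x \<otimes> y \<otimes> inv (conj_by g x) \<otimes> inv y \<in> N" if y: "y \<in> P" for y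
    proof -
      have "commutator x (inv g \<otimes> y \<otimes> g) \<in> N"
        using x g y by (simp add: centre_mod_def)
      from normalized_byD[OF nb g this] show ?thesis
        using g y xP by (simp add: m_assoc inv_mult_group)
    qed
    then show "conj_by g x \<in> centre_mod P N" using g xP by (simp add: centre_mod_def)
  qed
qed

lemma rcos_eq_iff:
  assumes "subgroup N G" "x \<in> carrier G" "y \<in> carrier G"
  shows "N #> x = N #> y \<longleftrightarrow> x \<otimes> inv y \<in> N"
proof -
  interpret subgroup N G by fact
  have "x \<in> N #> y \<longleftrightarrow> x \<otimes> inv y \<in> N" using rcos_module[OF is_group assms(3,2)] .
  moreover have "N #> x = N #> y \<longleftrightarrow> x \<in> N #> y"
    using repr_independence[of x N y] rcos_self[of x N] assms by auto
  ultimately show ?thesis by simp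
qed

lemma card_subgroup_cosets:
  assumes N: "subgroup N G" and K: "subgroup K G" "N \<subseteq> K"
  shows "card ((\<lambda>k. N #> k) ` K) * card N = card K"
proof -
  have "group (G\<lparr>carrier := K\<rparr>)" "subgroup N (G\<lparr>carrier := K\<rparr>)"
    using subgroup_imp_group K N subgroup_incl by blast+
  from group.lagrange[OF this] have "card (rcosets\<^bsub>G\<lparr>carrier := K\<rparr>\<^esub> N) * card N = card K" by (simp add: Coset.order_def)
  moreover have "rcosets\<^bsub>G\<lparr>carrier := K\<rparr>\<^esub> N = (\<lambda>k. N #> k) ` K" by (auto simp: RCOSETS_def)
  ultimately show ?thesis by simp
qed

lemma p_group_subgroup:
  assumes "subgroup P G" "card P = p ^ a" "prime (p::nat)" "subgroup K G" "K \<subseteq> P"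
  shows "\<exists>b. card K = p ^ b"
proof -
  have "card K dvd p ^ a" using card_subgroup_cosets[of K P] assms by (metis dvd_triv_right)
  then show ?thesis using divides_primepow_nat[OF assms(3)] by auto
qed

lemma p_group_index:
  assumes "subgroup P G" "card P = p ^ a" "prime (p::nat)" "subgroup K G" "K \<subset> P"
  shows "p dvd card ((\<lambda>k. K #> k) ` P)"
proof -
  have e: "card ((\<lambda>k. K #> k) ` P) * card K = p ^ a" using card_subgroup_cosets[of K P] assms by auto
  have "finite P" using assms by (metis card.infinite not_prime_0 power_not_zero)
  then have "card K < card P" using assms(5) by (simp add: psubset_card_mono)
  then have "card ((\<lambda>k. K #> k) ` P) \<noteq> 1" using e assms(2) by (metis less_irrefl mult_1)
  moreover have "card ((\<lambda>k. K #> k) ` P) dvd p ^ a" using e by (metis dvd_triv_left)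
  then obtain i where "card ((\<lambda>k. K #> k) ` P) = p ^ i" using divides_primepow_nat[OF assms(3)] by auto
  ultimately show ?thesis by (cases i) auto
qed

text \<open>\<open>P\<close> permutes the cosets of \<open>N\<close> in \<open>K\<close> by
  conjugation. Their number is divisible by \<open>p\<close>, so the number of fixed cosets is as
  well; \<open>N\<close> is one of them, hence there is another one \<open>N z\<close>, and being
  fixed means that \<open>z\<close> is central modulo \<open>N\<close>.\<close>

lemma p_group_central_mod:
  assumes P: "subgroup P G" "card P = p ^ a" "prime (p::nat)"
    and N: "subgroup N G" "normalized_by P N" and K: "subgroup K G" "normalized_by P K" "K \<subseteq> P" and NK: "N \<subset> K"
  obtains z where "z \<in> K" "z \<notin> N" "\<And>g. g \<in> P \<Longrightarrow> commutator g z \<in> N"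
proof -
  interpret P: subgroup P G by fact
  interpret N: subgroup N G by fact
  interpret K: subgroup K G by fact
  let ?\<Xi> = "(\<lambda>k. N #> k) ` K"
  let ?\<phi> = "\<lambda>g C. g <# C #> inv g"
  have fP: "finite P" using P by (metis card.infinite not_prime_0 power_not_zero)
  have act: "?\<phi> g (N #> k) = N #> (conj_by g k)" if g: "g \<in> P" and k: "k \<in> K" for g k
  proof
    show "?\<phi> g (N #> k) \<subseteq> N #> (conj_by g k)"
    proof
      fix y assume "y \<in> ?\<phi> g (N #> k)"
      then obtain n where n: "n \<in> N" "y = conj_by g (n \<otimes> k)" by (auto simp: l_coset_def r_coset_def)
      have "y = (conj_by g n) \<otimes> conj_by g k" using n g k by (simp add: m_assoc)
      then show "y \<in> N #> (conj_by g k)"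
        using normalized_byD[OF N(2) g n(1)] by (auto simp: r_coset_def)
    qed
    show "N #> (conj_by g k) \<subseteq> ?\<phi> g (N #> k)"
    proof
      fix y assume "y \<in> N #> (conj_by g k)"
      then obtain n where n: "n \<in> N" "y = n \<otimes> conj_by g k" by (auto simp: r_coset_def)
      have "y = g \<otimes> ((inv g \<otimes> n \<otimes> inv (inv g)) \<otimes> k) \<otimes> inv g" using n g k by (simp add: m_assoc)
      then show "y \<in> ?\<phi> g (N #> k)"
        using normalized_byD[OF N(2) P.m_inv_closed[OF g] n(1)] by (auto simp: r_coset_def l_coset_def)
    qed
  qed
  let ?F = "{x \<in> ?\<Xi>. \<forall>g\<in>P. ?\<phi> g x = x}"
  have fO: "finite ?\<Xi>" using fP K(3) finite_subset by blast
  have "card ?F mod p = card ?\<Xi> mod p"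
  proof (rule p_group_fixed_points[OF P fO])
    show "?\<phi> g x \<in> ?\<Xi>" if "g \<in> P" "x \<in> ?\<Xi>" for g x
      using that act normalized_byD[OF K(2)] by auto
    show "?\<phi> \<one> x = x" if "x \<in> ?\<Xi>" for x using that act[OF P.one_closed] by auto
    show "?\<phi> (g \<otimes> h) x = ?\<phi> g (?\<phi> h x)" if g: "g \<in> P" and h: "h \<in> P" and x: "x \<in> ?\<Xi>" for g h x
    proof -
      obtain k where k: "k \<in> K" "x = N #> k" using x by blast
      have "conj_by h k \<in> K" using normalized_byD[OF K(2)] g h k by auto
      then have "?\<phi> g (?\<phi> h x) = N #> (conj_by g (h \<otimes> k \<otimes> inv h))"
        using g h k act[of h k] act[of g "conj_by h k"] by simp
      moreover have "?\<phi> (g \<otimes> h) x = N #> (conj_by (g \<otimes> h) k)"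
        using g h k act[of "g \<otimes> h" k] by simp
      ultimately show ?thesis using g h k by (simp add: m_assoc inv_mult_group)
    qed
  qed
  moreover have "p dvd card ?\<Xi>"
  proof -
    obtain b where b: "card K = p ^ b" using p_group_subgroup[OF P(1,2,3) K(1,3)] by auto
    show ?thesis by (rule p_group_index[OF K(1) b P(3) N(1) NK])
  qed
  ultimately have dvd: "p dvd card ?F" by (simp only: dvd_eq_mod_eq_0)
  have NF: "N \<in> ?F"
  proof -
    have "N #> \<one> = N" by (rule coset_mult_one[OF N.subset])
    then have "N \<in> ?\<Xi>" using K.one_closed by (metis imageI)
    moreover have "?\<phi> g N = N" if "g \<in> P" for g
      using act[OF that K.one_closed] that \<open>N #> \<one> = N\<close> by simp
    ultimately show ?thesis by simp
  qed
  define F where "F = ?F"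
  have "F \<noteq> {N}"
  proof
    assume "F = {N}"
    with dvd have "p dvd card {N}" by (simp only: F_def)
    then show False using P(3) by simp
  qed
  moreover have "N \<in> F" using NF by (simp only: F_def)
  ultimately obtain C where "C \<in> F" and CN: "C \<noteq> N" by blast
  then have C: "C \<in> ?\<Xi>" "\<And>g. g \<in> P \<Longrightarrow> ?\<phi> g C = C" by (simp_all add: F_def)
  from C(1) obtain z where z: "z \<in> K" "C = N #> z" by auto
  have "z \<notin> N" using CN z coset_join2[of z N] N(1) by (metis K.mem_carrier)
  moreover have "commutator g z \<in> N" if g: "g \<in> P" for g
  proof -
    have "N #> (conj_by g z) = N #> z" using C(2)[OF g] act[OF g z(1)] z(2) by simp
    then show ?thesis using rcos_eq_iff[OF N(1)] g z by simp
  qed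
  ultimately show ?thesis by (rule that[OF z(1)])
qed

text \<open>\<open>L\<close> is \<open>N<z>\<close>: natural exponents suffice in a finite group,
  and \<open>z\<close> being central modulo \<open>N\<close> makes \<open>L\<close> normal in
  \<open>P\<close>. The last claim, that the powers of \<open>z\<close> are central modulo
  \<open>N\<close> too, permits repeating the construction with \<open>z [^] p\<close>.\<close>

lemma powers_mod_subgroup:
  assumes P: "subgroup P G" "finite P" and N: "subgroup N G" "normalized_by P N" "N \<subseteq> P"
    and z: "z \<in> P" "\<And>g. g \<in> P \<Longrightarrow> commutator g z \<in> N"
  defines "L \<equiv> {n \<otimes> z [^] (i::nat) | n i. n \<in> N}"
  shows "subgroup L G" "normalized_by P L" "N \<subseteq> L" "z \<in> L" "L \<subseteq> P"
    "\<And>g i. g \<in> P \<Longrightarrow> g \<otimes> z [^] (i::nat) \<otimes> inv g \<otimes> inv (z [^] i) \<in> N"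
proof -
  interpret P: subgroup P G by fact
  interpret N: subgroup N G by fact
  have zi: "z [^] (i::nat) \<in> P" for i
    by (induction i) (use z in auto)
  have zc: "z [^] (i::nat) \<in> carrier G" for i using z by simp
  have LI: "n \<otimes> z [^] (i::nat) \<in> L" if "n \<in> N" for n i using that by (auto simp: L_def)
  show NL: "N \<subseteq> L"
  proof
    fix n assume "n \<in> N" then show "n \<in> L" using LI[of n 0] by simp
  qed
  show "z \<in> L" using LI[OF N.one_closed, of 1] z by simp
  show LP: "L \<subseteq> P" using N zi by (auto simp: L_def)
  have mL: "x \<otimes> y \<in> L" if x: "x \<in> L" and y: "y \<in> L" for x y
  proof -
    obtain n i m j where e: "x = n \<otimes> z [^] (i::nat)" "n \<in> N" "y = m \<otimes> z [^] (j::nat)" "m \<in> N"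
      using x y unfolding L_def by blast
    have "z [^] i \<otimes> m \<otimes> inv (z [^] i) \<in> N" by (rule normalized_byD[OF N(2) zi e(4)])
    then have "(n \<otimes> (z [^] i \<otimes> m \<otimes> inv (z [^] i))) \<otimes> z [^] (i + j) \<in> L" using e by (intro LI) auto
    moreover have "(n \<otimes> (z [^] i \<otimes> m \<otimes> inv (z [^] i))) \<otimes> z [^] (i + j) = x \<otimes> y"
      using e zc z by (simp add: m_assoc nat_pow_mult [symmetric])
    ultimately show ?thesis by simp
  qed
  show "subgroup L G"
  proof (rule subgroup_finiteI)
    show "L \<subseteq> carrier G" using LP P.subset by blast
    show "finite L" using LP P(2) finite_subset by blast
    show "\<one> \<in> L" using NL N.one_closed by blast
  qed (rule mL)
  show pc: "g \<otimes> z [^] (i::nat) \<otimes> inv g \<otimes> inv (z [^] i) \<in> N" if g: "g \<in> P" for g i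
  proof (induction i)
    case 0
    then show ?case using g by simp
  next
    case (Suc i)
    have "z [^] i \<otimes> (commutator g z) \<otimes> inv (z [^] i) \<in> N"
      by (rule normalized_byD[OF N(2) zi z(2)[OF g]])
    then have "(g \<otimes> z [^] i \<otimes> inv g \<otimes> inv (z [^] i)) \<otimes> (z [^] i \<otimes> (commutator g z) \<otimes> inv (z [^] i)) \<in> N"
      using Suc by simp
    then show ?case using g z zc[of i] by (simp add: m_assoc inv_mult_group)
  qed
  show "normalized_by P L"
    unfolding normalized_by_def
  proof (intro ballI)
    fix g x assume g: "g \<in> P" and "x \<in> L"
    then obtain n i where x: "x = n \<otimes> z [^] (i::nat)" "n \<in> N" by (auto simp: L_def)
    have "conj_by g n \<otimes> (g \<otimes> z [^] i \<otimes> inv g \<otimes> inv (z [^] i)) \<otimes> z [^] i \<in> L"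
      using normalized_byD[OF N(2) g x(2)] pc[OF g] by (intro LI) auto
    moreover have "conj_by g n \<otimes> (g \<otimes> z [^] i \<otimes> inv g \<otimes> inv (z [^] i)) \<otimes> z [^] i = conj_by g x"
      using g x zc[of i] by (simp add: m_assoc)
    ultimately show "conj_by g x \<in> L" by simp
  qed
qed

lemma pow_in_subgroup:
  assumes "subgroup N G" "x \<in> N" shows "x [^] (i::nat) \<in> N"
  using assms by (induction i) (auto simp: subgroup.one_closed subgroup.m_closed)

lemma pow_coprime_mem:
  assumes N: "subgroup N G" and x: "x \<in> carrier G" "x [^] (a::nat) \<in> N" "x [^] (b::nat) \<in> N" and ab: "coprime a b"
  shows "x \<in> N"
proof (cases "a = 0")
  case True
  then show ?thesis using assms by simp
next
  case False
  then obtain u v where "a * u = b * v + 1" using bezout_nat[of a b] ab by auto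
  then have "(x [^] b) [^] v \<otimes> x = (x [^] a) [^] u" using x(1) by (simp add: nat_pow_pow)
  moreover have "(x [^] a) [^] u \<in> N" "(x [^] b) [^] v \<in> N" using N x pow_in_subgroup by auto
  ultimately show ?thesis using subgroup_mult_eq(1)[OF N \<open>(x [^] b) [^] v \<in> N\<close> x(1)] by simp
qed

text \<open>\<open>\<eta>\<close> is a homomorphism from \<open>K\<close> onto the integers modulo
  \<open>p\<close>, with natural numbers as representatives. It reads off the exponent of
  \<open>z\<close> in \<open>K/M\<close>, where \<open>M\<close> is a maximal proper subgroup of
  \<open>K\<close> above \<open>N\<close> that is normal in \<open>P\<close>: some \<open>z\<close>
  is central modulo \<open>M\<close>, and maximality makes \<open>K/M\<close> cyclic of order
  \<open>p\<close>, generated by \<open>z\<close>. Centrality gives the invariance.\<close>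

lemma p_group_invariant_character:
  assumes P: "subgroup P G" "card P = p ^ a" "prime (p::nat)"
    and N: "subgroup N G" "normalized_by P N" and K: "subgroup K G" "normalized_by P K" "K \<subseteq> P" and NK: "N \<subset> K"
  obtains \<eta> :: "'a \<Rightarrow> nat" and z where "z \<in> K" "[\<eta> z = 1] (mod p)"
    "\<And>k k'. k \<in> K \<Longrightarrow> k' \<in> K \<Longrightarrow> [\<eta> (k \<otimes> k') = \<eta> k + \<eta> k'] (mod p)"
    "\<And>g k. g \<in> P \<Longrightarrow> k \<in> K \<Longrightarrow> [\<eta> (conj_by g k) = \<eta> k] (mod p)"
    "\<And>n. n \<in> N \<Longrightarrow> [\<eta> n = 0] (mod p)"
proof -
  interpret P: subgroup P G by fact
  interpret K: subgroup K G by fact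
  have fP: "finite P" using P by (metis card.infinite not_prime_0 power_not_zero)
  define \<M> where "\<M> = {M. subgroup M G \<and> normalized_by P M \<and> N \<subseteq> M \<and> M \<subset> K}"
  have "\<M> \<subseteq> Pow P" using K(3) by (auto simp: \<M>_def)
  then have "finite \<M>" using fP finite_subset by blast
  moreover have "N \<in> \<M>" using N NK by (auto simp: \<M>_def)
  ultimately obtain M where M: "M \<in> \<M>" and max: "\<And>M'. M' \<in> \<M> \<Longrightarrow> M \<subseteq> M' \<Longrightarrow> M' = M"
    using finite_has_maximal[of \<M>] by blast
  have Ms: "subgroup M G" "normalized_by P M" "N \<subseteq> M" "M \<subset> K" using M by (auto simp: \<M>_def)
  interpret M: subgroup M G by (fact Ms(1))
  obtain z where z: "z \<in> K" "z \<notin> M" "\<And>g. g \<in> P \<Longrightarrow> commutator g z \<in> M"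
    by (rule p_group_central_mod[OF P Ms(1,2) K Ms(4)]) blast
  have zP: "z \<in> P" and zc: "z \<in> carrier G" using z K by auto
  have MP: "M \<subseteq> P" using Ms K by auto
  \<comment> \<open>\<open>M\<close> together with the powers of \<open>w\<close> is again normal in
    \<open>P\<close>; by maximality of \<open>M\<close> it is all of \<open>K\<close>.\<close>
  have ex: "\<exists>n i. k = n \<otimes> w [^] (i::nat) \<and> n \<in> M"
    if w: "w \<in> K" "w \<notin> M" "\<And>g. g \<in> P \<Longrightarrow> commutator g w \<in> M" and k: "k \<in> K" for w k
  proof -
    let ?L = "{n \<otimes> w [^] (i::nat) | n i. n \<in> M}"
    have wP: "w \<in> P" using w K by auto
    note L = powers_mod_subgroup[OF P(1) fP Ms(1,2) MP wP w(3)]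
    have LK: "?L \<subseteq> K"
    proof
      fix x assume "x \<in> ?L"
      then obtain n i where x: "x = n \<otimes> w [^] (i::nat)" "n \<in> M" by blast
      then have "n \<in> K" using Ms(4) by blast
      then show "x \<in> K" unfolding x(1) by (rule K.m_closed) (rule pow_in_subgroup[OF K(1) w(1)])
    qed
    have "?L = K"
    proof (rule ccontr)
      assume "?L \<noteq> K"
      then have "?L \<in> \<M>" unfolding \<M>_def using LK L(1-3) Ms(3) by blast
      from max[OF this L(3)] show False using L(4) w(2) by blast
    qed
    then show ?thesis using k by blast
  qed
  \<comment> \<open>Otherwise \<open>z [^] p\<close> generates \<open>K\<close> modulo
    \<open>M\<close> as well, so \<open>z\<close> is \<open>z [^] (p * i)\<close> modulo
    \<open>M\<close> for some \<open>i\<close>. After \<open>a\<close> iterations the exponent is a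
    multiple of \<open>p ^ a\<close>, the order of \<open>P\<close>, and \<open>z\<close> would lie
    in \<open>M\<close>.\<close>
  have zp: "z [^] p \<in> M"
  proof (rule ccontr)
    assume n: "z [^] p \<notin> M"
    have c: "g \<otimes> z [^] p \<otimes> inv g \<otimes> inv (z [^] p) \<in> M" if "g \<in> P" for g
      by (rule powers_mod_subgroup(6)[OF P(1) fP Ms(1,2) MP zP z(3) that])
    obtain m i where m: "z = m \<otimes> (z [^] p) [^] (i::nat)" "m \<in> M"
      using ex[OF pow_in_subgroup[OF K(1) z(1)] n c z(1)] by blast
    have step: "\<exists>m\<in>M. z = m \<otimes> z [^] ((p * i) ^ j)" for j
    proof (induction j)
      case 0
      show ?case using zc by (intro bexI[of _ \<one>]) auto
    next
      case (Suc j)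
      then obtain m' where m': "m' \<in> M" "z = m' \<otimes> z [^] ((p * i) ^ j)" by blast
      have comm: "z [^] (p*i) \<otimes> inv (z [^] ((p * i) ^ Suc j)) \<in> M"
      proof -
        let ?w = "z [^] ((p * i) ^ j)"
        have mw: "z \<otimes> inv ?w \<in> M"
          using m' zc by (metis M.mem_carrier inv_solve_right nat_pow_closed)
        have "z [^] l \<otimes> inv (?w [^] l) \<in> M" for l :: nat
        proof (induction l)
          case 0
          then show ?case by simp
        next
          case (Suc l)
          have zlP: "z [^] l \<in> P" by (rule pow_in_subgroup[OF P(1) zP])
          have "z [^] l \<otimes> (z \<otimes> inv ?w) \<otimes> inv (z [^] l) \<in> M" by (rule normalized_byD[OF Ms(2) zlP mw])
          then have "(z [^] l \<otimes> (z \<otimes> inv ?w) \<otimes> inv (z [^] l)) \<otimes> (z [^] l \<otimes> inv (?w [^] l)) \<in> M"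
            using Suc by simp
          moreover have "?w [^] Suc l = ?w [^] l \<otimes> ?w" by simp
          then have "inv (?w [^] Suc l) = inv ?w \<otimes> inv (?w [^] l)" using zc by (simp add: inv_mult_group)
          then have "(z [^] l \<otimes> (z \<otimes> inv ?w) \<otimes> inv (z [^] l)) \<otimes> (z [^] l \<otimes> inv (?w [^] l)) = z [^] Suc l \<otimes> inv (?w [^] Suc l)"
            using zc by (simp add: m_assoc)
          ultimately show ?case by simp
        qed
        from this[of "p * i"] show ?thesis using zc by (simp add: nat_pow_pow mult.commute)
      qed
      have "z = (m \<otimes> (z [^] (p*i) \<otimes> inv (z [^] ((p * i) ^ Suc j)))) \<otimes> z [^] ((p * i) ^ Suc j)"
        using m zc by (simp add: m_assoc nat_pow_pow)
      then show ?case using m(2) comm by (metis M.m_closed)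
    qed
    have "(p * i) ^ a = p ^ a * i ^ a" by (simp add: power_mult_distrib)
    moreover have "z [^] (p ^ a) = \<one>"
    proof -
      have "group (G\<lparr>carrier := P\<rparr>)" using P(1) subgroup_imp_group by blast
      from group.pow_order_eq_1[OF this, of z] show ?thesis
        using zP P(2) by (simp add: Coset.order_def nat_pow_consistent [symmetric])
    qed
    ultimately have "z [^] ((p * i) ^ a) = \<one>" using zc by (simp add: nat_pow_pow [symmetric])
    then show False using step[of a] z(2) by auto
  qed
  define \<eta> where "\<eta> k = (SOME i. \<exists>n\<in>M. k = n \<otimes> z [^] (i::nat))" for k
  have \<eta>: "\<exists>n\<in>M. k = n \<otimes> z [^] \<eta> k" if "k \<in> K" for k
    unfolding \<eta>_def by (rule someI_ex) (use ex[OF z that] in blast)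
  \<comment> \<open>If \<open>i - j\<close> were prime to \<open>p\<close>, then \<open>z\<close>
    itself would lie in \<open>M\<close>, since both \<open>z [^] (i - j)\<close> and
    \<open>z [^] p\<close> do.\<close>
  have uniq': "[i = j] (mod p)" if "z [^] i \<otimes> inv (z [^] j) \<in> M" "j \<le> i" for i j :: nat
  proof (rule ccontr)
    assume "\<not> [i = j] (mod p)"
    then have "\<not> p dvd i - j" using that(2) by (simp add: cong_altdef_nat)
    then have "coprime (i - j) p" using P(3) prime_imp_coprime by (metis coprime_commute)
    moreover have "z [^] i = z [^] (i - j) \<otimes> z [^] j" using that(2) zc by (simp add: nat_pow_mult)
    then have "z [^] (i - j) \<in> M" using that(1) zc by (simp add: m_assoc)
    ultimately have "z \<in> M" using pow_coprime_mem[OF Ms(1) zc _ zp, of "i - j"] by simp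
    then show False using z(2) by simp
  qed
  have uniq: "[i = j] (mod p)" if "n \<otimes> z [^] i = n' \<otimes> z [^] j" "n \<in> M" "n' \<in> M" for n n' and i j :: nat
  proof -
    have "inv n \<otimes> (n \<otimes> z [^] i) \<otimes> inv (z [^] j) = inv n \<otimes> (n' \<otimes> z [^] j) \<otimes> inv (z [^] j)"
      using that(1) by simp
    then have "z [^] i \<otimes> inv (z [^] j) = inv n \<otimes> n'"
      using that(2,3) zc by (simp add: m_assoc)
    then have 1: "z [^] i \<otimes> inv (z [^] j) \<in> M" using that by simp
    then have "inv (z [^] i \<otimes> inv (z [^] j)) \<in> M" by simp
    then have 2: "z [^] j \<otimes> inv (z [^] i) \<in> M" using zc by (simp add: inv_mult_group)
    show ?thesis using uniq'[OF 1] uniq'[OF 2] by (metis cong_sym linear)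
  qed
  show thesis
  proof (rule that)
    show "z \<in> K" by fact
    obtain n where "n \<in> M" "z = n \<otimes> z [^] \<eta> z" using \<eta>[OF z(1)] by blast
    then show "[\<eta> z = 1] (mod p)" using uniq[of n "\<eta> z" \<one> 1] zc by simp
  next
    fix k k' assume k: "k \<in> K" "k' \<in> K"
    obtain n where n: "n \<in> M" "k = n \<otimes> z [^] \<eta> k" using \<eta>[OF k(1)] by blast
    obtain n' where n': "n' \<in> M" "k' = n' \<otimes> z [^] \<eta> k'" using \<eta>[OF k(2)] by blast
    obtain m where m: "m \<in> M" "k \<otimes> k' = m \<otimes> z [^] \<eta> (k \<otimes> k')" using \<eta>[of "k \<otimes> k'"] k by blast
    have zkP: "z [^] \<eta> k \<in> P" by (rule pow_in_subgroup[OF P(1) zP])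
    have "(n \<otimes> (z [^] \<eta> k \<otimes> n' \<otimes> inv (z [^] \<eta> k))) \<otimes> z [^] (\<eta> k + \<eta> k') = (n \<otimes> z [^] \<eta> k) \<otimes> (n' \<otimes> z [^] \<eta> k')"
      using n(1) n'(1) zc by (simp add: m_assoc nat_pow_mult [symmetric])
    then have "m \<otimes> z [^] \<eta> (k \<otimes> k') = (n \<otimes> (z [^] \<eta> k \<otimes> n' \<otimes> inv (z [^] \<eta> k))) \<otimes> z [^] (\<eta> k + \<eta> k')"
      using n(2) n'(2) m(2) by simp
    then show "[\<eta> (k \<otimes> k') = \<eta> k + \<eta> k'] (mod p)"
      using uniq m(1) n(1) normalized_byD[OF Ms(2) zkP n'(1)] by blast
  next
    fix g k assume g: "g \<in> P" and k: "k \<in> K"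
    have gk: "conj_by g k \<in> K" by (rule normalized_byD[OF K(2) g k])
    obtain n where n: "n \<in> M" "k = n \<otimes> z [^] \<eta> k" using \<eta>[OF k] by blast
    obtain m where m: "m \<in> M" "conj_by g k = m \<otimes> z [^] \<eta> (conj_by g k)" using \<eta>[OF gk] by blast
    let ?c = "g \<otimes> z [^] \<eta> k \<otimes> inv g \<otimes> inv (z [^] \<eta> k)"
    have c: "?c \<in> M" by (rule powers_mod_subgroup(6)[OF P(1) fP Ms(1,2) MP zP z(3) g])
    have "((conj_by g n) \<otimes> ?c) \<otimes> z [^] \<eta> k = conj_by g (n \<otimes> z [^] \<eta> k)"
      using n(1) g zc by (simp add: m_assoc)
    then have "m \<otimes> z [^] \<eta> (conj_by g k) = ((conj_by g n) \<otimes> ?c) \<otimes> z [^] \<eta> k"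
      using n(2) m(2) by simp
    then show "[\<eta> (conj_by g k) = \<eta> k] (mod p)"
      using uniq m(1) M.m_closed[OF normalized_byD[OF Ms(2) g n(1)] c] by blast
  next
    fix n assume n: "n \<in> N"
    then have "n \<in> M" "n \<in> K" using Ms by auto
    then obtain m where m: "m \<in> M" "n = m \<otimes> z [^] \<eta> n" using \<eta> by blast
    then show "[\<eta> n = 0] (mod p)" using uniq[of m "\<eta> n" n 0] \<open>n \<in> M\<close> by simp
  qed
qed

text \<open>\<open>S\<close> acts on the right cosets of \<open>T\<close> in \<open>Y\<close> by
  right translation; the inverse in \<open>C #> inv s\<close> turns this into a left action.\<close>

lemma p_group_fixed_coset:
  assumes S: "subgroup S G" "card S = p ^ b" "prime (p::nat)" and Y: "subgroup Y G" "finite Y" "S \<subseteq> Y"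
    and T: "subgroup T G" "T \<subseteq> Y"
  shows "card {C \<in> (\<lambda>y. T #> y) ` Y. \<forall>s\<in>S. C #> inv s = C} mod p = card ((\<lambda>y. T #> y) ` Y) mod p"
proof (rule p_group_fixed_points[OF S])
  interpret Y: subgroup Y G by fact
  interpret T: subgroup T G by fact
  show "finite ((\<lambda>y. T #> y) ` Y)" using Y by simp
  have act: "T #> y #> inv s = T #> (y \<otimes> inv s)" if "y \<in> Y" "s \<in> S" for y s
    using that Y(3) T.subset by (intro coset_mult_assoc) auto
  fix g C assume g: "g \<in> S" and C: "C \<in> (\<lambda>y. T #> y) ` Y"
  obtain y where y: "y \<in> Y" "C = T #> y" using C by blast
  have "y \<otimes> inv g \<in> Y" using y g Y by (meson Y.m_closed Y.m_inv_closed subsetD)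
  then show "C #> inv g \<in> (\<lambda>y. T #> y) ` Y" using act[OF y(1) g] y(2) by simp
next
  interpret Y: subgroup Y G by fact
  interpret T: subgroup T G by fact
  fix C assume C: "C \<in> (\<lambda>y. T #> y) ` Y"
  obtain y where y: "y \<in> Y" "C = T #> y" using C by blast
  then show "C #> inv \<one> = C" using coset_mult_assoc[OF T.subset, of y \<one>] by simp
next
  interpret Y: subgroup Y G by fact
  interpret T: subgroup T G by fact
  fix g h C assume g: "g \<in> S" and h: "h \<in> S" and C: "C \<in> (\<lambda>y. T #> y) ` Y"
  obtain y where y: "y \<in> Y" "C = T #> y" using C by blast
  have c: "g \<in> carrier G" "h \<in> carrier G" "y \<in> carrier G" using g h y Y(3) by auto
  then have "T #> y \<subseteq> carrier G" by (intro r_coset_subset_G T.subset)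
  then show "C #> inv (g \<otimes> h) = C #> inv h #> inv g"
    unfolding y(2) using c by (simp add: inv_mult_group coset_mult_assoc)
qed

text \<open>A maximal proper subgroup \<open>M\<close> above \<open>S\<close> will do. Acting on its
  own cosets in \<open>P\<close>, \<open>M\<close> fixes those in its normaliser; their number is
  divisible by \<open>p\<close>, so the normaliser is larger than \<open>M\<close> and hence is
  \<open>P\<close>. The preimage of the centre of \<open>P/M\<close> is larger than \<open>M\<close>
  too, so \<open>P/M\<close> is abelian.\<close>

lemma p_group_proper_subgroup:
  assumes P: "subgroup P G" "card P = p ^ a" "prime (p::nat)" and S: "subgroup S G" "S \<subset> P"
  obtains M where "subgroup M G" "S \<subseteq> M" "M \<subset> P" "normalized_by P M" "derived G P \<subseteq> M"
proof -
  interpret P: subgroup P G by fact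
  have fP: "finite P" using P by (metis card.infinite not_prime_0 power_not_zero)
  define \<M> where "\<M> = {M. subgroup M G \<and> S \<subseteq> M \<and> M \<subset> P}"
  have "\<M> \<subseteq> Pow P" by (auto simp: \<M>_def)
  then have "finite \<M>" using fP finite_subset by blast
  moreover have "S \<in> \<M>" using S by (auto simp: \<M>_def)
  ultimately obtain M where M: "M \<in> \<M>" and max: "\<And>M'. M' \<in> \<M> \<Longrightarrow> M \<subseteq> M' \<Longrightarrow> M' = M"
    using finite_has_maximal[of \<M>] by blast
  have Ms: "subgroup M G" "S \<subseteq> M" "M \<subset> P" using M by (auto simp: \<M>_def)
  interpret M: subgroup M G by (fact Ms(1))
  have maxP: "T = P" if "subgroup T G" "M \<subset> T" "T \<subseteq> P" for T
    using max[of T] that Ms unfolding \<M>_def by blast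
  let ?\<Xi> = "(\<lambda>y. M #> y) ` P"
  define F where "F = {C \<in> ?\<Xi>. \<forall>s\<in>M. C #> inv s = C}"
  obtain b where b: "card M = p ^ b" using p_group_subgroup[OF P Ms(1)] Ms(3) by blast
  have "card F mod p = card ?\<Xi> mod p"
    unfolding F_def using Ms(3) by (intro p_group_fixed_coset[OF Ms(1) b P(3) P(1) fP _ Ms(1)]) auto
  moreover have "p dvd card ?\<Xi>" by (rule p_group_index[OF P Ms(1,3)])
  ultimately have dvd: "p dvd card F" by (simp only: dvd_eq_mod_eq_0)
  have "F \<noteq> {M}"
  proof
    assume "F = {M}"
    then show False using P(3) dvd by simp
  qed
  moreover have "M \<in> F"
  proof -
    have "M #> \<one> = M" by (rule coset_mult_one[OF M.subset])
    then have "M \<in> ?\<Xi>" using P.one_closed by (metis imageI)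
    moreover have "M #> inv s = M" if "s \<in> M" for s
      using that by (intro coset_join2 Ms(1)) simp_all
    ultimately show ?thesis by (simp add: F_def)
  qed
  ultimately obtain C where C: "C \<in> F" "C \<noteq> M" by blast
  then obtain x where x: "x \<in> P" "C = M #> x" unfolding F_def by blast
  have xM: "x \<notin> M" using C(2) x(2) coset_join2[of x M] Ms(1) by (metis M.mem_carrier)
  have xn: "conj_by x s \<in> M" if s: "s \<in> M" for s
  proof -
    have "C #> inv s = C" using C(1) s unfolding F_def by blast
    then have "M #> (x \<otimes> inv s) = M #> x" unfolding x(2) using coset_mult_assoc[OF M.subset, of x "inv s"] x s by simp
    then have "x \<otimes> inv s \<otimes> inv x \<in> M" using rcos_eq_iff[OF Ms(1)] x s by simp
    then have "inv (x \<otimes> inv s \<otimes> inv x) \<in> M" by simp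
    then show ?thesis using x s by (simp add: inv_mult_group m_assoc)
  qed
  \<comment> \<open>The normaliser of \<open>M\<close> in \<open>P\<close>; in a finite group one
    inclusion is enough to define it.\<close>
  define T where "T = {x \<in> P. \<forall>s\<in>M. conj_by x s \<in> M}"
  have "subgroup T G"
  proof (rule subgroup_finiteI)
    show "x \<otimes> y \<in> T" if x: "x \<in> T" and y: "y \<in> T" for x y
    proof -
      have "x \<otimes> y \<otimes> s \<otimes> inv (x \<otimes> y) \<in> M" if s: "s \<in> M" for s
      proof -
        have "conj_by x (y \<otimes> s \<otimes> inv y) \<in> M" using x y s unfolding T_def by blast
        then show ?thesis using x y s by (simp add: T_def m_assoc inv_mult_group)
      qed
      then show ?thesis using x y by (simp add: T_def)
    qed
    show "T \<subseteq> carrier G" using P.subset by (auto simp: T_def)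
    show "finite T" using fP by (simp add: T_def)
    show "\<one> \<in> T" by (simp add: T_def)
  qed
  moreover have "M \<subset> T"
  proof -
    have "M \<subseteq> T" using Ms(3) by (auto simp: T_def)
    moreover have "x \<in> T" using x xn by (simp add: T_def)
    ultimately show ?thesis using xM by blast
  qed
  moreover have "T \<subseteq> P" by (auto simp: T_def)
  ultimately have "T = P" by (rule maxP)
  then have nM: "normalized_by P M" by (auto simp: normalized_by_def T_def)
  have MP: "M \<subseteq> P" using Ms(3) by auto
  obtain z where z: "z \<in> P" "z \<notin> M" "\<And>g. g \<in> P \<Longrightarrow> commutator g z \<in> M"
    by (rule p_group_central_mod[OF P Ms(1) nM P(1) _ _ Ms(3)]) (auto simp: normalized_by_def)
  note cm = centre_mod[OF P(1) Ms(1) nM MP]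
  have "z \<in> centre_mod P M"
    using z commutator_mod_sym[OF Ms(1)] by (simp add: centre_mod_def)
  then have "M \<subset> centre_mod P M" using cm(2) z(2) by blast
  moreover have "centre_mod P M \<subseteq> P" by (auto simp: centre_mod_def)
  ultimately have "centre_mod P M = P" using maxP[OF cm(1)] by blast
  then have "derived_set G P \<subseteq> M" by (auto simp: centre_mod_def)
  then have "derived G P \<subseteq> M" unfolding derived_def by (rule generate_subgroup_incl[OF _ Ms(1)])
  then show thesis by (rule that[OF Ms nM])
qed

text \<open>Modulo \<open>N\<close>, adjoin to the centre of \<open>P\<close> an element
  \<open>z\<close> of the second centre outside the centre. The result \<open>A\<close> is abelian
  and normal but not central, and \<open>z\<close> itself is the witness \<open>b\<close>.\<close>

lemma p_group_abelian_mod_subgroup: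
  assumes P: "subgroup P G" "card P = p ^ a" "prime (p::nat)"
    and N: "subgroup N G" "normalized_by P N" "N \<subseteq> P" and nab: "\<not> derived_set G P \<subseteq> N"
  obtains A b g where "subgroup A G" "A \<subseteq> P" "N \<subseteq> A" "normalized_by P A" "derived_set G A \<subseteq> N"
    "b \<in> A" "g \<in> P" "commutator b g \<notin> N"
proof -
  interpret P: subgroup P G by fact
  have fP: "finite P" using P by (metis card.infinite not_prime_0 power_not_zero)
  note cm = centre_mod[OF P(1) N]
  have CP: "centre_mod P N \<subseteq> P" by (auto simp: centre_mod_def)
  have "centre_mod P N \<noteq> P" using nab unfolding centre_mod_def by blast
  then have sub: "centre_mod P N \<subset> P" using CP by blast
  obtain z where z: "z \<in> P" "z \<notin> centre_mod P N"
    "\<And>g. g \<in> P \<Longrightarrow> commutator g z \<in> centre_mod P N"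
    by (rule p_group_central_mod[OF P cm(1,3) P(1) _ _ sub]) (auto simp: normalized_by_def)
  define A where "A = {n \<otimes> z [^] (i::nat) | n i. n \<in> centre_mod P N}"
  note A = powers_mod_subgroup(1-5)[OF P(1) fP cm(1,3) CP z(1,3), folded A_def]
  obtain g where g: "g \<in> P" "commutator z g \<notin> N" using z(1,2) unfolding centre_mod_def by blast
  have AS: "A \<subseteq> {x \<in> P. commutator x y \<in> N}" (is "_ \<subseteq> ?S")
    if y: "y \<in> P" "commutator z y \<in> N" for y
  proof
    fix x assume "x \<in> A"
    then obtain n i where x: "x = n \<otimes> z [^] (i::nat)" "n \<in> centre_mod P N" by (auto simp: A_def)
    have S: "subgroup ?S G" by (rule commutator_mod_subgroup[OF P(1) N(1,2) y(1)])
    have "n \<in> ?S" using x(2) y(1) by (auto simp: centre_mod_def)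
    moreover have "z [^] i \<in> ?S" by (rule pow_in_subgroup[OF S]) (use z y in auto)
    ultimately show "x \<in> ?S" unfolding x(1) by (rule subgroup.m_closed[OF S])
  qed
  have zz: "commutator z z \<in> N" using z(1) subgroup.one_closed[OF N(1)] by (simp add: m_assoc)
  have "commutator x y \<in> N" if x: "x \<in> A" and y: "y \<in> A" for x y
  proof -
    have yP: "y \<in> P" using y A(5) by blast
    have "commutator y z \<in> N" using AS[OF z(1) zz] y by blast
    then have "commutator z y \<in> N" using commutator_mod_sym[OF N(1)] z(1) yP by simp
    then show ?thesis using AS[OF yP] x by blast
  qed
  then have "derived_set G A \<subseteq> N" by auto
  moreover have "N \<subseteq> A" using cm(2) A(3) by blast
  ultimately show thesis using that A(1,2,4,5) g by blast
qed

section \<open>Sylow theory relative to a subgroup\<close>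

lemma sylow_in_subgroup:
  assumes Y: "subgroup Y G" "finite Y" and p: "prime (p::nat)"
  obtains T a m where "subgroup T G" "T \<subseteq> Y" "card T = p ^ a" "card Y = p ^ a * m" "\<not> p dvd m"
proof -
  interpret Y: subgroup Y G by fact
  have "card Y \<noteq> 0" using Y(2) Y.one_closed by (metis card_eq_0_iff empty_iff)
  then obtain m where m: "card Y = p ^ multiplicity p (card Y) * m" "\<not> p dvd m"
    using multiplicity_decompose'[of "card Y" p] p by (metis not_prime_unit)
  let ?Y = "G\<lparr>carrier := Y\<rparr>"
  have gY: "group ?Y" by (rule subgroup_imp_group[OF Y(1)])
  have "\<exists>T. subgroup T ?Y \<and> card T = p ^ multiplicity p (card Y)"
    by (rule sylow_thm[OF p gY, of _ m]) (use m Y in \<open>auto simp: Coset.order_def\<close>)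
  then obtain T where T: "subgroup T ?Y" "card T = p ^ multiplicity p (card Y)" by blast
  have "subgroup T G" by (rule incl_subgroup[OF Y(1) T(1)])
  moreover have "T \<subseteq> Y" using subgroup.subset[OF T(1)] by simp
  ultimately show thesis using that T(2) m by blast
qed

lemma cauchy_in_subgroup:
  assumes Y: "subgroup Y G" "finite Y" and p: "prime (p::nat)" "p dvd card Y"
  obtains x where "x \<in> Y" "x \<noteq> \<one>" "x [^] p = \<one>"
proof -
  let ?Y = "G\<lparr>carrier := Y\<rparr>"
  have gY: "group ?Y" by (rule subgroup_imp_group[OF Y(1)])
  obtain m where m: "card Y = p * m" using p(2) by auto
  have "\<exists>T. subgroup T ?Y \<and> card T = p ^ 1"
    by (rule sylow_thm[OF p(1) gY, of _ m]) (use m Y in \<open>auto simp: Coset.order_def\<close>)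
  then obtain T where T: "subgroup T ?Y" "card T = p" by auto
  have TG: "subgroup T G" "T \<subseteq> Y"
    using incl_subgroup[OF Y(1) T(1)] subgroup.subset[OF T(1)] by simp_all
  have "T \<noteq> {\<one>}" using T(2) p(1) by auto
  then obtain x where x: "x \<in> T" "x \<noteq> \<one>" using subgroup.one_closed[OF TG(1)] by blast
  have "x [^] p = \<one>"
    using group.pow_order_eq_1[OF subgroup_imp_group[OF TG(1)], of x] x T(2)
    by (simp add: Coset.order_def nat_pow_consistent [symmetric])
  then show thesis using that x TG(2) by blast
qed

text \<open>The index of \<open>T\<close> in \<open>Y\<close> is prime to \<open>p\<close>, so the
  \<open>p\<close>-group \<open>S\<close> fixes a coset \<open>T y\<close>; then
  \<open>y S y^-1\<close> lies in \<open>T\<close>, and \<open>g\<close> is the inverse of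
  \<open>y\<close>.\<close>

lemma sylow_conjugate:
  assumes Y: "subgroup Y G" "finite Y" and p: "prime (p::nat)"
    and T: "subgroup T G" "T \<subseteq> Y" "card T = p ^ a" "card Y = p ^ a * m" "\<not> p dvd m"
    and S: "subgroup S G" "S \<subseteq> Y" "card S = p ^ b"
  obtains g where "g \<in> Y" "\<And>s. s \<in> S \<Longrightarrow> inv g \<otimes> s \<otimes> g \<in> T"
proof -
  interpret Y: subgroup Y G by fact
  interpret T: subgroup T G by fact
  define F where "F = {C \<in> (\<lambda>y. T #> y) ` Y. \<forall>s\<in>S. C #> inv s = C}"
  have "card ((\<lambda>y. T #> y) ` Y) = m"
    using card_subgroup_cosets[OF T(1) Y(1) T(2)] T p by (simp add: mult.commute prime_gt_0_nat)
  then have "card F mod p = m mod p"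
    unfolding F_def using p_group_fixed_coset[OF S(1,3) p Y S(2) T(1,2)] by simp
  then have "F \<noteq> {}" using T(5) by (metis card.empty dvd_eq_mod_eq_0 mod_0)
  then obtain C where "C \<in> F" by blast
  then obtain y where y: "y \<in> Y" "\<And>s. s \<in> S \<Longrightarrow> T #> y #> inv s = T #> y" unfolding F_def by blast
  have "inv (inv y) \<otimes> s \<otimes> inv y \<in> T" if s: "s \<in> S" for s
  proof -
    have sc: "s \<in> carrier G" using s S(2) by auto
    have "T #> (y \<otimes> inv s) = T #> y"
      using y(2)[OF s] coset_mult_assoc[OF T.subset, of y "inv s"] y(1) sc by simp
    then have "y \<otimes> inv s \<otimes> inv y \<in> T" using rcos_eq_iff[OF T(1)] y(1) sc by simp
    then have "inv (y \<otimes> inv s \<otimes> inv y) \<in> T" by simp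
    then show ?thesis using y(1) sc by (simp add: inv_mult_group m_assoc)
  qed
  then show thesis using that[of "inv y"] y(1) by blast
qed

end

subsection \<open>Tate's theorem\<close>

text \<open>\<open>r\<close> chooses representatives of the right cosets \<open>P g\<close>, and
  \<open>\<one>\<close> for \<open>P\<close> itself, so that
  \<open>g = (g \<otimes> inv r g) \<otimes> r g\<close> splits off the part of \<open>g\<close> in
  \<open>P\<close>. By the normalisation, the part of an element of \<open>P\<close> is the element
  itself.\<close>

definition (in group) transversal :: "'a set \<Rightarrow> ('a \<Rightarrow> 'a) \<Rightarrow> bool"
  where "transversal P r \<longleftrightarrow> (\<forall>g\<in>carrier G. r g \<in> carrier G \<and> g \<otimes> inv r g \<in> P \<and> r (r g) = r g
      \<and> (\<forall>x\<in>P. r (x \<otimes> g) = r g)) \<and> (\<forall>g\<in>P. r g = \<one>)"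

lemma (in group) transversal_exists:
  assumes P: "subgroup P G"
  obtains r where "transversal P r"
proof -
  interpret P: subgroup P G by fact
  define r where "r g = (if g \<in> P then \<one> else (SOME h. h \<in> P #> g))" for g
  have r: "r g \<in> P #> g" if "g \<in> carrier G" for g
  proof (cases "g \<in> P")
    case True
    have "P #> g = P" using True by (intro coset_join2 P) auto
    then show ?thesis using True by (simp add: r_def)
  next
    case False
    have "g \<in> P #> g" by (rule rcos_self[OF that P])
    then have "(SOME h. h \<in> P #> g) \<in> P #> g" by (rule someI)
    then show ?thesis using False by (simp add: r_def)
  qed
  have rc: "r g \<in> carrier G" if "g \<in> carrier G" for g
    using r[OF that] r_coset_subset_G[OF P.subset that] by blast
  have rP: "g \<otimes> inv r g \<in> P" if g: "g \<in> carrier G" for g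
  proof -
    have "r g \<otimes> inv g \<in> P" by (rule P.rcos_module_imp[OF is_group g r[OF g]])
    then have "inv (r g \<otimes> inv g) \<in> P" by (rule P.m_inv_closed)
    then show ?thesis using g rc[OF g] by (simp add: inv_mult_group)
  qed
  have r_const: "r (x \<otimes> g) = r g" if "x \<in> P" "g \<in> carrier G" for x g
  proof -
    have "x \<otimes> g \<in> P \<longleftrightarrow> g \<in> P" using subgroup_mult_eq(1)[OF P that] .
    moreover have "P #> (x \<otimes> g) = P #> g"
      using that coset_mult_assoc[OF P.subset, of x g] coset_join2[of x P] P by simp
    ultimately show ?thesis by (simp add: r_def)
  qed
  have "r (r g) = r g" if g: "g \<in> carrier G" for g
  proof -
    have "g = (g \<otimes> inv r g) \<otimes> r g" using g rc[OF g] by (simp add: m_assoc)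
    then show ?thesis using r_const[OF rP[OF g] rc[OF g]] by simp
  qed
  then have "transversal P r" using rc rP r_const by (simp add: transversal_def r_def)
  then show thesis by (rule that)
qed

text \<open>The last claim is what sums and products over a transversal are reindexed with: right
  multiplication by \<open>h\<close> permutes the cosets of \<open>P\<close>, hence, followed by
  \<open>r\<close>, the representatives.\<close>

lemma (in group) transversal:
  assumes P: "subgroup P G" and t: "transversal P r"
  shows "\<And>g. g \<in> carrier G \<Longrightarrow> r g \<in> carrier G" "\<And>g. g \<in> carrier G \<Longrightarrow> g \<otimes> inv r g \<in> P"
    "\<And>x g. x \<in> P \<Longrightarrow> g \<in> carrier G \<Longrightarrow> r (x \<otimes> g) = r g" "\<And>g. g \<in> P \<Longrightarrow> r g = \<one>"
    "\<And>g. g \<in> r ` carrier G \<Longrightarrow> r g = g"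
    "\<And>g h. g \<in> carrier G \<Longrightarrow> h \<in> carrier G \<Longrightarrow> r g = r h \<longleftrightarrow> g \<otimes> inv h \<in> P"
    "finite (carrier G) \<Longrightarrow> card (r ` carrier G) * card P = card (carrier G)"
    "finite (carrier G) \<Longrightarrow> h \<in> carrier G \<Longrightarrow> bij_betw (\<lambda>g. r (g \<otimes> h)) (r ` carrier G) (r ` carrier G)"
proof -
  interpret P: subgroup P G by fact
  show rc: "\<And>g. g \<in> carrier G \<Longrightarrow> r g \<in> carrier G" and rP: "\<And>g. g \<in> carrier G \<Longrightarrow> g \<otimes> inv r g \<in> P"
    and r_const: "\<And>x g. x \<in> P \<Longrightarrow> g \<in> carrier G \<Longrightarrow> r (x \<otimes> g) = r g" and "\<And>g. g \<in> P \<Longrightarrow> r g = \<one>"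
    and r_id: "\<And>g. g \<in> r ` carrier G \<Longrightarrow> r g = g"
    using t by (auto simp: transversal_def)
  show rr: "r g = r h \<longleftrightarrow> g \<otimes> inv h \<in> P" if g: "g \<in> carrier G" and h: "h \<in> carrier G" for g h
  proof
    assume e: "r g = r h"
    have "(g \<otimes> inv r g) \<otimes> inv (h \<otimes> inv r h) \<in> P" by (rule P.m_closed[OF rP[OF g] P.m_inv_closed[OF rP[OF h]]])
    then show "g \<otimes> inv h \<in> P" using e g h rc[OF h] by (simp add: m_assoc inv_mult_group)
  next
    assume e: "g \<otimes> inv h \<in> P"
    then show "r g = r h" using r_const[OF e h] g h by (simp add: m_assoc)
  qed
  let ?R = "r ` carrier G"
  show "card ?R * card P = card (carrier G)" if fin: "finite (carrier G)"
  proof -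
    have "bij_betw (\<lambda>g. P #> g) ?R ((\<lambda>g. P #> g) ` carrier G)"
    proof (rule bij_betw_imageI)
      show "inj_on ((#>) P) ?R"
      proof (rule inj_onI)
        fix x y assume xy: "x \<in> ?R" "y \<in> ?R" "P #> x = P #> y"
        have c: "x \<in> carrier G" "y \<in> carrier G" using xy(1,2) rc by auto
        then have "r x = r y" using rcos_eq_iff[OF P c] rr[OF c] xy(3) by blast
        then show "x = y" using r_id[OF xy(1)] r_id[OF xy(2)] by simp
      qed
      show "(#>) P ` ?R = (#>) P ` carrier G"
      proof (intro equalityI subsetI)
        fix C assume "C \<in> (#>) P ` carrier G"
        then obtain g where g: "g \<in> carrier G" "C = P #> g" by blast
        have "C = P #> r g" using g(2) rcos_eq_iff[OF P g(1) rc[OF g(1)]] rP[OF g(1)] by blast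
        then show "C \<in> (#>) P ` ?R" using g(1) by blast
      qed (use rc in auto)
    qed
    then have "card ?R = card ((\<lambda>g. P #> g) ` carrier G)" by (rule bij_betw_same_card)
    then show ?thesis using card_subgroup_cosets[OF P subgroup_self P.subset] by simp
  qed
  show "bij_betw (\<lambda>g. r (g \<otimes> h)) ?R ?R" if fin: "finite (carrier G)" and h: "h \<in> carrier G"
  proof -
    have "inj_on (\<lambda>g. r (g \<otimes> h)) ?R"
    proof (rule inj_onI)
      fix g g' assume g: "g \<in> ?R" "g' \<in> ?R" and e: "r (g \<otimes> h) = r (g' \<otimes> h)"
      have gc: "g \<in> carrier G" "g' \<in> carrier G" using g rc by auto
      have "(g \<otimes> h) \<otimes> inv (g' \<otimes> h) \<in> P" using e rr[of "g \<otimes> h" "g' \<otimes> h"] gc h by blast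
      then have "r g = r g'" using rr[OF gc] gc h by (simp add: inv_mult_group m_assoc)
      then show "g = g'" using r_id[OF g(1)] r_id[OF g(2)] by simp
    qed
    moreover have "(\<lambda>g. r (g \<otimes> h)) ` ?R \<subseteq> ?R" using rc h by auto
    ultimately show ?thesis using fin by (simp add: bij_betw_def endo_inj_surj)
  qed
qed

context group begin

text \<open>Approximate retractions of \<open>H\<close> onto \<open>P\<close>, multiplicative and the identity on \<open>P\<close> only up to \<open>K\<close>; they are
  corrected step by step while \<open>K\<close> shrinks to the trivial group.\<close>

definition hom_mod :: "'a set \<Rightarrow> 'a set \<Rightarrow> 'a set \<Rightarrow> 'a set \<Rightarrow> ('a \<Rightarrow> 'a) \<Rightarrow> bool"
  where "hom_mod P Q H K f \<longleftrightarrow> f ` H \<subseteq> P \<and> f ` Q \<subseteq> P \<inter> Q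
    \<and> (\<forall>g\<in>H. \<forall>h\<in>H. f g \<otimes> f h \<otimes> inv f (g \<otimes> h) \<in> K) \<and> (\<forall>x\<in>P. f x \<otimes> inv x \<in> K)"

text \<open>The hypothesis of Tate's theorem, with natural numbers standing for the integers modulo
  \<open>p\<close>. For a \<open>p\<close>-group \<open>P\<close> it says that
  \<open>P \<inter> Q\<close> lies in the Frattini subgroup of \<open>P\<close>.\<close>

definition characters_vanish :: "nat \<Rightarrow> 'a set \<Rightarrow> 'a set \<Rightarrow> bool"
  where "characters_vanish p P Q \<longleftrightarrow> (\<forall>\<chi> :: 'a \<Rightarrow> nat.
    (\<forall>x\<in>P. \<forall>y\<in>P. [\<chi> (x \<otimes> y) = \<chi> x + \<chi> y] (mod p)) \<longrightarrow> (\<forall>x\<in>P \<inter> Q. [\<chi> x = 0] (mod p)))"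

text \<open>The obstruction is a cocycle with values in a central factor \<open>K/K'\<close> of order \<open>p\<close>. Summing it over the cosets
  of \<open>P\<close>, whose number \<open>m\<close> is invertible modulo \<open>p\<close>, splits it.\<close>

lemma hom_mod_refine:
  assumes P: "subgroup P G" "card P = p ^ a" "prime (p::nat)"
    and fin: "finite (carrier G)" and m: "card (carrier G) = p ^ a * m" "\<not> p dvd m"
    and Q: "subgroup Q G"
    and hyp: "characters_vanish p P Q"
    and K: "subgroup K G" "normalized_by P K" "K \<subseteq> P \<inter> Q" "K \<noteq> {\<one>}"
    and f: "hom_mod P Q (carrier G) K f"
  obtains K' f' where "subgroup K' G" "normalized_by P K'" "K' \<subset> K" "hom_mod P Q (carrier G) K' f'"
proof -
  interpret P: subgroup P G by fact
  interpret K: subgroup K G by fact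
  interpret Q: subgroup Q G by fact
  have KP: "K \<subseteq> P" and KQ: "K \<subseteq> Q" using K(3) by auto
  have K1: "{\<one>} \<subset> K" using K(4) K.one_closed by blast
  have "subgroup {\<one>} G" by (simp add: triv_subgroup)
  moreover have "normalized_by P {\<one>}" by (auto simp: normalized_by_def)
  \<comment> \<open>A \<open>P\<close>-invariant character of the coefficients \<open>K\<close>.
    This step removes the image of the obstruction under \<open>\<eta>\<close>, and the kernel of
    \<open>\<eta>\<close> becomes the new \<open>K'\<close>.\<close>
  ultimately obtain \<eta> z where z: "z \<in> K" "[\<eta> z = 1] (mod p)"
    and \<eta>: "\<And>k k'. k \<in> K \<Longrightarrow> k' \<in> K \<Longrightarrow> [\<eta> (k \<otimes> k') = \<eta> k + \<eta> k'] (mod p)"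
      "\<And>g k. g \<in> P \<Longrightarrow> k \<in> K \<Longrightarrow> [\<eta> (conj_by g k) = \<eta> k] (mod p)"
      "[\<eta> \<one> = 0] (mod p)"
    using p_group_invariant_character[OF P _ _ K(1,2) KP K1] by (metis singletonI)
  have fP: "\<And>g. g \<in> carrier G \<Longrightarrow> f g \<in> P" and fQ: "\<And>q. q \<in> Q \<Longrightarrow> f q \<in> P \<inter> Q"
    and fm: "\<And>g h. g \<in> carrier G \<Longrightarrow> h \<in> carrier G \<Longrightarrow> f g \<otimes> f h \<otimes> inv f (g \<otimes> h) \<in> K"
    and fx: "\<And>x. x \<in> P \<Longrightarrow> f x \<otimes> inv x \<in> K"
    using f unfolding hom_mod_def by blast+
  obtain r where tr: "transversal P r" using transversal_exists[OF P(1)] .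
  note rc = transversal(1)[OF P(1) tr] and rP = transversal(2)[OF P(1) tr] and r_const = transversal(3)[OF P(1) tr]
  \<comment> \<open>Changing \<open>f\<close> inside \<open>K\<close> makes it exactly equivariant
    under left multiplication by \<open>P\<close> and exactly the identity on \<open>P\<close>. The
    case distinction is there because \<open>f \<one>\<close> may differ from
    \<open>\<one>\<close>.\<close>
  define s where "s g = (if g \<in> P then g else (g \<otimes> inv r g) \<otimes> f (r g))" for g
  have sP: "s g \<in> P" if "g \<in> carrier G" for g
    using rP[OF that] fP[OF rc[OF that]] by (simp add: s_def)
  have sc: "s g \<in> carrier G" if "g \<in> carrier G" for g using sP[OF that] by simp
  have s_left: "s (x \<otimes> g) = x \<otimes> s g" if x: "x \<in> P" and g: "g \<in> carrier G" for x g
  proof (cases "g \<in> P")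
    case True
    then show ?thesis using x by (simp add: s_def)
  next
    case False
    then have "x \<otimes> g \<notin> P" using subgroup_mult_eq(1)[OF P(1) x g] by blast
    then show ?thesis using False x g rc[OF g] fP[OF rc[OF g]] by (simp add: s_def r_const m_assoc)
  qed
  have sf: "s g \<otimes> inv f g \<in> K" if g: "g \<in> carrier G" for g
  proof (cases "g \<in> P")
    case True
    have "inv (f g \<otimes> inv g) \<in> K" using fx[OF True] by (rule K.m_inv_closed)
    then show ?thesis using True fP[OF g] by (simp add: s_def inv_mult_group)
  next
    case False
    let ?x = "g \<otimes> inv r g"
    have x: "?x \<in> P" by (rule rP[OF g])
    have gx: "?x \<otimes> r g = g" using g rc[OF g] by (simp add: m_assoc)
    have 1: "f ?x \<otimes> f (r g) \<otimes> inv f g \<in> K" using fm[of ?x "r g"] g rc[OF g] gx by simp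
    have 2: "inv (f ?x \<otimes> inv ?x) \<in> K" using fx[OF x] by (rule K.m_inv_closed)
    have fc: "f ?x \<in> carrier G" "f (r g) \<in> carrier G" "f g \<in> carrier G" "?x \<in> carrier G"
      using fP[of ?x] fP[OF rc[OF g]] fP[OF g] x by auto
    have "inv (f ?x \<otimes> inv ?x) \<otimes> (f ?x \<otimes> f (r g) \<otimes> inv f g) = ?x \<otimes> f (r g) \<otimes> inv f g"
      unfolding inv_mult_group[OF fc(1) inv_closed[OF fc(4)]] inv_inv[OF fc(4)]
      using fc(1-3) fc(4) by (simp only: m_assoc inv_mult_cancel inv_closed m_closed)
    then show ?thesis using K.m_closed[OF 2 1] False by (simp add: s_def)
  qed
  have KI: "conj_by x k \<in> K" if "x \<in> P" "k \<in> K" for x k using normalized_byD[OF K(2)] that by blast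
  \<comment> \<open>The defect of \<open>s\<close>. It lies in \<open>K\<close> and satisfies the
    cocycle identity, and equivariance of \<open>s\<close> makes \<open>\<eta> (c g h)\<close>
    depend on the coset \<open>P g\<close> only, so that it can be summed over a
    transversal.\<close>
  define c where "c g h = s g \<otimes> s h \<otimes> inv s (g \<otimes> h)" for g h
  have cK: "c g h \<in> K" if g: "g \<in> carrier G" and h: "h \<in> carrier G" for g h
  proof -
    have 1: "s g \<otimes> inv f g \<in> K" "s h \<otimes> inv f h \<in> K" by (rule sf, fact)+
    have 2: "inv (s (g \<otimes> h) \<otimes> inv f (g \<otimes> h)) \<in> K" using g h by (intro K.m_inv_closed sf) simp
    have 3: "f g \<otimes> (s h \<otimes> inv f h) \<otimes> inv f g \<in> K" by (rule KI[OF fP[OF g] 1(2)])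
    have fc: "f g \<in> carrier G" "f h \<in> carrier G" "f (g \<otimes> h) \<in> carrier G" "s g \<in> carrier G" "s h \<in> carrier G" "s (g \<otimes> h) \<in> carrier G"
      using fP sP g h by simp_all
    have "(s g \<otimes> inv f g) \<otimes> (f g \<otimes> (s h \<otimes> inv f h) \<otimes> inv f g) \<otimes> (f g \<otimes> f h \<otimes> inv f (g \<otimes> h)) \<otimes>
        inv (s (g \<otimes> h) \<otimes> inv f (g \<otimes> h)) \<in> K"
      by (intro K.m_closed 1 2 3 fm g h)
    then show ?thesis unfolding c_def using fc by (simp add: m_assoc inv_mult_group)
  qed
  have \<eta>c_left: "[\<eta> (c (x \<otimes> g) h) = \<eta> (c g h)] (mod p)"
    if x: "x \<in> P" and g: "g \<in> carrier G" and h: "h \<in> carrier G" for x g h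
  proof -
    have "c (x \<otimes> g) h = x \<otimes> c g h \<otimes> inv x"
      using x g h sc[OF g] sc[OF h] sc[of "g \<otimes> h"] s_left[OF x g] s_left[OF x, of "g \<otimes> h"]
      unfolding c_def by (simp add: m_assoc inv_mult_group)
    then show ?thesis using \<eta>(2)[OF x cK[OF g h]] by simp
  qed
  have cocycle: "[\<eta> (c g h) + \<eta> (c (g \<otimes> h) k) = \<eta> (c h k) + \<eta> (c g (h \<otimes> k))] (mod p)"
    if g: "g \<in> carrier G" and h: "h \<in> carrier G" and k: "k \<in> carrier G" for g h k
  proof -
    have C: "s g \<in> carrier G" "s h \<in> carrier G" "s k \<in> carrier G" "s (g \<otimes> h) \<in> carrier G" "s (h \<otimes> k) \<in> carrier G" "s (g \<otimes> h \<otimes> k) \<in> carrier G"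
      using sc g h k by simp_all
    have eq: "c g h \<otimes> c (g \<otimes> h) k = (s g \<otimes> c h k \<otimes> inv s g) \<otimes> c g (h \<otimes> k)"
      using C m_assoc[OF g h k] unfolding c_def by (simp add: m_assoc)
    have "[\<eta> (c g h \<otimes> c (g \<otimes> h) k) = \<eta> (c g h) + \<eta> (c (g \<otimes> h) k)] (mod p)"
      using g h k by (intro \<eta>(1) cK) simp_all
    moreover have "[\<eta> ((s g \<otimes> c h k \<otimes> inv s g) \<otimes> c g (h \<otimes> k)) = \<eta> (s g \<otimes> c h k \<otimes> inv s g) + \<eta> (c g (h \<otimes> k))] (mod p)"
      using g h k by (intro \<eta>(1) cK KI sP) simp_all
    moreover have "[\<eta> (s g \<otimes> c h k \<otimes> inv s g) = \<eta> (c h k)] (mod p)"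
      by (rule \<eta>(2)[OF sP[OF g] cK[OF h k]])
    ultimately show ?thesis unfolding eq by (metis cong_add_rcancel_nat cong_sym cong_trans)
  qed
  define R where "R = r ` carrier G"
  have Rc: "R \<subseteq> carrier G" using rc by (auto simp: R_def)
  have "card R * p ^ a = p ^ a * m"
    using transversal(7)[OF P(1) tr fin] P(2) m(1) by (simp add: R_def)
  then have cardR: "card R = m" using P(3) by (simp add: prime_gt_0_nat)
  note shift = transversal(8)[OF P(1) tr fin, folded R_def]
  define t where "t h = (\<Sum>g\<in>R. \<eta> (c g h))" for h
  have tsum: "[t h + t k = m * \<eta> (c h k) + t (h \<otimes> k)] (mod p)" if h: "h \<in> carrier G" and k: "k \<in> carrier G" for h k
  proof -
    have "[\<eta> (c (g \<otimes> h) k) = \<eta> (c (r (g \<otimes> h)) k)] (mod p)" if "g \<in> R" for g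
    proof -
      have gh: "g \<otimes> h \<in> carrier G" using that Rc h by auto
      have "g \<otimes> h = (g \<otimes> h \<otimes> inv r (g \<otimes> h)) \<otimes> r (g \<otimes> h)"
        using gh rc[OF gh] by (simp only: m_assoc inv_closed l_inv r_one)
      then show ?thesis using \<eta>c_left[OF rP[OF gh] rc[OF gh] k] by simp
    qed
    then have "[(\<Sum>g\<in>R. \<eta> (c (g \<otimes> h) k)) = (\<Sum>g\<in>R. \<eta> (c (r (g \<otimes> h)) k))] (mod p)" by (rule cong_sum)
    also have "(\<Sum>g\<in>R. \<eta> (c (r (g \<otimes> h)) k)) = t k"
      unfolding t_def using sum.reindex_bij_betw[OF shift[OF h], of "\<lambda>g. \<eta> (c g k)"] by simp
    finally have 1: "[(\<Sum>g\<in>R. \<eta> (c (g \<otimes> h) k)) = t k] (mod p)" .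
    have "[(\<Sum>g\<in>R. \<eta> (c g h) + \<eta> (c (g \<otimes> h) k)) = (\<Sum>g\<in>R. \<eta> (c h k) + \<eta> (c g (h \<otimes> k)))] (mod p)"
      using Rc h k by (intro cong_sum cocycle) auto
    then have "[t h + (\<Sum>g\<in>R. \<eta> (c (g \<otimes> h) k)) = m * \<eta> (c h k) + t (h \<otimes> k)] (mod p)"
      by (simp add: sum.distrib t_def cardR)
    then show ?thesis using 1 by (meson cong_add cong_refl cong_sym cong_trans)
  qed
  obtain m' where m': "[m * m' = 1] (mod p)"
    using cong_solve_coprime_nat[of m p] prime_imp_coprime[OF P(3) m(2)] by (auto simp: coprime_commute)
  \<comment> \<open>\<open>e\<close> is \<open>- t / m\<close> modulo \<open>p\<close>: the factor
    \<open>p - 1\<close> stands for -1 in the natural numbers, and \<open>m'\<close> inverts the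
    index \<open>m\<close>. Its coboundary cancels \<open>\<eta>\<close> of the cocycle.\<close>
  define e where "e h = (p - 1) * m' * t h" for h
  have p1: "[(p - 1) * x + x = 0] (mod p)" for x :: nat
  proof -
    have "(p - 1) * x + x = p * x" using prime_gt_0_nat[OF P(3)] by (cases p) auto
    then show ?thesis by (simp add: cong_def)
  qed
  have e_add: "[e h + e k + \<eta> (c h k) = e (h \<otimes> k)] (mod p)" if h: "h \<in> carrier G" and k: "k \<in> carrier G" for h k
  proof -
    have "[(p - 1) * m' * (t h + t k) = (p - 1) * m' * (m * \<eta> (c h k) + t (h \<otimes> k))] (mod p)"
      by (rule cong_scalar_left[OF tsum[OF h k]])
    then have "[e h + e k = (p - 1) * ((m * m') * \<eta> (c h k)) + e (h \<otimes> k)] (mod p)"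
      by (simp add: e_def algebra_simps)
    moreover have "[(p - 1) * ((m * m') * \<eta> (c h k)) = (p - 1) * (1 * \<eta> (c h k))] (mod p)"
      by (intro cong_scalar_left cong_scalar_right m')
    ultimately have "[e h + e k = (p - 1) * \<eta> (c h k) + e (h \<otimes> k)] (mod p)"
      by (metis (no_types, lifting) cong_add_rcancel_nat cong_trans mult_1)
    then have "[e h + e k + \<eta> (c h k) = (p - 1) * \<eta> (c h k) + e (h \<otimes> k) + \<eta> (c h k)] (mod p)"
      by (simp add: cong_add_rcancel_nat)
    also have "(p - 1) * \<eta> (c h k) + e (h \<otimes> k) + \<eta> (c h k) = ((p - 1) * \<eta> (c h k) + \<eta> (c h k)) + e (h \<otimes> k)" by simp
    also have "[\<dots> = 0 + e (h \<otimes> k)] (mod p)" by (intro cong_add p1 cong_refl)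
    finally show ?thesis by simp
  qed
  have sx: "s x = x" if "x \<in> P" for x using that by (simp add: s_def)
  have e_hom: "[e (x \<otimes> y) = e x + e y] (mod p)" if x: "x \<in> P" and y: "y \<in> P" for x y
  proof -
    have "c x y = \<one>" using x y sx by (simp add: c_def)
    then have "[e x + e y + \<eta> \<one> = e (x \<otimes> y)] (mod p)" using e_add[of x y] x y by simp
    moreover have "[e x + e y + \<eta> \<one> = e x + e y + 0] (mod p)" by (intro cong_add cong_refl \<eta>(3))
    ultimately show ?thesis by (metis add_0_right cong_sym cong_trans)
  qed
  \<comment> \<open>Here the hypothesis on characters enters: \<open>c\<close> is trivial on
    \<open>P\<close>, so \<open>e\<close> is a homomorphism there, and \<open>K\<close> lies in
    \<open>P \<inter> Q\<close>.\<close>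
  have e_K: "[e x = 0] (mod p)" if "x \<in> K" for x
    using hyp e_hom that K(3) unfolding characters_vanish_def by blast
  \<comment> \<open>Subtracting \<open>e (s g)\<close> makes the correction vanish on
    \<open>P\<close>, so that the new map stays the identity there. The equation solved by
    \<open>e\<close> survives because \<open>e\<close> kills the values of \<open>c\<close>, which
    makes \<open>e (s g)\<close> additive in \<open>g\<close> modulo \<open>p\<close>.\<close>
  define E where "E g = e g + (p - 1) * e (s g)" for g
  have E_add: "[E h + E k + \<eta> (c h k) = E (h \<otimes> k)] (mod p)" if h: "h \<in> carrier G" and k: "k \<in> carrier G" for h k
  proof -
    have hk: "h \<otimes> k \<in> carrier G" using h k by simp
    have "s h \<otimes> s k = c h k \<otimes> s (h \<otimes> k)" using sc[OF h] sc[OF k] sc[OF hk] by (simp add: c_def m_assoc)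
    moreover have "[e (s h \<otimes> s k) = e (s h) + e (s k)] (mod p)" using e_hom sP h k by simp
    moreover have "[e (c h k \<otimes> s (h \<otimes> k)) = e (c h k) + e (s (h \<otimes> k))] (mod p)"
      using e_hom sP[OF hk] cK[OF h k] KP by blast
    moreover have "[e (c h k) + e (s (h \<otimes> k)) = 0 + e (s (h \<otimes> k))] (mod p)"
      by (intro cong_add cong_refl e_K cK h k)
    ultimately have "[e (s h) + e (s k) = e (s (h \<otimes> k))] (mod p)"
      by (metis add_0 cong_sym cong_trans)
    then have "[(p - 1) * (e (s h) + e (s k)) = (p - 1) * e (s (h \<otimes> k))] (mod p)" by (rule cong_scalar_left)
    from cong_add[OF e_add[OF h k] this] show ?thesis by (simp add: E_def algebra_simps)
  qed
  have E_P: "[E x = 0] (mod p)" if "x \<in> P" for x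
    using p1[of "e x"] sx[OF that] by (simp add: E_def add.commute)
  define K' where "K' = {k \<in> K. [\<eta> k = 0] (mod p)}"
  have zi: "z [^] (i::nat) \<in> K" for i by (rule pow_in_subgroup[OF K(1) z(1)])
  have zc: "z \<in> carrier G" using z(1) by simp
  have \<eta>z: "[\<eta> (z [^] (i::nat)) = i] (mod p)" for i
  proof (induction i)
    case 0
    then show ?case using \<eta>(3) by simp
  next
    case (Suc i)
    have "[\<eta> (z [^] i \<otimes> z) = \<eta> (z [^] i) + \<eta> z] (mod p)" by (rule \<eta>(1)[OF zi z(1)])
    moreover have "[\<eta> (z [^] i) + \<eta> z = i + 1] (mod p)" by (intro cong_add Suc z(2))
    ultimately show ?case using cong_trans by simp
  qed
  define F where "F g = s g \<otimes> z [^] E g" for g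
  have FP: "F g \<in> P" if "g \<in> carrier G" for g
    unfolding F_def using sP[OF that] zi KP by (intro P.m_closed) auto
  show thesis
  proof (rule that)
    have "\<one> \<in> K'" using \<eta>(3) K.one_closed by (simp add: K'_def)
    moreover have "x \<otimes> y \<in> K'" if "x \<in> K'" "y \<in> K'" for x y
    proof -
      have xy: "x \<in> K" "y \<in> K" "[\<eta> x = 0] (mod p)" "[\<eta> y = 0] (mod p)" using that by (simp_all add: K'_def)
      have "[\<eta> x + \<eta> y = 0 + 0] (mod p)" by (rule cong_add[OF xy(3,4)])
      then have "[\<eta> (x \<otimes> y) = 0] (mod p)" using cong_trans[OF \<eta>(1)[OF xy(1,2)]] by simp
      then show ?thesis using that K.m_closed by (simp add: K'_def)
    qed
    moreover have "K' \<subseteq> carrier G" using K.subset by (auto simp: K'_def)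
    moreover have "finite K'" using \<open>K' \<subseteq> carrier G\<close> fin finite_subset by blast
    ultimately show "subgroup K' G" by (intro subgroup_finiteI)
    show "normalized_by P K'"
      unfolding normalized_by_def
    proof (intro ballI)
      fix g k assume "g \<in> P" "k \<in> K'"
      then have k: "g \<in> P" "k \<in> K" "[\<eta> k = 0] (mod p)" by (auto simp: K'_def)
      then show "conj_by g k \<in> K'" using KI[OF k(1,2)] cong_trans[OF \<eta>(2)[OF k(1,2)]] by (simp add: K'_def)
    qed
    have "z \<notin> K'"
    proof
      assume "z \<in> K'"
      then have "[\<eta> z = 0] (mod p)" by (simp add: K'_def)
      then have "[(1::nat) = 0] (mod p)" using cong_trans[OF cong_sym[OF z(2)]] by simp
      then show False using P(3) by (simp add: cong_0_iff)
    qed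
    then show "K' \<subset> K" using z(1) by (auto simp: K'_def)
    show "hom_mod P Q (carrier G) K' F"
      unfolding hom_mod_def
    proof (intro conjI ballI subsetI)
      fix y assume "y \<in> F ` carrier G" then show "y \<in> P" using FP by blast
    next
      fix y assume "y \<in> F ` Q"
      then obtain q where q: "q \<in> Q" "y = F q" by blast
      have qc: "q \<in> carrier G" using q(1) by simp
      have "s q = (s q \<otimes> inv f q) \<otimes> f q" using sc[OF qc] fP[OF qc] by (simp add: m_assoc)
      moreover have "s q \<otimes> inv f q \<in> Q" using sf[OF qc] KQ by blast
      moreover have "f q \<in> Q" using fQ[OF q(1)] by blast
      ultimately have "s q \<in> Q" using Q.m_closed by metis
      moreover have "z [^] E q \<in> Q" using zi KQ by blast
      ultimately have "F q \<in> Q" unfolding F_def by (rule Q.m_closed)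
      then show "y \<in> P \<inter> Q" using FP[OF qc] q(2) by blast
    next
      fix h k assume h: "h \<in> carrier G" and k: "k \<in> carrier G"
      have hk: "h \<otimes> k \<in> carrier G" using h k by simp
      have C: "s h \<in> carrier G" "s k \<in> carrier G" "s (h \<otimes> k) \<in> carrier G" "\<And>i::nat. z [^] i \<in> carrier G"
        using sc h k hk zc by simp_all
      let ?d = "F h \<otimes> F k \<otimes> inv F (h \<otimes> k)"
      let ?a = "s h \<otimes> z [^] E h \<otimes> inv s h" and ?b = "(s h \<otimes> s k) \<otimes> z [^] E k \<otimes> inv (s h \<otimes> s k)"
      let ?g = "s (h \<otimes> k) \<otimes> z [^] E (h \<otimes> k) \<otimes> inv s (h \<otimes> k)"
      \<comment> \<open>The powers of \<open>z\<close> are written as conjugates by elements of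
        \<open>P\<close>, and \<open>\<eta>\<close> does not notice the conjugation.\<close>
      have eq: "?d \<otimes> ?g = ?a \<otimes> ?b \<otimes> c h k"
        unfolding F_def c_def using C by (simp add: m_assoc inv_mult_group)
      have abg: "?a \<in> K" "?b \<in> K" "?g \<in> K"
        using sP[OF h] sP[OF k] sP[OF hk] zi by (auto intro!: KI P.m_closed)
      have dc: "?d \<in> carrier G" using FP h k hk by simp
      have "?d \<otimes> ?g \<in> K" unfolding eq by (rule K.m_closed[OF K.m_closed[OF abg(1,2)] cK[OF h k]])
      then have dK: "?d \<in> K" using subgroup_mult_eq(2)[OF K(1) abg(3) dc] by simp
      have "[\<eta> (?d \<otimes> ?g) = \<eta> ?d + \<eta> ?g] (mod p)" by (rule \<eta>(1)[OF dK abg(3)])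
      moreover have "[\<eta> ?d + \<eta> ?g = \<eta> ?d + E (h \<otimes> k)] (mod p)"
        by (intro cong_add cong_refl cong_trans[OF \<eta>(2)[OF sP[OF hk] zi] \<eta>z])
      moreover have "[\<eta> (?a \<otimes> ?b \<otimes> c h k) = \<eta> (?a \<otimes> ?b) + \<eta> (c h k)] (mod p)"
        by (rule \<eta>(1)[OF K.m_closed[OF abg(1,2)] cK[OF h k]])
      moreover have "[\<eta> (?a \<otimes> ?b) + \<eta> (c h k) = \<eta> ?a + \<eta> ?b + \<eta> (c h k)] (mod p)"
        by (rule cong_add[OF \<eta>(1)[OF abg(1,2)] cong_refl])
      moreover have "[\<eta> ?a + \<eta> ?b + \<eta> (c h k) = E h + E k + \<eta> (c h k)] (mod p)"
        by (rule cong_add[OF cong_add[OF cong_trans[OF \<eta>(2)[OF sP[OF h] zi] \<eta>z]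
              cong_trans[OF \<eta>(2)[OF P.m_closed[OF sP[OF h] sP[OF k]] zi] \<eta>z]] cong_refl])
      ultimately have "[\<eta> ?d + E (h \<otimes> k) = E h + E k + \<eta> (c h k)] (mod p)"
        unfolding eq by (simp add: cong_def)
      then have "[\<eta> ?d + E (h \<otimes> k) = 0 + E (h \<otimes> k)] (mod p)" using cong_trans[OF _ E_add[OF h k]] by simp
      then have "[\<eta> ?d = 0] (mod p)" by (simp only: cong_add_rcancel_nat)
      then show "?d \<in> K'" using dK by (simp add: K'_def)
    next
      fix x assume x: "x \<in> P"
      have "F x \<otimes> inv x = x \<otimes> z [^] E x \<otimes> inv x" using sx[OF x] by (simp add: F_def)
      moreover have "x \<otimes> z [^] E x \<otimes> inv x \<in> K" by (rule KI[OF x zi])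
      moreover have "[\<eta> (x \<otimes> z [^] E x \<otimes> inv x) = 0] (mod p)"
        using cong_trans[OF \<eta>(2)[OF x zi] cong_trans[OF \<eta>z E_P[OF x]]] .
      ultimately show "F x \<otimes> inv x \<in> K'" by (simp add: K'_def)
    qed
  qed
qed

lemma eq_if_mult_inv_one:
  assumes "x \<in> carrier G" "y \<in> carrier G" "x \<otimes> inv y = \<one>"
  shows "x = y"
  using assms inv_equality[of x "inv y"] by simp

lemma card_generate_prime_order:
  assumes "x \<in> carrier G" "x \<noteq> \<one>" "x [^] p = \<one>" "prime (p::nat)"
  shows "card (generate G {x}) = p"
proof -
  have "ord x dvd p" using assms(1,3) pow_eq_id by blast
  moreover have "ord x \<noteq> 1" using assms(1,2) ord_eq_1 by blast
  ultimately have "ord x = p" using assms(4) by (metis prime_nat_iff)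
  then show ?thesis using generate_pow_card[OF assms(1)] by simp
qed

text \<open>Starting from \<open>K = P \<inter> Q\<close> and any choice of \<open>P\<close>-parts,
  refinement goes on until \<open>K\<close> is trivial and yields a retraction of the whole group
  onto its Sylow subgroup \<open>P\<close>. An element of order \<open>p\<close> of \<open>Q\<close>
  in its kernel would be conjugate into \<open>P\<close>, on which the retraction is the
  identity.\<close>

lemma tate_retraction_product:
  assumes P: "subgroup P G" "card P = p ^ a" "prime (p::nat)"
    and fin: "finite (carrier G)" and m: "card (carrier G) = p ^ a * m" "\<not> p dvd m"
    and Q: "subgroup Q G" "normalized_by (carrier G) Q" and PQ: "\<And>g. g \<in> carrier G \<Longrightarrow> \<exists>x\<in>P. \<exists>q\<in>Q. g = x \<otimes> q"
    and hyp: "characters_vanish p P Q"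
  shows "\<exists>\<rho>. (\<forall>x\<in>Q. \<forall>y\<in>Q. \<rho> (x \<otimes> y) = \<rho> x \<otimes> \<rho> y) \<and> \<rho> ` Q \<subseteq> P \<inter> Q
    \<and> \<not> p dvd card {x \<in> Q. \<rho> x = \<one>}"
proof -
  interpret P: subgroup P G by fact
  interpret Q: subgroup Q G by fact
  define good where "good K \<longleftrightarrow> subgroup K G \<and> normalized_by P K \<and> K \<subseteq> P \<inter> Q \<and> (\<exists>f. hom_mod P Q (carrier G) K f)" for K
  have "good (P \<inter> Q)"
    unfolding good_def
  proof (intro conjI exI)
    show "subgroup (P \<inter> Q) G" by (rule subgroups_Inter_pair[OF P(1) Q(1)])
    show "normalized_by P (P \<inter> Q)"
      using normalized_byD[OF Q(2)] by (auto simp: normalized_by_def)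
    define f where "f g = (SOME x. x \<in> P \<and> (\<exists>q\<in>Q. g = x \<otimes> q))" for g
    have f: "f g \<in> P \<and> (\<exists>q\<in>Q. g = f g \<otimes> q)" if "g \<in> carrier G" for g
      unfolding f_def by (rule someI_ex) (use PQ[OF that] in blast)
    have fQ: "f g \<otimes> inv g \<in> Q" if g: "g \<in> carrier G" for g
    proof -
      obtain q where q: "q \<in> Q" "g = f g \<otimes> q" using f[OF g] by blast
      have fc: "f g \<in> carrier G" using f[OF g] by simp
      have "inv g = inv q \<otimes> inv f g" using q fc by (metis Q.mem_carrier inv_mult_group)
      then have "f g \<otimes> inv g = f g \<otimes> inv q \<otimes> inv f g" using q(1) fc by (simp add: m_assoc)
      then show ?thesis using normalized_byD[OF Q(2) fc, of "inv q"] q(1) by simp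
    qed
    have fP: "f g \<in> P" "f g \<in> carrier G" if "g \<in> carrier G" for g using f[OF that] by auto
    show "hom_mod P Q (carrier G) (P \<inter> Q) f"
      unfolding hom_mod_def
    proof (intro conjI ballI subsetI)
      fix y assume "y \<in> f ` carrier G" then show "y \<in> P" using fP by blast
    next
      fix y assume "y \<in> f ` Q"
      then obtain q where q: "q \<in> Q" "y = f q" by blast
      have "(f q \<otimes> inv q) \<otimes> q \<in> Q" by (rule Q.m_closed[OF fQ q(1)]) (use q(1) in simp)
      then show "y \<in> P \<inter> Q" using q fP[of q] by (simp add: m_assoc)
    next
      fix g h assume g: "g \<in> carrier G" and h: "h \<in> carrier G"
      have gh: "g \<otimes> h \<in> carrier G" using g h by simp
      have "(f g \<otimes> inv g) \<otimes> (conj_by g (f h \<otimes> inv h)) \<otimes> inv (f (g \<otimes> h) \<otimes> inv (g \<otimes> h)) \<in> Q"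
        by (rule Q.m_closed[OF Q.m_closed[OF fQ[OF g] normalized_byD[OF Q(2) g fQ[OF h]]] Q.m_inv_closed[OF fQ[OF gh]]])
      moreover have "(f g \<otimes> inv g) \<otimes> (conj_by g (f h \<otimes> inv h)) \<otimes> inv (f (g \<otimes> h) \<otimes> inv (g \<otimes> h)) = f g \<otimes> f h \<otimes> inv f (g \<otimes> h)"
        using fP(2)[OF g] fP(2)[OF h] fP(2)[OF gh] g h by (simp add: m_assoc inv_mult_group)
      moreover have "f g \<otimes> f h \<otimes> inv f (g \<otimes> h) \<in> P"
        by (rule P.m_closed[OF P.m_closed[OF fP(1)[OF g] fP(1)[OF h]] P.m_inv_closed[OF fP(1)[OF gh]]])
      ultimately show "f g \<otimes> f h \<otimes> inv f (g \<otimes> h) \<in> P \<inter> Q" by simp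
    next
      fix x assume x: "x \<in> P"
      have "f x \<otimes> inv x \<in> P" by (rule P.m_closed[OF fP(1) P.m_inv_closed[OF x]]) (use x in simp)
      then show "f x \<otimes> inv x \<in> P \<inter> Q" using fQ[of x] x by auto
    qed
  qed auto
  moreover have "finite {K. good K}"
  proof (rule finite_subset)
    show "{K. good K} \<subseteq> Pow (carrier G)" using subgroup.subset by (auto simp: good_def)
  qed (use fin in simp)
  ultimately obtain K where K: "good K" "\<And>K'. good K' \<Longrightarrow> K' \<subseteq> K \<Longrightarrow> K' = K"
    using finite_has_minimal[of "{K. good K}"] by blast
  obtain f where Kg: "subgroup K G" "normalized_by P K" "K \<subseteq> P \<inter> Q" and f: "hom_mod P Q (carrier G) K f"
    using K(1) unfolding good_def by blast
  have K1: "K = {\<one>}"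
  proof (rule ccontr)
    assume "K \<noteq> {\<one>}"
    then obtain K' f' where K': "subgroup K' G" "normalized_by P K'" "K' \<subset> K" "hom_mod P Q (carrier G) K' f'"
      using hom_mod_refine[OF P fin m Q(1) hyp Kg \<open>K \<noteq> {\<one>}\<close> f] by blast
    then have "good K'" using Kg(3) unfolding good_def by blast
    then show False using K(2) K'(3) by blast
  qed
  have fP: "f g \<in> P" "f g \<in> carrier G" if "g \<in> carrier G" for g using f that unfolding hom_mod_def by auto
  have fQ: "f ` Q \<subseteq> P \<inter> Q" using f unfolding hom_mod_def by blast
  have fhom: "f (g \<otimes> h) = f g \<otimes> f h" if g: "g \<in> carrier G" and h: "h \<in> carrier G" for g h
  proof -
    have "f g \<otimes> f h \<otimes> inv f (g \<otimes> h) = \<one>" using f g h unfolding hom_mod_def K1 by blast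
    then show ?thesis using eq_if_mult_inv_one[of "f g \<otimes> f h" "f (g \<otimes> h)"] fP(2) g h by simp
  qed
  have fx: "f x = x" if x: "x \<in> P" for x
  proof -
    have "f x \<otimes> inv x = \<one>" using f x unfolding hom_mod_def K1 by blast
    then show ?thesis using eq_if_mult_inv_one[of "f x" x] fP(2)[of x] x by simp
  qed
  let ?C = "{x \<in> Q. f x = \<one>}"
  have fC: "finite ?C" by (rule finite_subset[OF _ fin]) (use Q.subset in blast)
  have C: "subgroup ?C G"
  proof (rule subgroup_finiteI[OF _ fC])
    show "\<one> \<in> ?C" using fx[OF P.one_closed] by simp
  qed (use fhom in auto)
  have "\<not> p dvd card ?C"
  proof
    assume d: "p dvd card ?C"
    obtain y where y: "y \<in> ?C" "y \<noteq> \<one>" "y [^] p = \<one>" using cauchy_in_subgroup[OF C fC P(3) d] by blast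
    have yc: "y \<in> carrier G" using y(1) by simp
    have S: "subgroup (generate G {y}) G" "generate G {y} \<subseteq> carrier G" "card (generate G {y}) = p ^ 1"
      using generate_is_subgroup[of "{y}"] generate_incl[of "{y}"] card_generate_prime_order[OF yc y(2,3) P(3)] yc by auto
    obtain g where g: "g \<in> carrier G" "\<And>s. s \<in> generate G {y} \<Longrightarrow> inv g \<otimes> s \<otimes> g \<in> P"
      using sylow_conjugate[OF subgroup_self fin P(3) P(1) P.subset P(2) m S] by blast
    have "y \<in> generate G {y}" by (rule generate.incl) simp
    then have gy: "inv g \<otimes> y \<otimes> g \<in> P" using g(2) by blast
    have "f (inv g \<otimes> y \<otimes> g) = f (inv g) \<otimes> f y \<otimes> f g" using fhom g(1) yc by simp
    also have "\<dots> = f (inv g \<otimes> g)" using y(1) fhom[of "inv g" g] g(1) fP(2)[of "inv g"] by simp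
    also have "\<dots> = \<one>" using g(1) fx[OF P.one_closed] by simp
    finally have "inv g \<otimes> y \<otimes> g = \<one>" using fx[OF gy] by simp
    then have "conj_by g (inv g \<otimes> y \<otimes> g) = \<one>" using g(1) by simp
    then show False using y(2) yc g(1) by (simp add: m_assoc)
  qed
  then show ?thesis using fhom fQ by (intro exI[of _ f]) auto
qed

text \<open>Inside \<open>H = P Q\<close> the product hypothesis holds, and \<open>P\<close> is
  still a Sylow subgroup because its index in \<open>H\<close> divides \<open>m\<close>.\<close>

lemma tate_retraction:
  assumes P: "subgroup P G" "card P = p ^ a" "prime (p::nat)"
    and fin: "finite (carrier G)" and m: "card (carrier G) = p ^ a * m" "\<not> p dvd m"
    and Q: "subgroup Q G" "normalized_by (carrier G) Q"
    and hyp: "characters_vanish p P Q"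
  shows "\<exists>\<rho>. (\<forall>x\<in>Q. \<forall>y\<in>Q. \<rho> (x \<otimes> y) = \<rho> x \<otimes> \<rho> y) \<and> \<rho> ` Q \<subseteq> P \<inter> Q
    \<and> \<not> p dvd card {x \<in> Q. \<rho> x = \<one>}"
proof -
  interpret P: subgroup P G by fact
  interpret Q: subgroup Q G by fact
  define H where "H = {x \<otimes> q | x q. x \<in> P \<and> q \<in> Q}"
  have HI: "x \<otimes> q \<in> H" if "x \<in> P" "q \<in> Q" for x q using that by (auto simp: H_def)
  have H: "subgroup H G"
  proof (rule subgroup_finiteI)
    show "H \<subseteq> carrier G" by (auto simp: H_def)
    then show "finite H" using fin finite_subset by blast
    show "\<one> \<in> H" using HI[OF P.one_closed Q.one_closed] by simp
    fix g h assume "g \<in> H" "h \<in> H"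
    then obtain x q y r where e: "x \<in> P" "q \<in> Q" "g = x \<otimes> q" "y \<in> P" "r \<in> Q" "h = y \<otimes> r" unfolding H_def by blast
    have "inv y \<otimes> q \<otimes> inv (inv y) \<in> Q" by (rule normalized_byD[OF Q(2) _ e(2)]) (use e in simp)
    then have "(x \<otimes> y) \<otimes> ((inv y \<otimes> q \<otimes> inv (inv y)) \<otimes> r) \<in> H"
      by (rule HI[OF P.m_closed[OF e(1,4)] Q.m_closed[OF _ e(5)]])
    moreover have "(x \<otimes> y) \<otimes> ((inv y \<otimes> q \<otimes> inv (inv y)) \<otimes> r) = g \<otimes> h" using e by (simp add: m_assoc)
    ultimately show "g \<otimes> h \<in> H" by simp
  qed
  interpret H: subgroup H G by (fact H)
  have PH: "P \<subseteq> H" and QH: "Q \<subseteq> H" using HI[OF _ Q.one_closed] HI[OF P.one_closed] by auto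
  let ?H = "G\<lparr>carrier := H\<rparr>"
  interpret GH: group ?H by (rule subgroup_imp_group[OF H])
  have fH: "finite H" using fin H.subset finite_subset by blast
  have "card H dvd card (carrier G)" using card_subgroup_cosets[OF H subgroup_self H.subset] by (metis dvd_triv_right)
  moreover have "p ^ a dvd card H" using card_subgroup_cosets[OF P(1) H PH] P(2) by (metis dvd_triv_right)
  then obtain l where l: "card H = p ^ a * l" by auto
  ultimately have "l dvd m" using m(1) P(3) by (simp add: prime_gt_0_nat)
  then have lp: "\<not> p dvd l" using m(2) dvd_trans by blast
  have "\<exists>\<rho>. (\<forall>x\<in>Q. \<forall>y\<in>Q. \<rho> (x \<otimes>\<^bsub>?H\<^esub> y) = \<rho> x \<otimes>\<^bsub>?H\<^esub> \<rho> y) \<and> \<rho> ` Q \<subseteq> P \<inter> Q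
    \<and> \<not> p dvd card {x \<in> Q. \<rho> x = \<one>\<^bsub>?H\<^esub>}"
  proof (rule GH.tate_retraction_product[of P p a l Q])
    show "subgroup P ?H" by (rule subgroup_incl[OF P(1) H PH])
    show "subgroup Q ?H" by (rule subgroup_incl[OF Q(1) H QH])
    show "GH.normalized_by (carrier ?H) Q"
      using normalized_byD[OF Q(2)] m_inv_consistent[OF H] by (auto simp: GH.normalized_by_def)
    show "\<exists>x\<in>P. \<exists>q\<in>Q. g = x \<otimes>\<^bsub>?H\<^esub> q" if "g \<in> carrier ?H" for g
      using that by (auto simp: H_def)
    show "GH.characters_vanish p P Q"
      using hyp by (simp add: characters_vanish_def GH.characters_vanish_def)
  qed (use P fH l lp in auto)
  then show ?thesis by simp
qed

end

subsection \<open>Burnside transfer\<close>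

text \<open>Split \<open>\<pi>\<close> into cycles: the cycle of \<open>g\<close>, of least period
  \<open>l\<close>, contributes \<open>z [^] l\<close>, and the periods add up to the size of
  \<open>R\<close>. The transfer of an element is evaluated in this form.\<close>

lemma (in comm_monoid) finprod_cycles:
  assumes "finite R" "bij_betw \<pi> R R" "f \<in> R \<rightarrow> carrier G" "z \<in> carrier G"
    and cyc: "\<And>g l. g \<in> R \<Longrightarrow> l > 0 \<Longrightarrow> (\<pi> ^^ l) g = g \<Longrightarrow> finprod G (\<lambda>j. f ((\<pi> ^^ j) g)) {..<l} = z [^] (l::nat)"
  shows "finprod G f R = z [^] card R"
  using assms(1-3) cyc
proof (induction "card R" arbitrary: R rule: less_induct)
  case less
  show ?case
  proof (cases "R = {}")
    case True
    then show ?thesis by simp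
  next
    case False
    then obtain g where g: "g \<in> R" by blast
    have \<pi>R: "\<And>h. h \<in> R \<Longrightarrow> \<pi> h \<in> R" and inj: "inj_on \<pi> R"
      using less.prems(2) by (auto simp: bij_betw_def)
    have pR: "(\<pi> ^^ j) h \<in> R" if "h \<in> R" for j h
      using that \<pi>R by (induction j) auto
    have inj_pow: "inj_on (\<pi> ^^ j) R" for j
    proof (induction j)
      case (Suc j)
      show ?case
      proof (rule inj_onI)
        fix x y assume xy: "x \<in> R" "y \<in> R" "(\<pi> ^^ Suc j) x = (\<pi> ^^ Suc j) y"
        then have "(\<pi> ^^ j) x = (\<pi> ^^ j) y" using inj_onD[OF inj] pR by simp
        then show "x = y" using Suc xy by (meson inj_onD)
      qed
    qed simp
    have "\<not> inj_on (\<lambda>j. (\<pi> ^^ j) g) {..card R}"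
    proof
      assume "inj_on (\<lambda>j. (\<pi> ^^ j) g) {..card R}"
      then have "card {..card R} \<le> card R"
        using card_inj_on_le[of "\<lambda>j. (\<pi> ^^ j) g" "{..card R}" R] pR[OF g] less.prems(1) by auto
      then show False by simp
    qed
    then obtain i j where ij: "i < j" "(\<pi> ^^ i) g = (\<pi> ^^ j) g"
      unfolding inj_on_def by (metis linorder_neqE_nat)
    have "(\<pi> ^^ i) ((\<pi> ^^ (j - i)) g) = (\<pi> ^^ i) g"
      using ij by (metis add_diff_inverse_nat comp_apply funpow_add less_imp_not_less)
    then have ex: "j - i > 0 \<and> (\<pi> ^^ (j - i)) g = g"
      using inj_onD[OF inj_pow] pR[OF g] g ij(1) by simp
    define l where "l = (LEAST l. l > 0 \<and> (\<pi> ^^ l) g = g)"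
    have l: "l > 0" "(\<pi> ^^ l) g = g" using LeastI[of "\<lambda>l. l > 0 \<and> (\<pi> ^^ l) g = g", OF ex] by (simp_all add: l_def)
    have lmin: "\<not> (k > 0 \<and> (\<pi> ^^ k) g = g)" if "k < l" for k
      using that unfolding l_def by (rule not_less_Least)
    have injl: "inj_on (\<lambda>j. (\<pi> ^^ j) g) {..<l}"
    proof (rule linorder_inj_onI)
      fix i j assume ij: "i < j" "i \<in> {..<l}" "j \<in> {..<l}"
      show "(\<pi> ^^ i) g \<noteq> (\<pi> ^^ j) g"
      proof
        assume "(\<pi> ^^ i) g = (\<pi> ^^ j) g"
        then have "(\<pi> ^^ i) ((\<pi> ^^ (j - i)) g) = (\<pi> ^^ i) g"
          using ij(1) by (metis add_diff_inverse_nat comp_apply funpow_add less_imp_not_less)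
        then have "(\<pi> ^^ (j - i)) g = g" using inj_onD[OF inj_pow] pR[OF g] g by simp
        moreover have "j - i < l" "j - i > 0" using ij by auto
        ultimately show False using lmin by blast
      qed
    qed auto
    define O' where "O' = (\<lambda>j. (\<pi> ^^ j) g) ` {..<l}"
    have O: "O' \<subseteq> R" "g \<in> O'" "finite O'" "card O' = l"
      using pR[OF g] l injl by (auto simp: O'_def card_image intro: image_eqI[of _ _ 0])
    have \<pi>O: "\<pi> h \<in> O' \<longleftrightarrow> h \<in> O'" if h: "h \<in> R" for h
    proof
      assume "h \<in> O'"
      then obtain j where j: "j < l" "h = (\<pi> ^^ j) g" by (auto simp: O'_def)
      show "\<pi> h \<in> O'"
      proof (cases "Suc j = l")
        case True
        then have "\<pi> h = g" using j l(2) by auto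
        then show ?thesis using O(2) by simp
      next
        case False
        then have "\<pi> h = (\<pi> ^^ Suc j) g" "Suc j < l" using j by auto
        then show ?thesis unfolding O'_def by blast
      qed
    next
      assume "\<pi> h \<in> O'"
      then obtain j where j: "j < l" "\<pi> h = (\<pi> ^^ j) g" by (auto simp: O'_def)
      obtain k where k: "k < l" "(\<pi> ^^ j) g = \<pi> ((\<pi> ^^ k) g)"
      proof (cases j)
        case 0
        obtain l' where "l = Suc l'" using l(1) gr0_implies_Suc by blast
        then show ?thesis using that[of l'] l(2) 0 by simp
      next
        case (Suc i)
        then show ?thesis using that[of i] j by simp
      qed
      then have "h = (\<pi> ^^ k) g" using inj_onD[OF inj] j h pR[OF g] by simp
      then show "h \<in> O'" using k(1) by (auto simp: O'_def)
    qed
    have "finprod G f (R - O') = z [^] card (R - O')"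
    proof (rule less.hyps)
      show "card (R - O') < card R" using O g less.prems(1) by (intro psubset_card_mono) auto
      have "\<pi> ` (R - O') = R - O'"
      proof (rule endo_inj_surj)
        show "\<pi> ` (R - O') \<subseteq> R - O'" using \<pi>R \<pi>O by blast
        show "inj_on \<pi> (R - O')" using inj by (rule inj_on_subset) simp
      qed (use less.prems in simp)
      then show "bij_betw \<pi> (R - O') (R - O')" using inj by (auto simp: bij_betw_def inj_on_diff)
    qed (use less.prems in auto)
    moreover have "finprod G f O' = z [^] l"
    proof -
      have "finprod G f O' = finprod G (\<lambda>j. f ((\<pi> ^^ j) g)) {..<l}"
        unfolding O'_def using less.prems(3) pR[OF g] injl by (intro finprod_reindex) auto
      then show ?thesis using less.prems(4)[OF g l] by simp
    qed
    moreover have "finprod G f ((R - O') \<union> O') = finprod G f (R - O') \<otimes> finprod G f O'"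
      using less.prems O by (intro finprod_Un_disjoint) auto
    moreover have "(R - O') \<union> O' = R" using O(1) by blast
    moreover have "card R = card (R - O') + l"
      using O less.prems(1) by (metis card_Diff_subset card_mono le_add_diff_inverse2)
    ultimately show ?thesis using assms(4) by (simp add: nat_pow_mult)
  qed
qed

context group begin

text \<open>Burnside's fusion argument. \<open>T\<close> and its conjugate by \<open>g\<close> are
  abelian, so both lie in the centraliser \<open>C\<close> of \<open>g x g^-1\<close> and are Sylow
  subgroups there. Some \<open>c\<close> in \<open>C\<close> conjugates one into the other; then
  \<open>c^-1 g\<close> normalises \<open>T\<close>, hence centralises it by \<open>NC\<close>, and
  \<open>c\<close> does not move \<open>g x g^-1\<close>.\<close>

lemma burnside_stable:
  assumes fin: "finite (carrier G)" and p: "prime (p::nat)"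
    and T: "subgroup T G" "card T = p ^ a" "card (carrier G) = p ^ a * m" "\<not> p dvd m"
    and ab: "\<And>x y. x \<in> T \<Longrightarrow> y \<in> T \<Longrightarrow> x \<otimes> y = y \<otimes> x"
    and NC: "\<And>g t. g \<in> carrier G \<Longrightarrow> (\<And>t. t \<in> T \<Longrightarrow> conj_by g t \<in> T) \<Longrightarrow> t \<in> T \<Longrightarrow> conj_by g t = t"
    and x: "x \<in> T" and g: "g \<in> carrier G" and gx: "conj_by g x \<in> T"
  shows "conj_by g x = x"
proof -
  interpret T: subgroup T G by fact
  let ?x = "conj_by g x"
  have xc: "x \<in> carrier G" "?x \<in> carrier G" using x g by auto
  define C where "C = {h \<in> carrier G. h \<otimes> ?x = ?x \<otimes> h}"
  have C: "subgroup C G"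
  proof (rule subgroup_finiteI)
    show "C \<subseteq> carrier G" by (auto simp: C_def)
    then show "finite C" using fin finite_subset by blast
    show "\<one> \<in> C" using xc by (simp add: C_def)
    fix h k assume "h \<in> C" "k \<in> C"
    then have hk: "h \<in> carrier G" "k \<in> carrier G" "h \<otimes> ?x = ?x \<otimes> h" "k \<otimes> ?x = ?x \<otimes> k" by (auto simp: C_def)
    have "h \<otimes> k \<otimes> ?x = (h \<otimes> ?x) \<otimes> k" using hk(1,2,4) xc(2) by (simp only: m_assoc)
    also have "\<dots> = ?x \<otimes> (h \<otimes> k)" unfolding hk(3) using hk(1,2) xc(2) by (simp only: m_assoc)
    finally show "h \<otimes> k \<in> C" using hk(1,2) by (simp only: C_def mem_Collect_eq m_closed)
  qed
  have fC: "finite C" using C fin finite_subset subgroup.subset by blast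
  have TC: "T \<subseteq> C" using ab gx by (auto simp: C_def)
  define S where "S = (\<lambda>t. conj_by g t) ` T"
  have S: "subgroup S G"
  proof (rule subgroup_finiteI)
    show "S \<subseteq> carrier G" using g by (auto simp: S_def)
    then show "finite S" using fin finite_subset by blast
    show "\<one> \<in> S" using g T.one_closed by (auto simp: S_def intro!: image_eqI[of _ _ \<one>])
    fix h k assume "h \<in> S" "k \<in> S"
    then obtain s t where st: "s \<in> T" "t \<in> T" "h = conj_by g s" "k = conj_by g t" by (auto simp: S_def)
    then have "h \<otimes> k = conj_by g (s \<otimes> t)" using g by (simp add: m_assoc)
    then show "h \<otimes> k \<in> S" using st T.m_closed by (auto simp: S_def)
  qed
  have "inj_on (\<lambda>t. conj_by g t) T" using g by (auto intro!: inj_onI)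
  then have cS: "card S = p ^ a" using T(2) by (simp add: S_def card_image)
  have SC: "S \<subseteq> C"
  proof
    fix h assume "h \<in> S"
    then obtain t where t: "t \<in> T" "h = conj_by g t" by (auto simp: S_def)
    have "conj_by g (t \<otimes> x) = conj_by g (x \<otimes> t)" using ab[OF t(1) x] by simp
    then show "h \<in> C" using t g x by (simp add: C_def m_assoc)
  qed
  have "card C dvd card (carrier G)" using card_subgroup_cosets[OF C subgroup_self subgroup.subset[OF C]] by (metis dvd_triv_right)
  moreover have "p ^ a dvd card C" using card_subgroup_cosets[OF T(1) C TC] T(2) by (metis dvd_triv_right)
  then obtain l where l: "card C = p ^ a * l" by auto
  ultimately have "l dvd m" using T(3) p by (simp add: prime_gt_0_nat)
  then have lp: "\<not> p dvd l" using T(4) dvd_trans by blast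
  obtain c where c: "c \<in> C" "\<And>s. s \<in> S \<Longrightarrow> inv c \<otimes> s \<otimes> c \<in> T"
    using sylow_conjugate[OF C fC p T(1) TC T(2) l lp S SC cS] by blast
  have cc: "c \<in> carrier G" "c \<otimes> ?x = ?x \<otimes> c" using c(1) by (auto simp: C_def)
  have eq: "conj_by (inv c \<otimes> g) t = inv c \<otimes> conj_by g t \<otimes> c" if "t \<in> T" for t
    using that cc(1) g by (simp add: m_assoc inv_mult_group)
  have "conj_by (inv c \<otimes> g) x = x"
  proof (rule NC[OF _ _ x])
    show "inv c \<otimes> g \<in> carrier G" using cc(1) g by simp
    fix t assume t: "t \<in> T"
    then have "conj_by g t \<in> S" by (auto simp: S_def)
    then show "conj_by (inv c \<otimes> g) t \<in> T" unfolding eq[OF t] by (rule c(2))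
  qed
  then have "inv c \<otimes> ?x \<otimes> c = x" unfolding eq[OF x] .
  moreover have "inv c \<otimes> ?x \<otimes> c = ?x"
  proof -
    have "inv c \<otimes> (?x \<otimes> c) = inv c \<otimes> (c \<otimes> ?x)" using cc(2) by simp
    also have "\<dots> = ?x" using cc(1) xc(2) by (rule inv_mult_cancel(1))
    finally show ?thesis using cc(1) xc(2) by (simp only: m_assoc inv_closed)
  qed
  ultimately show ?thesis by simp
qed

text \<open>The transfer \<open>\<tau>\<close> into \<open>T\<close> kills the derived subgroup, as
  \<open>T\<close> is abelian, and by fusion it sends \<open>x\<close> in \<open>T\<close> to
  \<open>x [^] m\<close>; since \<open>m\<close> is prime to the order of \<open>T\<close>, it is
  injective on \<open>T\<close>. \<open>NC\<close> says that the normaliser of \<open>T\<close>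
  centralises \<open>T\<close>.\<close>

lemma burnside_transfer:
  assumes fin: "finite (carrier G)" and p: "prime (p::nat)"
    and T: "subgroup T G" "card T = p ^ a" "card (carrier G) = p ^ a * m" "\<not> p dvd m"
    and ab: "\<And>x y. x \<in> T \<Longrightarrow> y \<in> T \<Longrightarrow> x \<otimes> y = y \<otimes> x"
    and NC: "\<And>g t. g \<in> carrier G \<Longrightarrow> (\<And>t. t \<in> T \<Longrightarrow> conj_by g t \<in> T) \<Longrightarrow> t \<in> T \<Longrightarrow> conj_by g t = t"
  shows "T \<inter> derived G (carrier G) \<subseteq> {\<one>}"
proof -
  interpret T: subgroup T G by fact
  let ?T = "G\<lparr>carrier := T\<rparr>"
  interpret TG: comm_group ?T
    by (rule group.group_comm_groupI[OF subgroup_imp_group[OF T(1)]]) (simp add: ab)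
  obtain r where tr: "transversal T r" using transversal_exists[OF T(1)] .
  note rc = transversal(1)[OF T(1) tr] and rT = transversal(2)[OF T(1) tr] and r_const = transversal(3)[OF T(1) tr]
    and rr = transversal(6)[OF T(1) tr]
  define R where "R = r ` carrier G"
  have Rc: "g \<in> carrier G" if "g \<in> R" for g using rc that by (auto simp: R_def)
  have fR: "finite R" using fin by (simp add: R_def)
  have "card R * p ^ a = p ^ a * m"
    using transversal(7)[OF T(1) tr fin] T(2,3) by (simp add: R_def)
  then have cardR: "card R = m" using p by (simp add: prime_gt_0_nat)
  note shift = transversal(8)[OF T(1) tr fin, folded R_def]
  define s where "s g = g \<otimes> inv r g" for g
  have sT: "s g \<in> T" if "g \<in> carrier G" for g using rT[OF that] by (simp add: s_def)
  have sc: "s g \<in> carrier G" if "g \<in> carrier G" for g using sT[OF that] by simp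
  have s_left: "s (x \<otimes> g) = x \<otimes> s g" if x: "x \<in> T" and g: "g \<in> carrier G" for x g
    using x g rc[OF g] by (simp add: s_def r_const m_assoc)
  \<comment> \<open>For a representative \<open>g\<close> the factor \<open>inv s g\<close> is
    trivial and this is the usual transfer factor. The general form depends on the coset
    \<open>T g\<close> only and telescopes along cycles.\<close>
  define F where "F h g = inv s g \<otimes> s (g \<otimes> h)" for h g
  have FT: "F h g \<in> T" if g: "g \<in> carrier G" and h: "h \<in> carrier G" for g h
    unfolding F_def by (rule T.m_closed[OF T.m_inv_closed[OF sT[OF g]] sT]) (use g h in simp)
  have F_left: "F h (x \<otimes> g) = F h g" if x: "x \<in> T" and g: "g \<in> carrier G" and h: "h \<in> carrier G" for x g h
  proof -
    have gh: "g \<otimes> h \<in> carrier G" using g h by simp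
    have "s (x \<otimes> g \<otimes> h) = x \<otimes> s (g \<otimes> h)" using s_left[OF x gh] x g h by (simp add: m_assoc)
    then show ?thesis
      using x sc[OF g] sc[OF gh] unfolding F_def s_left[OF x g] by (simp add: m_assoc inv_mult_group)
  qed
  have F_r: "F h (r g) = F h g" if g: "g \<in> carrier G" and h: "h \<in> carrier G" for g h
  proof -
    have "g = (g \<otimes> inv r g) \<otimes> r g" using g rc[OF g] by (simp add: m_assoc)
    then show ?thesis using F_left[OF rT[OF g] rc[OF g] h] by simp
  qed
  have F_mult: "F (h \<otimes> k) g = F h g \<otimes> F k (g \<otimes> h)" if g: "g \<in> carrier G" and h: "h \<in> carrier G" and k: "k \<in> carrier G" for g h k
    using sc[OF g] sc[of "g \<otimes> h"] sc[of "g \<otimes> (h \<otimes> k)"] g h k by (simp add: F_def m_assoc)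
  define \<tau> where "\<tau> h = finprod ?T (F h) R" for h
  have FR: "F h \<in> R \<rightarrow> carrier ?T" if "h \<in> carrier G" for h using FT[OF Rc that] by simp
  have \<tau>T: "\<tau> h \<in> T" if "h \<in> carrier G" for h
    using TG.finprod_closed[OF FR[OF that]] by (simp add: \<tau>_def)
  have \<tau>_mult: "\<tau> (h \<otimes> k) = \<tau> h \<otimes> \<tau> k" if h: "h \<in> carrier G" and k: "k \<in> carrier G" for h k
  proof -
    have "\<tau> (h \<otimes> k) = finprod ?T (\<lambda>g. F h g \<otimes>\<^bsub>?T\<^esub> F k (r (g \<otimes> h))) R"
      unfolding \<tau>_def
    proof (rule TG.finprod_cong')
      show "(\<lambda>g. F h g \<otimes>\<^bsub>?T\<^esub> F k (r (g \<otimes> h))) \<in> R \<rightarrow> carrier ?T"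
        using FT Rc h k rc by simp
      fix g assume "g \<in> R"
      then show "F (h \<otimes> k) g = F h g \<otimes>\<^bsub>?T\<^esub> F k (r (g \<otimes> h))"
        using F_mult[OF Rc h k] F_r[OF _ k, of "g \<otimes> h"] Rc h by simp
    qed simp
    also have "\<dots> = finprod ?T (F h) R \<otimes>\<^bsub>?T\<^esub> finprod ?T (\<lambda>g. F k (r (g \<otimes> h))) R"
      by (rule TG.finprod_multf) (use FT Rc h k rc in auto)
    also have "finprod ?T (\<lambda>g. F k (r (g \<otimes> h))) R = finprod ?T (F k) ((\<lambda>g. r (g \<otimes> h)) ` R)"
      by (rule TG.finprod_reindex[symmetric]) (use FT Rc h k rc shift[OF h] in \<open>auto simp: bij_betw_def\<close>)
    also have "(\<lambda>g. r (g \<otimes> h)) ` R = R" using shift[OF h] by (simp add: bij_betw_def)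
    finally show ?thesis by (simp add: \<tau>_def)
  qed
  have \<tau>_pow: "\<tau> x = x [^] m" if x: "x \<in> T" for x
  proof -
    have xc: "x \<in> carrier G" using x by simp
    have "finprod ?T (F x) R = x [^]\<^bsub>?T\<^esub> card R"
    proof (rule TG.finprod_cycles[OF fR shift[OF xc] FR[OF xc]])
      fix g l assume g: "g \<in> R" and l: "(l::nat) > 0" and fx: "((\<lambda>g. r (g \<otimes> x)) ^^ l) g = g"
      have gc: "g \<in> carrier G" by (rule Rc[OF g])
      have it: "((\<lambda>g. r (g \<otimes> x)) ^^ j) g = r (g \<otimes> x [^] j)" for j
      proof (induction j)
        case 0
        then show ?case using transversal(5)[OF T(1) tr g[unfolded R_def]] gc by simp
      next
        case (Suc j)
        let ?y = "g \<otimes> x [^] j"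
        have y: "?y \<in> carrier G" using gc xc by simp
        have "(?y \<otimes> inv r ?y) \<otimes> (r ?y \<otimes> x) = g \<otimes> x [^] Suc j"
          using gc xc rc[OF y] by (simp add: m_assoc)
        then show ?case using Suc r_const[OF rT[OF y], of "r ?y \<otimes> x"] rc[OF y] xc by simp
      qed
      have tele: "finprod ?T (\<lambda>j. F x (((\<lambda>g. r (g \<otimes> x)) ^^ j) g)) {..<j} = inv s g \<otimes> s (g \<otimes> x [^] j)" for j
      proof (induction j)
        case 0
        then show ?case using gc sc[OF gc] by simp
      next
        case (Suc j)
        have y: "g \<otimes> x [^] i \<in> carrier G" for i :: nat using gc xc by simp
        have "finprod ?T (\<lambda>j. F x (((\<lambda>g. r (g \<otimes> x)) ^^ j) g)) {..<Suc j} =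
            F x (((\<lambda>g. r (g \<otimes> x)) ^^ j) g) \<otimes>\<^bsub>?T\<^esub> finprod ?T (\<lambda>j. F x (((\<lambda>g. r (g \<otimes> x)) ^^ j) g)) {..<j}"
          unfolding lessThan_Suc by (rule TG.finprod_insert) (use FT rc y xc it in auto)
        also have "\<dots> = F x (g \<otimes> x [^] j) \<otimes> (inv s g \<otimes> s (g \<otimes> x [^] j))"
          using Suc it F_r[OF y xc] by simp
        also have "\<dots> = (inv s g \<otimes> s (g \<otimes> x [^] j)) \<otimes> F x (g \<otimes> x [^] j)"
          by (rule ab[OF FT[OF y xc]]) (rule T.m_closed[OF T.m_inv_closed[OF sT[OF gc]] sT[OF y]])
        also have "\<dots> = inv s g \<otimes> s (g \<otimes> x [^] Suc j)"
          using sc[OF gc] sc[OF y[of j]] sc[OF y[of "Suc j"]] gc xc by (simp add: F_def m_assoc)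
        finally show ?case .
      qed
      have xl: "x [^] l \<in> T" by (rule pow_in_subgroup[OF T(1) x])
      have xlc: "x [^] l \<in> carrier G" using xc by simp
      have "r (g \<otimes> x [^] l) = r g" using fx it[of l] it[of 0] gc by simp
      then have y: "g \<otimes> x [^] l \<otimes> inv g \<in> T" using rr[of "g \<otimes> x [^] l" g] gc xlc by blast
      \<comment> \<open>The cycle closes after \<open>l\<close> steps, so \<open>g x^l g^-1\<close>
        lies in \<open>T\<close>; fusion identifies it with \<open>x^l\<close>, the contribution of
        the cycle.\<close>
      have yx: "g \<otimes> x [^] l \<otimes> inv g = x [^] l"
        by (rule burnside_stable[OF fin p T ab NC xl gc y])
      have "g \<otimes> x [^] l = (g \<otimes> x [^] l \<otimes> inv g) \<otimes> g" using gc xlc by (simp add: m_assoc)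
      then have "g \<otimes> x [^] l = x [^] l \<otimes> g" unfolding yx .
      then have "inv s g \<otimes> s (g \<otimes> x [^] l) = inv s g \<otimes> (x [^] l \<otimes> s g)" using s_left[OF xl gc] by simp
      also have "\<dots> = inv s g \<otimes> (s g \<otimes> x [^] l)" using ab[OF xl sT[OF gc]] by simp
      also have "\<dots> = x [^] l" by (rule inv_mult_cancel(1)[OF sc[OF gc] xlc])
      finally show "finprod ?T (\<lambda>j. F x (((\<lambda>g. r (g \<otimes> x)) ^^ j) g)) {..<l} = x [^]\<^bsub>?T\<^esub> l"
        unfolding tele by (simp add: nat_pow_consistent [symmetric])
    qed (use x in simp)
    then show ?thesis by (simp add: \<tau>_def cardR nat_pow_consistent [symmetric])
  qed
  define K where "K = {h \<in> carrier G. \<tau> h = \<one>}"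
  have "\<tau> \<one> = \<one>" using \<tau>_pow[OF T.one_closed] by simp
  have \<tau>_inv: "\<tau> (inv h) = inv \<tau> h" if h: "h \<in> carrier G" for h
    using \<tau>_mult[of "inv h" h] h \<open>\<tau> \<one> = \<one>\<close> \<tau>T[OF h] \<tau>T[of "inv h"] inv_equality[of "\<tau> (inv h)" "\<tau> h"] by simp
  have K: "subgroup K G"
  proof (rule subgroup_finiteI)
    show "finite K" using fin by (simp add: K_def)
  qed (auto simp: K_def \<open>\<tau> \<one> = \<one>\<close> \<tau>_mult)
  have "derived_set G (carrier G) \<subseteq> K"
  proof
    fix y assume "y \<in> derived_set G (carrier G)"
    then obtain h k where hk: "h \<in> carrier G" "k \<in> carrier G" "y = commutator h k" by blast
    have "\<tau> y = \<tau> h \<otimes> \<tau> k \<otimes> inv \<tau> h \<otimes> inv \<tau> k"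
      unfolding hk(3) using hk(1,2) by (simp add: \<tau>_mult \<tau>_inv)
    also have "\<dots> = \<tau> k \<otimes> \<tau> h \<otimes> inv \<tau> h \<otimes> inv \<tau> k" using ab[OF \<tau>T[OF hk(1)] \<tau>T[OF hk(2)]] by simp
    also have "\<dots> = \<one>" using \<tau>T[OF hk(1)] \<tau>T[OF hk(2)] by (simp add: m_assoc)
    finally show "y \<in> K" using hk by (simp add: K_def)
  qed
  then have dK: "derived G (carrier G) \<subseteq> K" unfolding derived_def by (rule generate_subgroup_incl[OF _ K])
  show ?thesis
  proof
    fix x assume x: "x \<in> T \<inter> derived G (carrier G)"
    then have "x [^] m = \<one>" using \<tau>_pow[of x] dK by (auto simp: K_def)
    moreover have "x [^] (p ^ a) = \<one>"
      using TG.pow_order_eq_1[of x] x T(2) by (simp add: Coset.order_def nat_pow_consistent [symmetric])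
    moreover have "coprime m (p ^ a)" using p T(4) by (metis coprime_commute coprime_power_left_iff prime_imp_coprime)
    ultimately show "x \<in> {\<one>}" using pow_coprime_mem[OF triv_subgroup, of x m "p ^ a"] x by simp
  qed
qed

end

subsection \<open>Linear actions of finite groups\<close>

context vector_space begin

lemma dim_psubset_less:
  assumes "subspace U" "subspace W" "U \<subset> W" "finite B" "W \<subseteq> span B"
  shows "dim U < dim W"
proof -
  obtain BU where BU: "BU \<subseteq> U" "independent BU" "U \<subseteq> span BU" "card BU = dim U" using basis_exists[of U] by blast
  obtain BW where BW: "BW \<subseteq> W" "independent BW" "W \<subseteq> span BW" "card BW = dim W" using basis_exists[of W] by blast
  have fW: "finite BW" using independent_span_bound[OF assms(4) BW(2)] BW(1) assms(5) by blast
  obtain w where w: "w \<in> W" "w \<notin> U" using assms(3) by blast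
  have "span BU \<subseteq> U" using span_minimal[OF BU(1) assms(1)] .
  then have "w \<notin> span BU" using w(2) by blast
  then have i: "independent (insert w BU)" "w \<notin> BU" using BU(2) independent_insert span_base by metis+
  have "insert w BU \<subseteq> span BW" using BU(1) w(1) assms(3) BW(3) by blast
  then have "finite (insert w BU)" "card (insert w BU) \<le> card BW" using independent_span_bound[OF fW i(1)] by auto
  then show ?thesis using i(2) BU(4) BW(4) by simp
qed

end

text \<open>Finite dimension is imposed on the subspaces in question, as
  \<open>W \<subseteq> span B\<close> with finite \<open>B\<close>, and faithfulness by conditions
  on \<open>trivial_on {0} W\<close>. Algebraic closedness supplies eigenvalues in every
  characteristic.\<close>

locale linear_group = group G + vector_space scale
  for G :: "('a, 'b) monoid_scheme" (structure) and scale :: "'k::alg_closed_field \<Rightarrow> 'v::ab_group_add \<Rightarrow> 'v" (infixr "*s" 75) +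
  fixes \<rho> :: "'a \<Rightarrow> 'v \<Rightarrow> 'v"
  assumes act_add: "g \<in> carrier G \<Longrightarrow> \<rho> g (v + w) = \<rho> g v + \<rho> g w"
    and act_scale: "g \<in> carrier G \<Longrightarrow> \<rho> g (c *s v) = c *s \<rho> g v"
    and act_mult: "g \<in> carrier G \<Longrightarrow> h \<in> carrier G \<Longrightarrow> \<rho> (g \<otimes> h) v = \<rho> g (\<rho> h v)"
    and act_one: "\<rho> \<one> v = v"
    and finite_group: "finite (carrier G)"
begin

lemma act_zero: "g \<in> carrier G \<Longrightarrow> \<rho> g 0 = 0"
  using act_scale[of g 0 0] by simp

lemma act_inv: "g \<in> carrier G \<Longrightarrow> \<rho> g (\<rho> (inv g) v) = v" "g \<in> carrier G \<Longrightarrow> \<rho> (inv g) (\<rho> g v) = v"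
  by (metis act_mult act_one inv_closed r_inv, metis act_mult act_one inv_closed l_inv)

lemma act_minus: "g \<in> carrier G \<Longrightarrow> \<rho> g (- v) = - \<rho> g v"
  using act_scale[of g "-1" v] by simp

lemma act_diff: "g \<in> carrier G \<Longrightarrow> \<rho> g (v - w) = \<rho> g v - \<rho> g w"
  using act_add[of g v "- w"] act_minus[of g w] by simp

lemma act_sum: "g \<in> carrier G \<Longrightarrow> \<rho> g (\<Sum>i\<in>I. f i) = (\<Sum>i\<in>I. \<rho> g (f i))"
  by (induction I rule: infinite_finite_induct) (simp_all add: act_zero act_add)

section \<open>Sections of stable subspaces, eigenvectors and weights\<close>

definition stable :: "'a set \<Rightarrow> 'v set \<Rightarrow> bool"
  where "stable H W \<longleftrightarrow> subspace W \<and> (\<forall>g\<in>H. \<forall>w\<in>W. \<rho> g w \<in> W)"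

text \<open>For stable \<open>U \<subseteq> W\<close>: \<open>g\<close> acts as the identity on
  \<open>W/U\<close>.\<close>

definition trivial_on :: "'v set \<Rightarrow> 'v set \<Rightarrow> 'a \<Rightarrow> bool"
  where "trivial_on U W g \<longleftrightarrow> (\<forall>w\<in>W. \<rho> g w - w \<in> U)"

definition weight_space :: "'a set \<Rightarrow> 'v set \<Rightarrow> 'v set \<Rightarrow> ('a \<Rightarrow> 'k) \<Rightarrow> 'v set"
  where "weight_space A U W \<chi> = {w \<in> W. \<forall>a\<in>A. \<rho> a w - \<chi> a *s w \<in> U}"

lemma stableD: "stable H W \<Longrightarrow> g \<in> H \<Longrightarrow> w \<in> W \<Longrightarrow> \<rho> g w \<in> W" "stable H W \<Longrightarrow> subspace W"
  by (auto simp: stable_def)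

lemma stable_mono: "stable H W \<Longrightarrow> K \<subseteq> H \<Longrightarrow> stable K W"
  by (auto simp: stable_def)

lemma trivial_on_subgroup:
  assumes H: "subgroup H G" and U: "stable H U" and W: "stable H W" and UW: "U \<subseteq> W"
  shows "subgroup {g \<in> H. trivial_on U W g} G" "normalized_by H {g \<in> H. trivial_on U W g}"
proof -
  interpret H: subgroup H G by fact
  show "subgroup {g \<in> H. trivial_on U W g} G"
  proof (rule subgroup_finiteI)
    show "{g \<in> H. trivial_on U W g} \<subseteq> carrier G" using H.subset by blast
    then show "finite {g \<in> H. trivial_on U W g}" using finite_group finite_subset by blast
    show "\<one> \<in> {g \<in> H. trivial_on U W g}" using stableD(2)[OF U] by (simp add: trivial_on_def act_one subspace_0)
  next
    fix g h assume "g \<in> {g \<in> H. trivial_on U W g}" "h \<in> {g \<in> H. trivial_on U W g}"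
    then have gh: "g \<in> H" "trivial_on U W g" "h \<in> H" "trivial_on U W h" by auto
    have "\<rho> (g \<otimes> h) w - w \<in> U" if w: "w \<in> W" for w
    proof -
      have "\<rho> g (\<rho> h w) - \<rho> h w \<in> U" using gh(2) stableD(1)[OF W gh(3) w] by (simp add: trivial_on_def)
      moreover have "\<rho> h w - w \<in> U" using gh(4) w by (simp add: trivial_on_def)
      ultimately have "(\<rho> g (\<rho> h w) - \<rho> h w) + (\<rho> h w - w) \<in> U" by (rule subspace_add[OF stableD(2)[OF U]])
      then show ?thesis using gh by (simp add: act_mult)
    qed
    then show "g \<otimes> h \<in> {g \<in> H. trivial_on U W g}" using gh by (simp add: trivial_on_def)
  qed
  show "normalized_by H {g \<in> H. trivial_on U W g}"
    unfolding normalized_by_def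
  proof (intro ballI)
    fix g n assume g: "g \<in> H" and "n \<in> {g \<in> H. trivial_on U W g}"
    then have n: "n \<in> H" "trivial_on U W n" by auto
    have gi: "inv g \<in> H" using g by simp
    have "\<rho> (conj_by g n) w - w \<in> U" if w: "w \<in> W" for w
    proof -
      have w': "\<rho> (inv g) w \<in> W" by (rule stableD(1)[OF W gi w])
      have "\<rho> n (\<rho> (inv g) w) - \<rho> (inv g) w \<in> U" using n(2) w' by (simp add: trivial_on_def)
      then have "\<rho> g (\<rho> n (\<rho> (inv g) w) - \<rho> (inv g) w) \<in> U" by (rule stableD(1)[OF U g])
      then show ?thesis using H.mem_carrier[OF g] H.mem_carrier[OF n(1)] by (simp add: act_mult act_diff act_inv)
    qed
    then show "conj_by g n \<in> {g \<in> H. trivial_on U W g}" using g n gi by (simp add: trivial_on_def)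
  qed
qed

text \<open>\<open>H p w\<close> is \<open>p(a) w\<close>. As \<open>a\<close> has finite order,
  \<open>X^N - 1\<close> annihilates every vector. Splitting off a root \<open>c\<close> of a
  polynomial that annihilates \<open>w\<close> modulo \<open>U\<close>, either the quotient
  \<open>q\<close> still annihilates \<open>w\<close>, or \<open>q(a) w\<close> is an eigenvector
  modulo \<open>U\<close> for \<open>c\<close>.\<close>

lemma eigenvector_mod:
  assumes a: "a \<in> carrier G" and U: "stable {a} U" and W: "stable {a} W" and UW: "U \<subset> W"
  obtains c w where "w \<in> W" "w \<notin> U" "\<rho> a w - c *s w \<in> U"
proof -
  define N where "N = Coset.order G"
  have N: "N > 0" using finite_group order_gt_0_iff_finite by (simp add: N_def)
  \<comment> \<open>The sum runs up to \<open>N + 1\<close>, one more than the largest degree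
    \<open>N\<close> in use, to leave room for the shift by \<open>pCons 0\<close>.\<close>
  define H where "H p w = (\<Sum>i<Suc (Suc N). coeff p i *s \<rho> (a [^] i) w)" for p w
  have Hadd: "H (p + q) w = H p w + H q w" for p q w by (simp add: H_def scale_left_distrib sum.distrib)
  have Hsmult: "H (smult c p) w = c *s H p w" for c p w by (simp only: H_def coeff_smult scale_sum_right scale_scale)
  have HpCons: "H (pCons 0 p) w = \<rho> a (H p w)" if d: "degree p \<le> N" for p w
  proof -
    have "H (pCons 0 p) w = (\<Sum>i<Suc N. coeff p i *s \<rho> (a [^] Suc i) w)"
      unfolding H_def by (subst sum.lessThan_Suc_shift) simp
    also have "\<dots> = (\<Sum>i<Suc N. coeff p i *s \<rho> a (\<rho> (a [^] i) w))"
      using a act_mult[of a] nat_pow_Suc2 by simp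
    also have "\<dots> = \<rho> a (\<Sum>i<Suc N. coeff p i *s \<rho> (a [^] i) w)" using a by (simp add: act_sum act_add act_scale)
    also have "(\<Sum>i<Suc N. coeff p i *s \<rho> (a [^] i) w) = H p w"
      unfolding H_def using d coeff_eq_0[of p "Suc N"] by simp
    finally show ?thesis .
  qed
  have pw: "\<rho> (a [^] (i::nat)) w \<in> W" if "w \<in> W" for w i
  proof (induction i)
    case (Suc i)
    then show ?case using a stableD(1)[OF W, of a] act_mult[of a "a [^] i"] nat_pow_Suc2[of a i] by simp
  qed (use that act_one in simp)
  have HW: "H p w \<in> W" if "w \<in> W" for p w
    unfolding H_def using pw[OF that] stableD(2)[OF W] by (intro subspace_sum subspace_scale) auto
  have main: "\<exists>c v. v \<in> W \<and> v \<notin> U \<and> \<rho> a v - c *s v \<in> U"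
    if "p \<noteq> 0" "degree p \<le> N" "w \<in> W" "w \<notin> U" "H p w \<in> U" for p w
    using that
  proof (induction "degree p" arbitrary: p)
    case 0
    then obtain c where c: "p = [:c:]" "c \<noteq> 0" by (metis degree_eq_zeroE pCons_0_0)
    have "H p w = c *s \<rho> (a [^] (0::nat)) w"
      unfolding H_def c(1) by (subst sum.lessThan_Suc_shift) simp
    then have "c *s w \<in> U" using 0 act_one by simp
    then have "inverse c *s (c *s w) \<in> U" by (rule subspace_scale[OF stableD(2)[OF U]])
    then show ?case using c(2) 0 by simp
  next
    case (Suc n)
    obtain c where "poly p c = 0" using alg_closed_imp_poly_has_root[of p] Suc by auto
    then have "[:-c, 1:] dvd p" by (simp only: poly_eq_0_iff_dvd)
    then obtain q where q: "p = [:-c, 1:] * q" by (rule dvdE)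
    have q0: "q \<noteq> 0" using q Suc(3) by auto
    have "degree p = degree [:-c, 1:] + degree q" unfolding q by (rule degree_mult_eq) (use q0 in auto)
    then have dq: "n = degree q" using Suc(2) by simp
    have pq: "p = pCons 0 q + smult (- c) q" by (simp add: q)
    have "degree q \<le> N" using dq Suc(2,4) by simp
    then have Hp: "H p w = \<rho> a (H q w) - c *s H q w"
      unfolding pq Hadd Hsmult by (simp add: HpCons)
    show ?case
    proof (cases "H q w \<in> U")
      case True
      then show ?thesis using Suc(1)[OF dq q0] Suc(2,4,5,6) dq by simp
    next
      case False
      then show ?thesis using Hp Suc(7) HW[OF Suc(5)] by metis
    qed
  qed
  obtain w where w: "w \<in> W" "w \<notin> U" using UW by blast
  let ?p = "monom 1 N - 1 :: 'k poly"
  have "coeff ?p N = 1" using N by simp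
  then have "?p \<noteq> 0" by (metis coeff_0 zero_neq_one)
  moreover have "degree ?p \<le> N" by (intro degree_diff_le degree_monom_le) simp
  moreover have "H ?p w \<in> U"
  proof -
    have "H (monom 1 N) w = (\<Sum>i<Suc (Suc N). if i = N then \<rho> (a [^] i) w else 0)"
      unfolding H_def by (intro sum.cong) auto
    also have "\<dots> = \<rho> (a [^] N) w" by simp
    also have "a [^] N = \<one>" unfolding N_def by (rule pow_order_eq_1[OF a])
    finally have 1: "H (monom 1 N) w = w" by (simp only: act_one)
    have "H 1 w = (\<Sum>i<Suc (Suc N). if i = 0 then \<rho> (a [^] i) w else 0)"
      unfolding H_def by (intro sum.cong) (auto simp: coeff_1)
    also have "\<dots> = \<rho> (a [^] (0::nat)) w" by simp
    finally have 2: "H 1 w = w" using act_one by simp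
    have "H ?p w = H (monom 1 N) w - H 1 w"
      unfolding H_def by (simp only: coeff_diff scale_left_diff_distrib sum_subtractf)
    then show ?thesis using 1 2 subspace_0[OF stableD(2)[OF U]] by simp
  qed
  ultimately show thesis using main w that by blast
qed

lemma weight_space_subspace:
  assumes U: "stable A U" and W: "stable A W" and A: "A \<subseteq> carrier G" and UW: "U \<subseteq> W"
  shows "subspace (weight_space A U W \<chi>)" "U \<subseteq> weight_space A U W \<chi>" "weight_space A U W \<chi> \<subseteq> W"
proof -
  note sU = stableD(2)[OF U] and sW = stableD(2)[OF W]
  show "subspace (weight_space A U W \<chi>)"
  proof (rule subspaceI)
    show "0 \<in> weight_space A U W \<chi>" using A sU sW by (auto simp: weight_space_def act_zero subspace_0)
  next
    fix x y assume xy: "x \<in> weight_space A U W \<chi>" "y \<in> weight_space A U W \<chi>"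
    have "\<rho> a (x + y) - \<chi> a *s (x + y) \<in> U" if a: "a \<in> A" for a
    proof -
      have "(\<rho> a x - \<chi> a *s x) + (\<rho> a y - \<chi> a *s y) \<in> U"
        using xy a by (intro subspace_add[OF sU]) (auto simp: weight_space_def)
      moreover have "(\<rho> a x - \<chi> a *s x) + (\<rho> a y - \<chi> a *s y) = \<rho> a (x + y) - \<chi> a *s (x + y)"
        using act_add[of a x y] a A by (auto simp: scale_right_distrib)
      ultimately show ?thesis by simp
    qed
    then show "x + y \<in> weight_space A U W \<chi>" using xy sW by (auto simp: weight_space_def subspace_add)
  next
    fix c x assume x: "x \<in> weight_space A U W \<chi>"
    have "\<rho> a (c *s x) - \<chi> a *s (c *s x) \<in> U" if a: "a \<in> A" for a
    proof -
      have "c *s (\<rho> a x - \<chi> a *s x) \<in> U"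
        using x a by (intro subspace_scale[OF sU]) (auto simp: weight_space_def)
      moreover have "c *s (\<rho> a x - \<chi> a *s x) = \<rho> a (c *s x) - \<chi> a *s (c *s x)"
        using act_scale[of a c x] a A by (auto simp: scale_right_diff_distrib mult.commute)
      ultimately show ?thesis by simp
    qed
    then show "c *s x \<in> weight_space A U W \<chi>" using x sW by (auto simp: weight_space_def subspace_scale)
  qed
  show "U \<subseteq> weight_space A U W \<chi>"
    using UW stableD(1)[OF U] sU by (auto simp: weight_space_def subspace_diff subspace_scale)
  show "weight_space A U W \<chi> \<subseteq> W" by (auto simp: weight_space_def)
qed

lemma commute_mod:
  assumes x: "x \<in> carrier G" and y: "y \<in> carrier G" and t: "trivial_on U W (commutator x y)"
    and v: "\<rho> (y \<otimes> x) v \<in> W"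
  shows "\<rho> x (\<rho> y v) - \<rho> y (\<rho> x v) \<in> U"
proof -
  have "\<rho> (commutator x y) (\<rho> (y \<otimes> x) v) - \<rho> (y \<otimes> x) v \<in> U" using t v by (simp add: trivial_on_def)
  moreover have "\<rho> (commutator x y) (\<rho> (y \<otimes> x) v) = \<rho> (x \<otimes> y) v"
    using x y by (simp add: act_mult[symmetric] m_assoc)
  ultimately show ?thesis using x y by (simp add: act_mult)
qed

text \<open>On an \<open>A\<close>-stable \<open>E\<close> strictly above \<open>U\<close> and of
  least dimension, every \<open>a\<close> acts as a scalar modulo \<open>U\<close>: its eigenspace
  in \<open>E/U\<close> is non-zero by \<open>eigenvector_mod\<close> and \<open>A\<close>-stable
  because \<open>A\<close> commutes modulo \<open>U\<close>, so it is everything.\<close>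

lemma weight_exists:
  assumes A: "subgroup A G" and ab: "\<And>a b. a \<in> A \<Longrightarrow> b \<in> A \<Longrightarrow> trivial_on U W (commutator a b)"
    and U: "stable A U" and W: "stable A W" and UW: "U \<subset> W" and B: "finite B" "W \<subseteq> span B"
  obtains \<chi> w where "w \<in> weight_space A U W \<chi>" "w \<notin> U"
proof -
  interpret A: subgroup A G by fact
  define Q where "Q E \<longleftrightarrow> stable A E \<and> U \<subset> E \<and> E \<subseteq> W" for E
  have "Q W" using W UW by (simp add: Q_def)
  then obtain E where E: "Q E" "\<And>E'. Q E' \<Longrightarrow> dim E \<le> dim E'"
    using ex_has_least_nat[of Q W dim] by blast
  have Es: "stable A E" "U \<subset> E" "E \<subseteq> W" using E(1) by (auto simp: Q_def)
  have EB: "E \<subseteq> span B" using Es(3) B(2) by blast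
  have "\<exists>c. \<forall>v\<in>E. \<rho> a v - c *s v \<in> U" if a: "a \<in> A" for a
  proof -
    have aE: "stable {a} E" "stable {a} U" using Es(1) U a stable_mono by blast+
    obtain c w where w: "w \<in> E" "w \<notin> U" "\<rho> a w - c *s w \<in> U"
      using eigenvector_mod[OF A.mem_carrier[OF a] aE(2,1) Es(2)] by blast
    let ?F = "weight_space {a} U E (\<lambda>_. c)"
    have ac: "{a} \<subseteq> carrier G" using a by simp
    have UE: "U \<subseteq> E" using Es(2) by blast
    note F = weight_space_subspace[OF aE(2,1) ac UE, of "\<lambda>_. c"]
    have "\<rho> b v \<in> ?F" if b: "b \<in> A" and v: "v \<in> ?F" for b v
    proof -
      have vE: "v \<in> E" "\<rho> a v - c *s v \<in> U" using v by (auto simp: weight_space_def)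
      have "\<rho> (b \<otimes> a) v \<in> W" using stableD(1)[OF W A.m_closed[OF b a]] vE(1) Es(3) by blast
      then have "\<rho> a (\<rho> b v) - \<rho> b (\<rho> a v) \<in> U"
        using commute_mod[OF _ _ ab[OF a b]] a b by simp
      moreover have "\<rho> b (\<rho> a v - c *s v) \<in> U" by (rule stableD(1)[OF U b vE(2)])
      ultimately have "(\<rho> a (\<rho> b v) - \<rho> b (\<rho> a v)) + \<rho> b (\<rho> a v - c *s v) \<in> U"
        by (rule subspace_add[OF stableD(2)[OF U]])
      then have "\<rho> a (\<rho> b v) - c *s \<rho> b v \<in> U" using b by (simp add: act_diff act_scale)
      then show ?thesis using stableD(1)[OF Es(1) b vE(1)] by (simp add: weight_space_def)
    qed
    then have "stable A ?F" using F(1) by (simp add: stable_def)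
    moreover have "w \<in> ?F" using w by (simp add: weight_space_def)
    ultimately have "Q ?F" using F(2,3) w(2) Es(3) unfolding Q_def by blast
    then have "dim E \<le> dim ?F" by (rule E(2))
    moreover have "dim ?F < dim E" if "?F \<noteq> E"
      using that F(3) by (intro dim_psubset_less[OF F(1) stableD(2)[OF Es(1)] _ B(1) EB]) blast
    ultimately have "?F = E" by force
    then show ?thesis unfolding weight_space_def by blast
  qed
  then obtain \<chi> where \<chi>: "\<And>a v. a \<in> A \<Longrightarrow> v \<in> E \<Longrightarrow> \<rho> a v - \<chi> a *s v \<in> U" by metis
  obtain w where "w \<in> E" "w \<notin> U" using Es(2) by blast
  then show thesis using that[of w \<chi>] \<chi> Es(3) by (auto simp: weight_space_def)
qed

text \<open>Modulo \<open>U\<close>, applying \<open>\<rho> a - \<chi>0 a\<close> to the sum removes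
  the term of \<open>\<chi>0\<close> and multiplies the term of \<open>\<psi>\<close> by
  \<open>\<psi> a - \<chi>0 a\<close>, which is non-zero for a suitable \<open>a\<close>.\<close>

lemma weights_independent:
  assumes "finite \<Xi>" and A: "A \<subseteq> carrier G" and U: "stable A U"
    and dist: "\<And>\<chi> \<psi>. \<chi> \<in> \<Xi> \<Longrightarrow> \<psi> \<in> \<Xi> \<Longrightarrow> \<chi> \<noteq> \<psi> \<Longrightarrow> \<exists>a\<in>A. \<chi> a \<noteq> \<psi> a"
    and w: "\<And>\<chi>. \<chi> \<in> \<Xi> \<Longrightarrow> w \<chi> \<in> weight_space A U W \<chi>" and sW: "subspace W"
    and sum: "(\<Sum>\<chi>\<in>\<Xi>. w \<chi>) \<in> U" and \<chi>: "\<chi> \<in> \<Xi>"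
  shows "w \<chi> \<in> U"
  using assms(1) dist w sum \<chi>
proof (induction \<Xi> arbitrary: w \<chi> rule: finite_induct)
  case empty
  then show ?case by simp
next
  case (insert \<chi>0 \<Xi> w \<chi>)
  note sU = stableD(2)[OF U]
  have wW: "w \<psi> \<in> W" "\<And>a. a \<in> A \<Longrightarrow> \<rho> a (w \<psi>) - \<psi> a *s w \<psi> \<in> U" if "\<psi> \<in> insert \<chi>0 \<Xi>" for \<psi>
    using insert.prems(2)[OF that] by (auto simp: weight_space_def)
  have *: "w \<psi> \<in> U" if \<psi>: "\<psi> \<in> \<Xi>" for \<psi>
  proof -
    obtain a where a: "a \<in> A" "\<psi> a \<noteq> \<chi>0 a" using insert.prems(1)[of \<psi> \<chi>0] insert.hyps(2) \<psi> by auto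
    have ac: "a \<in> carrier G" using a(1) A by blast
    let ?w = "\<lambda>\<psi>. (\<psi> a - \<chi>0 a) *s w \<psi>"
    have "?w \<psi> \<in> U"
    proof (rule insert.IH)
      show "\<exists>a\<in>A. \<chi> a \<noteq> \<psi> a" if "\<chi> \<in> \<Xi>" "\<psi> \<in> \<Xi>" "\<chi> \<noteq> \<psi>" for \<chi> \<psi> using insert.prems(1) that by blast
      show "?w \<psi> \<in> weight_space A U W \<psi>" if "\<psi> \<in> \<Xi>" for \<psi>
      proof -
        have "\<rho> b (?w \<psi>) - \<psi> b *s ?w \<psi> \<in> U" if b: "b \<in> A" for b
        proof -
          have "(\<psi> a - \<chi>0 a) *s (\<rho> b (w \<psi>) - \<psi> b *s w \<psi>) \<in> U"
            using wW(2)[OF _ b] \<open>\<psi> \<in> \<Xi>\<close> by (intro subspace_scale[OF sU]) blast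
          then show ?thesis using b A act_scale[of b] by (auto simp: scale_right_diff_distrib mult.commute)
        qed
        then show ?thesis using wW(1)[of \<psi>] that subspace_scale[OF sW] by (simp add: weight_space_def)
      qed
      let ?S = "\<Sum>\<psi>\<in>insert \<chi>0 \<Xi>. w \<psi>"
      have "\<rho> a ?S - \<chi>0 a *s ?S \<in> U"
        using stableD(1)[OF U a(1) insert.prems(3)] insert.prems(3) by (intro subspace_diff[OF sU] subspace_scale[OF sU])
      moreover have "(\<Sum>\<psi>\<in>insert \<chi>0 \<Xi>. \<rho> a (w \<psi>) - \<psi> a *s w \<psi>) \<in> U"
        using wW(2)[OF _ a(1)] by (intro subspace_sum[OF sU])
      ultimately have "(\<rho> a ?S - \<chi>0 a *s ?S) - (\<Sum>\<psi>\<in>insert \<chi>0 \<Xi>. \<rho> a (w \<psi>) - \<psi> a *s w \<psi>) \<in> U"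
        by (rule subspace_diff[OF sU])
      moreover have "(\<rho> a ?S - \<chi>0 a *s ?S) - (\<Sum>\<psi>\<in>insert \<chi>0 \<Xi>. \<rho> a (w \<psi>) - \<psi> a *s w \<psi>)
          = (\<Sum>\<psi>\<in>insert \<chi>0 \<Xi>. ?w \<psi>)"
        using ac by (simp only: act_sum scale_sum_right sum_subtractf[symmetric]) (simp add: scale_left_diff_distrib)
      ultimately show "(\<Sum>\<psi>\<in>\<Xi>. ?w \<psi>) \<in> U" using insert.hyps by simp
    qed (fact \<psi>)
    then have "inverse (\<psi> a - \<chi>0 a) *s ?w \<psi> \<in> U" by (rule subspace_scale[OF sU])
    then show ?thesis using a(2) by simp
  qed
  show ?case
  proof (cases "\<chi> = \<chi>0")
    case False
    then show ?thesis using * insert.prems(4) by blast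
  next
    case True
    have "(\<Sum>\<psi>\<in>\<Xi>. w \<psi>) \<in> U" using * by (intro subspace_sum[OF sU])
    then have "(\<Sum>\<psi>\<in>insert \<chi>0 \<Xi>. w \<psi>) - (\<Sum>\<psi>\<in>\<Xi>. w \<psi>) \<in> U" using insert.prems(3) by (intro subspace_diff[OF sU])
    then show ?thesis using insert.hyps True by simp
  qed
qed

end

lemma card_image_eq_if_same_fibres:
  assumes "\<And>x y. x \<in> A \<Longrightarrow> y \<in> A \<Longrightarrow> f x = f y \<longleftrightarrow> g x = g y"
  shows "card (f ` A) = card (g ` A)"
proof (rule bij_betw_same_card)
  have g: "inv_into A f y \<in> A \<and> f (inv_into A f y) = y" if "y \<in> f ` A" for y
    using that by (simp add: inv_into_into f_inv_into_f)
  show "bij_betw (\<lambda>y. g (inv_into A f y)) (f ` A) (g ` A)"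
  proof (rule bij_betw_imageI)
    show "inj_on (\<lambda>y. g (inv_into A f y)) (f ` A)"
    proof (rule inj_onI)
      fix y z assume yz: "y \<in> f ` A" "z \<in> f ` A" "g (inv_into A f y) = g (inv_into A f z)"
      then have "f (inv_into A f y) = f (inv_into A f z)" using assms g by blast
      then show "y = z" using g[OF yz(1)] g[OF yz(2)] by simp
    qed
    have "g (inv_into A f (f x)) = g x" if "x \<in> A" for x
      using assms[of "inv_into A f (f x)" x] g[of "f x"] that by blast
    then show "(\<lambda>y. g (inv_into A f y)) ` f ` A = g ` A" by (force simp: image_image)
  qed
qed

context linear_group begin

lemma span_weight_spaces:
  assumes "finite \<Xi>" and sub: "\<And>\<chi>. \<chi> \<in> \<Xi> \<Longrightarrow> subspace (E \<chi>)" and w: "w \<in> span (\<Union>\<chi>\<in>\<Xi>. E \<chi>)"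
  obtains v where "\<And>\<chi>. \<chi> \<in> \<Xi> \<Longrightarrow> v \<chi> \<in> E \<chi>" "w = (\<Sum>\<chi>\<in>\<Xi>. v \<chi>)"
proof -
  define S where "S = {\<Sum>\<chi>\<in>\<Xi>. v \<chi> | v. \<forall>\<chi>\<in>\<Xi>. v \<chi> \<in> E \<chi>}"
  have SI: "(\<Sum>\<chi>\<in>\<Xi>. v \<chi>) \<in> S" if "\<And>\<chi>. \<chi> \<in> \<Xi> \<Longrightarrow> v \<chi> \<in> E \<chi>" for v
    using that by (auto simp: S_def)
  have "subspace S"
  proof (rule subspaceI)
    show "0 \<in> S" using SI[of "\<lambda>_. 0"] sub by (simp add: subspace_0)
    show "x + y \<in> S" if x: "x \<in> S" and y: "y \<in> S" for x y
    proof -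
      obtain v where v: "\<forall>\<chi>\<in>\<Xi>. v \<chi> \<in> E \<chi>" "x = (\<Sum>\<chi>\<in>\<Xi>. v \<chi>)" using x by (auto simp: S_def)
      obtain u where u: "\<forall>\<chi>\<in>\<Xi>. u \<chi> \<in> E \<chi>" "y = (\<Sum>\<chi>\<in>\<Xi>. u \<chi>)" using y by (auto simp: S_def)
      have "(\<Sum>\<chi>\<in>\<Xi>. v \<chi> + u \<chi>) \<in> S" using v u sub by (intro SI) (simp add: subspace_add)
      then show ?thesis using v u by (simp add: sum.distrib)
    qed
    show "c *s x \<in> S" if x: "x \<in> S" for c x
    proof -
      obtain v where v: "\<forall>\<chi>\<in>\<Xi>. v \<chi> \<in> E \<chi>" "x = (\<Sum>\<chi>\<in>\<Xi>. v \<chi>)" using x by (auto simp: S_def)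
      have "(\<Sum>\<chi>\<in>\<Xi>. c *s v \<chi>) \<in> S" using v sub by (intro SI) (simp add: subspace_scale)
      then show ?thesis using v by (simp add: scale_sum_right)
    qed
  qed
  moreover have "(\<Union>\<chi>\<in>\<Xi>. E \<chi>) \<subseteq> S"
  proof
    fix x assume "x \<in> (\<Union>\<chi>\<in>\<Xi>. E \<chi>)"
    then obtain \<psi> where \<psi>: "\<psi> \<in> \<Xi>" "x \<in> E \<psi>" by blast
    have "(\<Sum>\<chi>\<in>\<Xi>. if \<chi> = \<psi> then x else 0) \<in> S" using \<psi> sub by (intro SI) (simp add: subspace_0)
    then show "x \<in> S" using \<psi> assms(1) by simp
  qed
  ultimately have "span (\<Union>\<chi>\<in>\<Xi>. E \<chi>) \<subseteq> S" by (rule span_minimal[rotated])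
  then show thesis using w that unfolding S_def by blast
qed

text \<open>Weights are taken extensional on \<open>A\<close>, so that different ones differ at some
  element of \<open>A\<close> and independence applies.\<close>

lemma weight_space_Int_span:
  assumes fin: "finite \<Xi>" and A: "A \<subseteq> carrier G" and U: "stable A U" and W: "stable A W" and UW: "U \<subseteq> W"
    and ext: "\<And>\<chi>. \<chi> \<in> insert \<psi> \<Xi> \<Longrightarrow> \<chi> \<in> extensional A" and \<psi>: "\<psi> \<notin> \<Xi>"
    and w: "w \<in> weight_space A U W \<psi>" "w \<in> span (\<Union>\<chi>\<in>\<Xi>. weight_space A U W \<chi>)"
  shows "w \<in> U"
proof -
  note ws = weight_space_subspace[OF U W A UW]
  obtain v where v: "\<And>\<chi>. \<chi> \<in> \<Xi> \<Longrightarrow> v \<chi> \<in> weight_space A U W \<chi>" "w = (\<Sum>\<chi>\<in>\<Xi>. v \<chi>)"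
    using span_weight_spaces[OF fin ws(1) w(2)] by blast
  define u where "u \<chi> = (if \<chi> = \<psi> then - w else v \<chi>)" for \<chi>
  have "(\<Sum>\<chi>\<in>insert \<psi> \<Xi>. u \<chi>) = - w + (\<Sum>\<chi>\<in>\<Xi>. u \<chi>)" using fin \<psi> by (simp add: u_def)
  also have "(\<Sum>\<chi>\<in>\<Xi>. u \<chi>) = (\<Sum>\<chi>\<in>\<Xi>. v \<chi>)" using \<psi> by (intro sum.cong) (auto simp: u_def)
  finally have s: "(\<Sum>\<chi>\<in>insert \<psi> \<Xi>. u \<chi>) \<in> U" using v(2) subspace_0[OF stableD(2)[OF U]] by simp
  have "u \<psi> \<in> U"
  proof (rule weights_independent[OF _ A U _ _ stableD(2)[OF W] s])
    show "\<exists>a\<in>A. \<chi> a \<noteq> \<phi> a" if "\<chi> \<in> insert \<psi> \<Xi>" "\<phi> \<in> insert \<psi> \<Xi>" "\<chi> \<noteq> \<phi>" for \<chi> \<phi>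
      using extensionalityI[OF ext[OF that(1)] ext[OF that(2)]] that(3) by blast
    show "u \<chi> \<in> weight_space A U W \<chi>" if "\<chi> \<in> insert \<psi> \<Xi>" for \<chi>
      using that w(1) v(1) ws(1) by (auto simp: u_def subspace_neg)
  qed (use fin in auto)
  then show ?thesis using subspace_neg[OF stableD(2)[OF U]] by (fastforce simp: u_def)
qed

text \<open>By independence modulo \<open>U\<close>, each further weight strictly enlarges the span
  of the weight spaces collected so far.\<close>

lemma card_weights:
  assumes fin: "finite \<Xi>" and A: "A \<subseteq> carrier G" and U: "stable A U" and W: "stable A W" and UW: "U \<subseteq> W"
    and ext: "\<And>\<chi>. \<chi> \<in> \<Xi> \<Longrightarrow> \<chi> \<in> extensional A" and nt: "\<And>\<chi>. \<chi> \<in> \<Xi> \<Longrightarrow> \<not> weight_space A U W \<chi> \<subseteq> U"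
    and B: "finite B" "W \<subseteq> span B"
  shows "dim U + card \<Xi> \<le> dim W"
proof -
  note ws = weight_space_subspace[OF U W A UW]
  note sU = stableD(2)[OF U] and sW = stableD(2)[OF W]
  let ?S = "\<lambda>\<Xi>. span (U \<union> (\<Union>\<chi>\<in>\<Xi>. weight_space A U W \<chi>))"
  have SW: "?S \<Xi>' \<subseteq> W" for \<Xi>' using ws(3) UW by (intro span_minimal[OF _ sW]) blast
  have "dim U + card \<Xi> \<le> dim (?S \<Xi>)"
    using fin ext nt
  proof (induction \<Xi> rule: finite_induct)
    case empty
    then show ?case by simp
  next
    case (insert \<psi> \<Xi>)
    have "?S \<Xi> \<subset> ?S (insert \<psi> \<Xi>)"
    proof
      show "?S \<Xi> \<subseteq> ?S (insert \<psi> \<Xi>)" by (intro span_mono) auto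
      obtain w where w: "w \<in> weight_space A U W \<psi>" "w \<notin> U" using insert.prems(2) by blast
      have "w \<in> ?S (insert \<psi> \<Xi>)" using w by (intro span_base) simp
      moreover have "w \<notin> ?S \<Xi>"
      proof (cases "\<Xi> = {}")
        case True
        then show ?thesis using w(2) span_minimal[OF order_refl sU] by auto
      next
        case False
        then have "U \<union> (\<Union>\<chi>\<in>\<Xi>. weight_space A U W \<chi>) = (\<Union>\<chi>\<in>\<Xi>. weight_space A U W \<chi>)" using ws(2) by blast
        then show ?thesis
          using weight_space_Int_span[OF insert.hyps(1) A U W UW insert.prems(1) insert.hyps(2) w(1)] w(2) by auto
      qed
      ultimately show "?S \<Xi> \<noteq> ?S (insert \<psi> \<Xi>)" by blast
    qed
    then have "dim (?S \<Xi>) < dim (?S (insert \<psi> \<Xi>))"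
      by (rule dim_psubset_less[OF subspace_span subspace_span _ B(1)]) (use SW B(2) in blast)
    then show ?case using insert by auto
  qed
  also have "dim (?S \<Xi>) \<le> dim W"
  proof (cases "?S \<Xi> = W")
    case False
    then have "?S \<Xi> \<subset> W" using SW[of \<Xi>] by blast
    then show ?thesis using dim_psubset_less[OF subspace_span sW _ B] by (simp add: less_imp_le)
  qed simp
  finally show ?thesis .
qed

text \<open>The weight whose space receives the weight space of \<open>\<chi>\<close> under
  \<open>\<rho> g\<close>. Restriction to \<open>A\<close> makes weights that agree on
  \<open>A\<close> equal as functions, so that orbits of weights can be counted.\<close>

definition conj_weight :: "'a set \<Rightarrow> ('a \<Rightarrow> 'k) \<Rightarrow> 'a \<Rightarrow> 'a \<Rightarrow> 'k"
  where "conj_weight A \<chi> g = restrict (\<lambda>a. \<chi> (inv g \<otimes> a \<otimes> g)) A"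

lemma conj_weight_space:
  assumes A: "A \<subseteq> Y" "normalized_by Y A" and Y: "subgroup Y G" and U: "stable Y U" and W: "stable Y W" and g: "g \<in> Y"
    and w: "w \<in> weight_space A U W \<chi>"
  shows "\<rho> g w \<in> weight_space A U W (conj_weight A \<chi> g)"
proof -
  interpret Y: subgroup Y G by fact
  have wW: "w \<in> W" "\<And>a. a \<in> A \<Longrightarrow> \<rho> a w - \<chi> a *s w \<in> U" using w by (auto simp: weight_space_def)
  have "\<rho> a (\<rho> g w) - conj_weight A \<chi> g a *s \<rho> g w \<in> U" if a: "a \<in> A" for a
  proof -
    let ?b = "inv g \<otimes> a \<otimes> g"
    have gi: "inv g \<in> Y" using g by simp
    have gc: "g \<in> carrier G" "a \<in> carrier G" using g a A(1) by auto
    have b: "?b \<in> A" using normalized_byD[OF A(2) gi a] gc by simp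
    have "\<rho> g (\<rho> ?b w - \<chi> ?b *s w) \<in> U" using wW(2)[OF b] by (rule stableD(1)[OF U g])
    moreover have "\<rho> g (\<rho> ?b w) = \<rho> a (\<rho> g w)"
      using gc by (simp add: act_mult[symmetric] m_assoc)
    ultimately show ?thesis using gc a by (simp add: act_diff act_scale conj_weight_def)
  qed
  then show ?thesis using stableD(1)[OF W g wW(1)] by (simp add: weight_space_def)
qed

text \<open>This is the inertia group of \<open>\<chi>\<close> in \<open>Y\<close>; its cosets
  correspond to the conjugates of \<open>\<chi>\<close>.\<close>

lemma conj_weight_eq_subgroup:
  assumes A: "A \<subseteq> Y" "normalized_by Y A" and Y: "subgroup Y G"
  shows "subgroup {g \<in> Y. \<forall>a\<in>A. \<chi> (conj_by g a) = \<chi> a} G"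
proof -
  interpret Y: subgroup Y G by fact
  have Ac: "a \<in> carrier G" if "a \<in> A" for a using A(1) that by auto
  show ?thesis
  proof (rule subgroup_finiteI)
    show "{g \<in> Y. \<forall>a\<in>A. \<chi> (conj_by g a) = \<chi> a} \<subseteq> carrier G" using Y.subset by blast
    then show "finite {g \<in> Y. \<forall>a\<in>A. \<chi> (conj_by g a) = \<chi> a}" using finite_group finite_subset by blast
    show "\<one> \<in> {g \<in> Y. \<forall>a\<in>A. \<chi> (conj_by g a) = \<chi> a}" using Ac by simp
  next
    fix g h assume "g \<in> {g \<in> Y. \<forall>a\<in>A. \<chi> (conj_by g a) = \<chi> a}" "h \<in> {g \<in> Y. \<forall>a\<in>A. \<chi> (conj_by g a) = \<chi> a}"
    then have gh: "g \<in> Y" "\<And>a. a \<in> A \<Longrightarrow> \<chi> (conj_by g a) = \<chi> a" "h \<in> Y" "\<And>a. a \<in> A \<Longrightarrow> \<chi> (conj_by h a) = \<chi> a" by auto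
    have "\<chi> (g \<otimes> h \<otimes> a \<otimes> inv (g \<otimes> h)) = \<chi> a" if a: "a \<in> A" for a
    proof -
      have "g \<otimes> h \<otimes> a \<otimes> inv (g \<otimes> h) = conj_by g (h \<otimes> a \<otimes> inv h)"
        using gh(1,3) Ac[OF a] by (simp add: m_assoc inv_mult_group)
      then show ?thesis using gh(2)[OF normalized_byD[OF A(2) gh(3) a]] gh(4)[OF a] by simp
    qed
    then show "g \<otimes> h \<in> {g \<in> Y. \<forall>a\<in>A. \<chi> (conj_by g a) = \<chi> a}" using gh by simp
  qed
qed

lemma conj_weight_eq_iff:
  assumes A: "A \<subseteq> Y" "normalized_by Y A" and Y: "subgroup Y G" and g: "g \<in> Y" and h: "h \<in> Y"
  shows "conj_weight A \<chi> g = conj_weight A \<chi> h \<longleftrightarrow> inv g \<otimes> h \<in> {g \<in> Y. \<forall>a\<in>A. \<chi> (conj_by g a) = \<chi> a}"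
proof -
  interpret Y: subgroup Y G by fact
  have Ac: "a \<in> carrier G" if "a \<in> A" for a using A(1) that by auto
  have gh: "inv g \<otimes> h \<in> Y" using g h by simp
  have "conj_weight A \<chi> g = conj_weight A \<chi> h \<longleftrightarrow> (\<forall>a\<in>A. \<chi> (inv g \<otimes> a \<otimes> g) = \<chi> (inv h \<otimes> a \<otimes> h))"
    unfolding conj_weight_def by (auto simp: restrict_def fun_eq_iff)
  also have "\<dots> \<longleftrightarrow> (\<forall>a\<in>A. \<chi> (conj_by (inv g \<otimes> h) a) = \<chi> a)"
  proof
    assume l: "\<forall>a\<in>A. \<chi> (inv g \<otimes> a \<otimes> g) = \<chi> (inv h \<otimes> a \<otimes> h)"
    show "\<forall>a\<in>A. \<chi> (conj_by (inv g \<otimes> h) a) = \<chi> a"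
    proof
      fix a assume a: "a \<in> A"
      have "\<chi> (inv g \<otimes> conj_by h a \<otimes> g) = \<chi> (inv h \<otimes> conj_by h a \<otimes> h)"
        using l normalized_byD[OF A(2) h a] by blast
      then show "\<chi> (conj_by (inv g \<otimes> h) a) = \<chi> a"
        using g h Ac[OF a] by (simp add: m_assoc inv_mult_group)
    qed
  next
    assume r: "\<forall>a\<in>A. \<chi> (conj_by (inv g \<otimes> h) a) = \<chi> a"
    show "\<forall>a\<in>A. \<chi> (inv g \<otimes> a \<otimes> g) = \<chi> (inv h \<otimes> a \<otimes> h)"
    proof
      fix a assume a: "a \<in> A"
      have ha: "inv h \<otimes> a \<otimes> h \<in> A" using normalized_byD[OF A(2) Y.m_inv_closed[OF h] a] h by simp
      have "\<chi> (conj_by (inv g \<otimes> h) (inv h \<otimes> a \<otimes> h)) = \<chi> (inv h \<otimes> a \<otimes> h)"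
        using r ha by blast
      then show "\<chi> (inv g \<otimes> a \<otimes> g) = \<chi> (inv h \<otimes> a \<otimes> h)"
        using g h Ac[OF a] by (simp add: m_assoc inv_mult_group)
    qed
  qed
  finally show ?thesis using gh by simp
qed

text \<open>\<open>(c - 1)^2\<close> maps \<open>W\<close> into \<open>U\<close>, so modulo
  \<open>U\<close> the binomial expansion of \<open>c^n\<close> stops at
  \<open>1 + n (c - 1)\<close>.\<close>

lemma act_pow_unipotent:
  assumes c: "c \<in> carrier G" and U: "stable {c} U" and EU: "trivial_on U E c" and WE: "trivial_on E W c" and w: "w \<in> W"
  shows "\<rho> (c [^] (n::nat)) w - w - of_nat n *s (\<rho> c w - w) \<in> U"
proof (induction n)
  case 0
  then show ?case using subspace_0[OF stableD(2)[OF U]] by (simp add: act_one)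
next
  case (Suc n)
  note sU = stableD(2)[OF U]
  let ?d = "\<rho> c w - w" and ?u = "\<rho> (c [^] n) w - w - of_nat n *s (\<rho> c w - w)"
  have d: "?d \<in> E" using WE w by (simp add: trivial_on_def)
  have "\<rho> c ?d - ?d \<in> U" using EU d by (simp add: trivial_on_def)
  then have 1: "of_nat n *s (\<rho> c ?d - ?d) \<in> U" by (rule subspace_scale[OF sU])
  have 2: "\<rho> c ?u \<in> U" using stableD(1)[OF U _ Suc] by simp
  have "of_nat n *s (\<rho> c ?d - ?d) + \<rho> c ?u \<in> U" using subspace_add[OF sU 1 2] .
  moreover have "\<rho> c ?u = \<rho> c (\<rho> (c [^] n) w) - \<rho> c w - of_nat n *s \<rho> c ?d" using c by (simp add: act_diff act_scale)
  moreover have "\<rho> (c [^] Suc n) w = \<rho> c (\<rho> (c [^] n) w)"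
    using act_mult[of c "c [^] n"] nat_pow_Suc2[of c n] c by simp
  moreover have "of_nat n *s (D - ?d) + (X - \<rho> c w - of_nat n *s D) = X - w - of_nat (Suc n) *s ?d" for D X
    by (simp only: of_nat_Suc scale_left_distrib scale_right_diff_distrib scale_one) (simp add: algebra_simps)
  ultimately show ?case by simp
qed

text \<open>\<open>Y\<close> permutes the at most \<open>m\<close> weights of \<open>A\<close>, and fixes each of them because its order is coprime to \<open>m!\<close>.\<close>

lemma coprime_abelian_central:
  assumes Y: "subgroup Y G" "coprime (card Y) (fact m)" and A: "subgroup A G" "A \<subseteq> Y" "normalized_by Y A"
    and ab: "\<And>a b. a \<in> A \<Longrightarrow> b \<in> A \<Longrightarrow> a \<otimes> b = b \<otimes> a" and cA: "of_nat (card A) \<noteq> (0::'k)"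
    and U: "stable Y U" and W: "stable Y W" and UW: "U \<subseteq> W" and dim: "dim W \<le> dim U + m"
    and B: "finite B" "W \<subseteq> span B" and a: "a \<in> A" and y: "y \<in> Y"
  shows "trivial_on U W (commutator a y)"
  using U W UW dim B(2)
proof (induction "dim W - dim U" arbitrary: U W rule: less_induct)
  case less
  interpret Y: subgroup Y G by fact
  interpret A: subgroup A G by fact
  let ?c = "commutator a y"
  have "a \<otimes> (y \<otimes> inv a \<otimes> inv y) \<in> A" by (rule A.m_closed[OF a normalized_byD[OF A(3) y A.m_inv_closed[OF a]]])
  then have cA': "?c \<in> A" using a y by (simp add: m_assoc)
  then have cY: "?c \<in> Y" and cc: "?c \<in> carrier G" using A(2) by auto
  note sU = stableD(2)[OF less.prems(1)] and sW = stableD(2)[OF less.prems(2)]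
  show ?case
  proof (cases "\<exists>E. stable Y E \<and> U \<subset> E \<and> E \<subset> W")
    case True
    then obtain E where E: "stable Y E" "U \<subset> E" "E \<subset> W" by blast
    note sE = stableD(2)[OF E(1)]
    have EB: "E \<subseteq> span B" using E(3) less.prems(5) by blast
    have d: "dim U < dim E" "dim E < dim W"
      using dim_psubset_less[OF sU sE E(2) B(1) EB] dim_psubset_less[OF sE sW E(3) B(1) less.prems(5)] by auto
    have t1: "trivial_on U E ?c"
      by (rule less.hyps) (use d less.prems E EB in auto)
    have t2: "trivial_on E W ?c"
      by (rule less.hyps) (use d less.prems E in auto)
    \<comment> \<open>In the reducible case the commutator is unipotent on \<open>W/U\<close>, so
      its power of exponent \<open>card A\<close> minus 1 is \<open>card A\<close> times the
      commutator minus 1. That power is trivial and \<open>card A\<close> is invertible in the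
      field.\<close>
    have "?c [^] card A = \<one>"
      using group.pow_order_eq_1[OF subgroup_imp_group[OF A(1)], of ?c] cA'
      by (simp add: Coset.order_def nat_pow_consistent [symmetric])
    have "\<rho> ?c w - w \<in> U" if w: "w \<in> W" for w
    proof -
      have "stable {?c} U" using less.prems(1) cY stable_mono by blast
      from act_pow_unipotent[OF cc this t1 t2 w, of "card A"]
      have "- (of_nat (card A) *s (\<rho> ?c w - w)) \<in> U" unfolding \<open>?c [^] card A = \<one>\<close> by (simp add: act_one)
      then have "- (- (of_nat (card A) *s (\<rho> ?c w - w))) \<in> U" by (rule subspace_neg[OF sU])
      then have "of_nat (card A) *s (\<rho> ?c w - w) \<in> U" by simp
      then have "inverse (of_nat (card A)) *s (of_nat (card A) *s (\<rho> ?c w - w)) \<in> U" by (rule subspace_scale[OF sU])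
      then show ?thesis using cA by simp
    qed
    then show ?thesis by (simp add: trivial_on_def)
  next
    case irr: False
    show ?thesis
    proof (cases "U = W")
      case True
      then show ?thesis using stableD(1)[OF less.prems(2) cY] sW by (auto simp: trivial_on_def subspace_diff)
    next
      case False
      then have UW: "U \<subset> W" using less.prems(3) by blast
      have AU: "stable A U" and AW: "stable A W" using less.prems(1,2) A(2) stable_mono by blast+
      have "trivial_on U W (commutator a b)" if a: "a \<in> A" and b: "b \<in> A" for a b
      proof -
        have "commutator a b = b \<otimes> a \<otimes> inv a \<otimes> inv b" using ab[OF a b] by simp
        then have "commutator a b = \<one>" using a b by (simp add: m_assoc)
        then show ?thesis using subspace_0[OF sU] by (simp add: trivial_on_def act_one)
      qed
      then obtain \<chi> w where w: "w \<in> weight_space A U W \<chi>" "w \<notin> U"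
        using weight_exists[OF A(1) _ AU AW UW B(1) less.prems(5)] by blast
      note ws = weight_space_subspace[OF AU AW A.subset less.prems(3)]
      let ?S = "{g \<in> Y. \<forall>a\<in>A. \<chi> (conj_by g a) = \<chi> a}"
      have S: "subgroup ?S G" by (rule conj_weight_eq_subgroup[OF A(2,3) Y(1)])
      have SY: "?S \<subseteq> Y" by blast
      let ?\<Xi> = "conj_weight A \<chi> ` Y"
      have fY: "finite Y" using finite_group Y.subset finite_subset by blast
      have "dim U + card ?\<Xi> \<le> dim W"
      proof (rule card_weights[OF _ A.subset AU AW less.prems(3) _ _ B(1) less.prems(5)])
        show "finite ?\<Xi>" using fY by simp
        fix \<psi> assume "\<psi> \<in> ?\<Xi>"
        then obtain g where g: "g \<in> Y" "\<psi> = conj_weight A \<chi> g" by blast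
        show "\<psi> \<in> extensional A" by (simp add: g(2) conj_weight_def)
        have "\<rho> g w \<in> weight_space A U W \<psi>"
          unfolding g(2) by (rule conj_weight_space[OF A(2,3) Y(1) less.prems(1,2) g(1) w(1)])
        moreover have "\<rho> g w \<notin> U"
        proof
          assume "\<rho> g w \<in> U"
          then have "\<rho> (inv g) (\<rho> g w) \<in> U" using stableD(1)[OF less.prems(1) Y.m_inv_closed[OF g(1)]] by blast
          then show False using w(2) g(1) by (simp add: act_inv)
        qed
        ultimately show "\<not> weight_space A U W \<psi> \<subseteq> U" by blast
      qed
      then have card\<Xi>: "card ?\<Xi> \<le> m" using less.prems(4) by simp
      have "card ?\<Xi> = card ((\<lambda>k. ?S #> k) ` Y)"
      proof -
        have "card ?\<Xi> = card ((\<lambda>g. ?S #> inv g) ` Y)"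
        proof (rule card_image_eq_if_same_fibres)
          fix g h assume gh: "g \<in> Y" "h \<in> Y"
          have "?S #> inv g = ?S #> inv h \<longleftrightarrow> inv g \<otimes> inv (inv h) \<in> ?S"
            by (rule rcos_eq_iff[OF S]) (use gh in auto)
          moreover have "inv (inv h) = h" using gh by simp
          ultimately show "conj_weight A \<chi> g = conj_weight A \<chi> h \<longleftrightarrow> ?S #> inv g = ?S #> inv h"
            using conj_weight_eq_iff[OF A(2,3) Y(1) gh, of \<chi>] by (simp only:)
        qed
        moreover have "(\<lambda>g. ?S #> inv g) ` Y = (\<lambda>k. ?S #> k) ` Y"
        proof (intro equalityI subsetI)
          fix C assume "C \<in> (\<lambda>k. ?S #> k) ` Y"
          then obtain k where k: "k \<in> Y" "C = ?S #> k" by blast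
          then have "C = ?S #> inv (inv k)" by simp
          then show "C \<in> (\<lambda>g. ?S #> inv g) ` Y" using Y.m_inv_closed[OF k(1)] by blast
        next
          fix C assume "C \<in> (\<lambda>g. ?S #> inv g) ` Y"
          then show "C \<in> (\<lambda>k. ?S #> k) ` Y" using Y.m_inv_closed by blast
        qed
        ultimately show ?thesis by (simp only:)
      qed
      then have e: "card ?\<Xi> * card ?S = card Y" using card_subgroup_cosets[OF S Y(1) SY] by simp
      have "?\<Xi> \<noteq> {}" using Y.one_closed by blast
      then have "card ?\<Xi> > 0" using fY by (simp add: card_gt_0_iff)
      then have "card ?\<Xi> dvd fact m" using card\<Xi> by (intro dvd_fact) auto
      moreover have "card ?\<Xi> dvd card Y" by (rule dvdI[OF e[symmetric]])
      ultimately have "card ?\<Xi> = 1" using coprime_common_divisor_nat[OF Y(2)] by blast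
      then have "card ?S = card Y" using e by (simp only: mult_1)
      then have "?S = Y" by (rule card_subset_eq[OF fY SY])
      have gE: "\<rho> g v \<in> weight_space A U W \<chi>" if g: "g \<in> Y" and v: "v \<in> weight_space A U W \<chi>" for g v
      proof -
        have "\<rho> g v \<in> weight_space A U W (conj_weight A \<chi> g)"
          by (rule conj_weight_space[OF A(2,3) Y(1) less.prems(1,2) g v])
        moreover have "conj_weight A \<chi> g b = \<chi> b" if b: "b \<in> A" for b
        proof -
          have "inv g \<in> ?S" using \<open>?S = Y\<close> Y.m_inv_closed[OF g] by blast
          then show ?thesis using b g by (simp add: conj_weight_def)
        qed
        ultimately show ?thesis by (simp add: weight_space_def)
      qed
      have "stable Y (weight_space A U W \<chi>)" using gE ws(1) by (simp add: stable_def)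
      \<comment> \<open>The weight space is stable, so irreducibility makes it all of
        \<open>W\<close>: \<open>A\<close> acts on \<open>W/U\<close> by scalars, and these commute
        with every \<open>y\<close>.\<close>
      then have EW: "weight_space A U W \<chi> = W" using irr ws(2,3) w by blast
      have "\<rho> ?c v - v \<in> U" if v: "v \<in> W" for v
      proof -
        have yc: "y \<in> carrier G" "a \<in> carrier G" using y a by auto
        let ?x = "\<rho> (inv a) (\<rho> (inv y) v)"
        have x: "?x \<in> W" using stableD(1)[OF less.prems(2)] v y a A(2) by (meson A.m_inv_closed Y.m_inv_closed subsetD)
        have wv: "\<rho> b v - \<chi> b *s v \<in> U" if "b \<in> A" "v \<in> W" for b v using EW that unfolding weight_space_def by blast
        have yx: "\<rho> y ?x \<in> W" by (rule stableD(1)[OF less.prems(2) y x])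
        have "\<rho> a (\<rho> y ?x) - \<chi> a *s \<rho> y ?x \<in> U" by (rule wv[OF a yx])
        moreover have "\<rho> y (\<rho> a ?x - \<chi> a *s ?x) \<in> U" by (rule stableD(1)[OF less.prems(1) y wv[OF a x]])
        ultimately have "(\<rho> a (\<rho> y ?x) - \<chi> a *s \<rho> y ?x) - \<rho> y (\<rho> a ?x - \<chi> a *s ?x) \<in> U" by (rule subspace_diff[OF sU])
        then have "\<rho> a (\<rho> y ?x) - \<rho> y (\<rho> a ?x) \<in> U" using yc by (simp add: act_diff act_scale)
        moreover have "\<rho> y (\<rho> a ?x) = v" using yc by (simp add: act_inv)
        moreover have "\<rho> a (\<rho> y ?x) = \<rho> ?c v" using yc by (simp add: act_mult)
        ultimately show ?thesis by simp
      qed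
      then show ?thesis by (simp add: trivial_on_def)
    qed
  qed
qed

end

section \<open>Derived length of linear p-groups\<close>

lemma (in group) exp_of_derived_decreasing:
  assumes "subgroup H G"
  shows "(derived G ^^ (m + n)) H \<subseteq> (derived G ^^ m) H"
proof (induction n)
  case (Suc n)
  have "derived G ((derived G ^^ (m + n)) H) \<subseteq> (derived G ^^ (m + n)) H"
    by (rule derived_incl[OF order_refl exp_of_derived_is_subgroup[OF assms]])
  then show ?case using Suc by simp
qed simp

context linear_group begin

text \<open>Both \<open>(g - 1)(h - 1)\<close> and \<open>(h - 1)(g - 1)\<close> map
  \<open>W\<close> into \<open>U\<close>, so \<open>g h\<close> and \<open>h g\<close> agree modulo
  \<open>U\<close>.\<close>

lemma trivial_on_commutator:
  assumes g: "g \<in> carrier G" "stable {g} U" "stable {g} W" and h: "h \<in> carrier G" "stable {h} U" "stable {h} W"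
    and gi: "stable {inv g} W" and hi: "stable {inv h} W"
    and tg: "trivial_on U E g" "trivial_on E W g" and th: "trivial_on U E h" "trivial_on E W h"
  shows "trivial_on U W (commutator g h)"
  unfolding trivial_on_def
proof
  fix w assume w: "w \<in> W"
  note sU = stableD(2)[OF g(2)]
  define v where "v = \<rho> (inv g) (\<rho> (inv h) w)"
  have vW: "v \<in> W" unfolding v_def using stableD(1)[OF gi] stableD(1)[OF hi] w by blast
  have e: "\<rho> h v - v \<in> E" "\<rho> g v - v \<in> E" using tg th vW by (auto simp: trivial_on_def)
  have "(\<rho> g (\<rho> h v - v) - (\<rho> h v - v)) - (\<rho> h (\<rho> g v - v) - (\<rho> g v - v)) \<in> U"
    by (rule subspace_diff[OF sU]) (use tg th e in \<open>simp_all add: trivial_on_def\<close>)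
  then have "\<rho> g (\<rho> h v) - \<rho> h (\<rho> g v) \<in> U" using g h by (simp add: act_diff)
  moreover have "\<rho> h (\<rho> g v) = w" using g h by (simp add: v_def act_inv)
  moreover have "\<rho> g (\<rho> h v) = \<rho> (commutator g h) w" using g h by (simp add: v_def act_mult)
  ultimately show "\<rho> (commutator g h) w - w \<in> U" by simp
qed

text \<open>Gluing: triviality on \<open>E/U\<close> and on \<open>W/E\<close> becomes triviality on
  \<open>W/U\<close> at the cost of one derived step.\<close>

lemma derived_trivial_extension:
  assumes P: "subgroup P G" and U: "stable P U" and W: "stable P W" and UW: "U \<subseteq> W"
    and t: "\<And>g. g \<in> (derived G ^^ n) P \<Longrightarrow> trivial_on U E g" "\<And>g. g \<in> (derived G ^^ n) P \<Longrightarrow> trivial_on E W g"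
  shows "(derived G ^^ Suc n) P \<subseteq> {g \<in> P. trivial_on U W g}"
proof -
  interpret P: subgroup P G by fact
  have D: "subgroup ((derived G ^^ n) P) G" by (rule exp_of_derived_is_subgroup[OF P])
  have DP: "(derived G ^^ n) P \<subseteq> P" using exp_of_derived_decreasing[OF P, of 0 n] by simp
  have K: "subgroup {g \<in> P. trivial_on U W g} G" by (rule trivial_on_subgroup(1)[OF P U W UW])
  have "derived_set G ((derived G ^^ n) P) \<subseteq> {g \<in> P. trivial_on U W g}"
  proof
    fix x assume "x \<in> derived_set G ((derived G ^^ n) P)"
    then obtain g h where gh: "g \<in> (derived G ^^ n) P" "h \<in> (derived G ^^ n) P" "x = commutator g h" by blast
    have P': "g \<in> P" "h \<in> P" using gh DP by auto
    have "trivial_on U W x"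
      unfolding gh(3)
      by (rule trivial_on_commutator[OF _ _ _ _ _ _ _ _ t[OF gh(1)] t[OF gh(2)]])
        (use P' in \<open>auto intro: stable_mono[OF U] stable_mono[OF W]\<close>)
    moreover have "x \<in> P" unfolding gh(3) using P' by simp
    ultimately show "x \<in> {g \<in> P. trivial_on U W g}" by simp
  qed
  then have "generate G (derived_set G ((derived G ^^ n) P)) \<subseteq> {g \<in> P. trivial_on U W g}"
    by (rule generate_subgroup_incl[OF _ K])
  then show ?thesis by (simp add: derived_def)
qed

text \<open>\<open>M\<close> permutes its conjugates of \<open>\<chi>\<close>, because conjugating
  by \<open>h\<close> and then by \<open>g\<close> is conjugating by
  \<open>g \<otimes> h\<close>.\<close>

lemma stable_weight_span:
  assumes A: "A \<subseteq> P" "normalized_by P A" and P: "subgroup P G" and U: "stable P U" and W: "stable P W" and UW: "U \<subseteq> W"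
    and M: "subgroup M G" "M \<subseteq> P"
  shows "stable M (span (\<Union>g\<in>M. weight_space A U W (conj_weight A \<chi> g)))" (is "stable M (span ?X)")
proof -
  interpret P: subgroup P G by fact
  interpret M: subgroup M G by fact
  have Ac: "A \<subseteq> carrier G" using A(1) P.subset by blast
  have "\<rho> g v \<in> span ?X" if g: "g \<in> M" and v: "v \<in> span ?X" for g v
  proof -
    have "subspace {v. \<rho> g v \<in> span ?X}"
      by (rule subspaceI) (use g in \<open>simp_all add: act_zero act_add act_scale span_zero span_add span_scale\<close>)
    moreover have "?X \<subseteq> {v. \<rho> g v \<in> span ?X}"
    proof
      fix x assume "x \<in> ?X"
      then obtain h where h: "h \<in> M" "x \<in> weight_space A U W (conj_weight A \<chi> h)" by blast
      have "\<rho> g x \<in> weight_space A U W (conj_weight A (conj_weight A \<chi> h) g)"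
        by (rule conj_weight_space[OF A P U W _ h(2)]) (use g M in blast)
      moreover have "conj_weight A (conj_weight A \<chi> h) g = conj_weight A \<chi> (g \<otimes> h)"
      proof
        fix a
        show "conj_weight A (conj_weight A \<chi> h) g a = conj_weight A \<chi> (g \<otimes> h) a"
        proof (cases "a \<in> A")
          case True
          have gP: "inv g \<in> P" using g M(2) by (meson M.m_inv_closed subsetD)
          have c: "g \<in> carrier G" "h \<in> carrier G" "a \<in> carrier G" using g h True Ac by auto
          have "inv g \<otimes> a \<otimes> g \<in> A" using normalized_byD[OF A(2) gP True] c by simp
          then show ?thesis using True c by (simp add: conj_weight_def m_assoc inv_mult_group)
        qed (simp add: conj_weight_def)
      qed
      ultimately have "\<rho> g x \<in> ?X" using M.m_closed[OF g h(1)] by auto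
      then show "x \<in> {v. \<rho> g v \<in> span ?X}" by (simp add: span_base)
    qed
    ultimately have "span ?X \<subseteq> {v. \<rho> g v \<in> span ?X}" by (rule span_minimal[rotated])
    then show ?thesis using v by blast
  qed
  then show ?thesis by (simp add: stable_def subspace_span)
qed

text \<open>A Clifford argument that works in every characteristic, by induction on the bound
  \<open>m\<close> for the dimension of \<open>W/U\<close>, each dimension costing two derived
  steps. If \<open>W/U\<close> is reducible, one step glues the two parts. Otherwise, unless
  \<open>P\<close> acts as an abelian group, some abelian normal subgroup \<open>A\<close> is not
  central modulo the kernel of the action; \<open>P\<close> does not fix its weight
  \<open>\<chi>\<close>, so the inertia group lies in a proper subgroup \<open>M\<close> that
  contains the derived subgroup of \<open>P\<close>. The weight spaces conjugate under
  \<open>M\<close> span a proper \<open>M\<close>-stable subspace, so \<open>M\<close> falls under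
  the reducible case, and the second step is spent on passing from \<open>P\<close> to
  \<open>M\<close>.\<close>

lemma p_group_derived_trivial:
  assumes P: "subgroup P G" "card P = p ^ e" "prime (p::nat)" and U: "stable P U" and W: "stable P W" and UW: "U \<subseteq> W"
    and dim: "dim W \<le> dim U + m" and B: "finite B" "W \<subseteq> span B"
  shows "(derived G ^^ (2 * m)) P \<subseteq> {g \<in> P. trivial_on U W g}"
  using P(1,2) U W UW dim B(2)
proof (induction m arbitrary: P e U W)
  case 0
  have "U = W"
  proof (rule ccontr)
    assume "U \<noteq> W"
    then have "dim U < dim W" using 0 stableD(2) by (intro dim_psubset_less[OF _ _ _ B(1)]) auto
    then show False using 0 by simp
  qed
  then have "trivial_on U W g" if "g \<in> P" for g
    using stableD[OF 0(4)] that by (auto simp: trivial_on_def subspace_diff)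
  then show ?case by auto
next
  case (Suc m P e U W)
  note P = Suc.prems(1) and cP = Suc.prems(2) and U = Suc.prems(3) and W = Suc.prems(4) and UW = Suc.prems(5)
    and dim = Suc.prems(6) and WB = Suc.prems(7)
  interpret P: subgroup P G by fact
  note sU = stableD(2)[OF U] and sW = stableD(2)[OF W]
  \<comment> \<open>Used with \<open>M = P\<close> if the section is reducible for \<open>P\<close>,
    and with a proper subgroup otherwise.\<close>
  have step: "(derived G ^^ Suc (2 * m)) M \<subseteq> {g \<in> M. trivial_on U W g}"
    if M: "subgroup M G" "M \<subseteq> P" and E: "stable M E" "U \<subset> E" "E \<subset> W" for M E
  proof -
    obtain f where f: "card M = p ^ f" using p_group_subgroup[OF P cP assms(3) M] by blast
    have MU: "stable M U" "stable M W" using U W M(2) stable_mono by blast+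
    note sE = stableD(2)[OF E(1)]
    have EB: "E \<subseteq> span B" using E(3) WB by blast
    have d: "dim U < dim E" "dim E < dim W"
      using dim_psubset_less[OF sU sE E(2) B(1) EB] dim_psubset_less[OF sE sW E(3) B(1) WB] by auto
    have "(derived G ^^ (2 * m)) M \<subseteq> {g \<in> M. trivial_on U E g}"
      by (rule Suc.IH[OF M(1) f MU(1) E(1)]) (use E d dim EB in auto)
    moreover have "(derived G ^^ (2 * m)) M \<subseteq> {g \<in> M. trivial_on E W g}"
      by (rule Suc.IH[OF M(1) f E(1) MU(2)]) (use E d dim WB in auto)
    ultimately show ?thesis by (intro derived_trivial_extension[OF M(1) MU UW]) blast+
  qed
  have mono: "(derived G ^^ (2 * Suc m)) P \<subseteq> (derived G ^^ Suc (2 * m)) P" "(derived G ^^ (2 * Suc m)) P \<subseteq> derived G P"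
    using exp_of_derived_decreasing[OF P, of "Suc (2 * m)" 1] exp_of_derived_decreasing[OF P, of 1 "Suc (2 * m)"] by simp_all
  let ?N = "{g \<in> P. trivial_on U W g}"
  note N = trivial_on_subgroup[OF P U W UW]
  show ?case
  proof (cases "\<exists>E. stable P E \<and> U \<subset> E \<and> E \<subset> W")
    case True
    then show ?thesis using step[OF P order_refl] mono(1) by blast
  next
    case irr: False
    show ?thesis
    proof (cases "derived_set G P \<subseteq> ?N")
      case True
      then have "derived G P \<subseteq> ?N" unfolding derived_def by (rule generate_subgroup_incl[OF _ N(1)])
      then show ?thesis using mono(2) by blast
    next
      case False
      have NP: "?N \<subseteq> P" by blast
      obtain A b g where A: "subgroup A G" "A \<subseteq> P" "?N \<subseteq> A" "normalized_by P A" "derived_set G A \<subseteq> ?N"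
        and b: "b \<in> A" and g: "g \<in> P" and bg: "commutator b g \<notin> ?N"
        by (rule p_group_abelian_mod_subgroup[OF P cP assms(3) N NP False])
      interpret A: subgroup A G by (fact A(1))
      have UW': "U \<subset> W"
      proof -
        have "U \<noteq> W"
        proof
          assume "U = W"
          then have "trivial_on U W h" if "h \<in> P" for h
            using stableD[OF W] that by (auto simp: trivial_on_def subspace_diff)
          moreover have "commutator b g \<in> P" using b g A(2) by (meson P.m_closed P.m_inv_closed subsetD)
          ultimately show False using bg by blast
        qed
        then show ?thesis using UW by blast
      qed
      have AU: "stable A U" and AW: "stable A W" using U W A(2) stable_mono by blast+
      have "trivial_on U W (commutator x y)" if "x \<in> A" "y \<in> A" for x y
        using A(5) that by blast
      then obtain \<chi> w where w: "w \<in> weight_space A U W \<chi>" "w \<notin> U"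
        using weight_exists[OF A(1) _ AU AW UW' B(1) WB] by blast
      note ws = weight_space_subspace[OF AU AW A.subset UW]
      define S where "S = {g \<in> P. \<forall>a\<in>A. \<chi> (conj_by g a) = \<chi> a}"
      have S: "subgroup S G" unfolding S_def by (rule conj_weight_eq_subgroup[OF A(2,4) P])
      \<comment> \<open>If \<open>P\<close> fixed \<open>\<chi>\<close>, its weight space would be
        stable, hence all of \<open>W\<close>; then \<open>A\<close> would act by scalars on
        \<open>W/U\<close>, against the choice of \<open>b\<close> and \<open>g\<close>.\<close>
      have "S \<noteq> P"
      proof
        assume SP: "S = P"
        have gE: "\<rho> h v \<in> weight_space A U W \<chi>" if h: "h \<in> P" and v: "v \<in> weight_space A U W \<chi>" for h v
        proof -
          have "\<rho> h v \<in> weight_space A U W (conj_weight A \<chi> h)"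
            by (rule conj_weight_space[OF A(2,4) P U W h v])
          moreover have "conj_weight A \<chi> h a = \<chi> a" if a: "a \<in> A" for a
          proof -
            have "inv h \<in> S" using SP P.m_inv_closed[OF h] by blast
            then show ?thesis using a h by (simp add: conj_weight_def S_def)
          qed
          ultimately show ?thesis by (simp add: weight_space_def)
        qed
        have "stable P (weight_space A U W \<chi>)" using gE ws(1) by (simp add: stable_def)
        then have EW: "weight_space A U W \<chi> = W" using irr ws(2,3) w by blast
        have "trivial_on U W (commutator b g)"
          unfolding trivial_on_def
        proof
          fix v assume v: "v \<in> W"
          have yc: "g \<in> carrier G" "b \<in> carrier G" using g b by auto
          let ?x = "\<rho> (inv b) (\<rho> (inv g) v)"
          have x: "?x \<in> W" using stableD(1)[OF W] v g b A(2) by (meson A.m_inv_closed P.m_inv_closed subsetD)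
          have wv: "\<rho> a v - \<chi> a *s v \<in> U" if "a \<in> A" "v \<in> W" for a v using EW that unfolding weight_space_def by blast
          have yx: "\<rho> g ?x \<in> W" by (rule stableD(1)[OF W g x])
          have "\<rho> b (\<rho> g ?x) - \<chi> b *s \<rho> g ?x \<in> U" by (rule wv[OF b yx])
          moreover have "\<rho> g (\<rho> b ?x - \<chi> b *s ?x) \<in> U" by (rule stableD(1)[OF U g wv[OF b x]])
          ultimately have "(\<rho> b (\<rho> g ?x) - \<chi> b *s \<rho> g ?x) - \<rho> g (\<rho> b ?x - \<chi> b *s ?x) \<in> U" by (rule subspace_diff[OF sU])
          then have "\<rho> b (\<rho> g ?x) - \<rho> g (\<rho> b ?x) \<in> U" using yc by (simp add: act_diff act_scale)
          moreover have "\<rho> g (\<rho> b ?x) = v" using yc by (simp add: act_inv)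
          moreover have "\<rho> b (\<rho> g ?x) = \<rho> (commutator b g) v" using yc by (simp add: act_mult)
          ultimately show "\<rho> (commutator b g) v - v \<in> U" by simp
        qed
        moreover have "commutator b g \<in> P" using b g A(2) by (meson P.m_closed P.m_inv_closed subsetD)
        ultimately show False using bg by blast
      qed
      then have SP: "S \<subset> P" unfolding S_def by blast
      obtain M where M: "subgroup M G" "S \<subseteq> M" "M \<subset> P" "derived G P \<subseteq> M"
        by (rule p_group_proper_subgroup[OF P cP assms(3) S SP])
      interpret M: subgroup M G by (fact M(1))
      have MP: "M \<subseteq> P" using M(3) by blast
      define \<Xi> where "\<Xi> = conj_weight A \<chi> ` M"
      define E where "E = span (\<Union>g\<in>M. weight_space A U W (conj_weight A \<chi> g))"
      have E\<Xi>: "E = span (\<Union>\<psi>\<in>\<Xi>. weight_space A U W \<psi>)" by (simp add: E_def \<Xi>_def)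
      have stE: "stable M E" unfolding E_def by (rule stable_weight_span[OF A(2,4) P U W UW M(1) MP])
      have orb: "\<exists>v. v \<in> weight_space A U W (conj_weight A \<chi> h) \<and> v \<notin> U" if h: "h \<in> P" for h
      proof (intro exI conjI)
        show "\<rho> h w \<in> weight_space A U W (conj_weight A \<chi> h)" by (rule conj_weight_space[OF A(2,4) P U W h w(1)])
        show "\<rho> h w \<notin> U"
        proof
          assume "\<rho> h w \<in> U"
          then have "\<rho> (inv h) (\<rho> h w) \<in> U" using stableD(1)[OF U P.m_inv_closed[OF h]] by blast
          then show False using w(2) h by (simp add: act_inv)
        qed
      qed
      have wE: "weight_space A U W (conj_weight A \<chi> h) \<subseteq> E" if "h \<in> M" for h
        unfolding E_def by (rule order_trans[OF UN_upper[OF that] span_superset])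
      have UE: "U \<subset> E"
        using wE[OF M.one_closed] orb[OF P.one_closed] ws(2) by blast
      have EW: "E \<subset> W"
      proof
        show "E \<subseteq> W" unfolding E_def using ws(3) by (intro span_minimal[OF _ sW]) blast
        obtain h where h: "h \<in> P" "h \<notin> M" using M(3) by blast
        \<comment> \<open>Since \<open>M\<close> contains the inertia group, an \<open>h\<close>
          outside \<open>M\<close> moves \<open>\<chi>\<close> to a weight that is not conjugate to
          it under \<open>M\<close>, and the corresponding weight space meets \<open>E\<close> in
          \<open>U\<close> only.\<close>
        have "conj_weight A \<chi> h \<notin> \<Xi>"
        proof
          assume "conj_weight A \<chi> h \<in> \<Xi>"
          then obtain k where k: "k \<in> M" "conj_weight A \<chi> k = conj_weight A \<chi> h" unfolding \<Xi>_def by force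
          have kP: "k \<in> P" using k MP by blast
          have "inv k \<otimes> h \<in> S"
            unfolding S_def using conj_weight_eq_iff[OF A(2,4) P kP h(1)] k(2) by blast
          then have "inv k \<otimes> h \<in> M" using M(2) by blast
          then show False using subgroup_mult_eq(1)[OF M(1) M.m_inv_closed[OF k(1)], of h] h by simp
        qed
        moreover obtain v where v: "v \<in> weight_space A U W (conj_weight A \<chi> h)" "v \<notin> U" using orb[OF h(1)] by blast
        moreover have "finite \<Xi>"
          unfolding \<Xi>_def using finite_group M.subset finite_subset by blast
        moreover have "\<psi> \<in> extensional A" if "\<psi> \<in> insert (conj_weight A \<chi> h) \<Xi>" for \<psi>
          using that by (auto simp: \<Xi>_def conj_weight_def)
        ultimately have "v \<notin> E"
          unfolding E\<Xi> using weight_space_Int_span[OF _ A.subset AU AW UW] by blast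
        then show "E \<noteq> W" using v(1) ws(3) by blast
      qed
      have "(derived G ^^ Suc (2 * m)) M \<subseteq> {g \<in> M. trivial_on U W g}" by (rule step[OF M(1) MP stE UE EW])
      moreover have "(derived G ^^ (2 * Suc m)) P = (derived G ^^ Suc (2 * m)) (derived G P)"
        by (simp add: funpow_swap1)
      moreover have "\<dots> \<subseteq> (derived G ^^ Suc (2 * m)) M" by (rule mono_exp_of_derived[OF M(4)])
      ultimately show ?thesis using MP by blast
    qed
  qed
qed

end

context linear_group begin

section \<open>Finite linear groups that retract onto Sylow subgroups\<close>

lemma subgroup_card_dvd:
  assumes "subgroup N G" "subgroup K G" "N \<subseteq> K"
  shows "card N dvd card K"
  using card_subgroup_cosets[OF assms] by (metis dvd_triv_right)

lemma stable_zero: "H \<subseteq> carrier G \<Longrightarrow> stable H {0}"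
  by (auto simp: stable_def act_zero subset_iff intro: subspaceI)

lemma p_group_derived_eq_one:
  assumes P: "subgroup P G" "card P = p ^ e" "prime (p::nat)"
    and W: "stable (carrier G) W" and B: "finite B" "W \<subseteq> span B" and dim: "dim W \<le> m"
    and faithful: "\<And>g. g \<in> carrier G \<Longrightarrow> trivial_on {0} W g \<Longrightarrow> g = \<one>"
  shows "(derived G ^^ (2 * m)) P \<subseteq> {\<one>}"
proof -
  interpret P: subgroup P G by fact
  have 0: "0 \<in> W" using stableD(2)[OF W] by (rule subspace_0)
  have "(derived G ^^ (2 * m)) P \<subseteq> {g \<in> P. trivial_on {0} W g}"
    by (rule p_group_derived_trivial[OF P stable_zero[OF P.subset] stable_mono[OF W P.subset] _ _ B]) (use dim 0 in simp_all)
  then show ?thesis using faithful P.subset by blast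
qed

text \<open>As \<open>t\<close> is not the characteristic, \<open>coprime_abelian_central\<close>
  makes a subgroup of \<open>T\<close> central in every subgroup of \<open>X\<close> in which it is
  abelian and normal. Inside \<open>T\<close> this forces \<open>T\<close> to be abelian; inside the
  normaliser of \<open>T\<close> in \<open>X\<close> it is the hypothesis of Burnside's transfer
  theorem.\<close>

lemma sylow_Int_derived:
  assumes X: "subgroup X G" "coprime (card X) (fact n)" and t: "prime t" "of_nat t \<noteq> (0::'k)"
    and T: "subgroup T G" "T \<subseteq> X" "card T = t ^ a" "card X = t ^ a * m" "\<not> t dvd m"
    and W: "stable (carrier G) W" and B: "finite B" "W \<subseteq> span B" and dim: "dim W \<le> n"
    and faithful: "\<And>g. g \<in> carrier G \<Longrightarrow> trivial_on {0} W g \<Longrightarrow> g = \<one>"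
  shows "T \<inter> derived G X \<subseteq> {\<one>}"
proof -
  interpret X: subgroup X G by fact
  interpret T: subgroup T G by fact
  have 0: "{0} \<subseteq> W" using stableD(2)[OF W] by (simp add: subspace_0)
  have central: "commutator a y = \<one>"
    if Y: "subgroup Y G" "Y \<subseteq> X" and A: "subgroup A G" "A \<subseteq> T" "A \<subseteq> Y" "normalized_by Y A"
      and ab: "\<And>a b. a \<in> A \<Longrightarrow> b \<in> A \<Longrightarrow> a \<otimes> b = b \<otimes> a" and ay: "a \<in> A" "y \<in> Y" for Y A a y
  proof -
    interpret Y: subgroup Y G by fact
    obtain j where j: "card A = t ^ j" using p_group_subgroup[OF T(1,3) t(1) A(1,2)] by blast
    have cY: "coprime (card Y) (fact n)"
      by (rule coprime_divisors[OF subgroup_card_dvd[OF Y(1) X(1) Y(2)] dvd_refl X(2)])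
    have cA: "of_nat (card A) \<noteq> (0::'k)" using j t(2) by simp
    have "trivial_on {0} W (commutator a y)"
      by (rule coprime_abelian_central[OF Y(1) cY A(1,3,4) ab cA stable_zero[OF Y.subset] stable_mono[OF W Y.subset] 0 _ B ay])
        (use dim in simp_all)
    moreover have "commutator a y \<in> carrier G" using ay A(3) by (simp add: subset_iff)
    ultimately show ?thesis by (simp add: faithful)
  qed
  have comm: "x \<otimes> y = y \<otimes> x" if xy: "x \<in> carrier G" "y \<in> carrier G" "commutator x y = \<one>" for x y
  proof -
    have "x \<otimes> y = (commutator x y) \<otimes> (y \<otimes> x)" using xy(1,2) by (simp add: m_assoc)
    then show ?thesis using xy by simp
  qed
  have triv: "subgroup {\<one>} G" by (rule triv_subgroup)
  have nt: "normalized_by H {\<one>}" if "H \<subseteq> carrier G" for H using that by (auto simp: normalized_by_def)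
  have T_ab: "x \<otimes> y = y \<otimes> x" if "x \<in> T" "y \<in> T" for x y
  proof (rule ccontr)
    assume ne: "x \<otimes> y \<noteq> y \<otimes> x"
    have nd: "\<not> derived_set G T \<subseteq> {\<one>}"
    proof
      assume "derived_set G T \<subseteq> {\<one>}"
      then have "commutator x y = \<one>" using that by blast
      then show False using comm[of x y] that ne by simp
    qed
    have 1: "{\<one>} \<subseteq> T" by simp
    obtain A b g where A: "subgroup A G" "A \<subseteq> T" "{\<one>} \<subseteq> A" "normalized_by T A" "derived_set G A \<subseteq> {\<one>}"
      and bg: "b \<in> A" "g \<in> T" "commutator b g \<notin> {\<one>}"
      by (rule p_group_abelian_mod_subgroup[OF T(1,3) t(1) triv nt[OF T.subset] 1 nd])
    have "u \<otimes> v = v \<otimes> u" if uv: "u \<in> A" "v \<in> A" for u v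
    proof -
      have "commutator u v = \<one>" using A(5) uv by blast
      then show ?thesis using comm[of u v] uv A(2) T.subset by blast
    qed
    then have "commutator b g = \<one>" by (rule central[OF T(1,2) A(1,2,2,4) _ bg(1,2)])
    then show False using bg(3) by simp
  qed
  have fX: "finite X" using X.subset finite_group finite_subset by blast
  let ?X = "G\<lparr>carrier := X\<rparr>"
  interpret GX: group ?X by (rule subgroup_imp_group[OF X(1)])
  have invX: "inv\<^bsub>?X\<^esub> g = inv g" if "g \<in> X" for g using m_inv_consistent[OF X(1) that] .
  have NC: "conj_by g s = s" if g: "g \<in> X" and st: "\<And>t. t \<in> T \<Longrightarrow> conj_by g t \<in> T" and s: "s \<in> T" for g s
  proof -
    define Y where "Y = {g \<in> X. \<forall>t\<in>T. conj_by g t \<in> T}"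
    have Y: "subgroup Y G"
    proof (rule subgroup_finiteI)
      show "Y \<subseteq> carrier G" "finite Y" using X.subset fX by (auto simp: Y_def)
      show "\<one> \<in> Y" by (simp add: Y_def)
    next
      fix x y assume xy: "x \<in> Y" "y \<in> Y"
      have "conj_by x (y \<otimes> t \<otimes> inv y) \<in> T" if "t \<in> T" for t using xy that by (simp add: Y_def)
      moreover have "conj_by (x \<otimes> y) t = conj_by x (y \<otimes> t \<otimes> inv y)" if "t \<in> T" for t
        using xy that by (simp add: Y_def m_assoc inv_mult_group)
      ultimately show "x \<otimes> y \<in> Y" using xy by (simp add: Y_def)
    qed
    have YX: "Y \<subseteq> X" by (auto simp: Y_def)
    have TY: "T \<subseteq> Y" using T(2) by (auto simp: Y_def)
    have nb: "normalized_by Y T" by (simp add: normalized_by_def Y_def)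
    have "commutator s g = \<one>"
      by (rule central[OF Y YX T(1) order_refl TY nb T_ab s]) (use g st in \<open>simp_all add: Y_def\<close>)
    then have "s \<otimes> g = g \<otimes> s" using comm[of s g] g s by simp
    then have "conj_by g s = s \<otimes> g \<otimes> inv g" by simp
    also have "\<dots> = s" using g s by (simp add: m_assoc)
    finally show ?thesis .
  qed
  have TX: "subgroup T ?X" using T(1,2) X(1) by (simp add: subgroup_incl)
  have "T \<inter> derived ?X (carrier ?X) \<subseteq> {\<one>\<^bsub>?X\<^esub>}"
  proof (rule GX.burnside_transfer[OF _ t(1) TX T(3) _ T(5)])
    show "g \<otimes>\<^bsub>?X\<^esub> s \<otimes>\<^bsub>?X\<^esub> inv\<^bsub>?X\<^esub> g = s"
      if g: "g \<in> carrier ?X" and st: "\<And>t. t \<in> T \<Longrightarrow> g \<otimes>\<^bsub>?X\<^esub> t \<otimes>\<^bsub>?X\<^esub> inv\<^bsub>?X\<^esub> g \<in> T" and s: "s \<in> T" for g s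
    proof -
      have "g \<in> X" using g by simp
      then show ?thesis using NC[of g s] st s by (simp add: invX)
    qed
  qed (use fX T(4) T_ab in simp_all)
  then show ?thesis by (simp add: derived_consistent[OF order_refl X(1)])
qed

text \<open>The term \<open>2n\<close> of the derived series lies in the common kernel of the retractions, the next one in a
  \<open>p\<close>-group for the characteristic \<open>p\<close>, and the latter has derived length at most \<open>2n\<close>.\<close>

lemma finite_linear_solvable:
  assumes W: "stable (carrier G) W" and B: "finite B" "W \<subseteq> span B" and dim: "dim W \<le> n"
    and faithful: "\<And>g. g \<in> carrier G \<Longrightarrow> trivial_on {0} W g \<Longrightarrow> g = \<one>"
    and ret: "\<And>l. prime l \<Longrightarrow> l \<le> n \<Longrightarrow> \<exists>r a. r \<in> hom G G \<and> card (r ` carrier G) = l ^ a \<and>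
      \<not> l dvd card {x \<in> carrier G. r x = \<one>}"
  shows "(derived G ^^ (4 * n + 1)) (carrier G) = {\<one>}"
proof -
  define L where "L = {l. prime l \<and> l \<le> n}"
  have "\<forall>l\<in>L. \<exists>r. r \<in> hom G G \<and> (\<exists>a. card (r ` carrier G) = l ^ a) \<and> \<not> l dvd card {x \<in> carrier G. r x = \<one>}"
    using ret unfolding L_def by blast
  then obtain r where r: "\<forall>l\<in>L. r l \<in> hom G G \<and> (\<exists>a. card (r l ` carrier G) = l ^ a) \<and> \<not> l dvd card {x \<in> carrier G. r l x = \<one>}"
    by (rule exE[OF bchoice])
  define K where "K l = {x \<in> carrier G. r l x = \<one>}" for l
  define X where "X = {x \<in> carrier G. \<forall>l\<in>L. r l x = \<one>}"
  have gh: "group_hom G G (r l)" if "l \<in> L" for l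
    using r that by unfold_locales blast
  have X: "subgroup X G"
  proof (rule subgroup_finiteI)
    show "X \<subseteq> carrier G" "finite X" using finite_group by (auto simp: X_def)
    show "\<one> \<in> X" using group_hom.hom_one[OF gh] by (simp add: X_def)
  next
    fix x y assume xy: "x \<in> X" "y \<in> X"
    have "r l (x \<otimes> y) = \<one>" if l: "l \<in> L" for l
      using group_hom.hom_mult[OF gh[OF l], of x y] xy l by (simp add: X_def)
    then show "x \<otimes> y \<in> X" using xy by (simp add: X_def)
  qed
  interpret X: subgroup X G by fact
  have fX: "finite X" by (rule finite_subset[OF X.subset finite_group])
  have cX: "coprime (card X) (fact n)"
  proof (rule ccontr)
    assume "\<not> coprime (card X) (fact n)"
    then obtain d where d: "d dvd card X" "d dvd fact n" "d \<noteq> 1" by (rule not_coprimeE) simp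
    \<comment> \<open>A prime \<open>l \<le> n\<close> dividing the order of \<open>X\<close> would
      divide the order of the kernel of the retraction \<open>r l\<close>, which contains
      \<open>X\<close>.\<close>
    obtain l where "prime l" "l dvd d" using prime_factor_nat[OF d(3)] by blast
    then have l: "prime l" "l dvd card X" "l dvd fact n" using d(1,2) dvd_trans by blast+
    then have lL: "l \<in> L" by (simp add: L_def prime_dvd_fact_iff)
    have K: "subgroup (K l) G"
      using group_hom.subgroup_kernel[OF gh[OF lL]] by (simp add: K_def kernel_def)
    have "X \<subseteq> K l" unfolding X_def K_def using lL by blast
    then have "card X dvd card (K l)" by (rule subgroup_card_dvd[OF X K])
    then have "l dvd card (K l)" using l(2) dvd_trans by blast
    then show False using bspec[OF r lL] by (simp add: K_def)
  qed
  have D1: "(derived G ^^ (2 * n)) (carrier G) \<subseteq> X"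
  proof
    fix x assume x: "x \<in> (derived G ^^ (2 * n)) (carrier G)"
    have xc: "x \<in> carrier G" using x exp_of_derived_in_carrier[OF order_refl] by blast
    have "r l x = \<one>" if l: "l \<in> L" for l
    proof -
      obtain a where a: "card (r l ` carrier G) = l ^ a" using bspec[OF r l] by blast
      have "(derived G ^^ (2 * n)) (r l ` carrier G) \<subseteq> {\<one>}"
        by (rule p_group_derived_eq_one[OF group_hom.img_is_subgroup[OF gh[OF l]] a _ W B dim faithful])
          (use l in \<open>simp_all add: L_def\<close>)
      then show ?thesis using group_hom.exp_of_derived_img[OF gh[OF l] order_refl] x by blast
    qed
    then show "x \<in> X" unfolding X_def using xc by blast
  qed
  define D where "D = derived G X"
  have D: "subgroup D G" unfolding D_def by (rule derived_is_subgroup[OF X.subset])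
  have DX: "D \<subseteq> X" unfolding D_def by (rule derived_incl[OF order_refl X])
  have fD: "finite D" using DX fX finite_subset by blast
  \<comment> \<open>A Sylow subgroup \<open>S\<close> of \<open>D\<close> for \<open>t\<close> is
    conjugate under \<open>X\<close> into a Sylow subgroup \<open>T\<close> of \<open>X\<close>. The
    conjugate stays in \<open>D\<close>, and \<open>T\<close> meets \<open>D\<close> trivially
    unless \<open>t\<close> vanishes in the field.\<close>
  have char: "of_nat t = (0::'k)" if t: "prime t" "t dvd card D" for t
  proof (rule ccontr)
    assume t0: "of_nat t \<noteq> (0::'k)"
    obtain T a m where T: "subgroup T G" "T \<subseteq> X" "card T = t ^ a" "card X = t ^ a * m" "\<not> t dvd m"
      by (rule sylow_in_subgroup[OF X fX t(1)])
    obtain S b k where S: "subgroup S G" "S \<subseteq> D" "card S = t ^ b" "card D = t ^ b * k" "\<not> t dvd k"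
      by (rule sylow_in_subgroup[OF D fD t(1)])
    have SX: "S \<subseteq> X" using S(2) DX by blast
    obtain g where g: "g \<in> X" "\<forall>s\<in>S. inv g \<otimes> s \<otimes> g \<in> T"
      by (rule sylow_conjugate[OF X fX t(1) T S(1) SX S(3)]) blast
    have TD: "T \<inter> D \<subseteq> {\<one>}"
      unfolding D_def by (rule sylow_Int_derived[OF X cX t(1) t0 T W B dim faithful])
    have "S \<subseteq> {\<one>}"
    proof
      fix s assume s: "s \<in> S"
      have sc: "s \<in> carrier G" "g \<in> carrier G" using s SX g by auto
      \<comment> \<open>The inner factors cancel: this is
        \<open>inv g \<otimes> s \<otimes> g\<close>, a commutator of elements of \<open>X\<close>
        times \<open>s\<close>.\<close>
      have "inv g \<otimes> s \<otimes> inv g \<otimes> inv (inv g) \<otimes> inv (inv g) \<in> D"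
      proof -
        have sD: "s \<in> D" "s \<in> X" "inv g \<in> X" using s S(2) SX g(1) by auto
        have "inv g \<otimes> s \<otimes> inv (inv g) \<otimes> inv s \<in> D"
          unfolding D_def derived_def by (rule generate.incl) (use sD in blast)
        then have "inv g \<otimes> s \<otimes> inv (inv g) \<otimes> inv s \<otimes> s \<in> D" using sD(1) by (rule subgroup.m_closed[OF D])
        then show ?thesis using sc by (simp add: m_assoc)
      qed
      then have "inv g \<otimes> s \<otimes> g \<in> D" using sc by (simp add: m_assoc)
      then have "inv g \<otimes> s \<otimes> g = \<one>" using TD bspec[OF g(2) s] by blast
      then have "conj_by g (inv g \<otimes> s \<otimes> g) = \<one>" using sc by simp
      then show "s \<in> {\<one>}" using sc by (simp add: m_assoc [symmetric]) (simp add: m_assoc)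
    qed
    then have "card S \<le> 1" using card_mono[of "{\<one>}" S] by simp
    then have "b = 0" using S(3) prime_gt_1_nat[OF t(1)] by (metis not_less one_less_power gr0I)
    then show False using S(4,5) t(2) by simp
  qed
  obtain p e where pe: "prime p" "card D = p ^ e"
  proof (cases "\<exists>p. prime p \<and> p dvd card D")
    case True
    then obtain p where p: "prime p" "p dvd card D" by blast
    have "card D \<noteq> 0" using fD subgroup.one_closed[OF D] by auto
    then obtain m where m: "card D = p ^ multiplicity p (card D) * m" "\<not> p dvd m"
      using multiplicity_decompose'[of "card D" p] p(1) by (metis not_prime_unit)
    have "m = 1"
    proof (rule ccontr)
      assume "m \<noteq> 1"
      then obtain q where q: "prime q" "q dvd m" using prime_factor_nat by blast
      then have qD: "q dvd card D" using m(1) by (metis dvd_mult)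
      have "q \<noteq> p" using q(2) m(2) by blast
      then have "coprime q p" using q(1) p(1) primes_coprime by blast
      moreover have "CHAR('k) dvd q" "CHAR('k) dvd p"
        using char[OF q(1) qD] char[OF p] by (simp_all add: of_nat_eq_0_iff_char_dvd)
      ultimately have "CHAR('k) = 1" by (metis coprime_common_divisor nat_dvd_1_iff_1)
      then show False by (simp add: CHAR_not_1)
    qed
    then show thesis using that[OF p(1)] m(1) by simp
  next
    case False
    then have "card D = 1" using prime_factor_nat by blast
    \<comment> \<open>The trivial group has order \<open>p ^ 0\<close> for any prime, and 2 is an
      arbitrary choice.\<close>
    then show thesis using that[of 2 0] by simp
  qed
  have "(derived G ^^ (2 * n)) D \<subseteq> {\<one>}"
    by (rule p_group_derived_eq_one[OF D pe(2,1) W B dim faithful])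
  moreover have "derived G ((derived G ^^ (2 * n)) (carrier G)) \<subseteq> D"
    unfolding D_def by (rule mono_derived[OF D1])
  moreover have "4 * n + 1 = 2 * n + Suc (2 * n)" by simp
  then have "(derived G ^^ (4 * n + 1)) (carrier G) = (derived G ^^ (2 * n)) (derived G ((derived G ^^ (2 * n)) (carrier G)))"
    by (simp only: funpow_add) simp
  ultimately have "(derived G ^^ (4 * n + 1)) (carrier G) \<subseteq> {\<one>}"
    using mono_exp_of_derived[of _ D "2 * n"] by blast
  moreover have "\<one> \<in> (derived G ^^ (4 * n + 1)) (carrier G)"
    by (rule subgroup.one_closed[OF exp_of_derived_is_subgroup[OF subgroup_self]])
  ultimately show ?thesis by blast
qed

end

subsection \<open>Specialisation of finitely generated domains\<close>

text \<open>Subrings are subsets of a type: integers, sums and polynomials are those of the type,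
  and a tower of rings involves no change of type.\<close>

definition subring_set :: "'a::comm_ring_1 set \<Rightarrow> bool"
  where "subring_set A \<longleftrightarrow> 1 \<in> A \<and> (\<forall>x\<in>A. \<forall>y\<in>A. x - y \<in> A \<and> x * y \<in> A)"

lemma subring_setD:
  assumes "subring_set A"
  shows "1 \<in> A" "0 \<in> A" "x \<in> A \<Longrightarrow> y \<in> A \<Longrightarrow> x + y \<in> A" "x \<in> A \<Longrightarrow> y \<in> A \<Longrightarrow> x - y \<in> A"
    "x \<in> A \<Longrightarrow> y \<in> A \<Longrightarrow> x * y \<in> A" "x \<in> A \<Longrightarrow> - x \<in> A" "x \<in> A \<Longrightarrow> x ^ n \<in> A"
proof -
  have d: "x - y \<in> A" "x * y \<in> A" if "x \<in> A" "y \<in> A" for x y using assms that by (auto simp: subring_set_def)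
  show 1: "1 \<in> A" using assms by (simp add: subring_set_def)
  show 0: "0 \<in> A" using d(1)[OF 1 1] by simp
  show m: "- x \<in> A" if "x \<in> A" for x using d(1)[OF 0 that] by simp
  show "x + y \<in> A" if "x \<in> A" "y \<in> A" using d(1)[OF that(1) m[OF that(2)]] by simp
  show "x - y \<in> A" "x * y \<in> A" if "x \<in> A" "y \<in> A" using d[OF that] .
  show "x ^ n \<in> A" if "x \<in> A" by (induction n) (simp_all add: 1 d(2)[OF that])
qed

lemma subring_set_sum:
  assumes "subring_set A" "\<And>i. i \<in> I \<Longrightarrow> f i \<in> A"
  shows "(\<Sum>i\<in>I. f i) \<in> A"
  using assms(2) by (induction I rule: infinite_finite_induct) (simp_all add: subring_setD[OF assms(1)])

section \<open>Polynomials over a subring and pseudo-division\<close>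

definition polys_over :: "'a::comm_ring_1 set \<Rightarrow> 'a poly set"
  where "polys_over A = {p. \<forall>i. coeff p i \<in> A}"

lemma polys_over_closed:
  assumes A: "subring_set A"
  shows "subring_set (polys_over A)" "c \<in> A \<Longrightarrow> p \<in> polys_over A \<Longrightarrow> smult c p \<in> polys_over A"
    "c \<in> A \<Longrightarrow> monom c n \<in> polys_over A"
proof -
  show "subring_set (polys_over A)"
    unfolding subring_set_def polys_over_def
    by (auto simp: coeff_mult coeff_1 subring_setD[OF A] intro!: subring_set_sum[OF A])
qed (auto simp: polys_over_def subring_setD[OF A] coeff_monom)

definition adjoin :: "'a::comm_ring_1 set \<Rightarrow> 'a \<Rightarrow> 'a set"
  where "adjoin A x = (\<lambda>p. poly p x) ` polys_over A"

lemma adjoin_subring: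
  assumes A: "subring_set A"
  shows "subring_set (adjoin A x)" "A \<subseteq> adjoin A x" "x \<in> adjoin A x"
proof -
  note P = subring_setD[OF polys_over_closed(1)[OF A]]
  show "subring_set (adjoin A x)"
    unfolding subring_set_def adjoin_def
  proof (intro conjI ballI)
    show "1 \<in> (\<lambda>p. poly p x) ` polys_over A" using P(1) by (intro image_eqI[of _ _ 1]) simp_all
  next
    fix a b assume "a \<in> (\<lambda>p. poly p x) ` polys_over A" "b \<in> (\<lambda>p. poly p x) ` polys_over A"
    then obtain p q where "p \<in> polys_over A" "a = poly p x" "q \<in> polys_over A" "b = poly q x" by blast
    then show "a - b \<in> (\<lambda>p. poly p x) ` polys_over A" "a * b \<in> (\<lambda>p. poly p x) ` polys_over A"
      using P(4)[of p q] P(5)[of p q] by (metis image_eqI poly_diff, metis image_eqI poly_mult)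
  qed
  show "A \<subseteq> adjoin A x"
  proof
    fix a assume "a \<in> A"
    then have "monom a 0 \<in> polys_over A" by (rule polys_over_closed(3)[OF A])
    then show "a \<in> adjoin A x" unfolding adjoin_def by (rule image_eqI[rotated]) (simp add: poly_monom)
  qed
  have "monom 1 1 \<in> polys_over A" by (rule polys_over_closed(3)[OF A subring_setD(1)[OF A]])
  then show "x \<in> adjoin A x" unfolding adjoin_def by (rule image_eqI[rotated]) (simp add: poly_monom)
qed

text \<open>The leading coefficient of \<open>g\<close> need not be a unit of \<open>A\<close>;
  multiplying by a power of it first keeps quotient and remainder over \<open>A\<close>.\<close>

lemma pseudo_division_over:
  fixes p :: "'a::idom poly"
  assumes A: "subring_set A" and p: "p \<in> polys_over A" and g: "g \<in> polys_over A" "g \<noteq> 0"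
  obtains k t r where "t \<in> polys_over A" "r \<in> polys_over A" "smult (lead_coeff g ^ k) p = g * t + r" "r = 0 \<or> degree r < degree g"
proof -
  note P = subring_setD[OF polys_over_closed(1)[OF A]]
  have lA: "coeff h i \<in> A" if "h \<in> polys_over A" for h i using that by (simp add: polys_over_def)
  have "\<exists>k t r. t \<in> polys_over A \<and> r \<in> polys_over A \<and> smult (lead_coeff g ^ k) p = g * t + r \<and> (r = 0 \<or> degree r < degree g)"
    using p
  \<comment> \<open>The measure places the zero polynomial strictly below the non-zero constants,
    which also have degree 0.\<close>
  proof (induction "if p = 0 then 0 else Suc (degree p)" arbitrary: p rule: less_induct)
    case less
    show ?case
    proof (cases "p = 0 \<or> degree p < degree g")
      case True
      have "smult (lead_coeff g ^ 0) p = g * 0 + p" by simp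
      then show ?thesis using True less.prems P(2) by blast
    next
      case False
      define m where "m = monom (lead_coeff p) (degree p - degree g)"
      have mA: "m \<in> polys_over A" unfolding m_def by (rule polys_over_closed(3)[OF A lA[OF less.prems]])
      define p' where "p' = smult (lead_coeff g) p - g * m"
      have p'A: "p' \<in> polys_over A"
        unfolding p'_def by (rule P(4)[OF polys_over_closed(2)[OF A lA[OF g(1)] less.prems] P(5)[OF g(1) mA]])
      have lp: "lead_coeff p \<noteq> 0" "lead_coeff g \<noteq> 0" using False g(2) by auto
      have m0: "m \<noteq> 0" using lp by (simp add: m_def)
      have dm: "degree m = degree p - degree g" using lp by (simp add: m_def degree_monom_eq)
      have dgm: "degree (g * m) = degree p" using degree_mult_eq[OF g(2) m0] dm False by simp
      have "degree p' \<le> degree p" unfolding p'_def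
        by (rule degree_diff_le) (use dgm in \<open>simp_all\<close>)
      moreover have "coeff p' (degree p) = 0"
      proof -
        have "coeff (g * m) (degree p) = lead_coeff g * lead_coeff m" using lead_coeff_mult[of g m] dgm by simp
        moreover have "lead_coeff m = lead_coeff p" unfolding dm by (simp add: m_def)
        ultimately show ?thesis by (simp add: p'_def)
      qed
      ultimately have "degree p' < degree p" if "p' \<noteq> 0"
        using that by (metis leading_coeff_0_iff order_le_imp_less_or_eq)
      then have "(if p' = 0 then 0 else Suc (degree p')) < (if p = 0 then 0 else Suc (degree p))"
        using lp(1) by auto
      from less.hyps[OF this p'A] obtain k t r where ih: "t \<in> polys_over A" "r \<in> polys_over A"
        "smult (lead_coeff g ^ k) p' = g * t + r" "r = 0 \<or> degree r < degree g" by blast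
      have "smult (lead_coeff g ^ k) p' = smult (lead_coeff g ^ Suc k) p - g * smult (lead_coeff g ^ k) m"
        by (simp add: p'_def smult_diff_right mult.commute)
      then have "smult (lead_coeff g ^ Suc k) p = g * (t + smult (lead_coeff g ^ k) m) + r"
        using ih(3) by (simp add: algebra_simps)
      moreover have "t + smult (lead_coeff g ^ k) m \<in> polys_over A"
        by (rule P(3)[OF ih(1) polys_over_closed(2)[OF A subring_setD(7)[OF A lA[OF g(1)]] mA]])
      ultimately show ?thesis using ih(2,4) by blast
    qed
  qed
  then show thesis using that by blast
qed

text \<open>The conditions concern \<open>A\<close> only; the values outside are arbitrary.\<close>

definition ring_map :: "'a::comm_ring_1 set \<Rightarrow> ('a \<Rightarrow> 'b::comm_ring_1) \<Rightarrow> bool"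
  where "ring_map A \<phi> \<longleftrightarrow> \<phi> 1 = 1 \<and> (\<forall>x\<in>A. \<forall>y\<in>A. \<phi> (x + y) = \<phi> x + \<phi> y \<and> \<phi> (x * y) = \<phi> x * \<phi> y)"

lemma ring_mapD:
  assumes "ring_map A \<phi>"
  shows "\<phi> 1 = 1" "x \<in> A \<Longrightarrow> y \<in> A \<Longrightarrow> \<phi> (x + y) = \<phi> x + \<phi> y" "x \<in> A \<Longrightarrow> y \<in> A \<Longrightarrow> \<phi> (x * y) = \<phi> x * \<phi> y"
  using assms by (auto simp: ring_map_def)

lemma ring_map_closed:
  assumes \<phi>: "ring_map A \<phi>" and A: "subring_set A"
  shows "\<phi> 0 = 0" "x \<in> A \<Longrightarrow> y \<in> A \<Longrightarrow> \<phi> (x - y) = \<phi> x - \<phi> y" "x \<in> A \<Longrightarrow> \<phi> (x ^ n) = \<phi> x ^ n"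
    "(\<And>i. i \<in> I \<Longrightarrow> f i \<in> A) \<Longrightarrow> \<phi> (\<Sum>i\<in>I. f i) = (\<Sum>i\<in>I. \<phi> (f i))"
proof -
  note m = ring_mapD[OF \<phi>] and a = subring_setD[OF A]
  have "\<phi> (0 + 0) = \<phi> 0 + \<phi> 0" by (rule m(2)[OF a(2,2)])
  then show 0: "\<phi> 0 = 0" by simp
  show "\<phi> (x - y) = \<phi> x - \<phi> y" if "x \<in> A" "y \<in> A"
    using m(2)[OF a(4)[OF that] that(2)] by (simp add: algebra_simps)
  show "\<phi> (x ^ n) = \<phi> x ^ n" if x: "x \<in> A"
    by (induction n) (simp_all add: m(1) m(3)[OF x a(7)[OF x]])
  show "\<phi> (\<Sum>i\<in>I. f i) = (\<Sum>i\<in>I. \<phi> (f i))" if "\<And>i. i \<in> I \<Longrightarrow> f i \<in> A"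
    using that
  proof (induction I rule: infinite_finite_induct)
    case (insert i I)
    have "\<phi> (f i + sum f I) = \<phi> (f i) + \<phi> (sum f I)" by (rule m(2)) (use insert subring_set_sum[OF A, of I f] in auto)
    then show ?case using insert by simp
  qed (simp_all add: 0)
qed

lemma map_poly_ring_map:
  assumes \<phi>: "ring_map A \<phi>" and A: "subring_set A" and p: "p \<in> polys_over A" and q: "q \<in> polys_over A"
  shows "map_poly \<phi> (p + q) = map_poly \<phi> p + map_poly \<phi> q" "map_poly \<phi> (p - q) = map_poly \<phi> p - map_poly \<phi> q"
    "map_poly \<phi> (p * q) = map_poly \<phi> p * map_poly \<phi> q" "c \<in> A \<Longrightarrow> map_poly \<phi> (smult c p) = smult (\<phi> c) (map_poly \<phi> p)"
proof -
  note m = ring_mapD[OF \<phi>] ring_map_closed[OF \<phi> A]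
  have c: "coeff p i \<in> A" "coeff q i \<in> A" for i using p q by (auto simp: polys_over_def)
  show "map_poly \<phi> (p + q) = map_poly \<phi> p + map_poly \<phi> q" "map_poly \<phi> (p - q) = map_poly \<phi> p - map_poly \<phi> q"
    by (simp_all add: poly_eq_iff coeff_map_poly m c)
  show "map_poly \<phi> (p * q) = map_poly \<phi> p * map_poly \<phi> q"
  proof (rule poly_eqI)
    fix n
    have "\<phi> (\<Sum>i\<le>n. coeff p i * coeff q (n - i)) = (\<Sum>i\<le>n. \<phi> (coeff p i * coeff q (n - i)))"
      by (rule m(7)) (simp add: subring_setD[OF A] c)
    then show "coeff (map_poly \<phi> (p * q)) n = coeff (map_poly \<phi> p * map_poly \<phi> q) n"
      by (simp add: coeff_map_poly coeff_mult m c)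
  qed
  show "map_poly \<phi> (smult c p) = smult (\<phi> c) (map_poly \<phi> p)" if "c \<in> A"
    using that by (simp add: poly_eq_iff coeff_map_poly m c)
qed

section \<open>Extending ring homomorphisms by one generator\<close>

definition transcendental_over :: "'a::comm_ring_1 set \<Rightarrow> 'a \<Rightarrow> bool"
  where "transcendental_over A x \<longleftrightarrow> (\<forall>p\<in>polys_over A. poly p x = 0 \<longrightarrow> p = 0)"

text \<open>A substitute for the minimal polynomial over the field of fractions: the coefficients
  are in \<open>A\<close>, and it need not be monic.\<close>

definition minimal_relation :: "'a::comm_ring_1 set \<Rightarrow> 'a \<Rightarrow> 'a poly \<Rightarrow> bool"
  where "minimal_relation A x p \<longleftrightarrow> p \<in> polys_over A \<and> p \<noteq> 0 \<and> poly p x = 0 \<and>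
    (\<forall>q\<in>polys_over A. q \<noteq> 0 \<longrightarrow> poly q x = 0 \<longrightarrow> degree p \<le> degree q)"

text \<open>Chevalley's condition: a ring homomorphism from \<open>A\<close> to an algebraically closed field not killing \<open>a\<close>
  extends to one from \<open>A[x]\<close> not killing \<open>b\<close>.\<close>

definition specialisation :: "'a::comm_ring_1 set \<Rightarrow> 'a \<Rightarrow> 'a \<Rightarrow> 'a \<Rightarrow> bool"
  where "specialisation A x b a \<longleftrightarrow>
    transcendental_over A x \<and> (\<exists>q\<in>polys_over A. b = poly q x \<and> (\<exists>i. a = coeff q i)) \<or>
    (\<exists>p q c. minimal_relation A x p \<and> q \<in> polys_over A \<and> c \<in> A \<and> b * poly q x = c \<and> a = lead_coeff p * c)"

text \<open>The pseudo-remainder of \<open>q\<close> is a relation of degree below that of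
  \<open>p\<close>, so it vanishes.\<close>

lemma minimal_relation_dvd:
  fixes x :: "'a::idom"
  assumes A: "subring_set A" and p: "minimal_relation A x p" and q: "q \<in> polys_over A" "poly q x = 0"
  shows "\<exists>k. \<exists>t\<in>polys_over A. smult (lead_coeff p ^ k) q = p * t"
proof -
  have pA: "p \<in> polys_over A" "p \<noteq> 0" "poly p x = 0" using p by (auto simp: minimal_relation_def)
  obtain k t r where d: "t \<in> polys_over A" "r \<in> polys_over A" "smult (lead_coeff p ^ k) q = p * t + r" "r = 0 \<or> degree r < degree p"
    by (rule pseudo_division_over[OF A q(1) pA(1,2)])
  have "poly (smult (lead_coeff p ^ k) q) x = poly (p * t + r) x" using d(3) by (rule arg_cong)
  then have "poly r x = 0" using q(2) pA(3) by simp
  then have "r = 0" using p d(2,4) unfolding minimal_relation_def by (meson not_le)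
  then show ?thesis using d by auto
qed

text \<open>In the transcendental case the leading coefficient of a polynomial for \<open>b\<close>
  serves. In the algebraic case some multiple of \<open>b\<close> in \<open>A[x]\<close> is a
  non-zero \<open>c\<close> in \<open>A\<close>; a homomorphism that does not kill \<open>c\<close>
  cannot kill \<open>b\<close>, and if \<open>lead_coeff p\<close> survives as well, the relation
  \<open>p\<close> keeps its degree and pseudo-division by it can be undone.\<close>

lemma specialisation_exists:
  fixes x :: "'a::idom"
  assumes A: "subring_set A" and b: "b \<in> adjoin A x" "b \<noteq> 0"
  shows "\<exists>a\<in>A. a \<noteq> 0 \<and> specialisation A x b a"
proof -
  note P = subring_setD[OF polys_over_closed(1)[OF A]]
  obtain B where B: "B \<in> polys_over A" "b = poly B x" using b(1) by (auto simp: adjoin_def)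
  show ?thesis
  proof (cases "transcendental_over A x")
    case True
    have "B \<noteq> 0" using B b(2) by auto
    then have "lead_coeff B \<noteq> 0" "lead_coeff B \<in> A" using B(1) by (auto simp: polys_over_def)
    then show ?thesis using True B unfolding specialisation_def by blast
  next
    case False
    define I where "I q \<longleftrightarrow> q \<in> polys_over A \<and> q \<noteq> 0 \<and> poly q x = 0" for q
    obtain p where p: "I p" "\<And>q. I q \<Longrightarrow> degree p \<le> degree q"
      using False ex_has_least_nat[of I _ degree] unfolding transcendental_over_def I_def by blast
    then have mp: "minimal_relation A x p" by (auto simp: minimal_relation_def I_def)
    have pA: "p \<in> polys_over A" "p \<noteq> 0" "poly p x = 0" using p(1) by (auto simp: I_def)
    \<comment> \<open>\<open>J w\<close> holds if \<open>w\<close> takes at \<open>x\<close> a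
      non-zero value that is a multiple of \<open>b\<close>. A candidate \<open>w\<close> of least
      degree is shown to be constant: the remainder of \<open>p\<close> modulo \<open>w\<close> is
      either a smaller candidate or a relation of \<open>x\<close> of degree below that of
      \<open>p\<close>, hence 0. In the latter case \<open>w\<close> divides a multiple of
      \<open>p\<close>, and the cofactor is a relation of too small a degree.\<close>
    define J where "J w \<longleftrightarrow> w \<in> polys_over A \<and> poly w x \<noteq> 0 \<and> (\<exists>q\<in>polys_over A. b * poly q x = poly w x)" for w
    have "J B" unfolding J_def using B b(2) P(1) by (auto intro!: bexI[of _ 1])
    then obtain w where w: "J w" "\<And>v. J v \<Longrightarrow> degree w \<le> degree v"
      using ex_has_least_nat[of J B degree] by blast
    then obtain q where q: "q \<in> polys_over A" "b * poly q x = poly w x" and wA: "w \<in> polys_over A" "poly w x \<noteq> 0"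
      by (auto simp: J_def)
    have w0: "w \<noteq> 0" using wA by auto
    obtain k t r where d: "t \<in> polys_over A" "r \<in> polys_over A" "smult (lead_coeff w ^ k) p = w * t + r" "r = 0 \<or> degree r < degree w"
      by (rule pseudo_division_over[OF A pA(1) wA(1) w0])
    have "poly (smult (lead_coeff w ^ k) p) x = poly (w * t + r) x" using d(3) by (rule arg_cong)
    then have rx: "poly r x = - (poly w x * poly t x)" using pA(3) by (simp add: eq_neg_iff_add_eq_0 add.commute)
    have dw: "degree w = 0"
    proof (rule ccontr)
      assume dw: "degree w \<noteq> 0"
      have "poly r x = 0"
      proof (rule ccontr)
        assume r: "poly r x \<noteq> 0"
        have "b * poly (- (q * t)) x = poly r x" using q(2) rx by (simp add: mult.assoc [symmetric])
        then have "J r" unfolding J_def using r d(2) P(6)[OF P(5)[OF q(1) d(1)]] by blast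
        then have "degree w \<le> degree r" by (rule w(2))
        then show False using d(4) r by auto
      qed
      then have tx: "poly t x = 0" using rx wA(2) by simp
      have "degree w < degree p"
      proof (rule ccontr)
        assume le: "\<not> degree w < degree p"
        obtain k' t' r' where d': "t' \<in> polys_over A" "r' \<in> polys_over A" "smult (lead_coeff p ^ k') w = p * t' + r'"
          "r' = 0 \<or> degree r' < degree p"
          by (rule pseudo_division_over[OF A wA(1) pA(1,2)])
        have "poly (smult (lead_coeff p ^ k') w) x = poly (p * t' + r') x" using d'(3) by (rule arg_cong)
        then have r'x: "poly r' x = lead_coeff p ^ k' * poly w x" using pA(3) by simp
        have lp: "lead_coeff p \<noteq> 0" "lead_coeff p \<in> A" using pA by (auto simp: polys_over_def)
        have r'0: "poly r' x \<noteq> 0" using r'x lp(1) wA(2) by simp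
        have qA: "smult (lead_coeff p ^ k') q \<in> polys_over A"
          by (rule polys_over_closed(2)[OF A subring_setD(7)[OF A lp(2)] q(1)])
        have "b * poly (smult (lead_coeff p ^ k') q) x = poly r' x" using q(2) r'x by (simp add: ac_simps)
        then have "J r'" unfolding J_def using r'0 d'(2) qA by blast
        then have "degree w \<le> degree r'" by (rule w(2))
        then show False using d'(4) r'0 le by auto
      qed
      moreover have "r = 0 \<or> degree p \<le> degree r" using p(2)[of r] d(2) \<open>poly r x = 0\<close> by (auto simp: I_def)
      ultimately have "r = 0" using d(4) by auto
      then have e: "smult (lead_coeff w ^ k) p = w * t" using d(3) by simp
      have t0: "t \<noteq> 0" using e w0 pA(2) by auto
      then have "degree p \<le> degree t" using p(2)[of t] d(1) tx by (auto simp: I_def)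
      moreover have "degree p = degree w + degree t"
        using arg_cong[OF e, of degree] degree_mult_eq[OF w0 t0] w0 by simp
      ultimately show False using dw by simp
    qed
    then obtain c where c: "w = [:c:]" by (metis degree_eq_zeroE)
    have "coeff w 0 \<in> A" using wA(1) by (simp add: polys_over_def)
    then have "c \<in> A" "c \<noteq> 0" using wA(2) c by simp_all
    moreover have "lead_coeff p \<in> A" "lead_coeff p \<noteq> 0" using pA by (auto simp: polys_over_def)
    moreover have "b * poly q x = c" using q(2) c by simp
    ultimately have "specialisation A x b (lead_coeff p * c)" "lead_coeff p * c \<in> A" "lead_coeff p * c \<noteq> 0"
      unfolding specialisation_def using mp q(1) subring_setD(5)[OF A] by (blast, blast, simp)
    then show ?thesis by blast
  qed
qed

text \<open>Substitution of \<open>\<omega>\<close> for \<open>x\<close>, well defined because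
  relations of \<open>x\<close> become relations of \<open>\<omega>\<close>.\<close>

lemma ring_map_adjoin:
  assumes A: "subring_set A" and \<phi>: "ring_map A \<phi>" and z: "\<And>q. q \<in> polys_over A \<Longrightarrow> poly q x = 0 \<Longrightarrow> poly (map_poly \<phi> q) \<omega> = 0"
  obtains \<psi> :: "'a::comm_ring_1 \<Rightarrow> 'b::comm_ring_1" where "ring_map (adjoin A x) \<psi>" "\<And>q. q \<in> polys_over A \<Longrightarrow> \<psi> (poly q x) = poly (map_poly \<phi> q) \<omega>"
proof -
  note P = subring_setD[OF polys_over_closed(1)[OF A]]
  define \<psi> where "\<psi> y = poly (map_poly \<phi> (SOME q. q \<in> polys_over A \<and> poly q x = y)) \<omega>" for y
  have \<psi>: "\<psi> (poly q x) = poly (map_poly \<phi> q) \<omega>" if q: "q \<in> polys_over A" for q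
  proof -
    define q' where "q' = (SOME r. r \<in> polys_over A \<and> poly r x = poly q x)"
    have q': "q' \<in> polys_over A \<and> poly q' x = poly q x" unfolding q'_def by (rule someI[of _ q]) (simp add: q)
    then have "poly (map_poly \<phi> (q' - q)) \<omega> = 0" using z[of "q' - q"] P(4) q by simp
    then show ?thesis using map_poly_ring_map(2)[OF \<phi> A _ q, of q'] q' by (simp add: \<psi>_def q'_def)
  qed
  have "ring_map (adjoin A x) \<psi>"
    unfolding ring_map_def
  proof (intro conjI ballI)
    have "\<psi> (poly 1 x) = poly (map_poly \<phi> 1) \<omega>" by (rule \<psi>[OF P(1)])
    then show "\<psi> 1 = 1" using ring_mapD(1)[OF \<phi>] by (simp add: map_poly_1')
  next
    fix a b assume "a \<in> adjoin A x" "b \<in> adjoin A x"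
    then obtain p q where pq: "p \<in> polys_over A" "a = poly p x" "q \<in> polys_over A" "b = poly q x" by (auto simp: adjoin_def)
    have "\<psi> (poly (p + q) x) = poly (map_poly \<phi> (p + q)) \<omega>" "\<psi> (poly (p * q) x) = poly (map_poly \<phi> (p * q)) \<omega>"
      by (rule \<psi>[OF P(3)[OF pq(1,3)]], rule \<psi>[OF P(5)[OF pq(1,3)]])
    then show "\<psi> (a + b) = \<psi> a + \<psi> b" "\<psi> (a * b) = \<psi> a * \<psi> b"
      using map_poly_ring_map(1,3)[OF \<phi> A pq(1,3)] pq by (simp_all add: \<psi>)
  qed
  then show thesis using \<psi> that by blast
qed

text \<open>In the transcendental case \<open>\<omega>\<close> is a non-root of the image of
  \<open>q\<close>, which is non-zero. In the algebraic case it is a root of the image of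
  \<open>p\<close>, whose degree stays positive because the leading coefficient survives; a relation
  of \<open>x\<close> is a multiple of \<open>p\<close> up to a power of that coefficient, which can
  be cancelled.\<close>

lemma ring_map_extend:
  fixes x :: "'a::idom" and \<phi> :: "'a \<Rightarrow> 'b::alg_closed_field"
  assumes A: "subring_set A" and \<phi>: "ring_map A \<phi>" and bA: "b \<in> adjoin A x" and s: "specialisation A x b a" and a: "\<phi> a \<noteq> 0"
  obtains \<psi> :: "'a \<Rightarrow> 'b" where "ring_map (adjoin A x) \<psi>" "\<psi> b \<noteq> 0"
proof -
  note P = subring_setD[OF polys_over_closed(1)[OF A]]
  note c = ring_map_closed[OF \<phi> A]
  from s show thesis
    unfolding specialisation_def
  proof (elim disjE conjE bexE exE)
    fix q i assume t: "transcendental_over A x" and q: "q \<in> polys_over A" "b = poly q x" "a = coeff q i"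
    have f0: "map_poly \<phi> q \<noteq> 0"
    proof
      assume "map_poly \<phi> q = 0"
      then have "coeff (map_poly \<phi> q) i = 0" by simp
      then show False using a q(3) by (simp add: coeff_map_poly c(1))
    qed
    obtain \<omega> where \<omega>: "poly (map_poly \<phi> q) \<omega> \<noteq> 0"
    proof (cases "degree (map_poly \<phi> q) = 0")
      case True
      then obtain e where "map_poly \<phi> q = [:e:]" by (metis degree_eq_zeroE)
      then show thesis using that[of 0] f0 by simp
    next
      case False
      \<comment> \<open>A root of the image of \<open>q\<close> minus 1 is a non-root of the image
        of \<open>q\<close>.\<close>
      then have "degree (map_poly \<phi> q - 1) > 0"
        using degree_add_eq_left[of "-1" "map_poly \<phi> q"] by simp
      then obtain \<omega> where "poly (map_poly \<phi> q - 1) \<omega> = 0" using alg_closed_imp_poly_has_root by blast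
      then show thesis using that[of \<omega>] by simp
    qed
    have z: "poly (map_poly \<phi> r) \<omega> = 0" if "r \<in> polys_over A" "poly r x = 0" for r
      using t that unfolding transcendental_over_def by (metis map_poly_0 poly_0)
    obtain \<psi> where "ring_map (adjoin A x) \<psi>" "\<And>q. q \<in> polys_over A \<Longrightarrow> \<psi> (poly q x) = poly (map_poly \<phi> q) \<omega>"
      using ring_map_adjoin[OF A \<phi> z] by metis
    then show thesis using that[of \<psi>] \<omega> q by simp
  next
    fix p q e assume m: "minimal_relation A x p" and q: "q \<in> polys_over A" "e \<in> A" "b * poly q x = e" "a = lead_coeff p * e"
    have pA: "p \<in> polys_over A" "p \<noteq> 0" "poly p x = 0" using m by (auto simp: minimal_relation_def)
    have lA: "lead_coeff p \<in> A" using pA(1) by (simp add: polys_over_def)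
    have ae: "\<phi> (lead_coeff p) \<noteq> 0" "\<phi> e \<noteq> 0" using a ring_mapD(3)[OF \<phi> lA q(2)] q(4) by auto
    have "degree p \<noteq> 0"
    proof
      assume "degree p = 0"
      then obtain d where "p = [:d:]" by (metis degree_eq_zeroE)
      then show False using pA by simp
    qed
    moreover have "coeff (map_poly \<phi> p) (degree p) \<noteq> 0" using ae(1) by (simp add: coeff_map_poly c(1))
    then have "degree (map_poly \<phi> p) \<ge> degree p" by (rule le_degree)
    ultimately have "degree (map_poly \<phi> p) > 0" by simp
    then obtain \<omega> where \<omega>: "poly (map_poly \<phi> p) \<omega> = 0" using alg_closed_imp_poly_has_root by blast
    have z: "poly (map_poly \<phi> r) \<omega> = 0" if r: "r \<in> polys_over A" "poly r x = 0" for r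
    proof -
      obtain k t where kt: "t \<in> polys_over A" "smult (lead_coeff p ^ k) r = p * t"
        using minimal_relation_dvd[OF A m r] by blast
      have "smult (\<phi> (lead_coeff p ^ k)) (map_poly \<phi> r) = map_poly \<phi> p * map_poly \<phi> t"
        using arg_cong[OF kt(2), of "map_poly \<phi>"] map_poly_ring_map(3)[OF \<phi> A pA(1) kt(1)]
          map_poly_ring_map(4)[OF \<phi> A r(1) r(1) subring_setD(7)[OF A lA]] by simp
      then have "\<phi> (lead_coeff p ^ k) * poly (map_poly \<phi> r) \<omega> = 0"
        using \<omega> by (metis mult_zero_left poly_mult poly_smult)
      then show ?thesis using ae(1) by (simp add: c(3)[OF lA])
    qed
    obtain \<psi> where \<psi>: "ring_map (adjoin A x) \<psi>" "\<And>q. q \<in> polys_over A \<Longrightarrow> \<psi> (poly q x) = poly (map_poly \<phi> q) \<omega>"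
      using ring_map_adjoin[OF A \<phi> z] by metis
    have "\<psi> b \<noteq> 0"
    proof
      assume "\<psi> b = 0"
      have "poly q x \<in> adjoin A x" using q(1) by (auto simp: adjoin_def)
      then have "\<psi> e = 0" using ring_mapD(3)[OF \<psi>(1) bA] q(3) \<open>\<psi> b = 0\<close> by fastforce
      moreover have "\<psi> (poly [:e:] x) = poly (map_poly \<phi> [:e:]) \<omega>"
        by (rule \<psi>(2)) (use q(2) polys_over_closed(3)[OF A, of e 0] in \<open>simp add: monom_0\<close>)
      ultimately show False using ae(2) c(1) by (simp add: Polynomial.map_poly_pCons)
    qed
    then show thesis using that \<psi>(1) by blast
  qed
qed

text \<open>The head of the list is adjoined last, so induction on the list takes off the top of the
  tower over the prime ring.\<close>

fun adjoin_list :: "'a::comm_ring_1 list \<Rightarrow> 'a set"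
  where "adjoin_list [] = range of_int" | "adjoin_list (x # xs) = adjoin (adjoin_list xs) x"

lemma adjoin_list_subring: "subring_set (adjoin_list xs)"
proof (induction xs)
  case Nil
  show ?case by (simp add: subring_set_def) (metis of_int_1 of_int_diff of_int_mult rangeI)
qed (simp add: adjoin_subring)

lemma set_subset_adjoin_list: "set xs \<subseteq> adjoin_list xs"
proof (induction xs)
  case (Cons x xs)
  then show ?case using adjoin_subring(2,3)[OF adjoin_list_subring[of xs], of x] by simp
qed simp

text \<open>Chevalley's conditions strung together: keeping one integer \<open>m\<close> non-zero is
  enough to keep \<open>b\<close> non-zero, generator by generator up the tower.\<close>

fun specialisation_chain :: "'a::comm_ring_1 list \<Rightarrow> 'a \<Rightarrow> int \<Rightarrow> bool"
  where "specialisation_chain [] b m \<longleftrightarrow> b = of_int m"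
  | "specialisation_chain (x # xs) b m \<longleftrightarrow> b \<in> adjoin (adjoin_list xs) x \<and>
      (\<exists>a. specialisation (adjoin_list xs) x b a \<and> specialisation_chain xs a m)"

lemma specialisation_chain_exists:
  fixes b :: "'a::idom"
  assumes "b \<in> adjoin_list xs" "b \<noteq> 0"
  shows "\<exists>m. specialisation_chain xs b m \<and> of_int m \<noteq> (0::'a)"
  using assms
proof (induction xs arbitrary: b)
  case (Cons x xs)
  have "b \<in> adjoin (adjoin_list xs) x" using Cons.prems by simp
  then obtain a where a: "a \<in> adjoin_list xs" "a \<noteq> 0 \<and> specialisation (adjoin_list xs) x b a"
    by (rule bexE[OF specialisation_exists[OF adjoin_list_subring _ Cons.prems(2)]])
  obtain m where m: "specialisation_chain xs a m \<and> of_int m \<noteq> (0::'a)"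
    by (rule exE[OF Cons.IH[OF a(1) conjunct1[OF a(2)]]])
  have "specialisation_chain (x # xs) b m"
    unfolding specialisation_chain.simps
    by (intro conjI exI[of _ a] \<open>b \<in> adjoin (adjoin_list xs) x\<close> conjunct2[OF a(2)] conjunct1[OF m])
  then show ?case using conjunct2[OF m] by (intro exI[of _ m] conjI)
qed auto

text \<open>\<open>char\<close> makes the map from the prime ring of \<open>'a\<close> to that of
  \<open>'o\<close> well defined; from there \<open>ring_map_extend\<close> climbs the
  tower.\<close>

lemma specialisation_chain_ring_map:
  fixes b :: "'a::idom"
  assumes ch: "specialisation_chain xs b m" and m: "of_int m \<noteq> (0::'o::alg_closed_field)"
    and char: "\<And>k. of_int k = (0::'a) \<Longrightarrow> of_int k = (0::'o::alg_closed_field)"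
  obtains \<phi> :: "'a \<Rightarrow> 'o::alg_closed_field" where "ring_map (adjoin_list xs) \<phi>" "\<phi> b \<noteq> 0"
proof -
  have "\<exists>\<phi> :: 'a \<Rightarrow> 'o. ring_map (adjoin_list xs) \<phi> \<and> \<phi> b \<noteq> 0"
    using ch
  proof (induction xs arbitrary: b)
    case Nil
    define \<phi> :: "'a \<Rightarrow> 'o" where "\<phi> y = of_int (SOME k. of_int k = y)" for y
    have \<phi>: "\<phi> (of_int k) = of_int k" for k
    proof -
      define l where "l = (SOME l. of_int l = (of_int k :: 'a))"
      have "of_int l = (of_int k :: 'a)" unfolding l_def by (rule someI[of _ k]) simp
      then have "of_int (l - k) = (0::'o)" by (intro char) simp
      then show ?thesis by (simp add: \<phi>_def l_def)
    qed
    have "ring_map (range of_int) \<phi>"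
      unfolding ring_map_def
    proof (intro conjI ballI)
      show "\<phi> 1 = 1" using \<phi>[of 1] by simp
    next
      fix x y :: 'a assume "x \<in> range of_int" "y \<in> range of_int"
      then obtain k l where "x = of_int k" "y = of_int l" by blast
      then show "\<phi> (x + y) = \<phi> x + \<phi> y" "\<phi> (x * y) = \<phi> x * \<phi> y"
        using \<phi>[of "k + l"] \<phi>[of "k * l"] \<phi> by simp_all
    qed
    then show ?case using Nil m \<phi> by auto
  next
    case (Cons x xs)
    then obtain a where a: "b \<in> adjoin (adjoin_list xs) x" "specialisation (adjoin_list xs) x b a" "specialisation_chain xs a m"
      by auto
    obtain \<phi> :: "'a \<Rightarrow> 'o" where \<phi>: "ring_map (adjoin_list xs) \<phi>" "\<phi> a \<noteq> 0" using Cons.IH[OF a(3)] by blast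
    obtain \<psi> :: "'a \<Rightarrow> 'o" where "ring_map (adjoin (adjoin_list xs) x) \<psi>" "\<psi> b \<noteq> 0"
      by (rule ring_map_extend[OF adjoin_list_subring \<phi>(1) a(1,2) \<phi>(2)])
    then show ?case by auto
  qed
  then show thesis using that by blast
qed

section \<open>Finiteness of the images in the algebraic closure of a finite prime field\<close>

lemma finite_polys_over:
  assumes "finite A"
  shows "finite {p \<in> polys_over A. p = 0 \<or> degree p < d}"
proof -
  have "{p \<in> polys_over A. p = 0 \<or> degree p < d} \<subseteq> Poly ` {cs. set cs \<subseteq> A \<and> length cs \<le> d}"
  proof
    fix p assume "p \<in> {p \<in> polys_over A. p = 0 \<or> degree p < d}"
    then have p: "p \<in> polys_over A" "p = 0 \<or> degree p < d" by auto
    have "set (coeffs p) \<subseteq> A" using p(1) by (auto simp: coeffs_def polys_over_def)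
    moreover have "length (coeffs p) \<le> d" using p(2) by (auto simp: length_coeffs coeffs_def)
    ultimately show "p \<in> Poly ` {cs. set cs \<subseteq> A \<and> length cs \<le> d}"
      by (intro image_eqI[of _ _ "coeffs p"]) simp_all
  qed
  then show ?thesis using finite_subset finite_lists_length_le[OF assms] by blast
qed

text \<open>With \<open>g\<close> monic, pseudo-division is division, and the remainders of bounded
  degree represent every element.\<close>

lemma finite_adjoin:
  fixes y :: "'a::idom"
  assumes A: "subring_set A" "finite A" and g: "g \<in> polys_over A" "lead_coeff g = 1" "poly g y = 0"
  shows "finite (adjoin A y)"
proof -
  have g0: "g \<noteq> 0" using g(2) by auto
  have "adjoin A y \<subseteq> (\<lambda>p. poly p y) ` {p \<in> polys_over A. p = 0 \<or> degree p < degree g}"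
  proof
    fix z assume "z \<in> adjoin A y"
    then obtain p where p: "p \<in> polys_over A" "z = poly p y" by (auto simp: adjoin_def)
    obtain k t r where d: "t \<in> polys_over A" "r \<in> polys_over A" "smult (lead_coeff g ^ k) p = g * t + r" "r = 0 \<or> degree r < degree g"
      by (rule pseudo_division_over[OF A(1) p(1) g(1) g0])
    have "p = g * t + r" using d(3) g(2) by simp
    then have "z = poly r y" using p(2) g(3) by simp
    then show "z \<in> (\<lambda>p. poly p y) ` {p \<in> polys_over A. p = 0 \<or> degree p < degree g}" using d(2,4) by blast
  qed
  then show ?thesis using finite_polys_over[OF A(2)] finite_subset by blast
qed

lemma ring_map_image_subring:
  assumes A: "subring_set A" and \<phi>: "ring_map A \<phi>"
  shows "subring_set (\<phi> ` A)"
  unfolding subring_set_def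
proof (intro conjI ballI)
  show "1 \<in> \<phi> ` A" using ring_mapD(1)[OF \<phi>] subring_setD(1)[OF A] by (metis image_eqI)
next
  fix x y assume "x \<in> \<phi> ` A" "y \<in> \<phi> ` A"
  then obtain a b where "a \<in> A" "b \<in> A" "x = \<phi> a" "y = \<phi> b" by blast
  then show "x - y \<in> \<phi> ` A" "x * y \<in> \<phi> ` A"
    using ring_map_closed(2)[OF \<phi> A] ring_mapD(3)[OF \<phi>] subring_setD(4,5)[OF A] by (metis image_eqI)+
qed

lemma ring_map_mono: "ring_map B \<phi> \<Longrightarrow> A \<subseteq> B \<Longrightarrow> ring_map A \<phi>"
  by (auto simp: ring_map_def)

text \<open>The target is algebraic over the finite field \<open>'q\<close>, which consists of
  multiples of 1 and therefore lies in each image; so every generator goes to a root of a monic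
  polynomial over the finite image obtained before.\<close>

lemma finite_ring_map_image:
  fixes \<phi> :: "'a::comm_ring_1 \<Rightarrow> 'q::field alg_closure"
  assumes \<phi>: "ring_map (adjoin_list xs) \<phi>" and q: "finite (UNIV :: 'q set)" "range (of_int :: int \<Rightarrow> 'q) = UNIV"
  shows "finite (\<phi> ` adjoin_list xs)"
  using \<phi>
proof (induction xs)
  case Nil
  have 0: "subring_set (range of_int :: 'a set)" using adjoin_list_subring[of "[]"] by simp
  have N: "\<phi> (of_nat k) = of_nat k" for k
    using ring_map_closed(4)[OF _ 0, of \<phi> "{..<k}" "\<lambda>_. 1"] ring_mapD(1)[OF Nil] Nil subring_setD(1)[OF 0] by simp
  have "\<phi> (of_int k) = of_int k" for k
  proof -
    obtain i j where k: "k = int i - int j" by (rule int_diff_cases)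
    have "(of_nat i :: 'a) \<in> range of_int" "(of_nat j :: 'a) \<in> range of_int" by (metis of_int_of_nat_eq rangeI)+
    then show ?thesis using ring_map_closed(2)[OF _ 0, of \<phi> "of_nat i" "of_nat j"] Nil N k by simp
  qed
  then have "\<phi> ` adjoin_list [] \<subseteq> range to_ac" by (auto simp: image_def) (metis to_ac_of_int)
  moreover have "finite (range (to_ac :: 'q \<Rightarrow> _))" using q(1) by simp
  ultimately show ?case using finite_subset by blast
next
  case (Cons x xs)
  let ?A = "adjoin_list xs"
  have sub: "subring_set ?A" by (rule adjoin_list_subring)
  have AA: "?A \<subseteq> adjoin ?A x" by (rule adjoin_subring(2)[OF sub])
  have \<phi>1: "ring_map (adjoin ?A x) \<phi>" using Cons.prems by simp
  have \<phi>A: "ring_map ?A \<phi>" by (rule ring_map_mono[OF \<phi>1 AA])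
  have fin: "finite (\<phi> ` ?A)" by (rule Cons.IH[OF \<phi>A])
  have sA: "subring_set (\<phi> ` ?A)" by (rule ring_map_image_subring[OF sub \<phi>A])
  have ofint: "of_int k \<in> \<phi> ` ?A" for k
  proof -
    have "of_nat i \<in> \<phi> ` ?A" for i by (induction i) (simp_all add: subring_setD[OF sA])
    moreover obtain i j where "k = int i - int j" by (rule int_diff_cases)
    ultimately show ?thesis using subring_setD(4)[OF sA, of "of_nat i" "of_nat j"] by simp
  qed
  have toac: "to_ac c \<in> \<phi> ` ?A" for c :: 'q
  proof -
    obtain k where "c = of_int k" using q(2) by (metis UNIV_I imageE)
    then show ?thesis using ofint by simp
  qed
  obtain p :: "'q poly" where p: "p \<noteq> 0" "poly (map_poly to_ac p) (\<phi> x) = 0" by (rule alg_closure_algebraic)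
  define g where "g = map_poly to_ac (smult (inverse (lead_coeff p)) p)"
  have "g = smult (to_ac (inverse (lead_coeff p))) (map_poly to_ac p)"
    unfolding g_def by (rule poly_eqI) (simp add: coeff_map_poly)
  then have gx: "poly g (\<phi> x) = 0" using p(2) by simp
  have gA: "g \<in> polys_over (\<phi> ` ?A)" unfolding polys_over_def g_def using toac by (simp add: coeff_map_poly del: coeff_smult)
  have dg: "degree g = degree p" unfolding g_def using p(1) by (subst degree_map_poly) simp_all
  have lg: "lead_coeff g = 1" unfolding dg using p(1) by (simp add: g_def coeff_map_poly del: to_ac_inverse to_ac_mult)
  have "\<phi> ` adjoin ?A x \<subseteq> adjoin (\<phi> ` ?A) (\<phi> x)"
  proof
    fix z assume "z \<in> \<phi> ` adjoin ?A x"
    then obtain r where r: "r \<in> polys_over ?A" "z = \<phi> (poly r x)" by (auto simp: adjoin_def)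
    have cr: "coeff r i \<in> adjoin ?A x" for i using r(1) AA by (auto simp: polys_over_def)
    note sx = adjoin_subring(1,3)[OF sub, of x]
    have xi: "x ^ i \<in> adjoin ?A x" for i by (rule subring_setD(7)[OF sx])
    have "z = \<phi> (\<Sum>i\<le>degree r. coeff r i * x ^ i)" using r(2) by (simp add: poly_altdef)
    also have "\<dots> = (\<Sum>i\<le>degree r. \<phi> (coeff r i * x ^ i))"
      by (rule ring_map_closed(4)[OF \<phi>1 sx(1)]) (rule subring_setD(5)[OF sx(1) cr xi])
    also have "\<dots> = (\<Sum>i\<le>degree r. \<phi> (coeff r i) * \<phi> x ^ i)"
      using ring_mapD(3)[OF \<phi>1 cr xi] ring_map_closed(3)[OF \<phi>1 sx(1,2)] by simp
    finally have z: "z = (\<Sum>i\<le>degree r. \<phi> (coeff r i) * \<phi> x ^ i)" .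
    note sAx = adjoin_subring[OF sA, of "\<phi> x"]
    have "\<phi> (coeff r i) \<in> adjoin (\<phi> ` ?A) (\<phi> x)" for i using r(1) sAx(2) by (auto simp: polys_over_def)
    then show "z \<in> adjoin (\<phi> ` ?A) (\<phi> x)"
      unfolding z by (intro subring_set_sum[OF sAx(1)] subring_setD(5)[OF sAx(1)] subring_setD(7)[OF sAx(1,3)])
  qed
  then show ?case using finite_adjoin[OF sA fin gA lg gx] finite_subset by simp
qed

subsection \<open>Characters and retractions in finite quotients\<close>

lemma finite_image_factor:
  assumes "finite (g ` A)" "\<And>x y. x \<in> A \<Longrightarrow> y \<in> A \<Longrightarrow> g x = g y \<Longrightarrow> f x = f y"
  shows "finite (f ` A)"
proof -
  have "f x = f (SOME y. y \<in> A \<and> g y = g x)" if x: "x \<in> A" for x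
  proof -
    have "(SOME y. y \<in> A \<and> g y = g x) \<in> A \<and> g (SOME y. y \<in> A \<and> g y = g x) = g x"
      by (rule someI[of _ x]) (simp add: x)
    then show ?thesis using assms(2)[OF x] by metis
  qed
  then have "f ` A \<subseteq> (\<lambda>z. f (SOME y. y \<in> A \<and> g y = z)) ` g ` A" by blast
  then show ?thesis using assms(1) finite_subset by blast
qed

context group begin

section \<open>Indices of subgroups\<close>

lemma rcosets_eq_image: "rcosets H = (\<lambda>g. H #> g) ` carrier G"
  by (auto simp: RCOSETS_def)

text \<open>Cosets of \<open>N\<close> correspond to pairs of a representative for \<open>P\<close>
  and a coset of \<open>N\<close> in \<open>P\<close>. Being a bijection, this gives the equation
  for infinite index too, where \<open>card\<close> is 0.\<close>

lemma index_tower: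
  assumes N: "subgroup N G" and P: "subgroup P G" and NP: "N \<subseteq> P"
  shows "card (rcosets N) = card (rcosets P) * card ((\<lambda>x. N #> x) ` P)"
    and "finite (rcosets N) \<Longrightarrow> finite (rcosets P)"
    and "finite (rcosets P) \<Longrightarrow> finite ((\<lambda>x. N #> x) ` P) \<Longrightarrow> finite (rcosets N)"
proof -
  interpret N: subgroup N G by fact
  interpret P: subgroup P G by fact
  obtain r where tr: "transversal P r" using transversal_exists[OF P] .
  note r = transversal(1-6)[OF P tr]
  have inj: "inj_on (\<lambda>t. P #> t) (r ` carrier G)"
  proof (rule inj_onI)
    fix s t assume st: "s \<in> r ` carrier G" "t \<in> r ` carrier G" "P #> s = P #> t"
    have c: "s \<in> carrier G" "t \<in> carrier G" using st(1,2) r(1) by auto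
    then have "r s = r t" using rcos_eq_iff[OF P c] r(6)[OF c] st(3) by blast
    then show "s = t" using r(5)[OF st(1)] r(5)[OF st(2)] by simp
  qed
  have img: "(\<lambda>t. P #> t) ` r ` carrier G = rcosets P"
    unfolding rcosets_eq_image image_image
  proof (rule image_cong[OF refl])
    fix g assume g: "g \<in> carrier G"
    show "P #> r g = P #> g" using rcos_eq_iff[OF P g r(1)[OF g]] r(2)[OF g] by simp
  qed
  have 1: "card (r ` carrier G) = card (rcosets P)" using card_image[OF inj] img by simp
  let ?f = "\<lambda>(t, C). C #> t"
  have coset: "(N #> x) #> t = N #> (x \<otimes> t)" if "x \<in> carrier G" "t \<in> carrier G" for x t
    using coset_mult_assoc[OF N.subset that] .
  have "inj_on ?f (r ` carrier G \<times> (\<lambda>x. N #> x) ` P)"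
  proof (rule inj_onI, clarify)
    fix s t x y assume s: "s \<in> carrier G" and t: "t \<in> carrier G" and xy: "x \<in> P" "y \<in> P"
      and e: "N #> x #> r s = N #> y #> r t"
    have c: "x \<in> carrier G" "y \<in> carrier G" "r s \<in> carrier G" "r t \<in> carrier G" using xy s t r(1) by auto
    have n: "(x \<otimes> r s) \<otimes> inv (y \<otimes> r t) \<in> N"
      using e c rcos_eq_iff[OF N, of "x \<otimes> r s" "y \<otimes> r t"] by (simp add: coset)
    then have "r (x \<otimes> r s) = r (y \<otimes> r t)" using r(6)[of "x \<otimes> r s" "y \<otimes> r t"] NP c by blast
    then have st: "r s = r t" using r(3)[OF xy(1) c(3)] r(3)[OF xy(2) c(4)] r(5)[of "r s"] r(5)[of "r t"] s t by simp
    then have "x \<otimes> inv y \<in> N" using n c by (simp add: inv_mult_group m_assoc)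
    then show "r s = r t \<and> N #> x = N #> y" using rcos_eq_iff[OF N c(1,2)] st by simp
  qed
  moreover have imgN: "?f ` (r ` carrier G \<times> (\<lambda>x. N #> x) ` P) = rcosets N"
  proof (intro equalityI subsetI)
    fix C assume "C \<in> ?f ` (r ` carrier G \<times> (\<lambda>x. N #> x) ` P)"
    then obtain s x where "s \<in> carrier G" "x \<in> P" "C = N #> x #> r s" by auto
    then show "C \<in> rcosets N" using coset[of x "r s"] r(1)[of s] by (auto simp: rcosets_eq_image)
  next
    fix C assume "C \<in> rcosets N"
    then obtain g where g: "g \<in> carrier G" "C = N #> g" by (auto simp: rcosets_eq_image)
    have "g = (g \<otimes> inv r g) \<otimes> r g" using g(1) r(1)[OF g(1)] by (simp add: m_assoc)
    then have "C = N #> (g \<otimes> inv r g) #> r g" using g r(1)[OF g(1)] coset[of "g \<otimes> inv r g" "r g"] by simp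
    then show "C \<in> ?f ` (r ` carrier G \<times> (\<lambda>x. N #> x) ` P)" using r(2)[OF g(1)] g(1) by (intro image_eqI[of _ _ "(r g, N #> (g \<otimes> inv r g))"]) auto
  qed
  ultimately have "card (rcosets N) = card (r ` carrier G \<times> (\<lambda>x. N #> x) ` P)" using card_image by fastforce
  then show "card (rcosets N) = card (rcosets P) * card ((\<lambda>x. N #> x) ` P)" by (simp add: card_cartesian_product 1)
  show "finite (rcosets N)" if "finite (rcosets P)" "finite ((\<lambda>x. N #> x) ` P)"
  proof -
    have "finite (r ` carrier G)" by (rule finite_imageD[OF _ inj]) (simp only: img that(1))
    then have "finite (?f ` (r ` carrier G \<times> (\<lambda>x. N #> x) ` P))"
      by (rule finite_imageI[OF finite_cartesian_product[OF _ that(2)]])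
    then show ?thesis by (simp only: imgN)
  qed
  show "finite (rcosets P)" if "finite (rcosets N)"
    unfolding rcosets_eq_image
  proof (rule finite_image_factor)
    show "finite ((\<lambda>g. N #> g) ` carrier G)" using that by (simp add: rcosets_eq_image)
  next
    fix x y assume "x \<in> carrier G" "y \<in> carrier G" "N #> x = N #> y"
    then show "P #> x = P #> y" using rcos_eq_iff[OF N] rcos_eq_iff[OF P] NP by blast
  qed
qed

lemma finite_index_Int:
  assumes H: "subgroup H G" "finite (rcosets H)" and K: "subgroup K G" "finite (rcosets K)"
  shows "finite (rcosets (H \<inter> K))"
  unfolding rcosets_eq_image
proof (rule finite_image_factor)
  have "(\<lambda>g. (H #> g, K #> g)) ` carrier G \<subseteq> (rcosets H) \<times> (rcosets K)" by (auto simp: rcosets_eq_image)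
  then show "finite ((\<lambda>g. (H #> g, K #> g)) ` carrier G)" using H(2) K(2) finite_subset finite_cartesian_product by blast
next
  fix x y assume c: "x \<in> carrier G" "y \<in> carrier G" and e: "(H #> x, K #> x) = (H #> y, K #> y)"
  have "x \<otimes> inv y \<in> H \<inter> K" using e rcos_eq_iff[OF H(1) c] rcos_eq_iff[OF K(1) c] by blast
  then show "H \<inter> K #> x = H \<inter> K #> y" using rcos_eq_iff[OF subgroups_Inter_pair[OF H(1) K(1)] c] by blast
qed

section \<open>Characters modulo p and the rank\<close>

definition additive_mod :: "nat \<Rightarrow> 'a set \<Rightarrow> ('a \<Rightarrow> nat) \<Rightarrow> bool"
  where "additive_mod p P \<chi> \<longleftrightarrow> (\<forall>x\<in>P. \<forall>y\<in>P. [\<chi> (x \<otimes> y) = \<chi> x + \<chi> y] (mod p))"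

text \<open>The homomorphisms from \<open>P/N\<close> to the integers modulo \<open>p\<close>.
  Values below \<open>p\<close> and extensionality outside \<open>P\<close> give each of them a
  unique representing function, so that \<open>card\<close> counts them.\<close>

definition characters :: "nat \<Rightarrow> 'a set \<Rightarrow> 'a set \<Rightarrow> ('a \<Rightarrow> nat) set"
  where "characters p P N = {\<chi> \<in> P \<rightarrow>\<^sub>E {..<p}. additive_mod p P \<chi> \<and> (\<forall>x\<in>N. \<chi> x = 0)}"

lemma additive_mod_one:
  assumes "additive_mod p P \<chi>" "\<one> \<in> P"
  shows "[\<chi> \<one> = 0] (mod p)"
proof -
  have "[\<chi> (\<one> \<otimes> \<one>) = \<chi> \<one> + \<chi> \<one>] (mod p)" using assms unfolding additive_mod_def by blast
  then have "[\<chi> \<one> + 0 = \<chi> \<one> + \<chi> \<one>] (mod p)" by simp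
  then show ?thesis unfolding cong_add_lcancel_nat by (rule cong_sym)
qed

lemma additive_mod_agree:
  assumes P: "subgroup P G" and \<chi>: "additive_mod p P \<chi>" and \<psi>: "additive_mod p P \<psi>"
  shows "subgroup {x \<in> P. [\<chi> x = \<psi> x] (mod p)} G"
proof (rule subgroupI)
  interpret P: subgroup P G by fact
  have add: "[\<chi> (x \<otimes> y) = \<chi> x + \<chi> y] (mod p)" "[\<psi> (x \<otimes> y) = \<psi> x + \<psi> y] (mod p)" if "x \<in> P" "y \<in> P" for x y
    using that \<chi> \<psi> unfolding additive_mod_def by blast+
  have one: "[\<chi> \<one> = \<psi> \<one>] (mod p)"
    by (rule cong_trans[OF additive_mod_one[OF \<chi> P.one_closed] cong_sym[OF additive_mod_one[OF \<psi> P.one_closed]]])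
  then show "{x \<in> P. [\<chi> x = \<psi> x] (mod p)} \<noteq> {}" using P.one_closed by blast
  show "{x \<in> P. [\<chi> x = \<psi> x] (mod p)} \<subseteq> carrier G" using P.subset by blast
  show "inv x \<in> {x \<in> P. [\<chi> x = \<psi> x] (mod p)}" if "x \<in> {x \<in> P. [\<chi> x = \<psi> x] (mod p)}" for x
  proof -
    have x: "x \<in> P" "[\<chi> x = \<psi> x] (mod p)" using that by auto
    have xi: "inv x \<in> P" using x by simp
    have 1: "[\<chi> \<one> = \<chi> x + \<chi> (inv x)] (mod p)" and 2: "[\<psi> \<one> = \<psi> x + \<psi> (inv x)] (mod p)"
      using add[OF x(1) xi] x(1) by simp_all
    have "[\<chi> x + \<chi> (inv x) = \<psi> x + \<psi> (inv x)] (mod p)"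
      by (rule cong_trans[OF cong_sym[OF 1] cong_trans[OF one 2]])
    moreover have "[\<psi> x + \<psi> (inv x) = \<chi> x + \<psi> (inv x)] (mod p)" by (rule cong_add[OF cong_sym[OF x(2)] cong_refl])
    ultimately have "[\<chi> x + \<chi> (inv x) = \<chi> x + \<psi> (inv x)] (mod p)" by (rule cong_trans)
    then show ?thesis using xi unfolding cong_add_lcancel_nat by blast
  qed
  show "x \<otimes> y \<in> {x \<in> P. [\<chi> x = \<psi> x] (mod p)}"
    if "x \<in> {x \<in> P. [\<chi> x = \<psi> x] (mod p)}" "y \<in> {x \<in> P. [\<chi> x = \<psi> x] (mod p)}" for x y
  proof -
    have xy: "x \<in> P" "y \<in> P" "[\<chi> x + \<chi> y = \<psi> x + \<psi> y] (mod p)" using that cong_add by auto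
    have "[\<chi> (x \<otimes> y) = \<psi> (x \<otimes> y)] (mod p)"
      by (rule cong_trans[OF add(1)[OF xy(1,2)] cong_trans[OF xy(3) cong_sym[OF add(2)[OF xy(1,2)]]]])
    then show ?thesis using xy by simp
  qed
qed

text \<open>The hypothesis on \<open>D\<close> expresses that \<open>N\<close> and \<open>E\<close>
  together generate \<open>P\<close>; it is applied to the subgroup on which the two characters
  agree.\<close>

lemma characters_eqI:
  assumes P: "subgroup P G" and \<chi>: "\<chi> \<in> characters p P N" "\<psi> \<in> characters p P N"
    and D: "\<And>D. subgroup D G \<Longrightarrow> D \<subseteq> P \<Longrightarrow> N \<subseteq> D \<Longrightarrow> E \<subseteq> D \<Longrightarrow> P \<subseteq> D" and N: "N \<subseteq> P" and E: "E \<subseteq> P"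
    and e: "\<And>x. x \<in> E \<Longrightarrow> \<chi> x = \<psi> x"
  shows "\<chi> = \<psi>"
proof
  fix x
  have c: "\<chi> \<in> P \<rightarrow>\<^sub>E {..<p}" "\<psi> \<in> P \<rightarrow>\<^sub>E {..<p}" "additive_mod p P \<chi>" "additive_mod p P \<psi>"
    "\<And>x. x \<in> N \<Longrightarrow> \<chi> x = \<psi> x"
    using \<chi> by (auto simp: characters_def)
  have "P \<subseteq> {x \<in> P. [\<chi> x = \<psi> x] (mod p)}"
    by (rule D[OF additive_mod_agree[OF P c(3,4)]]) (use c(5) e N E in auto)
  then have "[\<chi> x = \<psi> x] (mod p)" if "x \<in> P" using that by blast
  moreover have "\<chi> x < p" "\<psi> x < p" if "x \<in> P" using c(1,2) that by (auto simp: PiE_iff)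
  ultimately show "\<chi> x = \<psi> x"
    using c(1,2) cong_less_modulus_unique_nat by (cases "x \<in> P") (auto simp: PiE_iff extensional_def)
qed

definition rank_at_most :: "nat \<Rightarrow> bool"
  where "rank_at_most r \<longleftrightarrow> (\<forall>T. finite T \<longrightarrow> T \<subseteq> carrier G \<longrightarrow> (\<exists>S. finite S \<and> card S \<le> r \<and> S \<subseteq> carrier G \<and> generate G S = generate G T))"

text \<open>Modulo \<open>N\<close>, finitely many elements cover \<open>P\<close>, and the subgroup
  they generate has at most \<open>r\<close> generators; a character trivial on \<open>N\<close> is
  determined by its values on the latter.\<close>

lemma card_characters_le:
  assumes r: "rank_at_most r" and P: "subgroup P G" and N: "subgroup N G" "N \<subseteq> P" "finite (rcosets N)" and p: "prime p"
  shows "finite (characters p P N)" "card (characters p P N) \<le> p ^ r"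
proof -
  interpret P: subgroup P G by fact
  have "(\<lambda>x. N #> x) ` P \<subseteq> rcosets N" by (auto simp: rcosets_eq_image)
  then have "finite ((\<lambda>x. N #> x) ` P)" using N(3) finite_subset by blast
  then obtain T where T: "T \<subseteq> P" "finite T" "(\<lambda>x. N #> x) ` P = (\<lambda>x. N #> x) ` T"
    using finite_subset_image[OF _ order_refl] by metis
  have Tc: "T \<subseteq> carrier G" using T(1) P.subset by blast
  obtain S where S: "finite S" "card S \<le> r" "S \<subseteq> carrier G" "generate G S = generate G T"
    using r T(2) Tc unfolding rank_at_most_def by metis
  have SP: "S \<subseteq> P"
  proof -
    have "generate G T \<subseteq> P" by (rule generate_subgroup_incl[OF T(1) P])
    moreover have "S \<subseteq> generate G S" by (auto intro: generate.incl)
    ultimately show ?thesis using S(4) by blast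
  qed
  let ?f = "\<lambda>\<chi>. restrict \<chi> S"
  have inj: "inj_on ?f (characters p P N)"
  proof (rule inj_onI)
    fix \<chi> \<psi> assume c: "\<chi> \<in> characters p P N" "\<psi> \<in> characters p P N" and e: "restrict \<chi> S = restrict \<psi> S"
    show "\<chi> = \<psi>"
    proof (rule characters_eqI[OF P c _ N(2) SP])
      show "\<chi> x = \<psi> x" if "x \<in> S" for x using fun_cong[OF e, of x] that by simp
    next
      fix D assume D: "subgroup D G" "D \<subseteq> P" "N \<subseteq> D" "S \<subseteq> D"
      have "generate G S \<subseteq> D" by (rule generate_subgroup_incl[OF D(4,1)])
      moreover have "T \<subseteq> generate G T" by (auto intro: generate.incl)
      ultimately have TD: "T \<subseteq> D" using S(4) by blast
      show "P \<subseteq> D"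
      proof
        fix x assume x: "x \<in> P"
        then obtain t where t: "t \<in> T" "N #> x = N #> t" using T(3) by blast
        have c: "x \<in> carrier G" "t \<in> carrier G" using x t Tc by auto
        have "x \<otimes> inv t \<in> D" using rcos_eq_iff[OF N(1) c] t(2) D(3) by blast
        then have "x \<otimes> inv t \<otimes> t \<in> D" using subgroup.m_closed[OF D(1)] TD t(1) by blast
        then show "x \<in> D" using c by (simp add: m_assoc)
      qed
    qed
  qed
  have sub: "?f ` characters p P N \<subseteq> (S \<rightarrow>\<^sub>E {..<p})" using SP by (auto simp: characters_def PiE_iff)
  have fin: "finite (S \<rightarrow>\<^sub>E {..<p})" using S(1) by (simp add: finite_PiE)
  show "finite (characters p P N)" using inj_on_finite[OF inj sub fin] .
  have "card (characters p P N) \<le> card (S \<rightarrow>\<^sub>E {..<p})" by (rule card_inj_on_le[OF inj sub fin])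
  also have "\<dots> = p ^ card S" using S(1) by (simp add: card_PiE)
  also have "\<dots> \<le> p ^ r" using S(2) prime_gt_0_nat[OF p] by (intro power_increasing) auto
  finally show "card (characters p P N) \<le> p ^ r" .
qed

end

lemma prime_power_part_unique:
  assumes p: "prime (p::nat)" and e: "a * p ^ d = b * p ^ c" and a: "\<not> p dvd a" and b: "\<not> p dvd b"
  shows "d = c"
proof -
  have *: False if dc: "d < c" "a * p ^ d = b * p ^ c" "\<not> p dvd a" for a b c d
  proof -
    obtain k where k: "c = Suc (d + k)" using less_imp_Suc_add[OF dc(1)] by blast
    have "a * p ^ d = (b * (p * p ^ k)) * p ^ d" unfolding dc(2) k by (simp only: power_Suc power_add ac_simps)
    moreover have "p ^ d \<noteq> 0" using prime_gt_0_nat[OF p] by simp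
    ultimately have "a = b * (p * p ^ k)" by (simp only: mult_cancel2) blast
    then show False using dc(3) by (metis dvd_mult dvd_triv_left)
  qed
  show ?thesis using *[OF _ e a] *[OF _ e[symmetric] b] by (cases d c rule: linorder_cases) auto
qed

context group begin

text \<open>\<open>Q\<close> is \<open>V/N\<close>. The retraction onto a Sylow subgroup is recorded
  as an endomorphism of \<open>Q\<close> with the right orders of image and kernel, the form in
  which the argument on finite linear groups consumes it.\<close>

definition prime_retractions :: "nat \<Rightarrow> 'a set \<Rightarrow> 'a set \<Rightarrow> bool"
  where "prime_retractions n V N \<longleftrightarrow> (\<forall>l. prime l \<longrightarrow> l \<le> n \<longrightarrow>
    (let Q = (G Mod N)\<lparr>carrier := (\<lambda>v. N #> v) ` V\<rparr> in
      \<exists>r a. r \<in> hom Q Q \<and> card (r ` carrier Q) = l ^ a \<and> \<not> l dvd card {x \<in> carrier Q. r x = \<one>\<^bsub>Q\<^esub>}))"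

text \<open>\<open>P/N\<close> is a Sylow \<open>p\<close>-subgroup of the finite group \<open>G/N\<close>.\<close>

definition sylow_pair :: "nat \<Rightarrow> 'a set \<Rightarrow> 'a set \<Rightarrow> bool"
  where "sylow_pair p P N \<longleftrightarrow> subgroup P G \<and> N \<lhd> G \<and> N \<subseteq> P \<and> finite (rcosets N)
    \<and> (\<exists>a. card ((\<lambda>x. N #> x) ` P) = p ^ a) \<and> \<not> p dvd card (rcosets P)"

text \<open>\<open>P'/N\<close> is a Sylow subgroup of \<open>P/N\<close>. The last claim says
  \<open>P' V = P\<close>: the index of a subgroup \<open>D\<close> above both is prime to
  \<open>p\<close>, whereas the index of \<open>D\<close> in \<open>P\<close> is a power of
  \<open>p\<close>, as \<open>P/V\<close> is a \<open>p\<close>-group.\<close>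

lemma sylow_pair_refine:
  assumes PV: "sylow_pair p P V" and p: "prime p" and N: "N \<lhd> G" "finite (rcosets N)" "N \<subseteq> V"
  obtains P' where "sylow_pair p P' N" "P' \<subseteq> P"
    "\<And>D. subgroup D G \<Longrightarrow> D \<subseteq> P \<Longrightarrow> V \<subseteq> D \<Longrightarrow> P' \<subseteq> D \<Longrightarrow> P \<subseteq> D"
proof -
  have P: "subgroup P G" and V: "V \<lhd> G" and VP: "V \<subseteq> P" and fV: "finite (rcosets V)" and iP: "\<not> p dvd card (rcosets P)"
    using PV by (auto simp: sylow_pair_def)
  obtain c where c: "card ((\<lambda>x. V #> x) ` P) = p ^ c" using PV by (auto simp: sylow_pair_def)
  have sN: "subgroup N G" and sV: "subgroup V G" using N(1) V normal_imp_subgroup by blast+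
  have NP: "N \<subseteq> P" using N(3) VP by blast
  interpret P: subgroup P G by fact
  interpret M: group "G Mod N" by (rule normal.factorgroup_is_group[OF N(1)])
  let ?\<pi> = "\<lambda>x. N #> x"
  interpret \<pi>: group_hom G "G Mod N" ?\<pi>
    by unfold_locales (rule normal.r_coset_hom_Mod[OF N(1)])
  have oM: "\<one>\<^bsub>G Mod N\<^esub> = N" by (simp add: FactGroup_def)
  have fP: "finite (?\<pi> ` P)"
    by (rule finite_subset[OF _ N(2)]) (use P.subset in \<open>auto simp: rcosets_eq_image\<close>)
  obtain T a m where T: "subgroup T (G Mod N)" "T \<subseteq> ?\<pi> ` P" "card T = p ^ a" "card (?\<pi> ` P) = p ^ a * m" "\<not> p dvd m"
    by (rule M.sylow_in_subgroup[OF \<pi>.subgroup_img_is_subgroup[OF P] fP p])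
  interpret T: subgroup T "G Mod N" by fact
  define P' where "P' = {x \<in> P. ?\<pi> x \<in> T}"
  have P'P: "P' \<subseteq> P" by (auto simp: P'_def)
  have P': "subgroup P' G"
  proof (rule subgroupI)
    show "P' \<subseteq> carrier G" using P'P P.subset by blast
    have "?\<pi> \<one> \<in> T" using \<pi>.hom_one T.one_closed by simp
    then show "P' \<noteq> {}" unfolding P'_def using P.one_closed by blast
  next
    fix x assume "x \<in> P'"
    then have x: "x \<in> P" "?\<pi> x \<in> T" by (auto simp: P'_def)
    have "?\<pi> (inv x) = inv\<^bsub>G Mod N\<^esub> ?\<pi> x" by (rule \<pi>.hom_inv) (use x in simp)
    then have "?\<pi> (inv x) \<in> T" using T.m_inv_closed[OF x(2)] by simp
    then show "inv x \<in> P'" using x(1) by (simp add: P'_def)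
  next
    fix x y assume "x \<in> P'" "y \<in> P'"
    then have xy: "x \<in> P" "?\<pi> x \<in> T" "y \<in> P" "?\<pi> y \<in> T" by (auto simp: P'_def)
    have "?\<pi> (x \<otimes> y) = ?\<pi> x \<otimes>\<^bsub>G Mod N\<^esub> ?\<pi> y" by (rule \<pi>.hom_mult) (use xy in simp_all)
    then have "?\<pi> (x \<otimes> y) \<in> T" using T.m_closed[OF xy(2,4)] by simp
    then show "x \<otimes> y \<in> P'" using xy(1,3) by (simp add: P'_def)
  qed
  have NP': "N \<subseteq> P'"
  proof
    fix x assume x: "x \<in> N"
    have "?\<pi> x = N" by (rule subgroup.rcos_const[OF sN is_group x])
    then show "x \<in> P'" using x NP T.one_closed oM by (auto simp: P'_def)
  qed
  have \<pi>P': "?\<pi> ` P' = T" using T(2) by (auto simp: P'_def)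
  have ind: "card (rcosets N) = card (rcosets P) * (p ^ a * m)"
    using index_tower(1)[OF sN P NP] T(4) by simp
  have ind': "card (rcosets N) = card (rcosets P') * p ^ a"
    using index_tower(1)[OF sN P' NP'] T(3) \<pi>P' by simp
  have "p ^ a \<noteq> 0" using prime_gt_0_nat[OF p] by simp
  moreover have "card (rcosets P') * p ^ a = (card (rcosets P) * m) * p ^ a"
    unfolding ind'[symmetric] ind by (simp only: ac_simps)
  ultimately have "card (rcosets P') = card (rcosets P) * m" by (simp only: mult_cancel2) blast
  then have iP': "\<not> p dvd card (rcosets P')" using iP T(5) prime_dvd_mult_iff[OF p] by simp
  have pair: "sylow_pair p P' N"
    unfolding sylow_pair_def using P' N NP' iP' \<pi>P' T(3) by blast
  have full: "P \<subseteq> D" if D: "subgroup D G" "D \<subseteq> P" "V \<subseteq> D" "P' \<subseteq> D" for D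
  proof -
    have "card (rcosets P') = card (rcosets D) * card ((\<lambda>x. P' #> x) ` D)" by (rule index_tower(1)[OF P' D(1,4)])
    then have iD: "\<not> p dvd card (rcosets D)" using iP' by (metis dvd_mult2)
    have VD: "card (rcosets V) = card (rcosets D) * card ((\<lambda>x. V #> x) ` D)" by (rule index_tower(1)[OF sV D(1,3)])
    have VP': "card (rcosets V) = card (rcosets P) * p ^ c" using index_tower(1)[OF sV P VP] c by simp
    interpret MV: group "G Mod V" by (rule normal.factorgroup_is_group[OF V])
    interpret \<sigma>: group_hom G "G Mod V" "\<lambda>x. V #> x"
      by unfold_locales (rule normal.r_coset_hom_Mod[OF V])
    obtain d where d: "card ((\<lambda>x. V #> x) ` D) = p ^ d"
      using MV.p_group_subgroup[OF \<sigma>.subgroup_img_is_subgroup[OF P] c p \<sigma>.subgroup_img_is_subgroup[OF D(1)] image_mono[OF D(2)]]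
      by blast
    have "card (rcosets D) * p ^ d = card (rcosets P) * p ^ c" using VD VP' d by simp
    then have "d = c" by (rule prime_power_part_unique[OF p _ iD iP])
    then have cDP: "card ((\<lambda>x. V #> x) ` D) = card ((\<lambda>x. V #> x) ` P)" unfolding c d by simp
    have "card ((\<lambda>x. V #> x) ` P) > 0" unfolding c using prime_gt_0_nat[OF p] by simp
    then have "finite ((\<lambda>x. V #> x) ` P)" by (rule card_ge_0_finite)
    then have e: "(\<lambda>x. V #> x) ` D = (\<lambda>x. V #> x) ` P" by (rule card_subset_eq[OF _ image_mono[OF D(2)] cDP])
    show "P \<subseteq> D"
    proof
      fix x assume x: "x \<in> P"
      have "V #> x \<in> (\<lambda>x. V #> x) ` D" unfolding e by (rule imageI[OF x])
      then obtain y where y: "V #> x = V #> y" "y \<in> D" by (rule imageE)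
      have cc: "x \<in> carrier G" "y \<in> carrier G" using x y(2) D(2) P.subset by blast+
      have "x \<otimes> inv y \<in> D" using rcos_eq_iff[OF sV cc] y(1) D(3) by blast
      then have "x \<otimes> inv y \<otimes> y \<in> D" by (rule subgroup.m_closed[OF D(1) _ y(2)])
      then show "x \<in> D" using cc by (simp add: m_assoc)
    qed
  qed
  show thesis using that pair P'P full by blast
qed

text \<open>Restriction is injective in any case; the maximality of the number of characters makes it surjective, so
  that the hypothesis of Tate's theorem passes to all smaller \<open>N\<close>.\<close>

lemma characters_restrict:
  assumes PV: "sylow_pair p P V" and max: "\<And>P' V'. sylow_pair p P' V' \<Longrightarrow> card (characters p P' V') \<le> card (characters p P V)"
    and P': "sylow_pair p P' N" "P' \<subseteq> P" "N \<subseteq> V"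
    and full: "\<And>D. subgroup D G \<Longrightarrow> D \<subseteq> P \<Longrightarrow> V \<subseteq> D \<Longrightarrow> P' \<subseteq> D \<Longrightarrow> P \<subseteq> D"
    and r: "rank_at_most r" and p: "prime p"
  shows "(\<lambda>\<chi>. restrict \<chi> P') ` characters p P V = characters p P' N"
proof (rule card_seteq)
  have P: "subgroup P G" and V: "V \<lhd> G" and VP: "V \<subseteq> P" using PV by (auto simp: sylow_pair_def)
  have sP': "subgroup P' G" and N: "N \<lhd> G" "N \<subseteq> P'" "finite (rcosets N)" using P' by (auto simp: sylow_pair_def)
  show "finite (characters p P' N)"
    by (rule card_characters_le(1)[OF r sP' normal_imp_subgroup[OF N(1)] N(2,3) p])
  show "(\<lambda>\<chi>. restrict \<chi> P') ` characters p P V \<subseteq> characters p P' N"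
  proof
    fix f assume "f \<in> (\<lambda>\<chi>. restrict \<chi> P') ` characters p P V"
    then obtain \<chi> where \<chi>: "\<chi> \<in> characters p P V" "f = restrict \<chi> P'" by blast
    interpret P': subgroup P' G by (rule sP')
    have "additive_mod p P' f"
      using \<chi> P'(2) by (simp add: characters_def additive_mod_def subset_iff)
    then show "f \<in> characters p P' N"
      using \<chi> P'(2,3) N(2) by (auto simp: characters_def PiE_iff subset_iff)
  qed
  have "inj_on (\<lambda>\<chi>. restrict \<chi> P') (characters p P V)"
  proof (rule inj_onI)
    fix \<chi> \<psi> assume c: "\<chi> \<in> characters p P V" "\<psi> \<in> characters p P V" and e: "restrict \<chi> P' = restrict \<psi> P'"
    have "\<chi> x = \<psi> x" if "x \<in> P'" for x using fun_cong[OF e, of x] that by simp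
    then show "\<chi> = \<psi>" by (intro characters_eqI[OF P c full VP P'(2)])
  qed
  then have "card ((\<lambda>\<chi>. restrict \<chi> P') ` characters p P V) = card (characters p P V)" by (rule card_image)
  then show "card (characters p P' N) \<le> card ((\<lambda>\<chi>. restrict \<chi> P') ` characters p P V)" using max[OF P'(1)] by simp
qed

text \<open>Tate's theorem in \<open>G/N\<close>, for the Sylow subgroup \<open>P'/N\<close> and the
  normal subgroup \<open>Q/N\<close>. A character of \<open>P'\<close> trivial on \<open>N\<close>
  is, by maximality, the restriction of a character of \<open>P\<close> trivial on \<open>V\<close>;
  since \<open>Q \<subseteq> V\<close>, it vanishes on \<open>P' \<inter> Q\<close>.\<close>

lemma sylow_pair_retraction:
  assumes PV: "sylow_pair p P V" and max: "\<And>P' V'. sylow_pair p P' V' \<Longrightarrow> card (characters p P' V') \<le> card (characters p P V)"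
    and r: "rank_at_most r" and p: "prime p"
    and N: "N \<lhd> G" "finite (rcosets N)" and Q: "Q \<lhd> G" "N \<subseteq> Q" "Q \<subseteq> V"
  shows "let Q = (G Mod N)\<lparr>carrier := (\<lambda>v. N #> v) ` Q\<rparr> in
      \<exists>r a. r \<in> hom Q Q \<and> card (r ` carrier Q) = p ^ a \<and> \<not> p dvd card {x \<in> carrier Q. r x = \<one>\<^bsub>Q\<^esub>}"
proof -
  have P: "subgroup P G" and V: "V \<lhd> G" and VP: "V \<subseteq> P" using PV by (auto simp: sylow_pair_def)
  have NV: "N \<subseteq> V" using Q by blast
  obtain P' where P': "sylow_pair p P' N" "P' \<subseteq> P"
    and full: "\<And>D. subgroup D G \<Longrightarrow> D \<subseteq> P \<Longrightarrow> V \<subseteq> D \<Longrightarrow> P' \<subseteq> D \<Longrightarrow> P \<subseteq> D"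
    using sylow_pair_refine[OF PV p N NV] by blast
  have restr: "(\<lambda>\<chi>. restrict \<chi> P') ` characters p P V = characters p P' N"
    by (rule characters_restrict[OF PV max P' NV full r p])
  have sP': "subgroup P' G" and NP': "N \<subseteq> P'" and iP': "\<not> p dvd card (rcosets P')" using P' by (auto simp: sylow_pair_def)
  obtain a where a: "card ((\<lambda>x. N #> x) ` P') = p ^ a" using P'(1) by (auto simp: sylow_pair_def)
  have sN: "subgroup N G" and sQ: "subgroup Q G" using N(1) Q(1) normal_imp_subgroup by blast+
  interpret N: subgroup N G by (rule sN)
  interpret Q: subgroup Q G by (rule sQ)
  interpret P': subgroup P' G by (rule sP')
  interpret M: group "G Mod N" by (rule normal.factorgroup_is_group[OF N(1)])
  let ?\<pi> = "\<lambda>x. N #> x"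
  interpret \<pi>: group_hom G "G Mod N" ?\<pi>
    by unfold_locales (rule normal.r_coset_hom_Mod[OF N(1)])
  have oM: "\<one>\<^bsub>G Mod N\<^esub> = N" and cM: "carrier (G Mod N) = rcosets N" by (simp_all add: FactGroup_def)
  have sT: "subgroup (?\<pi> ` P') (G Mod N)" and sQ': "subgroup (?\<pi> ` Q) (G Mod N)"
    using \<pi>.subgroup_img_is_subgroup sP' sQ by blast+
  interpret T: subgroup "?\<pi> ` P'" "G Mod N" by (rule sT)
  interpret Q': subgroup "?\<pi> ` Q" "G Mod N" by (rule sQ')
  have fin: "finite (carrier (G Mod N))" using N(2) cM by simp
  have card: "card (carrier (G Mod N)) = p ^ a * card (rcosets P')"
    unfolding cM using index_tower(1)[OF sN sP' NP'] a by simp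
  have nb: "M.normalized_by (carrier (G Mod N)) (?\<pi> ` Q)"
    unfolding M.normalized_by_def
  proof (intro ballI)
    fix C D assume C: "C \<in> carrier (G Mod N)" and D: "D \<in> ?\<pi> ` Q"
    obtain g where g: "g \<in> carrier G" "C = ?\<pi> g" using C by (auto simp: cM rcosets_eq_image)
    obtain q where q: "q \<in> Q" "D = ?\<pi> q" using D by blast
    have "conj_by g q \<in> Q" by (rule normal.inv_op_closed2[OF Q(1) g(1) q(1)])
    moreover have "?\<pi> (conj_by g q) = C \<otimes>\<^bsub>G Mod N\<^esub> D \<otimes>\<^bsub>G Mod N\<^esub> inv\<^bsub>G Mod N\<^esub> C"
      using \<pi>.hom_mult[of "g \<otimes> q" "inv g"] \<pi>.hom_mult[of g q] \<pi>.hom_inv[OF g(1)] g q by simp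
    ultimately show "C \<otimes>\<^bsub>G Mod N\<^esub> D \<otimes>\<^bsub>G Mod N\<^esub> inv\<^bsub>G Mod N\<^esub> C \<in> ?\<pi> ` Q" by (metis image_eqI)
  qed
  have van: "M.characters_vanish p (?\<pi> ` P') (?\<pi> ` Q)"
    unfolding M.characters_vanish_def
  proof (intro allI impI ballI)
    fix \<chi> :: "'a set \<Rightarrow> nat" and C
    assume "\<forall>x\<in>?\<pi> ` P'. \<forall>y\<in>?\<pi> ` P'. [\<chi> (x \<otimes>\<^bsub>G Mod N\<^esub> y) = \<chi> x + \<chi> y] (mod p)"
      and C: "C \<in> ?\<pi> ` P' \<inter> ?\<pi> ` Q"
    then have \<chi>: "[\<chi> (?\<pi> x \<otimes>\<^bsub>G Mod N\<^esub> ?\<pi> y) = \<chi> (?\<pi> x) + \<chi> (?\<pi> y)] (mod p)" if "x \<in> P'" "y \<in> P'" for x y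
      using that by blast
    define f where "f = restrict (\<lambda>x. \<chi> (?\<pi> x) mod p) P'"
    have add: "additive_mod p P' f"
      unfolding additive_mod_def
    proof (intro ballI)
      fix x y assume xy: "x \<in> P'" "y \<in> P'"
      have "?\<pi> (x \<otimes> y) = ?\<pi> x \<otimes>\<^bsub>G Mod N\<^esub> ?\<pi> y" by (rule \<pi>.hom_mult) (use xy in simp_all)
      then have "[\<chi> (?\<pi> (x \<otimes> y)) = \<chi> (?\<pi> x) + \<chi> (?\<pi> y)] (mod p)" using \<chi>[OF xy] by simp
      then show "[f (x \<otimes> y) = f x + f y] (mod p)" using xy by (simp add: f_def cong_def mod_add_eq)
    qed
    have z: "f x = 0" if x: "x \<in> N" for x
    proof -
      have o: "\<one> \<in> N" "\<one> \<in> P'" by simp_all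
      have "?\<pi> x = N" "?\<pi> \<one> = N" using N.rcos_const[OF is_group] x o by blast+
      then have "f x = f \<one>" using x NP' by (auto simp: f_def)
      moreover have "[f \<one> = 0] (mod p)" by (rule additive_mod_one[OF add o(2)])
      ultimately show ?thesis by (simp add: f_def cong_def)
    qed
    have "f \<in> characters p P' N"
      using add z prime_gt_0_nat[OF p] by (simp add: characters_def f_def)
    then obtain \<psi> where \<psi>: "\<psi> \<in> characters p P V" "f = restrict \<psi> P'" using restr by blast
    obtain x where x: "x \<in> P'" "C = ?\<pi> x" using C by blast
    obtain q where q: "q \<in> Q" "C = ?\<pi> q" using C by blast
    have "x \<otimes> inv q \<in> N" using rcos_eq_iff[OF sN, of x q] x q by simp
    then have "x \<otimes> inv q \<otimes> q \<in> Q" using Q(2) Q.m_closed q(1) by blast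
    then have "x \<in> V" using Q(3) x(1) q(1) by (simp add: m_assoc subset_iff)
    then have "f x = 0" using \<psi> x(1) by (simp add: characters_def)
    then show "[\<chi> C = 0] (mod p)" using x by (simp add: f_def cong_def)
  qed
  obtain \<rho> where "(\<forall>x\<in>?\<pi> ` Q. \<forall>y\<in>?\<pi> ` Q. \<rho> (x \<otimes>\<^bsub>G Mod N\<^esub> y) = \<rho> x \<otimes>\<^bsub>G Mod N\<^esub> \<rho> y)
    \<and> \<rho> ` ?\<pi> ` Q \<subseteq> ?\<pi> ` P' \<inter> ?\<pi> ` Q \<and> \<not> p dvd card {x \<in> ?\<pi> ` Q. \<rho> x = \<one>\<^bsub>G Mod N\<^esub>}"
    by (rule exE[OF M.tate_retraction[OF sT a p fin card iP' sQ' nb van]])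
  note \<rho> = this[THEN conjunct1] this[THEN conjunct2, THEN conjunct1] this[THEN conjunct2, THEN conjunct2]
  define QM where "QM = (G Mod N)\<lparr>carrier := ?\<pi> ` Q\<rparr>"
  have QM: "carrier QM = ?\<pi> ` Q" "(\<otimes>\<^bsub>QM\<^esub>) = (\<otimes>\<^bsub>G Mod N\<^esub>)" "\<one>\<^bsub>QM\<^esub> = \<one>\<^bsub>G Mod N\<^esub>" by (simp_all add: QM_def)
  have gQ: "group QM" unfolding QM_def by (rule M.subgroup_imp_group[OF sQ'])
  have hom: "\<rho> \<in> hom QM QM"
    unfolding hom_def mem_Collect_eq QM
  proof
    have "\<rho> ` ?\<pi> ` Q \<subseteq> ?\<pi> ` Q" using \<rho>(2) by (rule order_trans) (rule Int_lower2)
    then show "\<rho> \<in> ?\<pi> ` Q \<rightarrow> ?\<pi> ` Q" by (simp only: image_subset_iff_funcset)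
  qed (rule \<rho>(1))
  have "group_hom QM QM \<rho>" using gQ hom by (simp add: group_hom_def group_hom_axioms_def)
  then have "subgroup (\<rho> ` carrier QM) QM" by (rule group_hom.img_is_subgroup)
  then have sI: "subgroup (\<rho> ` ?\<pi> ` Q) (G Mod N)"
    unfolding QM(1) unfolding QM_def by (rule M.incl_subgroup[OF sQ'])
  have "\<rho> ` ?\<pi> ` Q \<subseteq> ?\<pi> ` P'" using \<rho>(2) by (rule order_trans) (rule Int_lower1)
  then obtain b where b: "card (\<rho> ` ?\<pi> ` Q) = p ^ b" by (rule exE[OF M.p_group_subgroup[OF sT a p sI]])
  have "\<exists>r a. r \<in> hom QM QM \<and> card (r ` carrier QM) = p ^ a \<and> \<not> p dvd card {x \<in> carrier QM. r x = \<one>\<^bsub>QM\<^esub>}"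
    by (intro exI[of _ \<rho>] exI[of _ b] conjI hom) (simp_all only: QM b \<rho>(3) not_False_eq_True)
  then show ?thesis unfolding QM_def Let_def .
qed

text \<open>The number of characters is at most \<open>p ^ r\<close>, so for each prime up to
  \<open>n\<close> some pair attains the maximum; \<open>V\<close> is the intersection of the
  finitely many normal subgroups found. One \<open>V\<close> serves all these primes because
  \<open>sylow_pair_retraction\<close> applies to every smaller normal \<open>Q\<close>.\<close>

lemma prime_retractions_exist:
  assumes r: "rank_at_most r"
  obtains V where "V \<lhd> G" "finite (rcosets V)" "\<And>K. K \<lhd> G \<Longrightarrow> finite (rcosets K) \<Longrightarrow> prime_retractions n V (V \<inter> K)"
proof -
  have self: "carrier G \<lhd> G" by (rule normal_self)
  have ex: "\<exists>V P. sylow_pair p P V \<and> (\<forall>P' V'. sylow_pair p P' V' \<longrightarrow> card (characters p P' V') \<le> card (characters p P V))"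
    if p: "prime p" for p
  proof -
    have c: "(\<lambda>x. carrier G #> x) ` carrier G = {carrier G}"
      using coset_join2[OF _ subgroup_self] one_closed by (auto simp: image_def)
    then have "sylow_pair p (carrier G) (carrier G)"
      unfolding sylow_pair_def rcosets_eq_image using self subgroup_self p by (auto intro: exI[of _ 0])
    moreover have "card (characters p P V) < Suc (p ^ r)" if "sylow_pair p P V" for P V
    proof -
      have "subgroup P G" "subgroup V G" "V \<subseteq> P" "finite (rcosets V)"
        using that normal_imp_subgroup by (auto simp: sylow_pair_def)
      then show ?thesis using card_characters_le(2)[OF r _ _ _ _ p] by (simp add: less_Suc_eq_le)
    qed
    ultimately have "\<exists>x. sylow_pair p (fst x) (snd x) \<and> (\<forall>y. sylow_pair p (fst y) (snd y) \<longrightarrow>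
        card (characters p (fst y) (snd y)) \<le> card (characters p (fst x) (snd x)))"
      by (intro ex_has_greatest_nat[of "\<lambda>x. sylow_pair p (fst x) (snd x)" "(carrier G, carrier G)"]) auto
    then show ?thesis by auto
  qed
  define L where "L = {l. prime l \<and> l \<le> n}"
  have "\<forall>l\<in>L. \<exists>V. \<exists>P. sylow_pair l P V \<and> (\<forall>P' V'. sylow_pair l P' V' \<longrightarrow> card (characters l P' V') \<le> card (characters l P V))"
    by (rule ballI, rule ex) (simp add: L_def)
  then obtain F where F: "\<forall>l\<in>L. \<exists>P. sylow_pair l P (F l) \<and> (\<forall>P' V'. sylow_pair l P' V' \<longrightarrow> card (characters l P' V') \<le> card (characters l P (F l)))"
    by (rule exE[OF bchoice])
  have Fn: "F l \<lhd> G" "finite (rcosets (F l))" if "l \<in> L" for l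
    using bspec[OF F that] by (auto simp: sylow_pair_def)
  have "\<exists>V. V \<lhd> G \<and> finite (rcosets V) \<and> (\<forall>l\<in>I. V \<subseteq> F l)" if "finite I" "I \<subseteq> L" for I
    using that
  proof (induction I)
    case empty
    have "(\<lambda>x. carrier G #> x) ` carrier G \<subseteq> {carrier G}" using coset_join2[OF _ subgroup_self] by auto
    then have "finite (rcosets (carrier G))" unfolding rcosets_eq_image using finite_subset by blast
    then show ?case using self by blast
  next
    case (insert l I)
    then obtain V where V: "V \<lhd> G" "finite (rcosets V)" "\<forall>l\<in>I. V \<subseteq> F l" by blast
    have l: "F l \<lhd> G" "finite (rcosets (F l))" using Fn insert by blast+
    have "V \<inter> F l \<lhd> G" by (rule normal_subgroup_intersect[OF V(1) l(1)]) 
    moreover have "finite (rcosets (V \<inter> F l))"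
      by (rule finite_index_Int[OF normal_imp_subgroup[OF V(1)] V(2) normal_imp_subgroup[OF l(1)] l(2)])
    ultimately show ?case using V(3) by blast
  qed
  moreover have "finite L" by (simp add: L_def)
  ultimately obtain V where V: "V \<lhd> G" "finite (rcosets V)" "\<forall>l\<in>L. V \<subseteq> F l" by blast
  have "prime_retractions n V (V \<inter> K)" if K: "K \<lhd> G" "finite (rcosets K)" for K
    unfolding prime_retractions_def
  proof (intro allI impI)
    fix l :: nat assume l: "prime l" "l \<le> n"
    then have lL: "l \<in> L" by (simp add: L_def)
    obtain P where P: "sylow_pair l P (F l)" "\<And>P' V'. sylow_pair l P' V' \<Longrightarrow> card (characters l P' V') \<le> card (characters l P (F l))"
      using bspec[OF F lL] by blast
    have VK: "V \<inter> K \<lhd> G" by (rule normal_subgroup_intersect[OF V(1) K(1)])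
    have fVK: "finite (rcosets (V \<inter> K))"
      by (rule finite_index_Int[OF normal_imp_subgroup[OF V(1)] V(2) normal_imp_subgroup[OF K(1)] K(2)])
    show "let Q = (G Mod (V \<inter> K))\<lparr>carrier := (\<lambda>v. V \<inter> K #> v) ` V\<rparr> in
      \<exists>r a. r \<in> hom Q Q \<and> card (r ` carrier Q) = l ^ a \<and> \<not> l dvd card {x \<in> carrier Q. r x = \<one>\<^bsub>Q\<^esub>}"
      by (rule sylow_pair_retraction[OF P r l(1) VK fVK V(1) Int_lower1 bspec[OF V(3) lL]])
  qed
  then show thesis using that V(1,2) by blast
qed

end

subsection \<open>Reduction of linear groups to finite fields\<close>

lemma GL_simps: "carrier (GL n) = Units (ring_mat TYPE('f::field) n ())" "(\<otimes>\<^bsub>GL n\<^esub>) = ((*) :: 'f mat \<Rightarrow> 'f mat \<Rightarrow> 'f mat)"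
  "\<one>\<^bsub>GL n\<^esub> = (1\<^sub>m n :: 'f mat)"
  by (simp_all add: GL_def units_of_def ring_mat_def)

lemma GL_carrier: "g \<in> carrier (GL n) \<Longrightarrow> g \<in> carrier_mat n n"
  by (auto simp: GL_simps Units_def ring_mat_def)

lemma group_GL: "group (GL n :: 'f::field mat monoid)"
proof -
  have "ring (ring_mat TYPE('f) n ())" by (rule ring_mat)
  then show ?thesis unfolding GL_def by (intro monoid.units_group ring.is_monoid)
qed

lemma sum_kronecker:
  fixes f :: "nat \<Rightarrow> 'b::comm_ring_1"
  assumes "i < n"
  shows "(\<Sum>j<n. (if i = j then 1 else 0) * f j) = f i" "(\<Sum>j<n. f j * (if j = i then 1 else 0)) = f i"
proof -
  have "(\<Sum>j<n. (if i = j then 1 else 0) * f j) = (\<Sum>j<n. if i = j then f j else 0)"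
    "(\<Sum>j<n. f j * (if j = i then 1 else 0)) = (\<Sum>j<n. if j = i then f j else 0)"
    by (rule sum.cong; simp)+
  then show "(\<Sum>j<n. (if i = j then 1 else 0) * f j) = f i" "(\<Sum>j<n. f j * (if j = i then 1 else 0)) = f i"
    using assms by simp_all
qed

lemma index_mult: "A \<in> carrier_mat n n \<Longrightarrow> B \<in> carrier_mat n n \<Longrightarrow> i < n \<Longrightarrow> j < n \<Longrightarrow>
    (A * B) $$ (i, j) = (\<Sum>l<n. A $$ (i, l) * B $$ (l, j))"
  by (simp add: scalar_prod_def atLeast0LessThan)

lemma vector_space_fun: "vector_space (\<lambda>c v i. c * v i :: 'k::field)"
  by unfold_locales (auto simp: fun_eq_iff algebra_simps)

definition entries_in :: "nat \<Rightarrow> 'f set \<Rightarrow> 'f mat \<Rightarrow> bool"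
  where "entries_in n R g \<longleftrightarrow> (\<forall>i<n. \<forall>j<n. g $$ (i, j) \<in> R)"

text \<open>The congruence subgroup of \<open>\<phi>\<close>, written out entrywise.\<close>

definition reduction_kernel :: "nat \<Rightarrow> 'f::field mat set \<Rightarrow> ('f \<Rightarrow> 'k::field) \<Rightarrow> 'f mat set"
  where "reduction_kernel n \<Gamma> \<phi> = {g \<in> \<Gamma>. \<forall>i<n. \<forall>j<n. \<phi> (g $$ (i, j)) = (if i = j then 1 else 0)}"

lemma (in group) exp_of_derived_consistent:
  assumes "subgroup H G" "K \<subseteq> H"
  shows "(derived (G\<lparr>carrier := H\<rparr>) ^^ k) K = (derived G ^^ k) K"
proof (induction k)
  case (Suc k)
  have "(derived G ^^ k) K \<subseteq> H"
    using group.exp_of_derived_in_carrier[OF subgroup_imp_group[OF assms(1)], of K k] assms(2) Suc by simp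
  then show ?case using Suc derived_consistent[OF _ assms(1)] by simp
qed simp

text \<open>\<open>\<phi>\<close> sends the ring \<open>R\<close> of entries to a finite ring inside
  an algebraically closed field, so \<open>\<Gamma>\<close> is reduced to a finite linear group
  whose eigenvalues are available.\<close>

locale matrix_reduction =
  fixes n :: nat and \<Gamma> :: "'f::field mat set" and R :: "'f set" and \<phi> :: "'f \<Rightarrow> 'k::alg_closed_field"
  assumes \<Gamma>: "subgroup \<Gamma> (GL n)" and R: "subring_set R" and entries: "\<And>g. g \<in> \<Gamma> \<Longrightarrow> entries_in n R g"
    and \<phi>: "ring_map R \<phi>" and finite_image: "finite (\<phi> ` R)"
begin

abbreviation G where "G \<equiv> GL n\<lparr>carrier := \<Gamma>\<rparr>"

sublocale G: group G
  by (rule group.subgroup_imp_group[OF group_GL \<Gamma>])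

lemma mem: "g \<in> \<Gamma> \<Longrightarrow> g \<in> carrier_mat n n"
  using GL_carrier subgroup.mem_carrier[OF \<Gamma>] by blast

lemma entry: "g \<in> \<Gamma> \<Longrightarrow> i < n \<Longrightarrow> j < n \<Longrightarrow> g $$ (i, j) \<in> R"
  using entries by (simp add: entries_in_def)

lemma mult_eq: "(\<otimes>\<^bsub>G\<^esub>) = (*)"
  by (simp add: GL_simps)

lemma reduction_mult:
  assumes "g \<in> \<Gamma>" "h \<in> \<Gamma>" "i < n" "j < n"
  shows "\<phi> ((g * h) $$ (i, j)) = (\<Sum>l<n. \<phi> (g $$ (i, l)) * \<phi> (h $$ (l, j)))"
proof -
  have "\<phi> ((g * h) $$ (i, j)) = (\<Sum>l<n. \<phi> (g $$ (i, l) * h $$ (l, j)))"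
    unfolding index_mult[OF mem[OF assms(1)] mem[OF assms(2)] assms(3,4)]
    by (rule ring_map_closed(4)[OF \<phi> R]) (use assms entry subring_setD(5)[OF R] in auto)
  also have "\<dots> = (\<Sum>l<n. \<phi> (g $$ (i, l)) * \<phi> (h $$ (l, j)))"
    using assms entry by (intro sum.cong refl ring_mapD(3)[OF \<phi>]) auto
  finally show ?thesis .
qed

lemma reduction_one: "i < n \<Longrightarrow> j < n \<Longrightarrow> \<phi> (1\<^sub>m n $$ (i, j)) = (if i = j then 1 else 0)"
  by (simp add: ring_mapD(1)[OF \<phi>] ring_map_closed(1)[OF \<phi> R])

text \<open>The reduced matrix padded with 0; it is determined by finitely many values in a finite
  set and serves to count cosets.\<close>

definition red :: "'f mat \<Rightarrow> nat \<Rightarrow> nat \<Rightarrow> 'k"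
  where "red g i j = (if i < n \<and> j < n then \<phi> (g $$ (i, j)) else 0)"

text \<open>Vectors are functions on all natural numbers. The coordinates from \<open>n\<close> on
  stay fixed, so that the identity matrix acts as the identity; the space of dimension
  \<open>n\<close> is cut out where dimensions matter.\<close>

definition act :: "'f mat \<Rightarrow> (nat \<Rightarrow> 'k) \<Rightarrow> nat \<Rightarrow> 'k"
  where "act g v i = (if i < n then \<Sum>j<n. \<phi> (g $$ (i, j)) * v j else v i)"

lemma act_mult:
  assumes g: "g \<in> \<Gamma>" and h: "h \<in> \<Gamma>"
  shows "act (g * h) v = act g (act h v)"
proof
  fix i
  show "act (g * h) v i = act g (act h v) i"
  proof (cases "i < n")
    case True
    have "act (g * h) v i = (\<Sum>j<n. (\<Sum>l<n. \<phi> (g $$ (i, l)) * \<phi> (h $$ (l, j))) * v j)"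
      using True reduction_mult[OF g h True] by (simp add: act_def)
    also have "\<dots> = (\<Sum>j<n. \<Sum>l<n. \<phi> (g $$ (i, l)) * (\<phi> (h $$ (l, j)) * v j))"
      by (simp add: sum_distrib_right mult.assoc)
    also have "\<dots> = (\<Sum>l<n. \<Sum>j<n. \<phi> (g $$ (i, l)) * (\<phi> (h $$ (l, j)) * v j))" by (rule sum.swap)
    also have "\<dots> = act g (act h v) i" using True by (simp add: act_def sum_distrib_left)
    finally show ?thesis .
  qed (simp add: act_def)
qed

lemma act_one: "act (1\<^sub>m n) v = v"
proof
  fix i
  show "act (1\<^sub>m n) v i = v i"
  proof (cases "i < n")
    case True
    have "act (1\<^sub>m n) v i = (\<Sum>j<n. \<phi> (1\<^sub>m n $$ (i, j)) * v j)" using True by (simp only: act_def if_True)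
    also have "\<dots> = (\<Sum>j<n. (if i = j then 1 else 0) * v j)"
      by (rule sum.cong[OF refl]) (simp only: lessThan_iff reduction_one[OF True])
    also have "\<dots> = v i" by (rule sum_kronecker(1)[OF True])
    finally show ?thesis .
  qed (simp add: act_def)
qed

abbreviation K where "K \<equiv> reduction_kernel n \<Gamma> \<phi>"

lemma kernel_iff: "g \<in> \<Gamma> \<Longrightarrow> g \<in> K \<longleftrightarrow> (\<forall>v. act g v = v)"
proof
  assume g: "g \<in> \<Gamma>" and "g \<in> K"
  then have e: "\<phi> (g $$ (i, j)) = (if i = j then 1 else 0)" if "i < n" "j < n" for i j
    using that by (simp add: reduction_kernel_def)
  show "\<forall>v. act g v = v"
  proof (intro allI ext)
    fix v i
    have "act g v i = act (1\<^sub>m n) v i" by (simp add: act_def e reduction_one[symmetric] del: index_one_mat)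
    then show "act g v i = v i" by (simp add: act_one)
  qed
next
  assume g: "g \<in> \<Gamma>" and a: "\<forall>v. act g v = v"
  have "\<phi> (g $$ (i, j)) = (if i = j then 1 else 0)" if ij: "i < n" "j < n" for i j
  proof -
    have "\<phi> (g $$ (i, j)) = act g (\<lambda>l. if l = j then 1 else 0) i"
      using ij sum_kronecker(2)[OF ij(2), of "\<lambda>l. \<phi> (g $$ (i, l))"] by (simp add: act_def)
    then show ?thesis using a by simp
  qed
  then show "g \<in> K" using g by (simp add: reduction_kernel_def)
qed

lemma one_eq: "\<one>\<^bsub>G\<^esub> = 1\<^sub>m n"
  by (simp add: GL_simps)

lemma act_inv:
  assumes g: "g \<in> \<Gamma>"
  shows "act g (act (inv\<^bsub>G\<^esub> g) v) = v" "act (inv\<^bsub>G\<^esub> g) (act g v) = v"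
proof -
  have i: "inv\<^bsub>G\<^esub> g \<in> \<Gamma>" using G.inv_closed[of g] g by simp
  show "act g (act (inv\<^bsub>G\<^esub> g) v) = v" "act (inv\<^bsub>G\<^esub> g) (act g v) = v"
    using act_mult[OF g i, of v] act_mult[OF i g, of v] G.r_inv[of g] G.l_inv[of g] g act_one
    by (simp_all add: mult_eq one_eq)
qed

lemma normal_kernel: "K \<lhd> G"
proof -
  have "subgroup K G"
  proof (rule G.subgroupI)
    show "K \<subseteq> carrier G" by (auto simp: reduction_kernel_def)
    have "1\<^sub>m n \<in> \<Gamma>" using G.one_closed by (simp add: one_eq)
    then show "K \<noteq> {}" using kernel_iff[of "1\<^sub>m n"] act_one by blast
  next
    fix g assume g: "g \<in> K"
    then have g': "g \<in> \<Gamma>" "inv\<^bsub>G\<^esub> g \<in> \<Gamma>" using G.inv_closed[of g] by (auto simp: reduction_kernel_def)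
    then show "inv\<^bsub>G\<^esub> g \<in> K" using kernel_iff g act_inv(2)[OF g'(1)] by metis
  next
    fix g h assume gh: "g \<in> K" "h \<in> K"
    then have g': "g \<in> \<Gamma>" "h \<in> \<Gamma>" "g * h \<in> \<Gamma>" using G.m_closed[of g h] by (auto simp: reduction_kernel_def mult_eq)
    then have "g * h \<in> K" using kernel_iff gh act_mult by metis
    then show "g \<otimes>\<^bsub>G\<^esub> h \<in> K" by (simp add: mult_eq)
  qed
  moreover have "x \<otimes>\<^bsub>G\<^esub> h \<otimes>\<^bsub>G\<^esub> inv\<^bsub>G\<^esub> x \<in> K" if x: "x \<in> carrier G" and h: "h \<in> K" for x h
  proof -
    have c: "x \<in> \<Gamma>" "h \<in> \<Gamma>" "inv\<^bsub>G\<^esub> x \<in> \<Gamma>" using x h G.inv_closed[OF x] by (auto simp: reduction_kernel_def)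
    have xh: "x * h \<in> \<Gamma>" "x * h * inv\<^bsub>G\<^esub> x \<in> \<Gamma>"
      using G.m_closed[of x h] G.m_closed[of "x * h" "inv\<^bsub>G\<^esub> x"] c by (simp_all add: mult_eq)
    have "act (x * h * inv\<^bsub>G\<^esub> x) v = v" for v
      using kernel_iff[OF c(2)] h act_inv(1)[OF c(1)] by (simp add: act_mult xh(1) c)
    then show ?thesis using kernel_iff[OF xh(2)] by (simp add: mult_eq)
  qed
  ultimately show ?thesis using G.normal_inv_iff by blast
qed

lemma red_eq_imp_coset_eq:
  assumes g: "g \<in> \<Gamma>" and h: "h \<in> \<Gamma>" and e: "red g = red h"
  shows "K #>\<^bsub>G\<^esub> g = K #>\<^bsub>G\<^esub> h"
proof -
  have a: "act g v = act h v" for v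
  proof
    fix i
    have "\<phi> (g $$ (i, j)) = \<phi> (h $$ (i, j))" if "i < n" "j < n" for j
      using fun_cong[OF fun_cong[OF e], of i j] that by (simp add: red_def)
    then show "act g v i = act h v i" by (simp add: act_def)
  qed
  have i: "inv\<^bsub>G\<^esub> h \<in> \<Gamma>" using G.inv_closed[of h] h by simp
  have gi: "g * inv\<^bsub>G\<^esub> h \<in> \<Gamma>" using G.m_closed[of g "inv\<^bsub>G\<^esub> h"] g i by (simp add: mult_eq)
  have "act (g * inv\<^bsub>G\<^esub> h) v = v" for v by (simp add: act_mult[OF g i] a act_inv(1)[OF h])
  then have "g \<otimes>\<^bsub>G\<^esub> inv\<^bsub>G\<^esub> h \<in> K" using kernel_iff[OF gi] by (simp add: mult_eq)
  then show ?thesis using G.rcos_eq_iff[of K g h] normal_imp_subgroup[OF normal_kernel] g h by simp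
qed

lemma finite_index_kernel: "finite (rcosets\<^bsub>G\<^esub> K)"
proof -
  have "rcosets\<^bsub>G\<^esub> K = (\<lambda>g. K #>\<^bsub>G\<^esub> g) ` \<Gamma>" by (auto simp: RCOSETS_def)
  moreover have "finite (red ` \<Gamma>)"
  proof -
    let ?F = "{f. \<forall>x. (x \<in> {..<n} \<times> {..<n} \<longrightarrow> f x \<in> \<phi> ` R) \<and> (x \<notin> {..<n} \<times> {..<n} \<longrightarrow> f x = 0)}"
    have fF: "finite ?F" by (rule finite_set_of_finite_funs) (simp_all add: finite_image)
    have "red ` \<Gamma> \<subseteq> curry ` ?F"
    proof
      fix f assume "f \<in> red ` \<Gamma>"
      then obtain g where g: "g \<in> \<Gamma>" "f = red g" by blast
      have m: "(\<lambda>(i, j). red g i j) \<in> ?F" using entry[OF g(1)] by (auto simp: red_def)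
      have e: "f = curry (\<lambda>(i, j). red g i j)" by (simp add: g curry_def)
      show "f \<in> curry ` ?F" by (subst e) (rule imageI[OF m])
    qed
    then show ?thesis by (rule finite_subset[OF _ finite_imageI[OF fF]])
  qed
  then have "finite ((\<lambda>g. K #>\<^bsub>G\<^esub> g) ` \<Gamma>)"
    by (rule finite_image_factor) (rule red_eq_imp_coset_eq)
  ultimately show ?thesis by (simp only:)
qed

text \<open>\<open>V/(V \<inter> K)\<close> is finite and acts faithfully on a space of dimension at
  most \<open>n\<close>, so \<open>finite_linear_solvable\<close> applies to it; a derived term that
  becomes trivial there lies in \<open>K\<close>.\<close>

lemma exp_of_derived_subset_kernel:
  assumes V: "V \<lhd> G" and ret: "G.prime_retractions n V (V \<inter> K)"
  shows "(derived G ^^ (4 * n + 1)) V \<subseteq> K"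
proof -
  interpret V: normal V G by fact
  interpret K: normal K G by (rule normal_kernel)
  have V\<Gamma>: "V \<subseteq> \<Gamma>" using V.subset by simp
  define N where "N = V \<inter> K"
  have "N \<lhd> G" unfolding N_def by (rule G.normal_subgroup_intersect[OF V normal_kernel])
  then interpret N: normal N G .
  let ?M = "G Mod N"
  let ?\<pi> = "\<lambda>v. N #>\<^bsub>G\<^esub> v"
  interpret M: group ?M by (rule N.factorgroup_is_group)
  interpret \<pi>: group_hom G ?M ?\<pi>
    by unfold_locales (rule N.r_coset_hom_Mod)
  have sV: "subgroup (?\<pi> ` V) ?M" by (rule \<pi>.subgroup_img_is_subgroup[OF V.subgroup_axioms])
  define Q where "Q = ?M\<lparr>carrier := ?\<pi> ` V\<rparr>"
  interpret Q: group Q unfolding Q_def by (rule M.subgroup_imp_group[OF sV])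
  have cQ: "carrier Q = ?\<pi> ` V" and oQ: "\<one>\<^bsub>Q\<^esub> = N" and mQ: "(\<otimes>\<^bsub>Q\<^esub>) = (\<otimes>\<^bsub>?M\<^esub>)"
    by (simp_all add: Q_def FactGroup_def)
  \<comment> \<open>Any representative of a coset may act, since the elements of \<open>N\<close>
    lie in \<open>K\<close> and act trivially.\<close>
  define \<rho> where "\<rho> C = act (SOME g. g \<in> C)" for C
  have \<rho>: "\<rho> (?\<pi> v) = act v" if v: "v \<in> \<Gamma>" for v
  proof -
    have "v \<in> ?\<pi> v" using G.rcos_self[of v N] N.subgroup_axioms v by simp
    then have "(SOME g. g \<in> ?\<pi> v) \<in> ?\<pi> v" by (rule someI)
    then obtain k where k: "k \<in> N" "(SOME g. g \<in> ?\<pi> v) = k * v" by (auto simp: r_coset_def mult_eq)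
    then have "k \<in> K" "k \<in> \<Gamma>" by (auto simp: N_def reduction_kernel_def)
    then have "act (k * v) w = act v w" for w using kernel_iff[of k] by (simp add: act_mult v)
    then show ?thesis unfolding \<rho>_def k(2) by blast
  qed
  have "finite (?\<pi> ` V)"
  proof (rule finite_image_factor[of "\<lambda>v. K #>\<^bsub>G\<^esub> v"])
    show "finite ((\<lambda>v. K #>\<^bsub>G\<^esub> v) ` V)"
      by (rule finite_subset[OF _ finite_index_kernel]) (use V\<Gamma> in \<open>auto simp: RCOSETS_def\<close>)
  next
    fix x y assume xy: "x \<in> V" "y \<in> V" "K #>\<^bsub>G\<^esub> x = K #>\<^bsub>G\<^esub> y"
    have c: "x \<in> carrier G" "y \<in> carrier G" using xy V.subset by blast+
    have "x \<otimes>\<^bsub>G\<^esub> inv\<^bsub>G\<^esub> y \<in> N"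
      unfolding N_def using G.rcos_eq_iff[OF K.subgroup_axioms c] xy V.m_closed[OF xy(1) V.m_inv_closed[OF xy(2)]] by blast
    then show "?\<pi> x = ?\<pi> y" using G.rcos_eq_iff[OF N.subgroup_axioms c] by blast
  qed
  then have finQ: "finite (carrier Q)" by (simp add: cQ)
  interpret vs: vector_space "\<lambda>c v i. c * v i :: 'k" by (rule vector_space_fun)
  interpret L: linear_group Q "\<lambda>c v i. c * v i :: 'k" \<rho>
  proof
    fix g v w assume "g \<in> carrier Q"
    then obtain x where x: "x \<in> V" "g = ?\<pi> x" by (auto simp: cQ)
    then have \<rho>g: "\<rho> g = act x" using \<rho> V\<Gamma> by blast
    show "\<rho> g (v + w) = \<rho> g v + \<rho> g w"
      unfolding \<rho>g by (auto simp: fun_eq_iff act_def algebra_simps sum.distrib)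
    fix c
    show "\<rho> g (\<lambda>i. c * v i) = (\<lambda>i. c * \<rho> g v i)"
      unfolding \<rho>g by (auto simp: fun_eq_iff act_def sum_distrib_left algebra_simps)
    fix h assume "h \<in> carrier Q"
    then obtain y where y: "y \<in> V" "h = ?\<pi> y" by (auto simp: cQ)
    have xy: "x \<in> \<Gamma>" "y \<in> \<Gamma>" using x(1) y(1) V\<Gamma> by blast+
    have "g \<otimes>\<^bsub>Q\<^esub> h = ?\<pi> (x * y)" using \<pi>.hom_mult[of x y] xy by (simp add: mQ x y mult_eq)
    moreover have "x * y \<in> \<Gamma>" using G.m_closed[of x y] xy by (simp add: mult_eq)
    ultimately show "\<rho> (g \<otimes>\<^bsub>Q\<^esub> h) v = \<rho> g (\<rho> h v)" using \<rho> xy x(2) y(2) by (simp add: act_mult)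
  next
    fix v
    have "\<one>\<^bsub>Q\<^esub> = ?\<pi> \<one>\<^bsub>G\<^esub>" using \<pi>.hom_one by (simp add: Q_def)
    then show "\<rho> \<one>\<^bsub>Q\<^esub> v = v" using \<rho>[of "1\<^sub>m n"] G.one_closed act_one by (simp add: one_eq)
  qed (rule finQ)
  define W where "W = {v :: nat \<Rightarrow> 'k. \<forall>i\<ge>n. v i = 0}"
  define e where "e j = (\<lambda>i. if i = j then 1 else 0 :: 'k)" for j :: nat
  have WB: "W \<subseteq> vs.span (e ` {..<n})"
  proof
    fix v assume v: "v \<in> W"
    have "v = (\<Sum>j<n. (\<lambda>i. v j * e j i))"
    proof
      fix i
      have "(\<Sum>j<n. (\<lambda>i. v j * e j i)) i = (\<Sum>j<n. v j * e j i)"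
        by (induction n) (simp_all add: plus_fun_def zero_fun_def)
      also have "\<dots> = v i"
      proof (cases "i < n")
        case True
        then show ?thesis using sum_kronecker(1)[OF True, of v] by (simp add: e_def mult.commute)
      next
        case False
        then show ?thesis using v by (simp add: W_def e_def)
      qed
      finally show "v i = (\<Sum>j<n. (\<lambda>i. v j * e j i)) i" ..
    qed
    moreover have "(\<Sum>j<n. (\<lambda>i. v j * e j i)) \<in> vs.span (e ` {..<n})"
      by (intro vs.span_sum vs.span_scale vs.span_base) blast
    ultimately show "v \<in> vs.span (e ` {..<n})" by simp
  qed
  have dW: "vs.dim W \<le> n"
    using vs.dim_le_card[OF WB] card_image_le[of "{..<n}" e] by simp
  have stW: "L.stable (carrier Q) W"
    unfolding L.stable_def
  proof (intro conjI ballI)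
    show "vs.subspace W" by (rule vs.subspaceI) (auto simp: W_def)
  next
    fix g w assume "g \<in> carrier Q" "w \<in> W"
    then show "\<rho> g w \<in> W" using \<rho> V\<Gamma> by (auto simp: cQ W_def act_def subset_iff)
  qed
  have faithful: "g = \<one>\<^bsub>Q\<^esub>" if g: "g \<in> carrier Q" and t: "L.trivial_on {0} W g" for g
  proof -
    obtain x where x: "x \<in> V" "g = ?\<pi> x" using g by (auto simp: cQ)
    have x\<Gamma>: "x \<in> \<Gamma>" using x V\<Gamma> by blast
    have fixW: "act x w = w" if "w \<in> W" for w
      using t that \<rho>[OF x\<Gamma>] by (simp add: L.trivial_on_def x(2))
    have "\<phi> (x $$ (i, j)) = (if i = j then 1 else 0)" if ij: "i < n" "j < n" for i j
    proof -
      have "e j \<in> W" using ij by (auto simp: W_def e_def)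
      then have "act x (e j) i = e j i" using fixW by simp
      moreover have "act x (e j) i = \<phi> (x $$ (i, j))"
        using ij sum_kronecker(2)[OF ij(2), of "\<lambda>l. \<phi> (x $$ (i, l))"] by (simp add: act_def e_def)
      ultimately show ?thesis using ij by (simp add: e_def)
    qed
    then have "x \<in> N" using x(1) x\<Gamma> by (simp add: N_def reduction_kernel_def)
    then have "?\<pi> x = N" by (rule N.rcos_const[OF G.group_axioms])
    then show ?thesis using x(2) oQ by simp
  qed
  have "(derived Q ^^ (4 * n + 1)) (carrier Q) = {\<one>\<^bsub>Q\<^esub>}"
  proof (rule L.finite_linear_solvable[OF stW _ WB dW faithful])
    fix l :: nat assume l: "prime l" "l \<le> n"
    then show "\<exists>r a. r \<in> hom Q Q \<and> card (r ` carrier Q) = l ^ a \<and> \<not> l dvd card {x \<in> carrier Q. r x = \<one>\<^bsub>Q\<^esub>}"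
      using ret[unfolded G.prime_retractions_def Let_def, folded N_def, folded Q_def] l by blast
  qed simp_all
  moreover have "(derived Q ^^ (4 * n + 1)) (carrier Q) = (derived ?M ^^ (4 * n + 1)) (?\<pi> ` V)"
    unfolding cQ unfolding Q_def by (rule M.exp_of_derived_consistent[OF sV order_refl])
  moreover have "\<dots> = ?\<pi> ` (derived G ^^ (4 * n + 1)) V"
    by (rule \<pi>.exp_of_derived_img[OF V.subset])
  ultimately have e: "?\<pi> ` (derived G ^^ (4 * n + 1)) V = {N}" by (simp only: oQ)
  show ?thesis
  proof
    fix x assume x: "x \<in> (derived G ^^ (4 * n + 1)) V"
    have xc: "x \<in> carrier G" using G.exp_of_derived_in_carrier[OF V.subset] x by blast
    have "?\<pi> x = N" using e x by blast
    then have "x \<in> N" using G.rcos_self[OF xc N.subgroup_axioms] by blast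
    then show "x \<in> K" by (simp add: N_def)
  qed
qed

end

text \<open>What reduction modulo \<open>p\<close> yields, with the residue field and the
  homomorphism eliminated: the only type variable is \<open>'f\<close>, so the predicate makes sense
  for every number \<open>p\<close>. The field element \<open>a\<close> is the one that has to
  survive the reduction.\<close>

definition reduction_at :: "'f::field itself \<Rightarrow> nat \<Rightarrow> bool"
  where "reduction_at T p \<longleftrightarrow> (\<forall>n (\<Gamma> :: 'f mat set) xs a m.
    subgroup \<Gamma> (GL n) \<longrightarrow> (\<forall>g\<in>\<Gamma>. entries_in n (adjoin_list xs) g) \<longrightarrow> specialisation_chain xs a m \<longrightarrow>
    \<not> int p dvd m \<longrightarrow> (\<forall>k. of_int k = (0::'f) \<longrightarrow> int p dvd k) \<longrightarrow>
    (\<exists>K. K \<lhd> GL n\<lparr>carrier := \<Gamma>\<rparr> \<and> finite (rcosets\<^bsub>GL n\<lparr>carrier := \<Gamma>\<rparr>\<^esub> K) \<and>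
      (\<forall>g\<in>K. \<forall>i<n. \<forall>j<n. g $$ (i, j) - (if i = j then 1 else 0) \<noteq> a) \<and>
      (\<forall>V. V \<lhd> GL n\<lparr>carrier := \<Gamma>\<rparr> \<longrightarrow> group.prime_retractions (GL n\<lparr>carrier := \<Gamma>\<rparr>) n V (V \<inter> K) \<longrightarrow>
        (derived (GL n\<lparr>carrier := \<Gamma>\<rparr>) ^^ (4 * n + 1)) V \<subseteq> K)))"

text \<open>The reduction goes to the algebraic closure of the field with \<open>CARD('q)\<close>
  elements. An integer vanishes there iff that prime divides it, which turns the conditions on
  \<open>m\<close> and on the characteristic of \<open>'f\<close> into those of
  \<open>specialisation_chain_ring_map\<close>.\<close>

lemma reduction_at_card: "reduction_at TYPE('f::field) CARD('q::prime_card)"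
  unfolding reduction_at_def
proof (intro allI impI)
  fix n :: nat and \<Gamma> :: "'f mat set" and xs a m
  assume \<Gamma>: "subgroup \<Gamma> (GL n)" and ent: "\<forall>g\<in>\<Gamma>. entries_in n (adjoin_list xs) g"
    and ch: "specialisation_chain xs a m" and m: "\<not> int CARD('q) dvd m"
    and char: "\<forall>k. of_int k = (0::'f) \<longrightarrow> int CARD('q) dvd k"
  have zero: "of_int k = (0 :: 'q mod_ring alg_closure) \<longleftrightarrow> int CARD('q) dvd k" for k
    by (simp add: of_int_eq_0_iff_char_dvd)
  have m0: "of_int m \<noteq> (0 :: 'q mod_ring alg_closure)" unfolding zero by (rule m)
  have char0: "of_int k = (0 :: 'q mod_ring alg_closure)" if "of_int k = (0 :: 'f)" for k
    unfolding zero by (rule mp[OF spec[OF char]]) (rule that)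
  obtain \<phi> :: "'f \<Rightarrow> 'q mod_ring alg_closure" where rm: "ring_map (adjoin_list xs) \<phi>" "\<phi> a \<noteq> 0"
    by (rule specialisation_chain_ring_map[OF ch m0 char0])
  have "range (of_int :: int \<Rightarrow> 'q mod_ring) = UNIV"
  proof -
    have "x \<in> range of_int" for x :: "'q mod_ring"
    proof -
      obtain i where "x = of_nat i" using surj_of_nat_mod_ring[of x] by blast
      then have "x = of_int (int i)" by simp
      then show ?thesis by blast
    qed
    then show ?thesis by blast
  qed
  then have fin: "finite (\<phi> ` adjoin_list xs)" by (rule finite_ring_map_image[OF rm(1) finite])
  interpret matrix_reduction n \<Gamma> "adjoin_list xs" \<phi>
    by (rule matrix_reduction.intro[OF \<Gamma> adjoin_list_subring bspec[OF ent] rm(1) fin])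
  \<comment> \<open>For \<open>g\<close> in \<open>K\<close> the entries of \<open>g - 1\<close> go
    to 0 under \<open>\<phi>\<close>, whereas \<open>\<phi> a\<close> is non-zero.\<close>
  have ne: "g $$ (i, j) - (if i = j then 1 else 0) \<noteq> a" if g: "g \<in> K" and ij: "i < n" "j < n" for g i j
  proof
    assume a: "g $$ (i, j) - (if i = j then 1 else 0) = a"
    define d :: 'f where "d = (if i = j then 1 else 0)"
    have g': "g \<in> \<Gamma>" "\<phi> (g $$ (i, j)) = (if i = j then 1 else 0)" using g ij by (simp_all add: reduction_kernel_def)
    have d: "d \<in> adjoin_list xs" "\<phi> d = (if i = j then 1 else 0)"
      using subring_setD(1,2)[OF R] ring_mapD(1)[OF rm(1)] ring_map_closed(1)[OF rm(1) R] by (simp_all add: d_def)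
    have "\<phi> (g $$ (i, j) - d) = \<phi> (g $$ (i, j)) - \<phi> d"
      by (rule ring_map_closed(2)[OF rm(1) R entry[OF g'(1) ij] d(1)])
    then have "\<phi> a = 0" using a g'(2) d(2) by (simp add: d_def)
    then show False using rm(2) by simp
  qed
  show "\<exists>K. K \<lhd> G \<and> finite (rcosets\<^bsub>G\<^esub> K) \<and>
      (\<forall>g\<in>K. \<forall>i<n. \<forall>j<n. g $$ (i, j) - (if i = j then 1 else 0) \<noteq> a) \<and>
      (\<forall>V. V \<lhd> G \<longrightarrow> G.prime_retractions n V (V \<inter> K) \<longrightarrow> (derived G ^^ (4 * n + 1)) V \<subseteq> K)"
    by (intro exI[of _ K] conjI normal_kernel finite_index_kernel ballI allI impI ne exp_of_derived_subset_kernel)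
qed

text \<open>\<open>reduction_at_card\<close> needs a type of cardinality \<open>p\<close>, whereas the prime \<open>p\<close> depends on the data. So take a type
  whose cardinality is a prime for which \<open>reduction_at\<close> fails, if there is one.\<close>

definition bad_prime :: "'f::field itself \<Rightarrow> nat"
  where "bad_prime T = (if \<exists>p. prime p \<and> \<not> reduction_at T p then SOME p. prime p \<and> \<not> reduction_at T p else 2)"

lemma prime_bad_prime: "prime (bad_prime T)"
proof (cases "\<exists>p. prime p \<and> \<not> reduction_at T p")
  case True
  then show ?thesis unfolding bad_prime_def using someI_ex[OF True] by simp
next
  case False
  then show ?thesis unfolding bad_prime_def if_not_P[OF False] by simp
qed

typedef (overloaded) 'f bad_residue = "{..<bad_prime TYPE('f::field)}"
  using prime_gt_0_nat[OF prime_bad_prime] by blast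

lemma card_bad_residue: "CARD('f::field bad_residue) = bad_prime TYPE('f)"
  using type_definition.card[OF type_definition_bad_residue[where 'f = 'f]] by simp

instance bad_residue :: (field) prime_card
  by standard (simp add: card_bad_residue prime_bad_prime)

lemma reduction_at_prime:
  assumes "prime p"
  shows "reduction_at TYPE('f::field) p"
proof (rule ccontr)
  assume "\<not> reduction_at TYPE('f) p"
  then have ex: "\<exists>p. prime p \<and> \<not> reduction_at TYPE('f) p" using assms by blast
  then have "\<not> reduction_at TYPE('f) (bad_prime TYPE('f))" unfolding bad_prime_def using someI_ex[OF ex] by simp
  then show False using reduction_at_card[where 'f = 'f and 'q = "'f bad_residue"] by (simp add: card_bad_residue)
qed

subsection \<open>Linear groups of finite rank are virtually solvable\<close>

lemma (in group) rank_at_most_exists: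
  assumes "finite_Pruefer_rank G"
  obtains r where "rank_at_most r"
proof -
  obtain r where r: "\<And>K. subgroup K G \<Longrightarrow> finitely_generated_group (G\<lparr>carrier := K\<rparr>) \<Longrightarrow>
      \<exists>S. finite S \<and> card S \<le> r \<and> S \<subseteq> K \<and> generate G S = K"
    using assms unfolding finite_Pruefer_rank_def by blast
  have "\<exists>S. finite S \<and> card S \<le> r \<and> S \<subseteq> carrier G \<and> generate G S = generate G T" if T: "finite T" "T \<subseteq> carrier G" for T
  proof -
    have K: "subgroup (generate G T) G" by (rule generate_is_subgroup[OF T(2)])
    have TK: "T \<subseteq> generate G T" by (auto intro: generate.incl)
    have "generate (G\<lparr>carrier := generate G T\<rparr>) T = generate G T" using generate_consistent[OF TK K] by simp
    then have "finitely_generated_group (G\<lparr>carrier := generate G T\<rparr>)"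
      unfolding finitely_generated_group_def using T(1) TK by (intro exI[of _ T]) simp
    from r[OF K this] show ?thesis using generate_incl[OF T(2)] by blast
  qed
  then have "rank_at_most r" unfolding rank_at_most_def by blast
  then show thesis by (rule that)
qed

text \<open>The entries of an inverse are in general not polynomials in the entries of the matrix,
  so the inverses of the generators contribute to the list as well.\<close>

lemma generated_entries:
  fixes \<Gamma> :: "'f::field mat set"
  assumes \<Gamma>: "subgroup \<Gamma> (GL n)" and S: "finite S" "S \<subseteq> \<Gamma>" "generate (GL n\<lparr>carrier := \<Gamma>\<rparr>) S = \<Gamma>"
  obtains xs where "\<And>g. g \<in> \<Gamma> \<Longrightarrow> entries_in n (adjoin_list xs) g"
proof -
  let ?G = "GL n\<lparr>carrier := \<Gamma>\<rparr>"
  interpret G: group ?G by (rule group.subgroup_imp_group[OF group_GL \<Gamma>])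
  define E where "E = (\<lambda>(g, i, j). g $$ (i, j)) ` ((S \<union> (\<lambda>s. inv\<^bsub>?G\<^esub> s) ` S) \<times> {..<n} \<times> {..<n})"
  have "finite E" unfolding E_def using S(1) by simp
  then obtain xs where xs: "set xs = E" using finite_list by blast
  define R where "R = adjoin_list xs"
  have R: "subring_set R" and ER: "E \<subseteq> R" unfolding R_def using adjoin_list_subring set_subset_adjoin_list xs by blast+
  have S': "entries_in n R s" if "s \<in> S \<union> (\<lambda>s. inv\<^bsub>?G\<^esub> s) ` S" for s
    unfolding entries_in_def
  proof (intro allI impI)
    fix i j assume "i < n" "j < n"
    then have "(\<lambda>(g, i, j). g $$ (i, j)) (s, i, j) \<in> E" unfolding E_def using that by (intro imageI) simp
    then show "s $$ (i, j) \<in> R" using ER by auto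
  qed
  have mem: "g \<in> carrier_mat n n" if "g \<in> \<Gamma>" for g using GL_carrier subgroup.mem_carrier[OF \<Gamma> that] .
  have "entries_in n R g" if "g \<in> generate ?G S" for g
    using that
  proof induction
    case one
    show ?case using subring_setD(1,2)[OF R] by (simp add: GL_simps entries_in_def)
  next
    case (incl h)
    then show ?case using S' by blast
  next
    case (inv h)
    then show ?case using S' by blast
  next
    case (eng g h)
    have gh: "g \<in> carrier_mat n n" "h \<in> carrier_mat n n" using eng(1,2) S(3) mem by blast+
    have "(\<Sum>l<n. g $$ (i, l) * h $$ (l, j)) \<in> R" if "i < n" "j < n" for i j
      using eng(3,4) that by (intro subring_set_sum[OF R] subring_setD(5)[OF R]) (simp_all add: entries_in_def)
    then have "entries_in n R (g * h)" unfolding entries_in_def using index_mult[OF gh] by simp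
    then show ?case by (simp add: GL_simps)
  qed
  then show thesis using that[of xs] S(3) unfolding R_def by blast
qed

text \<open>In characteristic 0 a prime above \<open>\<bar>m\<bar>\<close> works. In positive
  characteristic the last condition leaves only the characteristic itself, which does not divide
  \<open>m\<close> by assumption.\<close>

lemma reduction_prime_exists:
  assumes "of_int m \<noteq> (0::'f::field)"
  obtains p where "prime p" "\<not> int p dvd m" "\<And>k. of_int k = (0::'f) \<Longrightarrow> int p dvd k"
proof (cases "CHAR('f) = 0")
  case True
  obtain p where p: "prime p" "nat \<bar>m\<bar> < p" using bigger_prime by blast
  have "m \<noteq> 0" using assms by auto
  then have "\<not> int p dvd m" using dvd_imp_le_int[of m "int p"] p(2) by auto
  then show thesis using that[OF p(1)] True by (simp add: of_int_eq_0_iff_char_dvd)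
next
  case False
  then have "prime CHAR('f)" using prime_CHAR_semidom by blast
  then show thesis using that[of "CHAR('f)"] assms by (simp add: of_int_eq_0_iff_char_dvd)
qed

text \<open>For a non-trivial \<open>x\<close> in the derived term, \<open>x - 1\<close> has a
  non-zero entry \<open>a\<close>. A reduction in which \<open>a\<close> survives has a kernel
  \<open>K\<close> without \<open>x\<close>, although \<open>K\<close> contains the whole derived
  term, because neither \<open>V\<close> nor the exponent \<open>4 * n + 1\<close> depends on the
  reduction.\<close>

theorem linear_virtually_solvable:
  fixes \<Gamma> :: "'f::field mat set"
  assumes \<Gamma>: "subgroup \<Gamma> (GL n)" and fg: "finitely_generated_group (GL n\<lparr>carrier := \<Gamma>\<rparr>)"
    and rk: "finite_Pruefer_rank (GL n\<lparr>carrier := \<Gamma>\<rparr>)"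
  obtains V where "V \<lhd> GL n\<lparr>carrier := \<Gamma>\<rparr>" "finite (rcosets\<^bsub>GL n\<lparr>carrier := \<Gamma>\<rparr>\<^esub> V)"
    "(derived (GL n\<lparr>carrier := \<Gamma>\<rparr>) ^^ (4 * n + 1)) V \<subseteq> {1\<^sub>m n}"
proof -
  let ?G = "GL n\<lparr>carrier := \<Gamma>\<rparr>"
  interpret G: group ?G by (rule group.subgroup_imp_group[OF group_GL \<Gamma>])
  obtain S where S: "finite S" "S \<subseteq> \<Gamma>" "generate ?G S = \<Gamma>" using fg unfolding finitely_generated_group_def by auto
  obtain xs where ent: "\<And>g. g \<in> \<Gamma> \<Longrightarrow> entries_in n (adjoin_list xs) g" using generated_entries[OF \<Gamma> S] by metis
  obtain r where r: "G.rank_at_most r" by (rule G.rank_at_most_exists[OF rk])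
  obtain V where V: "V \<lhd> ?G" "finite (rcosets\<^bsub>?G\<^esub> V)"
    and ret: "\<And>K. K \<lhd> ?G \<Longrightarrow> finite (rcosets\<^bsub>?G\<^esub> K) \<Longrightarrow> G.prime_retractions n V (V \<inter> K)"
    by (rule G.prime_retractions_exist[OF r, of n]) metis
  have "(derived ?G ^^ (4 * n + 1)) V \<subseteq> {1\<^sub>m n}"
  proof (rule subsetI, rule ccontr)
    fix x assume x: "x \<in> (derived ?G ^^ (4 * n + 1)) V" and "x \<notin> {1\<^sub>m n}"
    have "V \<subseteq> carrier ?G" by (rule subgroup.subset[OF normal_imp_subgroup[OF V(1)]])
    then have x\<Gamma>: "x \<in> \<Gamma>" using G.exp_of_derived_in_carrier[of V "4 * n + 1"] x by auto
    then have xc: "x \<in> carrier_mat n n" using GL_carrier subgroup.mem_carrier[OF \<Gamma>] by blast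
    have "\<exists>i<n. \<exists>j<n. x $$ (i, j) \<noteq> (if i = j then 1 else 0)"
    proof (rule ccontr)
      assume "\<not> (\<exists>i<n. \<exists>j<n. x $$ (i, j) \<noteq> (if i = j then 1 else 0))"
      then have "x = 1\<^sub>m n" using xc by (intro eq_matI) auto
      then show False using \<open>x \<notin> {1\<^sub>m n}\<close> by simp
    qed
    then obtain i j where ij: "i < n" "j < n" "x $$ (i, j) \<noteq> (if i = j then 1 else 0)" by blast
    define a where "a = x $$ (i, j) - (if i = j then 1 else 0)"
    note R = adjoin_list_subring[of xs]
    have "x $$ (i, j) \<in> adjoin_list xs" using ent[OF x\<Gamma>] ij by (simp add: entries_in_def)
    then have a: "a \<in> adjoin_list xs" "a \<noteq> 0" using ij(3) subring_setD(1,2,4)[OF R] by (simp_all add: a_def)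
    obtain m where m: "specialisation_chain xs a m \<and> of_int m \<noteq> (0::'f)" by (rule exE[OF specialisation_chain_exists[OF a]])
    obtain p where p: "prime p" "\<not> int p dvd m" "\<And>k. of_int k = (0::'f) \<Longrightarrow> int p dvd k"
      by (rule reduction_prime_exists[OF conjunct2[OF m]]) metis
    have "\<exists>K. K \<lhd> ?G \<and> finite (rcosets\<^bsub>?G\<^esub> K) \<and>
      (\<forall>g\<in>K. \<forall>i<n. \<forall>j<n. g $$ (i, j) - (if i = j then 1 else 0) \<noteq> a) \<and>
      (\<forall>V. V \<lhd> ?G \<longrightarrow> G.prime_retractions n V (V \<inter> K) \<longrightarrow> (derived ?G ^^ (4 * n + 1)) V \<subseteq> K)"
      using reduction_at_prime[OF p(1), where 'f = 'f, unfolded reduction_at_def, rule_format,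
          OF \<Gamma> ent conjunct1[OF m] p(2,3)] .
    then obtain K where K: "K \<lhd> ?G" "finite (rcosets\<^bsub>?G\<^esub> K)"
      "\<forall>g\<in>K. \<forall>i<n. \<forall>j<n. g $$ (i, j) - (if i = j then 1 else 0) \<noteq> a"
      "\<forall>V. V \<lhd> ?G \<longrightarrow> G.prime_retractions n V (V \<inter> K) \<longrightarrow> (derived ?G ^^ (4 * n + 1)) V \<subseteq> K"
      by (elim exE conjE)
    have "x \<in> K" using K(4)[rule_format, OF V(1) ret[OF K(1,2)]] x by (rule subsetD)
    then show False using K(3) ij(1,2) a_def by blast
  qed
  then show thesis using that V by blast
qed

subsection \<open>Hirsch number\<close>

context group begin

text \<open>\<open>B/A\<close> is infinite cyclic iff \<open>A\<close> is the kernel of a nonzero homomorphism from \<open>B\<close> to the integers.\<close>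

definition exponent_map :: "'a set \<Rightarrow> 'a set \<Rightarrow> ('a \<Rightarrow> int) \<Rightarrow> bool"
  where "exponent_map A B e \<longleftrightarrow> (\<forall>x\<in>B. \<forall>y\<in>B. e (x \<otimes> y) = e x + e y) \<and> (\<forall>x\<in>B. e x = 0 \<longleftrightarrow> x \<in> A)"

definition cyclic_factor :: "'a set \<Rightarrow> 'a set \<Rightarrow> bool"
  where "cyclic_factor A B \<longleftrightarrow> (\<exists>e. exponent_map A B e) \<and> \<not> B \<subseteq> A"

definition torsion_factor :: "'a set \<Rightarrow> 'a set \<Rightarrow> bool"
  where "torsion_factor A B \<longleftrightarrow> (\<forall>x\<in>B. \<exists>k::nat. k > 0 \<and> x [^] k \<in> A)"

lemma exponent_map_pow:
  assumes B: "subgroup B G" and e: "exponent_map A B e"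
  shows "e \<one> = 0" "x \<in> B \<Longrightarrow> e (inv x) = - e x" "x \<in> B \<Longrightarrow> e (x [^] (k::nat)) = int k * e x" "x \<in> B \<Longrightarrow> e (x [^] (i::int)) = i * e x"
proof -
  interpret B: subgroup B G by fact
  have m: "e (x \<otimes> y) = e x + e y" if "x \<in> B" "y \<in> B" for x y using e that by (simp add: exponent_map_def)
  show 1: "e \<one> = 0" using m[OF B.one_closed B.one_closed] by simp
  show i: "e (inv x) = - e x" if "x \<in> B" for x
    using m[OF that B.m_inv_closed[OF that]] that 1 by simp
  have p: "e (x [^] (k::nat)) = int k * e x" if x: "x \<in> B" for x k
  proof (induction k)
    case (Suc k)
    have "x [^] k \<in> B" by (rule pow_in_subgroup[OF B x])
    then show ?case using m[of "x [^] k" x] x Suc by (simp add: algebra_simps)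
  qed (simp add: 1)
  show "e (x [^] (k::nat)) = int k * e x" if "x \<in> B" for x by (rule p[OF that])
  show "e (x [^] (i::int)) = i * e x" if x: "x \<in> B"
  proof (cases "i < 0")
    case True
    then have "e (x [^] i) = - e (x [^] nat (- i))" using i[OF pow_in_subgroup[OF B x, of "nat (- i)"]] by (simp only: int_pow_def2 if_True)
    then show ?thesis using True by (simp only: p[OF x]) simp
  next
    case False
    then have "e (x [^] i) = e (x [^] nat i)" by (simp only: int_pow_def2 if_False)
    then show ?thesis using False by (simp only: p[OF x]) simp
  qed
qed

lemma int_pow_in_subgroup:
  assumes B: "subgroup B G" and x: "x \<in> B"
  shows "x [^] (i::int) \<in> B"
proof (cases "i < 0")
  case True
  then show ?thesis using subgroup.m_inv_closed[OF B pow_in_subgroup[OF B x, of "nat (- i)"]] by (simp only: int_pow_def2 if_True)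
next
  case False
  then show ?thesis using pow_in_subgroup[OF B x, of "nat i"] by (simp only: int_pow_def2 if_False)
qed

lemma cyclic_factor_not_torsion:
  assumes B: "subgroup B G" and c: "cyclic_factor A B"
  shows "\<not> torsion_factor A B"
proof
  assume t: "torsion_factor A B"
  obtain e x where e: "exponent_map A B e" and x: "x \<in> B" "x \<notin> A" using c unfolding cyclic_factor_def by blast
  obtain k :: nat where k: "k > 0" "x [^] k \<in> A" using t x(1) unfolding torsion_factor_def by blast
  have "e (x [^] k) = 0" using e k(2) pow_in_subgroup[OF B x(1), of k] by (simp add: exponent_map_def)
  then have "e x = 0" using exponent_map_pow(3)[OF B e x(1), of k] k(1) by simp
  moreover have "e x = 0 \<longleftrightarrow> x \<in> A" using e x(1) by (simp add: exponent_map_def)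
  ultimately show False using x(2) by simp
qed

text \<open>The ends of the chain are left free, so that chains can be intersected with subgroups,
  shortened and joined.\<close>

definition rank_chain :: "nat \<Rightarrow> (nat \<Rightarrow> 'a set) \<Rightarrow> bool"
  where "rank_chain m N \<longleftrightarrow> (\<forall>i\<le>m. subgroup (N i) G) \<and>
    (\<forall>i<m. N i \<subseteq> N (Suc i) \<and> normalized_by (N (Suc i)) (N i) \<and> (torsion_factor (N i) (N (Suc i)) \<or> cyclic_factor (N i) (N (Suc i))))"

definition cyclic_indices :: "nat \<Rightarrow> (nat \<Rightarrow> 'a set) \<Rightarrow> nat set"
  where "cyclic_indices m N = {i. i < m \<and> cyclic_factor (N i) (N (Suc i))}"

lemma finite_cyclic_indices: "finite (cyclic_indices m N)"
  by (simp add: cyclic_indices_def)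

lemma rank_chainD:
  assumes "rank_chain m N"
  shows "i \<le> m \<Longrightarrow> subgroup (N i) G" "i < m \<Longrightarrow> N i \<subseteq> N (Suc i)" "i < m \<Longrightarrow> normalized_by (N (Suc i)) (N i)"
    "i < m \<Longrightarrow> torsion_factor (N i) (N (Suc i)) \<or> cyclic_factor (N i) (N (Suc i))" "i \<le> j \<Longrightarrow> j \<le> m \<Longrightarrow> N i \<subseteq> N j"
proof -
  show s: "i < m \<Longrightarrow> N i \<subseteq> N (Suc i)" for i using assms by (simp add: rank_chain_def)
  show "N i \<subseteq> N j" if "i \<le> j" "j \<le> m"
    using that
  proof (induction j rule: dec_induct)
    case (step n)
    have "N i \<subseteq> N n" "N n \<subseteq> N (Suc n)" using step.IH step.prems s[of n] by simp_all
    then show ?case by (rule order_trans)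
  qed simp
qed (use assms in \<open>auto simp: rank_chain_def\<close>)

lemma factor_restrict:
  assumes "subgroup H G"
  shows "torsion_factor A B \<Longrightarrow> torsion_factor (H \<inter> A) (H \<inter> B)"
    and "cyclic_factor A B \<Longrightarrow> \<not> H \<inter> B \<subseteq> A \<Longrightarrow> cyclic_factor (H \<inter> A) (H \<inter> B)"
    and "H \<inter> B \<subseteq> A \<Longrightarrow> torsion_factor (H \<inter> A) (H \<inter> B)"
proof -
  show "torsion_factor (H \<inter> A) (H \<inter> B)" if t: "torsion_factor A B"
    unfolding torsion_factor_def
  proof
    fix x assume x: "x \<in> H \<inter> B"
    then obtain k :: nat where "k > 0" "x [^] k \<in> A" using t unfolding torsion_factor_def by blast
    then show "\<exists>k::nat. k > 0 \<and> x [^] k \<in> H \<inter> A" using pow_in_subgroup[OF assms, of x k] x by blast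
  qed
  show "cyclic_factor (H \<inter> A) (H \<inter> B)" if c: "cyclic_factor A B" and n: "\<not> H \<inter> B \<subseteq> A"
  proof -
    obtain e where "exponent_map A B e" using c unfolding cyclic_factor_def by blast
    then have "exponent_map (H \<inter> A) (H \<inter> B) e" unfolding exponent_map_def by blast
    then show ?thesis using n unfolding cyclic_factor_def by blast
  qed
  show "torsion_factor (H \<inter> A) (H \<inter> B)" if s: "H \<inter> B \<subseteq> A"
    unfolding torsion_factor_def
  proof
    fix x assume x: "x \<in> H \<inter> B"
    then have "x [^] (1::nat) \<in> H \<inter> A" using s subgroup.mem_carrier[OF assms] by auto
    then show "\<exists>k::nat. k > 0 \<and> x [^] k \<in> H \<inter> A" by (intro exI[of _ 1]) simp
  qed
qed

text \<open>Torsion factors stay torsion. An infinite cyclic factor stays so if \<open>H\<close>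
  meets it outside the lower term, and becomes trivial otherwise; a trivial factor counts as
  torsion.\<close>

lemma rank_chain_Int:
  assumes H: "subgroup H G" and N: "rank_chain m N"
  shows "rank_chain m (\<lambda>i. H \<inter> N i)"
    "cyclic_indices m (\<lambda>i. H \<inter> N i) = {i \<in> cyclic_indices m N. \<not> H \<inter> N (Suc i) \<subseteq> N i}"
proof -
  interpret H: subgroup H G by fact
  note N' = rank_chainD[OF N]
  show ch: "rank_chain m (\<lambda>i. H \<inter> N i)"
    unfolding rank_chain_def
  proof (intro conjI allI impI)
    fix i assume "i \<le> m"
    then show "subgroup (H \<inter> N i) G" using subgroups_Inter_pair[OF H N'(1)] by blast
  next
    fix i assume i: "i < m"
    show "H \<inter> N i \<subseteq> H \<inter> N (Suc i)" using N'(2)[OF i] by blast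
    show "normalized_by (H \<inter> N (Suc i)) (H \<inter> N i)"
      unfolding normalized_by_def
    proof (intro ballI IntI)
      fix g x assume g: "g \<in> H \<inter> N (Suc i)" and x: "x \<in> H \<inter> N i"
      show "conj_by g x \<in> H" using g x by simp
      show "conj_by g x \<in> N i" by (rule normalized_byD[OF N'(3)[OF i] IntD2[OF g] IntD2[OF x]])
    qed
    from N'(4)[OF i] show "torsion_factor (H \<inter> N i) (H \<inter> N (Suc i)) \<or> cyclic_factor (H \<inter> N i) (H \<inter> N (Suc i))"
    proof
      assume "torsion_factor (N i) (N (Suc i))"
      then show ?thesis by (intro disjI1 factor_restrict(1)[OF H])
    next
      assume "cyclic_factor (N i) (N (Suc i))"
      then show ?thesis using factor_restrict(2,3)[OF H, where A = "N i" and B = "N (Suc i)"] by (cases "H \<inter> N (Suc i) \<subseteq> N i") simp_all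
    qed
  qed
  have "cyclic_factor (H \<inter> N i) (H \<inter> N (Suc i)) \<longleftrightarrow> cyclic_factor (N i) (N (Suc i)) \<and> \<not> H \<inter> N (Suc i) \<subseteq> N i" if i: "i < m" for i
  proof -
    have s: "subgroup (H \<inter> N (Suc i)) G" using rank_chainD(1)[OF ch, of "Suc i"] i by simp
    from N'(4)[OF i] show ?thesis
    proof
      assume t: "torsion_factor (N i) (N (Suc i))"
      have "\<not> cyclic_factor (N i) (N (Suc i))" using cyclic_factor_not_torsion[OF N'(1)[of "Suc i"]] t i by auto
      moreover have "\<not> cyclic_factor (H \<inter> N i) (H \<inter> N (Suc i))"
        using cyclic_factor_not_torsion[OF s] factor_restrict(1)[OF H t] by blast
      ultimately show ?thesis by simp
    next
      assume c: "cyclic_factor (N i) (N (Suc i))"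
      show ?thesis
      proof (cases "H \<inter> N (Suc i) \<subseteq> N i")
        case True
        then show ?thesis using cyclic_factor_not_torsion[OF s] factor_restrict(3)[OF H True] by blast
      next
        case False
        then show ?thesis using c factor_restrict(2)[OF H c False] by blast
      qed
    qed
  qed
  then show "cyclic_indices m (\<lambda>i. H \<inter> N i) = {i \<in> cyclic_indices m N. \<not> H \<inter> N (Suc i) \<subseteq> N i}"
    unfolding cyclic_indices_def by blast
qed

text \<open>Monotonicity of the number of cyclic factors, from which its independence of the series
  follows. Intersecting \<open>L\<close> with \<open>N m\<close>, the last term but one, costs
  \<open>L\<close> at most one cyclic factor, and none if the top factor of \<open>N\<close> is
  torsion. The condition on \<open>N 0\<close> takes the place of a common starting point.\<close>

lemma cyclic_indices_le:
  assumes N: "rank_chain m N" and L: "rank_chain k L" and LN: "L k \<subseteq> N m" "N 0 \<inter> L k \<subseteq> L 0"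
  shows "card (cyclic_indices k L) \<le> card (cyclic_indices m N)"
  using assms
proof (induction m arbitrary: L)
  case 0
  note L' = rank_chainD[OF "0.prems"(2)]
  have "L k \<subseteq> L 0" using "0.prems"(3,4) by blast
  then have "\<not> cyclic_factor (L i) (L (Suc i))" if "i < k" for i
    using L'(5)[of 0 i] L'(5)[of "Suc i" k] that unfolding cyclic_factor_def by auto
  then have "cyclic_indices k L = {}" unfolding cyclic_indices_def by blast
  then show ?case by simp
next
  case (Suc m)
  note N' = rank_chainD[OF Suc.prems(1)] and L' = rank_chainD[OF Suc.prems(2)]
  let ?H = "N m"
  have H: "subgroup ?H G" using N'(1)[of m] by simp
  have N1: "rank_chain m N" using Suc.prems(1) by (simp add: rank_chain_def)
  note L1 = rank_chain_Int[OF H Suc.prems(2)]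
  have "N 0 \<subseteq> ?H" using N'(5)[of 0 m] by simp
  then have ih: "card (cyclic_indices k (\<lambda>i. ?H \<inter> L i)) \<le> card (cyclic_indices m N)"
    using Suc.prems(4) by (intro Suc.IH[OF N1 L1(1)]) blast+
  define D where "D = {i \<in> cyclic_indices k L. ?H \<inter> L (Suc i) \<subseteq> L i}"
  have fD: "finite D" unfolding D_def using finite_cyclic_indices by simp
  have "cyclic_indices k L = cyclic_indices k (\<lambda>i. ?H \<inter> L i) \<union> D" unfolding L1(2) D_def by blast
  then have cL: "card (cyclic_indices k L) \<le> card (cyclic_indices k (\<lambda>i. ?H \<inter> L i)) + card D" by (simp add: card_Un_le)
  have LH: "L (Suc i) \<subseteq> N (Suc m)" if "i < k" for i using L'(5)[of "Suc i" k] that Suc.prems(3) by auto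
  have Dx: "\<exists>e x. exponent_map (L i) (L (Suc i)) e \<and> x \<in> L (Suc i) \<and> x \<notin> L i" if "i \<in> D" for i
    using that unfolding D_def cyclic_indices_def cyclic_factor_def by blast
  have Dk: "i < k" if "i \<in> D" for i using that unfolding D_def cyclic_indices_def by blast
  have Dsub: "?H \<inter> L (Suc i) \<subseteq> L i" if "i \<in> D" for i using that unfolding D_def by blast
  show ?case
  proof (cases "cyclic_factor (N m) (N (Suc m))")
    case False
    then have t: "torsion_factor (N m) (N (Suc m))" using N'(4)[of m] by simp
    have "D = {}"
    proof (rule ccontr)
      assume "D \<noteq> {}"
      then obtain i where i: "i \<in> D" by blast
      have sL: "subgroup (L (Suc i)) G" using L'(1) Dk[OF i] by simp
      have "torsion_factor (L i) (L (Suc i))"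
        unfolding torsion_factor_def
      proof
        fix x assume x: "x \<in> L (Suc i)"
        then obtain p :: nat where p: "p > 0" "x [^] p \<in> ?H" using t LH[OF Dk[OF i]] unfolding torsion_factor_def by blast
        have "x [^] p \<in> L i" using Dsub[OF i] p(2) pow_in_subgroup[OF sL x, of p] by blast
        then show "\<exists>p::nat. p > 0 \<and> x [^] p \<in> L i" using p(1) by blast
      qed
      then show False using cyclic_factor_not_torsion[OF sL] i unfolding D_def cyclic_indices_def by blast
    qed
    moreover have "cyclic_indices (Suc m) N = cyclic_indices m N"
      using False unfolding cyclic_indices_def by (auto simp: less_Suc_eq)
    ultimately show ?thesis using cL ih by simp
  next
    case True
    then obtain e where e: "exponent_map ?H (N (Suc m)) e" unfolding cyclic_factor_def by blast
    have sN: "subgroup (N (Suc m)) G" using N'(1) by simp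
    \<comment> \<open>Suppose the factors at \<open>i < j\<close> are both lost. The element
      \<open>w\<close> has exponent 0 under \<open>e\<close>, so it lies in \<open>N m\<close> and,
      the factor at \<open>j\<close> being lost, in \<open>L j\<close>. The exponent map
      \<open>f\<close> of that factor then gives \<open>e x * f y = 0\<close> with
      \<open>f y\<close> non-zero, so \<open>x\<close> lies in \<open>N m\<close>, hence in
      \<open>L i\<close>, a contradiction.\<close>
    have "\<not> i < j" if ij: "i \<in> D" "j \<in> D" for i j
    proof
      assume lt: "i < j"
      obtain x where x: "x \<in> L (Suc i)" "x \<notin> L i" using Dx[OF ij(1)] by blast
      obtain f y where f: "exponent_map (L j) (L (Suc j)) f" and y: "y \<in> L (Suc j)" "y \<notin> L j" using Dx[OF ij(2)] by blast
      have xN: "x \<in> N (Suc m)" and yN: "y \<in> N (Suc m)" using x y LH Dk ij by blast+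
      have sj: "subgroup (L (Suc j)) G" using L'(1) Dk[OF ij(2)] by simp
      have xj: "x \<in> L j" using L'(5)[of "Suc i" j] lt Dk[OF ij(2)] x(1) by auto
      have xsj: "x \<in> L (Suc j)" using L'(2)[OF Dk[OF ij(2)]] xj by blast
      define w where "w = x [^] e y \<otimes> y [^] (- e x)"
      have wN: "x [^] e y \<in> N (Suc m)" "y [^] (- e x) \<in> N (Suc m)" using int_pow_in_subgroup[OF sN] xN yN by blast+
      have wL: "x [^] e y \<in> L (Suc j)" "y [^] (- e x) \<in> L (Suc j)" using int_pow_in_subgroup[OF sj] xsj y(1) by blast+
      have "e w = e y * e x + - e x * e y"
        unfolding w_def using e wN exponent_map_pow(4)[OF sN e] xN yN unfolding exponent_map_def by simp
      then have "e w = 0" by simp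
      moreover have "w \<in> N (Suc m)" "w \<in> L (Suc j)" unfolding w_def
        by (rule subgroup.m_closed[OF sN wN], rule subgroup.m_closed[OF sj wL])
      ultimately have "w \<in> L j" using e Dsub[OF ij(2)] unfolding exponent_map_def by blast
      then have "f w = 0" using f \<open>w \<in> L (Suc j)\<close> unfolding exponent_map_def by blast
      moreover have "f w = e y * f x + - e x * f y"
        unfolding w_def using f wL exponent_map_pow(4)[OF sj f] xsj y(1) unfolding exponent_map_def by simp
      moreover have "f x = 0" using f xj xsj unfolding exponent_map_def by blast
      moreover have "f y \<noteq> 0" using f y unfolding exponent_map_def by blast
      ultimately have "e x = 0" by simp
      then have "x \<in> ?H" using e xN unfolding exponent_map_def by blast
      then show False using Dsub[OF ij(1)] x by blast
    qed
    then have "\<forall>i\<in>D. \<forall>j\<in>D. i = j" by (metis linorder_neqE_nat)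
    then have "card D \<le> 1" by (metis card_le_Suc0_iff_eq fD One_nat_def)
    moreover have "cyclic_indices (Suc m) N = insert m (cyclic_indices m N)" "m \<notin> cyclic_indices m N"
      using True unfolding cyclic_indices_def by (auto simp: less_Suc_eq)
    then have "card (cyclic_indices (Suc m) N) = Suc (card (cyclic_indices m N))"
      using finite_cyclic_indices by simp
    ultimately show ?thesis using cL ih by simp
  qed
qed

lemma infinite_cyclic_group_iff:
  "infinite_cyclic_group G \<longleftrightarrow> (\<exists>e. exponent_map {\<one>} (carrier G) e) \<and> \<not> carrier G \<subseteq> {\<one>}"
proof
  assume "infinite_cyclic_group G"
  then obtain x where x: "x \<in> carrier G" "carrier G = range (\<lambda>n::int. x [^] n)" and inf: "infinite (carrier G)"
    unfolding infinite_cyclic_group_def cyclic_group by blast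
  have "carrier (subgroup_generated G {x}) = carrier G" using carrier_subgroup_generated_by_singleton[OF x(1)] x(2) by simp
  then have "infinite (carrier (subgroup_generated G {x}))" using inf by simp
  then have inj: "inj (\<lambda>n::int. x [^] n)" using infinite_cyclic_subgroup_int[OF x(1)] by (simp add: inj_def)
  define e where "e y = the_inv (\<lambda>n::int. x [^] n) y" for y
  have e: "e (x [^] (n::int)) = n" for n unfolding e_def by (rule the_inv_f_f[OF inj])
  have "exponent_map {\<one>} (carrier G) e"
    unfolding exponent_map_def
  proof (intro conjI ballI)
    fix y z assume "y \<in> carrier G" "z \<in> carrier G"
    then obtain k l :: int where kl: "y = x [^] k" "z = x [^] l" using x(2) by blast
    have "y \<otimes> z = x [^] (k + l)" unfolding kl by (rule int_pow_mult[OF x(1), symmetric])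
    then show "e (y \<otimes> z) = e y + e z" unfolding kl by (simp only: e)
  next
    fix y assume "y \<in> carrier G"
    then obtain k :: int where k: "y = x [^] k" using x(2) by blast
    have "x [^] k = x [^] (0::int) \<longleftrightarrow> k = 0" using inj by (auto simp: inj_def)
    then show "(e y = 0) = (y \<in> {\<one>})" unfolding k by (simp add: e)
  qed
  moreover have "\<not> carrier G \<subseteq> {\<one>}" using inf finite_subset by blast
  ultimately show "(\<exists>e. exponent_map {\<one>} (carrier G) e) \<and> \<not> carrier G \<subseteq> {\<one>}" by blast
next
  assume "(\<exists>e. exponent_map {\<one>} (carrier G) e) \<and> \<not> carrier G \<subseteq> {\<one>}"
  then obtain e y where e: "exponent_map {\<one>} (carrier G) e" and y: "y \<in> carrier G" "y \<noteq> \<one>" by blast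
  note p = exponent_map_pow[OF subgroup_self e]
  have "e y \<noteq> 0" using e y by (simp add: exponent_map_def)
  \<comment> \<open>An element with the least positive value of \<open>e\<close> generates the
    group, by division with remainder.\<close>
  define Q where "Q k \<longleftrightarrow> k > 0 \<and> (\<exists>x\<in>carrier G. e x = int k)" for k :: nat
  have "Q (nat \<bar>e y\<bar>)"
    using \<open>e y \<noteq> 0\<close> y(1) p(2)[OF y(1)] unfolding Q_def by (cases "e y > 0") (auto intro: bexI[of _ y] bexI[of _ "inv y"])
  then obtain d where d: "Q d" "\<And>k. Q k \<Longrightarrow> d \<le> k" using LeastI Least_le by metis
  obtain x where x: "x \<in> carrier G" "e x = int d" and d0: "d > 0" using d(1) by (auto simp: Q_def)
  have gen: "\<exists>n::int. z = x [^] n" if z: "z \<in> carrier G" for z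
  proof -
    define q where "q = e z div int d"
    define r where "r = e z mod int d"
    have xq: "x [^] (- q) \<in> carrier G" using x(1) by simp
    have "e (z \<otimes> x [^] (- q)) = e z + - q * int d" using e z xq p(4)[OF x(1), of "- q"] x(2) by (simp add: exponent_map_def)
    then have er: "e (z \<otimes> x [^] (- q)) = r" by (simp add: q_def r_def minus_div_mult_eq_mod)
    have "r \<ge> 0" "r < int d" using d0 by (simp_all add: r_def)
    then have "r = 0"
    proof (cases "r > 0")
      case True
      then have "Q (nat r)" unfolding Q_def using er z xq by (auto intro!: bexI[of _ "z \<otimes> x [^] (- q)"])
      then show ?thesis using d(2)[of "nat r"] \<open>r < int d\<close> \<open>r \<ge> 0\<close> by simp
    qed simp
    have c: "z \<otimes> x [^] (- q) \<in> carrier G" using z xq by simp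
    have "e (z \<otimes> x [^] (- q)) = 0 \<longleftrightarrow> z \<otimes> x [^] (- q) = \<one>" using e c unfolding exponent_map_def singleton_iff by blast
    then have "z \<otimes> inv (x [^] q) = \<one>" using er \<open>r = 0\<close> x(1) by (simp only: int_pow_neg)
    then have "z = x [^] q" by (rule eq_if_mult_inv_one[OF z int_pow_closed[OF x(1)]])
    then show ?thesis by blast
  qed
  have ran: "carrier G = range (\<lambda>n::int. x [^] n)"
  proof (intro equalityI subsetI)
    fix z assume "z \<in> carrier G"
    then show "z \<in> range (\<lambda>n::int. x [^] n)" using gen by blast
  next
    fix z assume "z \<in> range (\<lambda>n::int. x [^] n)"
    then obtain n :: int where "z = x [^] n" by blast
    then show "z \<in> carrier G" using int_pow_closed[OF x(1)] by simp
  qed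
  have "inj (\<lambda>n::int. x [^] n)"
  proof (rule injI)
    fix k l :: int assume "x [^] k = x [^] l"
    then have "e (x [^] k) = e (x [^] l)" by (rule arg_cong)
    then have "k * e x = l * e x" by (simp only: p(4)[OF x(1)])
    then show "k = l" using x(2) d0 by (simp only: mult_cancel_right) simp
  qed
  then have "infinite (carrier G)" unfolding ran by (simp add: finite_image_iff)
  then show "infinite_cyclic_group G"
    unfolding infinite_cyclic_group_def cyclic_group using x(1) ran by blast
qed

section \<open>Series of quotient groups translated into chains of subgroups\<close>

lemma
  assumes B: "subgroup B G" and A: "A \<lhd> G\<lparr>carrier := B\<rparr>"
  shows periodic_quotient_iff: "periodic_group (G\<lparr>carrier := B\<rparr> Mod A) \<longleftrightarrow> torsion_factor A B"
    and infinite_cyclic_quotient_iff: "infinite_cyclic_group (G\<lparr>carrier := B\<rparr> Mod A) \<longleftrightarrow> cyclic_factor A B"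
proof -
  let ?B = "G\<lparr>carrier := B\<rparr>"
  interpret A: normal A ?B by (rule A)
  define Q where "Q = ?B Mod A"
  define p where "p x = A #>\<^bsub>?B\<^esub> x" for x
  interpret Q: group Q unfolding Q_def by (rule A.factorgroup_is_group)
  have "p \<in> hom ?B Q" unfolding p_def Q_def by (rule A.r_coset_hom_Mod)
  then interpret p: group_hom ?B Q p by unfold_locales
  have oQ: "\<one>\<^bsub>Q\<^esub> = A" and cQ: "carrier Q = p ` B" by (auto simp: Q_def p_def FactGroup_def RCOSETS_def)
  have ker: "p x = \<one>\<^bsub>Q\<^esub> \<longleftrightarrow> x \<in> A" if x: "x \<in> B" for x
  proof
    assume "p x = \<one>\<^bsub>Q\<^esub>"
    then show "x \<in> A" using A.rcos_self[of x A] A.subgroup_axioms x by (simp add: oQ p_def)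
  next
    assume "x \<in> A"
    then show "p x = \<one>\<^bsub>Q\<^esub>" unfolding oQ p_def by (rule A.rcos_const[OF A.is_group])
  qed
  have pw: "p x [^]\<^bsub>Q\<^esub> (k::nat) = \<one>\<^bsub>Q\<^esub> \<longleftrightarrow> x [^] k \<in> A" if x: "x \<in> B" for x k
  proof -
    have "p x [^]\<^bsub>Q\<^esub> k = p (x [^] k)" using p.hom_nat_pow[of x k] x by (simp add: nat_pow_consistent [symmetric])
    then show ?thesis using ker[OF pow_in_subgroup[OF B x, of k]] by simp
  qed
  have "periodic_group Q \<longleftrightarrow> torsion_factor A B"
    unfolding periodic_group_def torsion_factor_def cQ by (simp add: pw)
  then show "periodic_group (?B Mod A) \<longleftrightarrow> torsion_factor A B" unfolding Q_def .
  have mult: "p x \<otimes>\<^bsub>Q\<^esub> p y = p (x \<otimes> y)" if "x \<in> B" "y \<in> B" for x y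
    using p.hom_mult[of x y] that by simp
  have sub: "carrier Q \<subseteq> {\<one>\<^bsub>Q\<^esub>} \<longleftrightarrow> B \<subseteq> A"
  proof
    assume s: "carrier Q \<subseteq> {\<one>\<^bsub>Q\<^esub>}"
    show "B \<subseteq> A"
    proof
      fix x assume x: "x \<in> B"
      then have "p x \<in> {\<one>\<^bsub>Q\<^esub>}" using s cQ by blast
      then show "x \<in> A" using ker[OF x] by blast
    qed
  next
    assume s: "B \<subseteq> A"
    show "carrier Q \<subseteq> {\<one>\<^bsub>Q\<^esub>}"
    proof
      fix C assume "C \<in> carrier Q"
      then obtain x where x: "x \<in> B" "C = p x" unfolding cQ by blast
      then show "C \<in> {\<one>\<^bsub>Q\<^esub>}" using ker[OF x(1)] s by auto
    qed
  qed
  have "(\<exists>e. Q.exponent_map {\<one>\<^bsub>Q\<^esub>} (carrier Q) e) \<longleftrightarrow> (\<exists>e. exponent_map A B e)"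
  proof
    assume "\<exists>e. Q.exponent_map {\<one>\<^bsub>Q\<^esub>} (carrier Q) e"
    then obtain e where e: "Q.exponent_map {\<one>\<^bsub>Q\<^esub>} (carrier Q) e" by blast
    have "exponent_map A B (\<lambda>x. e (p x))"
      unfolding exponent_map_def
    proof (intro conjI ballI)
      fix x y assume xy: "x \<in> B" "y \<in> B"
      have "e (p x \<otimes>\<^bsub>Q\<^esub> p y) = e (p x) + e (p y)"
        using e xy unfolding Q.exponent_map_def cQ by blast
      then show "e (p (x \<otimes> y)) = e (p x) + e (p y)" by (simp only: mult[OF xy])
    next
      fix x assume x: "x \<in> B"
      then have "e (p x) = 0 \<longleftrightarrow> p x \<in> {\<one>\<^bsub>Q\<^esub>}" using e unfolding Q.exponent_map_def cQ by blast
      then show "(e (p x) = 0) = (x \<in> A)" by (simp only: singleton_iff ker[OF x])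
    qed
    then show "\<exists>e. exponent_map A B e" by blast
  next
    assume "\<exists>e. exponent_map A B e"
    then obtain e where e: "exponent_map A B e" by blast
    define f where "f C = e (SOME b. b \<in> B \<and> p b = C)" for C
    have f: "f (p x) = e x" if x: "x \<in> B" for x
    proof -
      define y where "y = (SOME b. b \<in> B \<and> p b = p x)"
      have y: "y \<in> B \<and> p y = p x" unfolding y_def by (rule someI[of _ x]) (simp add: x)
      have yx: "inv x \<in> B" "y \<otimes> inv x \<in> B" using x y subgroup.m_inv_closed[OF B] subgroup.m_closed[OF B] by blast+
      have "p (y \<otimes> inv x) = p (x \<otimes> inv x)" using mult[of y "inv x"] mult[of x "inv x"] x y yx(1) by simp
      also have "\<dots> = \<one>\<^bsub>Q\<^esub>" using x subgroup.mem_carrier[OF B x] ker[of \<one>] subgroup.one_closed[OF B] subgroup.one_closed[OF A.subgroup_axioms] by simp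
      finally have "y \<otimes> inv x \<in> A" by (simp only: ker[OF yx(2)])
      then have "e (y \<otimes> inv x) = 0" using e yx(2) by (simp add: exponent_map_def)
      then have "e y + e (inv x) = 0" using e y yx(1) by (simp add: exponent_map_def)
      then show ?thesis unfolding f_def y_def[symmetric] using exponent_map_pow(2)[OF B e x] by simp
    qed
    have "Q.exponent_map {\<one>\<^bsub>Q\<^esub>} (carrier Q) f"
      unfolding Q.exponent_map_def
    proof (intro conjI ballI)
      fix C D assume "C \<in> carrier Q" "D \<in> carrier Q"
      then obtain x y where xy: "x \<in> B" "C = p x" "y \<in> B" "D = p y" unfolding cQ by blast
      have "x \<otimes> y \<in> B" by (rule subgroup.m_closed[OF B xy(1,3)])
      then have "f (p (x \<otimes> y)) = e x + e y" using f[of "x \<otimes> y"] e xy(1,3) by (simp add: exponent_map_def)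
      then show "f (C \<otimes>\<^bsub>Q\<^esub> D) = f C + f D" unfolding xy(2,4) by (simp only: mult[OF xy(1,3)] f[OF xy(1)] f[OF xy(3)])
    next
      fix C assume "C \<in> carrier Q"
      then obtain x where x: "x \<in> B" "C = p x" unfolding cQ by blast
      show "(f C = 0) = (C \<in> {\<one>\<^bsub>Q\<^esub>})"
        unfolding x(2) singleton_iff ker[OF x(1)] f[OF x(1)] using e x(1) by (simp add: exponent_map_def)
    qed
    then show "\<exists>e. Q.exponent_map {\<one>\<^bsub>Q\<^esub>} (carrier Q) e" by blast
  qed
  then have "infinite_cyclic_group Q \<longleftrightarrow> cyclic_factor A B"
    unfolding Q.infinite_cyclic_group_iff cyclic_factor_def sub by (simp only:)
  then show "infinite_cyclic_group (?B Mod A) \<longleftrightarrow> cyclic_factor A B" unfolding Q_def .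
qed

lemma torsion_free_rank_series_iff:
  assumes H: "subgroup H G"
  shows "torsion_free_rank_series (G\<lparr>carrier := H\<rparr>) m N \<longleftrightarrow> rank_chain m N \<and> N 0 = {\<one>} \<and> N m = H"
    and "torsion_free_rank_series (G\<lparr>carrier := H\<rparr>) m N \<Longrightarrow>
      {i. i < m \<and> infinite_cyclic_group (series_factor (G\<lparr>carrier := H\<rparr>) N i)} = cyclic_indices m N"
proof -
  have fac: "series_factor (G\<lparr>carrier := H\<rparr>) N i = G\<lparr>carrier := N (Suc i)\<rparr> Mod N i" for i
    by (simp add: series_factor_def)
  have normal_iff: "N i \<lhd> G\<lparr>carrier := N (Suc i)\<rparr> \<longleftrightarrow> subgroup (N i) G \<and> N i \<subseteq> N (Suc i) \<and> normalized_by (N (Suc i)) (N i)"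
    if s: "subgroup (N (Suc i)) G" for i
  proof -
    interpret B: group "G\<lparr>carrier := N (Suc i)\<rparr>" by (rule subgroup_imp_group[OF s])
    have inv: "inv\<^bsub>G\<lparr>carrier := N (Suc i)\<rparr>\<^esub> x = inv x" if "x \<in> N (Suc i)" for x by (rule m_inv_consistent[OF s that])
    have "subgroup (N i) (G\<lparr>carrier := N (Suc i)\<rparr>) \<longleftrightarrow> subgroup (N i) G \<and> N i \<subseteq> N (Suc i)"
      using incl_subgroup[OF s] subgroup_incl[OF _ s] subgroup.subset[of "N i" "G\<lparr>carrier := N (Suc i)\<rparr>"] by auto
    then show ?thesis unfolding B.normal_inv_iff normalized_by_def using inv by auto
  qed
  have sub_iff: "subgroup K (G\<lparr>carrier := H\<rparr>) \<longleftrightarrow> subgroup K G \<and> K \<subseteq> H" for K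
    using incl_subgroup[OF H] subgroup_incl[OF _ H] subgroup.subset[of K "G\<lparr>carrier := H\<rparr>"] by auto
  have per: "periodic_group (series_factor (G\<lparr>carrier := H\<rparr>) N i) \<longleftrightarrow> torsion_factor (N i) (N (Suc i))"
    and cyc: "infinite_cyclic_group (series_factor (G\<lparr>carrier := H\<rparr>) N i) \<longleftrightarrow> cyclic_factor (N i) (N (Suc i))"
    if "subgroup (N (Suc i)) G" "N i \<lhd> G\<lparr>carrier := N (Suc i)\<rparr>" for i
    unfolding fac using periodic_quotient_iff[OF that] infinite_cyclic_quotient_iff[OF that] by blast+
  show "torsion_free_rank_series (G\<lparr>carrier := H\<rparr>) m N \<longleftrightarrow> rank_chain m N \<and> N 0 = {\<one>} \<and> N m = H"
  proof
    assume t: "torsion_free_rank_series (G\<lparr>carrier := H\<rparr>) m N"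
    have s: "subgroup (N i) G" if "i \<le> m" for i using t that sub_iff by (simp add: torsion_free_rank_series_def)
    have n: "N i \<lhd> G\<lparr>carrier := N (Suc i)\<rparr>" if "i < m" for i using t that by (simp add: torsion_free_rank_series_def)
    have f: "torsion_factor (N i) (N (Suc i)) \<or> cyclic_factor (N i) (N (Suc i))" if i: "i < m" for i
    proof -
      have s': "subgroup (N (Suc i)) G" using s i by simp
      have "periodic_group (series_factor (G\<lparr>carrier := H\<rparr>) N i) \<or> infinite_cyclic_group (series_factor (G\<lparr>carrier := H\<rparr>) N i)"
        using t i by (simp add: torsion_free_rank_series_def)
      then show ?thesis unfolding per[OF s' n[OF i]] cyc[OF s' n[OF i]] .
    qed
    have "rank_chain m N"
      unfolding rank_chain_def using s f n normal_iff by simp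
    then show "rank_chain m N \<and> N 0 = {\<one>} \<and> N m = H" using t by (simp add: torsion_free_rank_series_def)
  next
    assume t: "rank_chain m N \<and> N 0 = {\<one>} \<and> N m = H"
    note N = rank_chainD[OF conjunct1[OF t]]
    have n: "N i \<lhd> G\<lparr>carrier := N (Suc i)\<rparr>" if "i < m" for i
      using normal_iff[OF N(1)[of "Suc i"]] N(1)[of i] N(2,3)[of i] that by simp
    have "subgroup (N i) (G\<lparr>carrier := H\<rparr>)" if "i \<le> m" for i
      using sub_iff N(1)[OF that] N(5)[OF that] t by simp
    moreover have "periodic_group (series_factor (G\<lparr>carrier := H\<rparr>) N i) \<or> infinite_cyclic_group (series_factor (G\<lparr>carrier := H\<rparr>) N i)"
      if i: "i < m" for i
    proof -
      have s': "subgroup (N (Suc i)) G" using N(1) i by simp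
      show ?thesis unfolding per[OF s' n[OF i]] cyc[OF s' n[OF i]] by (rule N(4)[OF i])
    qed
    ultimately show "torsion_free_rank_series (G\<lparr>carrier := H\<rparr>) m N"
      using t n by (simp add: torsion_free_rank_series_def)
  qed
  show "{i. i < m \<and> infinite_cyclic_group (series_factor (G\<lparr>carrier := H\<rparr>) N i)} = cyclic_indices m N"
    if t: "torsion_free_rank_series (G\<lparr>carrier := H\<rparr>) m N"
  proof -
    have s: "subgroup (N i) G" if "i \<le> m" for i using t that sub_iff by (simp add: torsion_free_rank_series_def)
    have n: "N i \<lhd> G\<lparr>carrier := N (Suc i)\<rparr>" if "i < m" for i using t that by (simp add: torsion_free_rank_series_def)
    have "infinite_cyclic_group (series_factor (G\<lparr>carrier := H\<rparr>) N i) \<longleftrightarrow> cyclic_factor (N i) (N (Suc i))" if i: "i < m" for i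
      using cyc[OF s n[OF i]] i by simp
    then show ?thesis unfolding cyclic_indices_def by blast
  qed
qed

text \<open>\<open>cyclic_indices_le\<close> in both directions gives the uniqueness that the
  definite description needs, so a single chain computes the number.\<close>

lemma Hirsch_number_eq:
  assumes H: "subgroup H G" and N: "rank_chain m N" "N 0 = {\<one>}" "N m = H"
  shows "Hirsch_number (G\<lparr>carrier := H\<rparr>) = card (cyclic_indices m N)"
  unfolding Hirsch_number_def
proof (rule the_equality)
  have "torsion_free_rank_series (G\<lparr>carrier := H\<rparr>) m N" using torsion_free_rank_series_iff(1)[OF H] N by blast
  then show "\<exists>m' N'. torsion_free_rank_series (G\<lparr>carrier := H\<rparr>) m' N' \<and>
      card (cyclic_indices m N) = card {i. i < m' \<and> infinite_cyclic_group (series_factor (G\<lparr>carrier := H\<rparr>) N' i)}"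
    using torsion_free_rank_series_iff(2)[OF H] by metis
next
  fix h assume "\<exists>m' N'. torsion_free_rank_series (G\<lparr>carrier := H\<rparr>) m' N' \<and>
      h = card {i. i < m' \<and> infinite_cyclic_group (series_factor (G\<lparr>carrier := H\<rparr>) N' i)}"
  then obtain m' N' where t: "torsion_free_rank_series (G\<lparr>carrier := H\<rparr>) m' N'"
    and h: "h = card {i. i < m' \<and> infinite_cyclic_group (series_factor (G\<lparr>carrier := H\<rparr>) N' i)}" by blast
  have N': "rank_chain m' N'" "N' 0 = {\<one>}" "N' m' = H" using torsion_free_rank_series_iff(1)[OF H] t by blast+
  have "h = card (cyclic_indices m' N')" unfolding h by (simp only: torsion_free_rank_series_iff(2)[OF H t])
  moreover have "card (cyclic_indices m' N') \<le> card (cyclic_indices m N)"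
    by (rule cyclic_indices_le[OF N(1) N'(1)]) (use N N' in auto)
  moreover have "card (cyclic_indices m N) \<le> card (cyclic_indices m' N')"
    by (rule cyclic_indices_le[OF N'(1) N(1)]) (use N N' in auto)
  ultimately show "h = card (cyclic_indices m N)" by simp
qed

subsection \<open>Subgroups of finite index\<close>

text \<open>Schreier's generators \<open>t s r(t s)^-1\<close>, with \<open>t\<close> a
  representative. \<open>S'\<close> contains the inverses because \<open>generate\<close> admits
  inverses of generators as letters.\<close>

lemma schreier:
  assumes S: "finite S" "S \<subseteq> carrier G" "generate G S = carrier G" and L: "subgroup L G" "finite (rcosets L)"
  obtains T where "finite T" "T \<subseteq> L" "generate G T = L"
proof -
  interpret L: subgroup L G by (rule L(1))
  obtain r where tr: "transversal L r" using transversal_exists[OF L(1)] .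
  note r = transversal(1-6)[OF L(1) tr]
  define R where "R = r ` carrier G"
  have Rc: "R \<subseteq> carrier G" unfolding R_def using r(1) by blast
  have fR: "finite R"
    unfolding R_def
  proof (rule finite_image_factor)
    show "finite ((\<lambda>g. L #> g) ` carrier G)" using L(2) by (simp add: rcosets_eq_image)
  next
    fix x y assume c: "x \<in> carrier G" "y \<in> carrier G" and e: "L #> x = L #> y"
    show "r x = r y" using e rcos_eq_iff[OF L(1) c] r(6)[OF c] by simp
  qed
  define S' where "S' = S \<union> (\<lambda>s. inv s) ` S"
  have S'c: "S' \<subseteq> carrier G" unfolding S'_def using S(2) by auto
  define T where "T = (\<lambda>(t, s). t \<otimes> s \<otimes> inv r (t \<otimes> s)) ` (R \<times> S')"
  have fT: "finite T" unfolding T_def S'_def using fR S(1) by simp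
  have TL: "T \<subseteq> L"
  proof
    fix x assume "x \<in> T"
    then obtain t s where ts: "t \<in> R" "s \<in> S'" "x = t \<otimes> s \<otimes> inv r (t \<otimes> s)" unfolding T_def by auto
    have "t \<otimes> s \<in> carrier G" using ts(1,2) Rc S'c by auto
    then show "x \<in> L" unfolding ts(3) by (rule r(2))
  qed
  interpret M: subgroup "generate G T" G by (rule generate_is_subgroup) (use TL L.subset in blast)
  have T: "t \<otimes> s \<otimes> inv r (t \<otimes> s) \<in> generate G T" if "t \<in> R" "s \<in> S'" for t s
    by (rule generate.incl) (use that in \<open>auto simp: T_def\<close>)
  \<comment> \<open>The quantification over all representatives \<open>t\<close> lets the induction
    pass through products: the part of \<open>t g h\<close> in \<open>L\<close> splits at the
    representative \<open>u\<close> of \<open>t g\<close>.\<close>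
  have gen: "\<forall>t\<in>R. t \<otimes> g \<otimes> inv r (t \<otimes> g) \<in> generate G T" if "g \<in> generate G S" for g
    using that
  proof induction
    case one
    show ?case
    proof
      fix t assume t: "t \<in> R"
      have tc: "t \<in> carrier G" using t Rc by blast
      have "r t = t" using r(5) t unfolding R_def by blast
      then show "t \<otimes> \<one> \<otimes> inv r (t \<otimes> \<one>) \<in> generate G T" using tc by simp
    qed
  next
    case (incl h)
    then show ?case using T by (simp add: S'_def)
  next
    case (inv h)
    then show ?case using T by (simp add: S'_def)
  next
    case (eng g h)
    have gh: "g \<in> carrier G" "h \<in> carrier G" using eng(1,2) S(3) by blast+
    show ?case
    proof
      fix t assume t: "t \<in> R"
      have tc: "t \<in> carrier G" using t Rc by blast
      have tg: "t \<otimes> g \<in> carrier G" using tc gh by simp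
      define u where "u = r (t \<otimes> g)"
      have u: "u \<in> R" "u \<in> carrier G" unfolding u_def R_def using tg r(1) by blast+
      have uh: "u \<otimes> h \<in> carrier G" using u gh by simp
      have "r ((t \<otimes> g \<otimes> inv u) \<otimes> (u \<otimes> h)) = r (u \<otimes> h)"
        by (rule r(3)[OF _ uh]) (unfold u_def, rule r(2)[OF tg])
      moreover have "(t \<otimes> g \<otimes> inv u) \<otimes> (u \<otimes> h) = t \<otimes> (g \<otimes> h)" using tc gh u(2) by (simp add: m_assoc)
      ultimately have ru: "r (t \<otimes> (g \<otimes> h)) = r (u \<otimes> h)" by simp
      have "(t \<otimes> g \<otimes> inv u) \<otimes> (u \<otimes> h \<otimes> inv r (u \<otimes> h)) \<in> generate G T"
        by (rule M.m_closed) (use eng(3,4) t u in \<open>simp_all add: u_def\<close>)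
      moreover have "(t \<otimes> g \<otimes> inv u) \<otimes> (u \<otimes> h \<otimes> inv r (u \<otimes> h)) = t \<otimes> (g \<otimes> h) \<otimes> inv r (t \<otimes> (g \<otimes> h))"
        unfolding ru using tc gh u(2) r(1)[OF uh] by (simp add: m_assoc)
      ultimately show "t \<otimes> (g \<otimes> h) \<otimes> inv r (t \<otimes> (g \<otimes> h)) \<in> generate G T" by simp
    qed
  qed
  have "generate G T = L"
  proof
    show "generate G T \<subseteq> L" by (rule generate_subgroup_incl[OF TL L(1)])
    show "L \<subseteq> generate G T"
    proof
      fix g assume g: "g \<in> L"
      have "\<one> \<in> R" unfolding R_def using r(4)[OF L.one_closed] by (metis imageI one_closed)
      moreover have "g \<in> generate G S" using g S(3) by simp
      ultimately have "\<one> \<otimes> g \<otimes> inv r (\<one> \<otimes> g) \<in> generate G T" using gen by blast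
      then show "g \<in> generate G T" using r(4)[OF g] g by simp
    qed
  qed
  then show thesis using that fT TL by blast
qed

text \<open>An abelian section \<open>D/N\<close> with its projection. Packed into one predicate,
  the laws keep cosets out of the calculations, which then run in the commutative group
  \<open>Q\<close>.\<close>

definition abelian_projection :: "'a set \<Rightarrow> 'a set \<Rightarrow> 'a set monoid \<Rightarrow> ('a \<Rightarrow> 'a set) \<Rightarrow> bool"
  where "abelian_projection D N Q p \<longleftrightarrow> comm_group Q \<and> (\<forall>x\<in>D. p x \<in> carrier Q) \<and>
    (\<forall>x\<in>D. \<forall>y\<in>D. p (x \<otimes> y) = p x \<otimes>\<^bsub>Q\<^esub> p y) \<and> (\<forall>x\<in>D. \<forall>k::nat. p (x [^] k) = p x [^]\<^bsub>Q\<^esub> k) \<and>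
    (\<forall>x\<in>D. \<forall>i::int. p (x [^] i) = p x [^]\<^bsub>Q\<^esub> i) \<and> (\<forall>x\<in>D. p x = \<one>\<^bsub>Q\<^esub> \<longleftrightarrow> x \<in> N) \<and>
    (\<forall>x\<in>D. \<forall>y\<in>D. p x = p y \<longleftrightarrow> N #> x = N #> y)"

lemma abelian_projectionD:
  assumes "abelian_projection D N Q p"
  shows "comm_group Q" "x \<in> D \<Longrightarrow> p x \<in> carrier Q" "x \<in> D \<Longrightarrow> y \<in> D \<Longrightarrow> p (x \<otimes> y) = p x \<otimes>\<^bsub>Q\<^esub> p y"
    "x \<in> D \<Longrightarrow> p (x [^] (k::nat)) = p x [^]\<^bsub>Q\<^esub> k" "x \<in> D \<Longrightarrow> p (x [^] (i::int)) = p x [^]\<^bsub>Q\<^esub> i"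
    "x \<in> D \<Longrightarrow> p x = \<one>\<^bsub>Q\<^esub> \<longleftrightarrow> x \<in> N" "x \<in> D \<Longrightarrow> y \<in> D \<Longrightarrow> p x = p y \<longleftrightarrow> N #> x = N #> y"
  using assms by (simp_all add: abelian_projection_def)

lemma abelian_quotient:
  assumes D: "subgroup D G" and N: "subgroup N G" "N \<subseteq> D" "derived_set G D \<subseteq> N"
  obtains Q p where "abelian_projection D N Q p"
proof -
  interpret D: subgroup D G by (rule D)
  interpret N: subgroup N G by (rule N(1))
  let ?D = "G\<lparr>carrier := D\<rparr>"
  interpret DG: group ?D by (rule subgroup_imp_group[OF D])
  have com: "commutator x y \<in> N" if "x \<in> D" "y \<in> D" for x y using N(3) that by blast
  have "N \<lhd> ?D"
    unfolding DG.normal_inv_iff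
  proof (intro conjI ballI)
    show "subgroup N ?D" by (rule subgroup_incl[OF N(1) D N(2)])
  next
    fix x h assume x: "x \<in> carrier ?D" and h: "h \<in> N"
    have xD: "x \<in> D" "h \<in> D" using x h N(2) by auto
    have "commutator x h \<otimes> h \<in> N" by (rule N.m_closed[OF com[OF xD] h])
    then show "x \<otimes>\<^bsub>?D\<^esub> h \<otimes>\<^bsub>?D\<^esub> inv\<^bsub>?D\<^esub> x \<in> N"
      using xD by (simp add: m_inv_consistent[OF D] m_assoc)
  qed
  then interpret ND: normal N ?D .
  define Q where "Q = ?D Mod N"
  define p where "p x = N #>\<^bsub>?D\<^esub> x" for x
  interpret Q: group Q unfolding Q_def by (rule ND.factorgroup_is_group)
  have "p \<in> hom ?D Q" unfolding p_def Q_def by (rule ND.r_coset_hom_Mod)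
  then interpret p: group_hom ?D Q p by unfold_locales
  have cQ: "carrier Q = p ` D" and oQ: "\<one>\<^bsub>Q\<^esub> = N" by (auto simp: Q_def p_def FactGroup_def RCOSETS_def)
  have px: "p x = N #> x" for x by (simp add: p_def r_coset_def)
  have pm: "p (x \<otimes> y) = p x \<otimes>\<^bsub>Q\<^esub> p y" if "x \<in> D" "y \<in> D" for x y using p.hom_mult[of x y] that by simp
  have comm: "p x \<otimes>\<^bsub>Q\<^esub> p y = p y \<otimes>\<^bsub>Q\<^esub> p x" if xy: "x \<in> D" "y \<in> D" for x y
  proof -
    have "(x \<otimes> y) \<otimes> inv (y \<otimes> x) \<in> N" using com[OF xy] xy by (simp add: inv_mult_group m_assoc)
    then have "p (x \<otimes> y) = p (y \<otimes> x)" unfolding px using rcos_eq_iff[OF N(1), of "x \<otimes> y" "y \<otimes> x"] xy by simp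
    then show ?thesis using pm xy by simp
  qed
  have cg: "comm_group Q"
    by (rule Q.group_comm_groupI) (use comm cQ in auto)
  have iff: "p x = p y \<longleftrightarrow> N #> x = N #> y" for x y by (simp add: px)
  have one: "p x = \<one>\<^bsub>Q\<^esub> \<longleftrightarrow> x \<in> N" if x: "x \<in> D" for x
    unfolding oQ px using coset_join1[OF _ _ N(1), of x] coset_join2[OF _ N(1), of x] D.mem_carrier[OF x] by blast
  have n: "p (x [^] (k::nat)) = p x [^]\<^bsub>Q\<^esub> k" if "x \<in> D" for x k
    using p.hom_nat_pow[of x k] that by (simp add: nat_pow_consistent [symmetric])
  have i: "p (x [^] (i::int)) = p x [^]\<^bsub>Q\<^esub> i" if "x \<in> D" for x i
    using p.hom_int_pow[of x i] that by (simp add: int_pow_consistent[OF D, symmetric])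
  have c: "p x \<in> carrier Q" if "x \<in> D" for x unfolding cQ by (rule imageI[OF that])
  show thesis
    by (rule that[of Q p]) (unfold abelian_projection_def, intro conjI cg ballI allI, (rule c pm n i one iff; assumption)+)
qed

text \<open>Commutators of \<open>D\<close> lie in \<open>B\<close>, so \<open>s\<close> normalises
  \<open>B\<close> and its powers can be collected on the right.\<close>

lemma adjoin_element:
  assumes D: "subgroup D G" and B: "subgroup B G" "B \<subseteq> D" "derived_set G D \<subseteq> B" and s: "s \<in> D"
  shows "generate G (B \<union> {s}) = {b \<otimes> s [^] (i::int) | b i. b \<in> B}" (is "_ = ?E")
proof
  interpret D: subgroup D G by (rule D)
  interpret B: subgroup B G by (rule B(1))
  have sp: "s [^] (i::int) \<in> D" for i by (rule int_pow_in_subgroup[OF D s])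
  have E: "subgroup ?E G"
  proof (rule subgroupI)
    show "?E \<subseteq> carrier G" using s by auto
    have "\<one> \<otimes> s [^] (0::int) \<in> ?E" using B.one_closed by blast
    then show "?E \<noteq> {}" by blast
  next
    fix x assume "x \<in> ?E"
    then obtain b and i :: int where x: "x = b \<otimes> s [^] i" "b \<in> B" by blast
    have c: "s [^] (- i) \<in> D" "inv b \<in> D" "s [^] (- i) \<in> carrier G" "b \<in> carrier G" using sp x(2) B(2) s by auto
    have "s [^] (- i) \<otimes> inv b \<otimes> inv (s [^] (- i)) \<otimes> inv (inv b) \<in> B" using B(3) c by blast
    then have "s [^] (- i) \<otimes> inv b \<otimes> inv (s [^] (- i)) \<otimes> inv (inv b) \<otimes> inv b \<in> B" using x(2) by simp
    then have m: "s [^] (- i) \<otimes> inv b \<otimes> inv (s [^] (- i)) \<in> B" using c(3,4) by (simp add: m_assoc)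
    have "inv x = (s [^] (- i) \<otimes> inv b \<otimes> inv (s [^] (- i))) \<otimes> s [^] (- i)"
      unfolding x(1) using c(3,4) s by (simp add: inv_mult_group int_pow_neg m_assoc)
    then show "inv x \<in> ?E" using m by blast
  next
    fix x y assume "x \<in> ?E" "y \<in> ?E"
    then obtain a b and i j :: int where x: "x = a \<otimes> s [^] i" "a \<in> B" and y: "y = b \<otimes> s [^] j" "b \<in> B" by blast
    have c: "s [^] i \<in> D" "b \<in> D" "s [^] i \<in> carrier G" "s [^] j \<in> carrier G" "b \<in> carrier G" "a \<in> carrier G" using sp x(2) y(2) B(2) s by auto
    have "s [^] i \<otimes> b \<otimes> inv (s [^] i) \<otimes> inv b \<in> B" using B(3) c(1,2) by blast
    then have "a \<otimes> (s [^] i \<otimes> b \<otimes> inv (s [^] i) \<otimes> inv b) \<otimes> b \<in> B" using x(2) y(2) by simp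
    then have m: "a \<otimes> (s [^] i \<otimes> b \<otimes> inv (s [^] i)) \<in> B" using c by (simp add: m_assoc)
    have "x \<otimes> y = a \<otimes> (s [^] i \<otimes> b \<otimes> inv (s [^] i)) \<otimes> (s [^] i \<otimes> s [^] j)"
      unfolding x(1) y(1) using c by (simp add: m_assoc)
    also have "s [^] i \<otimes> s [^] j = s [^] (i + j)" using s by (simp add: int_pow_mult)
    finally show "x \<otimes> y \<in> ?E" using m by blast
  qed
  have "B \<union> {s} \<subseteq> ?E"
  proof (intro Un_least subsetI)
    fix b assume b: "b \<in> B"
    then have "b = b \<otimes> s [^] (0::int)" by simp
    then show "b \<in> ?E" using b by blast
  next
    fix x assume "x \<in> {s}"
    then have "x = \<one> \<otimes> s [^] (1::int)" using s by simp
    then show "x \<in> ?E" using B.one_closed by blast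
  qed
  then show "generate G (B \<union> {s}) \<subseteq> ?E" by (rule generate_subgroup_incl[OF _ E])
  interpret M: subgroup "generate G (B \<union> {s})" G by (rule generate_is_subgroup) (use s B.subset in auto)
  show "?E \<subseteq> generate G (B \<union> {s})"
  proof
    fix x assume "x \<in> ?E"
    then obtain b and i :: int where x: "x = b \<otimes> s [^] i" "b \<in> B" by blast
    have "b \<in> generate G (B \<union> {s})" "s \<in> generate G (B \<union> {s})" using x(2) by (auto intro: generate.incl)
    then show "x \<in> generate G (B \<union> {s})" unfolding x(1) by (intro M.m_closed int_pow_in_subgroup[OF M.subgroup_axioms])
  qed
qed

text \<open>In an abelian section of exponent \<open>e\<close>, adjoining \<open>s\<close>
  multiplies the order by at most \<open>e\<close>, because exponents of \<open>s\<close> may be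
  reduced modulo \<open>e\<close>.\<close>

lemma finite_exponent_cosets:
  assumes B: "subgroup B G" and X: "subgroup X G" "X \<subseteq> B" "derived_set G B \<subseteq> X"
    and e: "e > 0" "\<And>b. b \<in> B \<Longrightarrow> b [^] (e::nat) \<in> X" and S: "finite S" "S \<subseteq> B"
  shows "finite ((\<lambda>x. X #> x) ` generate G (X \<union> S)) \<and> card ((\<lambda>x. X #> x) ` generate G (X \<union> S)) \<le> e ^ card S"
  using S
proof (induction S)
  case empty
  interpret X: subgroup X G by (rule X(1))
  have "generate G X \<subseteq> X" by (rule generate_subgroup_incl[OF order_refl X(1)])
  then have sX: "(\<lambda>x. X #> x) ` generate G (X \<union> {}) \<subseteq> {X}"
    using coset_join2[OF _ X(1)] X.mem_carrier by auto
  have f: "finite ((\<lambda>x. X #> x) ` generate G (X \<union> {}))" by (rule finite_subset[OF sX]) simp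
  have "card ((\<lambda>x. X #> x) ` generate G (X \<union> {})) \<le> card {X}" by (rule card_mono[OF _ sX]) simp
  also have "\<dots> = e ^ card {}" by simp
  finally show ?case using f by (rule conjI[rotated])
next
  case (insert s S)
  obtain Q p where Q': "abelian_projection B X Q p"
    by (rule abelian_quotient[OF B X])
  note Q = abelian_projectionD(1)[OF Q'] and p = abelian_projectionD(2-)[OF Q']
  interpret Q: comm_group Q by (rule Q)
  interpret B: subgroup B G by (rule B)
  define C where "C = generate G (X \<union> S)"
  have XSB: "X \<union> S \<subseteq> B" using X(2) insert.prems by blast
  have C: "subgroup C G" unfolding C_def by (rule generate_is_subgroup) (use XSB B.subset in blast)
  have CB: "C \<subseteq> B" unfolding C_def by (rule generate_subgroup_incl[OF XSB B])
  have XC: "X \<subseteq> C" unfolding C_def by (auto intro: generate.incl)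
  have sB: "s \<in> B" using insert.prems by blast
  have ih: "finite ((\<lambda>x. X #> x) ` C)" "card ((\<lambda>x. X #> x) ` C) \<le> e ^ card S" using insert.IH insert.prems unfolding C_def by blast+
  have dC: "derived_set G B \<subseteq> C" using X(3) XC by blast
  have E: "subgroup (generate G (C \<union> {s})) G" by (rule generate_is_subgroup) (use CB sB B.subset in blast)
  have sub: "generate G (X \<union> insert s S) \<subseteq> generate G (C \<union> {s})"
  proof (rule generate_subgroup_incl[OF _ E])
    have "S \<subseteq> C" unfolding C_def by (auto intro: generate.incl)
    then show "X \<union> insert s S \<subseteq> generate G (C \<union> {s})" using XC by (auto intro: generate.incl)
  qed
  let ?f = "\<lambda>(D, k). D #> s [^] (k::nat)"
  have img: "(\<lambda>x. X #> x) ` generate G (X \<union> insert s S) \<subseteq> ?f ` (((\<lambda>x. X #> x) ` C) \<times> {..<e})"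
  proof
    fix Y assume "Y \<in> (\<lambda>x. X #> x) ` generate G (X \<union> insert s S)"
    then obtain x where x: "x \<in> generate G (C \<union> {s})" "Y = X #> x" using sub by blast
    then obtain b and i :: int where bi: "x = b \<otimes> s [^] i" "b \<in> C" unfolding adjoin_element[OF B C CB dC sB] by blast
    define k where "k = nat (i mod int e)"
    have ke: "k < e" and ki: "int k = i mod int e" using e(1) by (simp_all add: k_def nat_less_iff)
    have bB: "b \<in> B" using bi(2) CB by blast
    have sp: "s [^] i \<in> B" "s [^] k \<in> B" by (rule int_pow_in_subgroup[OF B sB], rule pow_in_subgroup[OF B sB])
    have ps: "p s [^]\<^bsub>Q\<^esub> e = \<one>\<^bsub>Q\<^esub>" using p(3)[OF sB] p(5)[OF pow_in_subgroup[OF B sB]] e(2)[OF sB] by simp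
    have psc: "p s \<in> carrier Q" by (rule p(1)[OF sB])
    have "i = int e * (i div int e) + int k" using ki by simp
    then have "p s [^]\<^bsub>Q\<^esub> i = p s [^]\<^bsub>Q\<^esub> (int e * (i div int e) + int k)" by simp
    also have "\<dots> = p s [^]\<^bsub>Q\<^esub> (int e * (i div int e)) \<otimes>\<^bsub>Q\<^esub> p s [^]\<^bsub>Q\<^esub> int k" by (rule Q.int_pow_mult[OF psc])
    also have "p s [^]\<^bsub>Q\<^esub> (int e * (i div int e)) = (p s [^]\<^bsub>Q\<^esub> int e) [^]\<^bsub>Q\<^esub> (i div int e)" by (rule Q.int_pow_pow[OF psc, symmetric])
    also have "p s [^]\<^bsub>Q\<^esub> int e = \<one>\<^bsub>Q\<^esub>" by (simp only: int_pow_int ps)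
    also have "\<one>\<^bsub>Q\<^esub> [^]\<^bsub>Q\<^esub> (i div int e) = \<one>\<^bsub>Q\<^esub>" by simp
    also have "\<one>\<^bsub>Q\<^esub> \<otimes>\<^bsub>Q\<^esub> p s [^]\<^bsub>Q\<^esub> int k = p s [^]\<^bsub>Q\<^esub> k" using psc by (simp add: int_pow_int)
    finally have eq: "p (s [^] i) = p (s [^] k)" using p(3,4)[OF sB] by simp
    have m: "b \<otimes> s [^] i \<in> B" "b \<otimes> s [^] k \<in> B" using bB sp by simp_all
    have "p (b \<otimes> s [^] i) = p (b \<otimes> s [^] k)" using p(2)[OF bB sp(1)] p(2)[OF bB sp(2)] eq by simp
    then have "X #> (b \<otimes> s [^] i) = X #> (b \<otimes> s [^] k)" using p(6)[OF m] by blast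
    then have "Y = X #> b #> s [^] k"
      using x(2) bi(1) coset_mult_assoc[OF subgroup.subset[OF X(1)], of b "s [^] k"] bB sB by simp
    then show "Y \<in> ?f ` (((\<lambda>x. X #> x) ` C) \<times> {..<e})" using bi(2) ke by (intro image_eqI[of _ _ "(X #> b, k)"]) auto
  qed
  have fin: "finite (((\<lambda>x. X #> x) ` C) \<times> {..<e})" using ih(1) by simp
  have f: "finite ((\<lambda>x. X #> x) ` generate G (X \<union> insert s S))"
    "card ((\<lambda>x. X #> x) ` generate G (X \<union> insert s S)) \<le> card (((\<lambda>x. X #> x) ` C) \<times> {..<e})"
    by (rule finite_subset[OF img finite_imageI[OF fin]], rule surj_card_le[OF fin img])
  have "card (((\<lambda>x. X #> x) ` C) \<times> {..<e}) \<le> e ^ card S * e" using ih(2) by (simp add: card_cartesian_product)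
  then have "card ((\<lambda>x. X #> x) ` generate G (X \<union> insert s S)) \<le> e ^ card (insert s S)"
    using f(2) insert.hyps by (simp add: mult.commute)
  then show ?case using f(1) by blast
qed

text \<open>Finitely many cosets of \<open>X\<close> in \<open>B\<close> lie in a subsection
  generated by at most \<open>r\<close> elements, so there are at most \<open>e ^ r\<close> of them.
  This bound is the same for all finite sets of cosets.\<close>

lemma finite_exponent_quotient:
  assumes r: "rank_at_most r" and B: "subgroup B G" and X: "subgroup X G" "X \<subseteq> B" "derived_set G B \<subseteq> X"
    and e: "e > 0" "\<And>b. b \<in> B \<Longrightarrow> b [^] (e::nat) \<in> X"
  shows "finite ((\<lambda>x. X #> x) ` B)"
proof (rule conjunct1[OF finite_if_finite_subsets_card_bdd])
  fix F assume F: "F \<subseteq> (\<lambda>x. X #> x) ` B" "finite F"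
  then obtain T where T: "T \<subseteq> B" "finite T" "F = (\<lambda>x. X #> x) ` T" using finite_subset_image by metis
  interpret B: subgroup B G by (rule B)
  have Tc: "T \<subseteq> carrier G" using T(1) B.subset by blast
  obtain S where S: "finite S" "card S \<le> r" "S \<subseteq> carrier G" "generate G S = generate G T"
    using r T(2) Tc unfolding rank_at_most_def by metis
  have "generate G T \<subseteq> B" by (rule generate_subgroup_incl[OF T(1) B])
  then have SB: "S \<subseteq> B" using S(4) by (metis generate.incl subset_iff)
  note c = finite_exponent_cosets[OF B X e S(1) SB]
  have "T \<subseteq> generate G (X \<union> S)"
  proof -
    have "T \<subseteq> generate G S" unfolding S(4) by (auto intro: generate.incl)
    also have "\<dots> \<subseteq> generate G (X \<union> S)" by (rule mono_generate) blast
    finally show ?thesis .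
  qed
  then have "F \<subseteq> (\<lambda>x. X #> x) ` generate G (X \<union> S)" unfolding T(3) by (rule image_mono)
  then have "card F \<le> e ^ card S" using c card_mono by (metis order_trans)
  also have "\<dots> \<le> e ^ r" using S(2) e(1) by (intro power_increasing) auto
  finally show "card F \<le> e ^ r" .
qed

section \<open>Descent of finite index along an abelian section\<close>

lemma set_mult_normal:
  assumes "B \<lhd> G" "subgroup H G"
  shows "subgroup (B <#> H) G" "B \<subseteq> B <#> H" "H \<subseteq> B <#> H"
proof -
  show "subgroup (B <#> H) G" by (rule mult_norm_subgroup[OF assms])
  interpret B: subgroup B G by (rule normal_imp_subgroup[OF assms(1)])
  interpret H: subgroup H G by (rule assms(2))
  show "B \<subseteq> B <#> H"
  proof
    fix b assume b: "b \<in> B"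
    then have "b = b \<otimes> \<one>" by simp
    then show "b \<in> B <#> H" using b H.one_closed unfolding set_mult_def by blast
  qed
  show "H \<subseteq> B <#> H"
  proof
    fix h assume h: "h \<in> H"
    then have "h = \<one> \<otimes> h" by simp
    then show "h \<in> B <#> H" using h B.one_closed unfolding set_mult_def by blast
  qed
qed

text \<open>\<open>BH\<close> is generated by finitely many products \<open>b h\<close>. For a common exponent \<open>e\<close> of these \<open>b\<close> modulo
  \<open>X = A(H \<inter> B)\<close>, the elements of \<open>B\<close> of exponent \<open>e\<close> modulo \<open>X\<close> form a subgroup \<open>Y\<close> normalised by \<open>H\<close> with
  \<open>YH = BH\<close>. So \<open>Y = B\<close>, and the rank bounds the order of \<open>B/X\<close>.\<close>

lemma finite_index_step:
  assumes S: "finite S" "S \<subseteq> carrier G" "generate G S = carrier G" and r: "rank_at_most r" and H: "subgroup H G"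
    and A: "A \<lhd> G" and B: "B \<lhd> G" and AB: "A \<subseteq> B" "derived_set G B \<subseteq> A" and fin: "finite (rcosets (B <#> H))"
    and tors: "\<And>x. x \<in> B \<Longrightarrow> \<exists>k>0. x [^] (k::nat) \<in> A <#> (H \<inter> B)"
  shows "finite (rcosets (A <#> H))"
proof -
  interpret H: subgroup H G by (rule H)
  interpret B: normal B G by (rule B)
  interpret A: normal A G by (rule A)
  have sB: "subgroup B G" by (rule normal_imp_subgroup, rule B)
  have sHB: "subgroup (H \<inter> B) G" by (rule subgroups_Inter_pair[OF H sB])
  define L where "L = B <#> H"
  note L = set_mult_normal[OF B H, folded L_def]
  obtain T where T: "finite T" "T \<subseteq> L" "generate G T = L"
    using schreier[OF S L(1)] fin unfolding L_def by metis
  define X where "X = A <#> (H \<inter> B)"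
  note X = set_mult_normal[OF A sHB, folded X_def]
  interpret X: subgroup X G by (rule X(1))
  have XB: "X \<subseteq> B"
  proof
    fix x assume "x \<in> X"
    then obtain a c where "a \<in> A" "c \<in> H \<inter> B" "x = a \<otimes> c" unfolding X_def set_mult_def by blast
    then show "x \<in> B" using AB(1) by auto
  qed
  have dX: "derived_set G B \<subseteq> X" using AB(2) X(2) by blast
  have HX: "conj_by h x \<in> X" if h: "h \<in> H" and x: "x \<in> X" for h x
  proof -
    obtain a c where ac: "a \<in> A" "c \<in> H \<inter> B" "x = a \<otimes> c" using x unfolding X_def set_mult_def by blast
    have cc: "h \<in> carrier G" "a \<in> carrier G" "c \<in> carrier G" using h ac by auto
    have "conj_by h a \<in> A" by (rule A.inv_op_closed2[OF cc(1) ac(1)])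
    moreover have "conj_by h c \<in> H \<inter> B"
    proof
      show "conj_by h c \<in> H" using h ac(2) by simp
      show "conj_by h c \<in> B" using B.inv_op_closed2[OF cc(1)] ac(2) by blast
    qed
    moreover have "conj_by h x = (conj_by h a) \<otimes> conj_by h c" unfolding ac(3) using cc by (simp add: m_assoc)
    ultimately show ?thesis unfolding X_def set_mult_def by blast
  qed
  have "\<exists>b. \<forall>t\<in>T. b t \<in> B \<and> inv b t \<otimes> t \<in> H"
  proof (rule bchoice, rule ballI)
    fix t assume "t \<in> T"
    then obtain b h where bh: "b \<in> B" "h \<in> H" "t = b \<otimes> h" using T(2) unfolding L_def set_mult_def by blast
    have "inv b \<otimes> t = h" unfolding bh(3) using bh(1,2) by (simp add: m_assoc [symmetric])
    then show "\<exists>b. b \<in> B \<and> inv b \<otimes> t \<in> H" using bh by blast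
  qed
  then obtain b where b: "\<And>t. t \<in> T \<Longrightarrow> b t \<in> B" "\<And>t. t \<in> T \<Longrightarrow> inv b t \<otimes> t \<in> H" by blast
  have "\<exists>k. \<forall>t\<in>T. k t > 0 \<and> b t [^] (k t :: nat) \<in> X"
    by (rule bchoice, rule ballI) (use tors[OF b(1)] in \<open>simp add: X_def\<close>)
  then obtain k where k: "\<And>t. t \<in> T \<Longrightarrow> k t > 0" "\<And>t. t \<in> T \<Longrightarrow> b t [^] (k t :: nat) \<in> X" by blast
  define e where "e = (\<Prod>t\<in>T. k t)"
  have e0: "e > 0" unfolding e_def using k(1) T(1) by (simp add: prod_pos)
  obtain Q p where Q': "abelian_projection B X Q p"
    by (rule abelian_quotient[OF sB X(1) XB dX])
  note Q = abelian_projectionD(1)[OF Q'] and p = abelian_projectionD(2-)[OF Q']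
  interpret Q: comm_group Q by (rule Q)
  define Y where "Y = {y \<in> B. y [^] e \<in> X}"
  have Yp: "y \<in> Y \<longleftrightarrow> y \<in> B \<and> p y [^]\<^bsub>Q\<^esub> e = \<one>\<^bsub>Q\<^esub>" for y
    unfolding Y_def using p(3)[of y e] p(5)[OF pow_in_subgroup[OF sB], of y e] by auto
  have Ym: "x \<otimes> y \<in> Y" if xy: "x \<in> Y" "y \<in> Y" for x y
  proof -
    have xB: "x \<in> B" "y \<in> B" using xy by (auto simp: Y_def)
    have "p (x \<otimes> y) [^]\<^bsub>Q\<^esub> e = p x [^]\<^bsub>Q\<^esub> e \<otimes>\<^bsub>Q\<^esub> p y [^]\<^bsub>Q\<^esub> e"
      unfolding p(2)[OF xB] by (rule Q.nat_pow_distrib[OF p(1)[OF xB(1)] p(1)[OF xB(2)]])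
    then show ?thesis using xy Yp xB by simp
  qed
  have Yi: "inv y \<in> Y" if y: "y \<in> Y" for y
  proof -
    have yB: "y \<in> B" "y [^] e \<in> X" using y by (auto simp: Y_def)
    have "(inv y) [^] e = inv (y [^] e)" using yB(1) by (simp add: nat_pow_inv)
    then show ?thesis using yB unfolding Y_def by simp
  qed
  have YH: "conj_by h y \<in> Y" if h: "h \<in> H" and y: "y \<in> Y" for h y
  proof -
    have yB: "y \<in> B" "y [^] e \<in> X" using y by (auto simp: Y_def)
    have c: "h \<in> carrier G" "y \<in> carrier G" using h yB by auto
    have "conj_by h y [^] n = h \<otimes> y [^] n \<otimes> inv h" for n :: nat
    proof (induction n)
      case (Suc n)
      have "conj_by h y [^] Suc n = (h \<otimes> y [^] n \<otimes> inv h) \<otimes> conj_by h y" using Suc by simp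
      also have "\<dots> = h \<otimes> y [^] Suc n \<otimes> inv h" using c by (simp add: m_assoc)
      finally show ?case .
    qed (use c in simp)
    then have "conj_by h y [^] e \<in> X" using HX[OF h yB(2)] by simp
    moreover have "conj_by h y \<in> B" by (rule B.inv_op_closed2[OF c(1) yB(1)])
    ultimately show ?thesis by (simp add: Y_def)
  qed
  have XY: "X \<subseteq> Y"
  proof
    fix x assume x: "x \<in> X"
    then show "x \<in> Y" using XB pow_in_subgroup[OF X(1) x, of e] unfolding Y_def by blast
  qed
  have Yc: "Y \<subseteq> carrier G" unfolding Y_def using B.subset by blast
  define Z where "Z = {y \<otimes> h | y h. y \<in> Y \<and> h \<in> H}"
  have Z: "subgroup Z G"
  proof (rule subgroupI)
    show "Z \<subseteq> carrier G" unfolding Z_def using Yc by auto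
    have "\<one> \<in> Y" using XY X.one_closed by blast
    then show "Z \<noteq> {}" unfolding Z_def using H.one_closed by blast
  next
    fix x assume "x \<in> Z"
    then obtain y h where x: "x = y \<otimes> h" "y \<in> Y" "h \<in> H" unfolding Z_def by blast
    have c: "y \<in> carrier G" "h \<in> carrier G" using x Yc by auto
    have "inv h \<otimes> inv y \<otimes> inv (inv h) \<in> Y" by (rule YH[OF H.m_inv_closed[OF x(3)] Yi[OF x(2)]])
    moreover have "inv x = (inv h \<otimes> inv y \<otimes> inv (inv h)) \<otimes> inv h" unfolding x(1) using c by (simp add: inv_mult_group m_assoc)
    ultimately show "inv x \<in> Z" unfolding Z_def using H.m_inv_closed[OF x(3)] by blast
  next
    fix x x' assume "x \<in> Z" "x' \<in> Z"
    then obtain y h y' h' where x: "x = y \<otimes> h" "y \<in> Y" "h \<in> H" and x': "x' = y' \<otimes> h'" "y' \<in> Y" "h' \<in> H" unfolding Z_def by blast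
    have c: "y \<in> carrier G" "h \<in> carrier G" "y' \<in> carrier G" "h' \<in> carrier G" using x x' Yc by auto
    have "y \<otimes> (conj_by h y') \<in> Y" by (rule Ym[OF x(2) YH[OF x(3) x'(2)]])
    moreover have "h \<otimes> h' \<in> H" using x x' by simp
    moreover have "x \<otimes> x' = (y \<otimes> (conj_by h y')) \<otimes> (h \<otimes> h')" unfolding x(1) x'(1) using c by (simp add: m_assoc)
    ultimately show "x \<otimes> x' \<in> Z" unfolding Z_def by blast
  qed
  have "T \<subseteq> Z"
  proof
    fix t assume t: "t \<in> T"
    have bB: "b t \<in> B" by (rule b(1)[OF t])
    have pbc: "p (b t) \<in> carrier Q" by (rule p(1)[OF bB])
    have "p (b t) [^]\<^bsub>Q\<^esub> k t = \<one>\<^bsub>Q\<^esub>" using p(3)[OF bB, of "k t"] p(5)[OF pow_in_subgroup[OF sB bB], of "k t"] k(2)[OF t] by simp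
    moreover obtain l where "e = k t * l" using dvd_prod_eqI[OF T(1) t] unfolding e_def by (metis dvd_def)
    ultimately have "p (b t) [^]\<^bsub>Q\<^esub> e = \<one>\<^bsub>Q\<^esub>" using Q.nat_pow_pow[OF pbc, of "k t" l] by simp
    then have "b t \<in> Y" using Yp bB by blast
    moreover have "t = b t \<otimes> (inv b t \<otimes> t)"
      using bB t T(2) subgroup.mem_carrier[OF L(1), of t] by (simp add: m_assoc [symmetric] subset_iff)
    ultimately show "t \<in> Z" unfolding Z_def using b(2)[OF t] by blast
  qed
  then have LZ: "L \<subseteq> Z" using generate_subgroup_incl[OF _ Z] T(3) by blast
  \<comment> \<open>An element of \<open>B\<close> is \<open>y \<otimes> h\<close> with
    \<open>y\<close> in \<open>Y\<close> and \<open>h\<close> in \<open>H\<close>; then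
    \<open>h\<close> lies in \<open>H \<inter> B\<close>, hence in \<open>X\<close> and so in
    \<open>Y\<close>.\<close>
  have BY: "x [^] e \<in> X" if x: "x \<in> B" for x
  proof -
    have "x \<in> Z" using x L(2) LZ by blast
    then obtain y h where yh: "x = y \<otimes> h" "y \<in> Y" "h \<in> H" unfolding Z_def by blast
    have yB: "y \<in> B" using yh(2) by (simp add: Y_def)
    have "h = inv y \<otimes> x" unfolding yh(1) using yB yh(3) by simp
    then have "h \<in> B" using yB x by simp
    then have "h \<in> Y" using X(3) XY yh(3) by blast
    then have "x \<in> Y" unfolding yh(1) by (rule Ym[OF yh(2)])
    then show ?thesis by (simp add: Y_def)
  qed
  have fX: "finite ((\<lambda>x. X #> x) ` B)"
    by (rule finite_exponent_quotient[OF r sB X(1) XB dX e0 BY])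
  define M where "M = A <#> H"
  note M = set_mult_normal[OF A H, folded M_def]
  have XM: "X \<subseteq> M" unfolding X_def M_def set_mult_def by blast
  have LM: "M \<subseteq> L" unfolding M_def L_def set_mult_def using AB(1) by blast
  have "finite ((\<lambda>x. M #> x) ` B)"
  proof (rule finite_image_factor[OF fX])
    fix x y assume "x \<in> B" "y \<in> B" and e: "X #> x = X #> y"
    then have c: "x \<in> carrier G" "y \<in> carrier G" by auto
    show "M #> x = M #> y" using e rcos_eq_iff[OF X(1) c] rcos_eq_iff[OF M(1) c] XM by blast
  qed
  \<comment> \<open>\<open>x h\<close> and \<open>h^-1 x h\<close> lie in the same coset of
    \<open>M\<close>, so \<open>B\<close> represents all cosets of \<open>M = A H\<close> in
    \<open>L = B H\<close>.\<close>
  moreover have "(\<lambda>l. M #> l) ` L \<subseteq> (\<lambda>x. M #> x) ` B"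
  proof
    fix C assume "C \<in> (\<lambda>l. M #> l) ` L"
    then obtain x h where xh: "x \<in> B" "h \<in> H" "C = M #> (x \<otimes> h)" unfolding L_def set_mult_def by blast
    have c: "x \<in> carrier G" "h \<in> carrier G" using xh by auto
    define y where "y = inv h \<otimes> x \<otimes> h"
    have y: "y \<in> B" unfolding y_def by (rule B.inv_op_closed1[OF c(2) xh(1)])
    have "(x \<otimes> h) \<otimes> inv y = h" unfolding y_def using c by (simp add: inv_mult_group m_assoc)
    then have m: "(x \<otimes> h) \<otimes> inv y \<in> M" using subsetD[OF M(3) xh(2)] by (simp only:)
    have cc: "x \<otimes> h \<in> carrier G" "y \<in> carrier G" using c y by simp_all
    have "C = M #> y" unfolding xh(3) by (rule iffD2[OF rcos_eq_iff[OF M(1) cc] m])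
    then show "C \<in> (\<lambda>x. M #> x) ` B" using y by (rule image_eqI)
  qed
  ultimately have fML: "finite ((\<lambda>l. M #> l) ` L)" by (rule finite_subset[rotated])
  have "finite (rcosets L)" unfolding L_def by (rule fin)
  then have "finite (rcosets M)" by (rule index_tower(3)[OF M(1) L(1) LM _ fML])
  then show ?thesis by (simp only: M_def)
qed

lemma finite_index_descent:
  assumes S: "finite S" "S \<subseteq> carrier G" "generate G S = carrier G" and r: "rank_at_most r" and H: "subgroup H G"
    and A: "\<And>j. j \<le> d \<Longrightarrow> A j \<lhd> G" "\<And>j. j < d \<Longrightarrow> A j \<subseteq> A (Suc j)" "\<And>j. j < d \<Longrightarrow> derived_set G (A (Suc j)) \<subseteq> A j"
    and A0: "A 0 = {\<one>}" and fin: "finite (rcosets (A d))"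
    and tors: "\<And>j x. j < d \<Longrightarrow> x \<in> A (Suc j) \<Longrightarrow> \<exists>k>0. x [^] (k::nat) \<in> A j <#> (H \<inter> A (Suc j))"
  shows "finite (rcosets H)"
proof -
  interpret H: subgroup H G by (rule H)
  have "finite (rcosets (A j <#> H))" if "j \<le> d" for j
    using that
  proof (induction rule: inc_induct)
    case base
    note s = set_mult_normal[OF A(1)[OF order_refl] H]
    show ?case by (rule index_tower(2)[OF normal_imp_subgroup[OF A(1)[OF order_refl]] s(1,2) fin])
  next
    case (step j)
    have "Suc j \<le> d" "j \<le> d" using step.hyps by simp_all
    then show ?case
      by (intro finite_index_step[OF S r H A(1) A(1) A(2,3) step.IH tors]) (use step.hyps in simp_all)
  qed
  from this[of 0] have "finite (rcosets ({\<one>} <#> H))" by (simp add: A0)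
  moreover have "{\<one>} <#> H = H" unfolding set_mult_def by auto
  ultimately show ?thesis by simp
qed

section \<open>Chains through abelian sections of finite rank\<close>

lemma int_pow_mem_imp_nat_pow_mem:
  assumes H: "subgroup H G" and x: "x \<in> carrier G" and i: "x [^] (i::int) \<in> H"
  shows "x [^] nat \<bar>i\<bar> \<in> H"
proof (cases "i \<ge> 0")
  case True
  then have "x [^] i = x [^] nat \<bar>i\<bar>" using int_pow_int[of G x "nat \<bar>i\<bar>"] by simp
  then show ?thesis using i by (simp only:)
next
  case False
  then have "x [^] (- i) = x [^] nat \<bar>i\<bar>" using int_pow_int[of G x "nat \<bar>i\<bar>"] by simp
  moreover have "x [^] (- i) = inv (x [^] i)" by (rule int_pow_neg[OF x])
  ultimately have "x [^] nat \<bar>i\<bar> = inv (x [^] i)" by (simp only:)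
  then show ?thesis using subgroup.m_inv_closed[OF H i] by (simp only:)
qed

text \<open>Modulo \<open>B\<close> the new section is cyclic, generated by \<open>s\<close>;
  whether it is periodic or infinite is decided by the powers of \<open>s\<close>.\<close>

lemma adjoin_factor:
  assumes D: "subgroup D G" and B: "subgroup B G" "B \<subseteq> D" "derived_set G D \<subseteq> B" and s: "s \<in> D"
  shows "k > 0 \<Longrightarrow> s [^] (k::nat) \<in> B \<Longrightarrow> torsion_factor B (generate G (B \<union> {s}))"
    and "\<forall>k>0. s [^] (k::nat) \<notin> B \<Longrightarrow> cyclic_factor B (generate G (B \<union> {s}))"
proof -
  interpret D: subgroup D G by (rule D)
  interpret B: subgroup B G by (rule B(1))
  obtain Q p where Q': "abelian_projection D B Q p"
    by (rule abelian_quotient[OF D B])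
  note Q = abelian_projectionD(1)[OF Q'] and p = abelian_projectionD(2-)[OF Q']
  interpret Q: comm_group Q by (rule Q)
  have ps: "p s \<in> carrier Q" by (rule p(1)[OF s])
  let ?E = "generate G (B \<union> {s})"
  have ED: "?E \<subseteq> D" by (rule generate_subgroup_incl[OF _ D]) (use B(2) s in blast)
  have form: "\<exists>i::int. p x = p s [^]\<^bsub>Q\<^esub> i" if x: "x \<in> ?E" for x
  proof -
    obtain b and i :: int where bi: "x = b \<otimes> s [^] i" "b \<in> B" using x unfolding adjoin_element[OF D B s] by blast
    have b: "b \<in> D" "p b = \<one>\<^bsub>Q\<^esub>" using bi(2) B(2) p(5)[of b] by auto
    have "p x = p b \<otimes>\<^bsub>Q\<^esub> p (s [^] i)" unfolding bi(1) by (rule p(2)[OF b(1) int_pow_in_subgroup[OF D s]])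
    also have "\<dots> = p s [^]\<^bsub>Q\<^esub> i" using b(2) p(4)[OF s, of i] ps by simp
    finally show ?thesis by blast
  qed
  show "torsion_factor B ?E" if k: "k > 0" "s [^] (k::nat) \<in> B"
    unfolding torsion_factor_def
  proof
    fix x assume x: "x \<in> ?E"
    then have xD: "x \<in> D" using ED by blast
    obtain i :: int where i: "p x = p s [^]\<^bsub>Q\<^esub> i" using form[OF x] by blast
    have psk: "p s [^]\<^bsub>Q\<^esub> int k = \<one>\<^bsub>Q\<^esub>"
      using p(3)[OF s, of k] p(5)[OF pow_in_subgroup[OF D s], of k] k(2) by (simp only: int_pow_int)
    have "p (x [^] k) = (p s [^]\<^bsub>Q\<^esub> i) [^]\<^bsub>Q\<^esub> int k" using p(3)[OF xD, of k] i by (simp only: int_pow_int)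
    also have "\<dots> = p s [^]\<^bsub>Q\<^esub> (int k * i)" by (simp only: Q.int_pow_pow[OF ps] mult.commute)
    also have "\<dots> = (p s [^]\<^bsub>Q\<^esub> int k) [^]\<^bsub>Q\<^esub> i" by (rule Q.int_pow_pow[OF ps, symmetric])
    also have "\<dots> = \<one>\<^bsub>Q\<^esub>" unfolding psk by simp
    finally have "x [^] k \<in> B" using p(5)[OF pow_in_subgroup[OF D xD, of k]] by blast
    then show "\<exists>k::nat. k > 0 \<and> x [^] k \<in> B" using k(1) by blast
  qed
  show "cyclic_factor B ?E" if n: "\<forall>k>0. s [^] (k::nat) \<notin> B"
  proof -
    have zero: "i = 0" if "p s [^]\<^bsub>Q\<^esub> (i::int) = \<one>\<^bsub>Q\<^esub>" for i
    proof (rule ccontr)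
      assume "i \<noteq> 0"
      have "s [^] i \<in> B" using that p(4)[OF s, of i] p(5)[OF int_pow_in_subgroup[OF D s], of i] by simp
      then have "s [^] nat \<bar>i\<bar> \<in> B" by (rule int_pow_mem_imp_nat_pow_mem[OF B(1) D.mem_carrier[OF s]])
      moreover have "nat \<bar>i\<bar> > 0" using \<open>i \<noteq> 0\<close> by simp
      ultimately show False using n by blast
    qed
    have uniq: "i = j" if "p s [^]\<^bsub>Q\<^esub> (i::int) = p s [^]\<^bsub>Q\<^esub> j" for i j
      using zero[of "i - j"] that Q.int_pow_diff[OF ps, of i j] ps by simp
    define e where "e x = (SOME i::int. p x = p s [^]\<^bsub>Q\<^esub> i)" for x
    have e: "p x = p s [^]\<^bsub>Q\<^esub> e x" if "x \<in> ?E" for x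
      unfolding e_def by (rule someI_ex[OF form[OF that]])
    interpret E: subgroup ?E G by (rule generate_is_subgroup) (use B.subset s in auto)
    have "exponent_map B ?E e"
      unfolding exponent_map_def
    proof (intro conjI ballI)
      fix x y assume xy: "x \<in> ?E" "y \<in> ?E"
      have "p s [^]\<^bsub>Q\<^esub> e (x \<otimes> y) = p s [^]\<^bsub>Q\<^esub> (e x + e y)"
        unfolding e[OF E.m_closed[OF xy], symmetric] Q.int_pow_mult[OF ps] e[OF xy(1), symmetric] e[OF xy(2), symmetric]
        by (rule p(2)) (use xy ED in blast)+
      then show "e (x \<otimes> y) = e x + e y" by (rule uniq)
    next
      fix x assume x: "x \<in> ?E"
      have "x \<in> B \<longleftrightarrow> p s [^]\<^bsub>Q\<^esub> e x = \<one>\<^bsub>Q\<^esub>" using p(5)[of x] x ED e[OF x] by auto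
      then show "(e x = 0) = (x \<in> B)" using zero[of "e x"] by auto
    qed
    moreover have "s [^] (1::nat) \<notin> B" by (rule n[rule_format]) simp
    then have "s \<notin> B" using nat_pow_eone[OF D.mem_carrier[OF s]] by (simp only:) simp
    moreover have "s \<in> ?E" by (auto intro: generate.incl)
    ultimately show ?thesis unfolding cyclic_factor_def by blast
  qed
qed

lemma generated_chain:
  fixes f :: "nat \<Rightarrow> 'a"
  assumes D: "subgroup D G" and A: "subgroup A G" "A \<subseteq> D" "derived_set G D \<subseteq> A" and fm: "f ` {..<m} \<subseteq> D"
  defines "B \<equiv> \<lambda>t. generate G (A \<union> f ` {..<t})"
  shows "rank_chain m B" "B 0 = A" "t \<le> m \<Longrightarrow> B t \<subseteq> D" "t \<le> m \<Longrightarrow> A \<subseteq> B t"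
    "t < m \<Longrightarrow> \<forall>k>0. f t [^] (k::nat) \<notin> B t \<Longrightarrow> cyclic_factor (B t) (B (Suc t))"
proof -
  interpret D: subgroup D G by (rule D)
  have f: "f t \<in> D" if "t < m" for t using fm that by blast
  have inc: "A \<union> f ` {..<t} \<subseteq> D" if "t \<le> m" for t
    using A(2) order_trans[OF image_mono[of "{..<t}" "{..<m}" f] fm] that by auto
  have BD: "B t \<subseteq> D" if "t \<le> m" for t unfolding B_def by (rule generate_subgroup_incl[OF inc[OF that] D])
  have sB: "subgroup (B t) G" if "t \<le> m" for t
    unfolding B_def by (rule generate_is_subgroup[OF order_trans[OF inc[OF that] D.subset]])
  have AB: "A \<subseteq> B t" for t unfolding B_def by (auto intro: generate.incl)
  show "t \<le> m \<Longrightarrow> B t \<subseteq> D" "t \<le> m \<Longrightarrow> A \<subseteq> B t" using BD AB by blast+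
  show "B 0 = A"
  proof
    show "B 0 \<subseteq> A" unfolding B_def by (rule generate_subgroup_incl[OF _ A(1)]) simp
  qed (rule AB)
  have BS: "B (Suc t) = generate G (B t \<union> {f t})" if t: "t < m" for t
  proof
    have s: "subgroup (B (Suc t)) G" using sB[of "Suc t"] t by simp
    have "A \<union> f ` {..<t} \<subseteq> B (Suc t)" "f t \<in> B (Suc t)" unfolding B_def by (auto intro: generate.incl simp: less_Suc_eq)
    then have "B t \<union> {f t} \<subseteq> B (Suc t)" using generate_subgroup_incl[OF _ s] unfolding B_def by blast
    then show "generate G (B t \<union> {f t}) \<subseteq> B (Suc t)" by (rule generate_subgroup_incl[OF _ s])
    have sE: "subgroup (generate G (B t \<union> {f t})) G" by (rule generate_is_subgroup) (use BD[of t] f t D.subset in auto)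
    have "A \<union> f ` {..<Suc t} \<subseteq> generate G (B t \<union> {f t})"
    proof -
      have "A \<union> f ` {..<t} \<subseteq> B t" unfolding B_def by (auto intro: generate.incl)
      then have "A \<union> f ` {..<Suc t} \<subseteq> B t \<union> {f t}" unfolding lessThan_Suc by blast
      also have "\<dots> \<subseteq> generate G (B t \<union> {f t})" by (auto intro: generate.incl)
      finally show ?thesis .
    qed
    then have "generate G (A \<union> f ` {..<Suc t}) \<subseteq> generate G (B t \<union> {f t})" by (rule generate_subgroup_incl[OF _ sE])
    then show "B (Suc t) \<subseteq> generate G (B t \<union> {f t})" by (simp only: B_def)
  qed
  have dB: "derived_set G D \<subseteq> B t" for t using A(3) AB by blast
  have fac: "torsion_factor (B t) (B (Suc t)) \<or> cyclic_factor (B t) (B (Suc t))" if t: "t < m" for t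
    using adjoin_factor[OF D sB BD dB f[OF t], of t] t BS[OF t] by auto
  show "t < m \<Longrightarrow> \<forall>k>0. f t [^] (k::nat) \<notin> B t \<Longrightarrow> cyclic_factor (B t) (B (Suc t))"
    using adjoin_factor(2)[OF D sB BD dB f, of t] BS by simp
  show "rank_chain m B"
    unfolding rank_chain_def
  proof (intro conjI allI impI)
    fix t assume "t \<le> m"
    then show "subgroup (B t) G" by (rule sB)
  next
    fix t assume t: "t < m"
    show "B t \<subseteq> B (Suc t)" unfolding BS[OF t] by (auto intro: generate.incl)
    show "torsion_factor (B t) (B (Suc t)) \<or> cyclic_factor (B t) (B (Suc t))" by (rule fac[OF t])
    show "normalized_by (B (Suc t)) (B t)"
      unfolding normalized_by_def
    proof (intro ballI)
      fix g x assume "g \<in> B (Suc t)" and x: "x \<in> B t"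
      then have gx: "g \<in> D" "x \<in> D" using BD[of "Suc t"] BD[of t] t by auto
      have "commutator g x \<in> B t" using dB gx by blast
      then have "commutator g x \<otimes> x \<in> B t" using subgroup.m_closed[OF sB _ x] t by simp
      then show "conj_by g x \<in> B t" using gx by (simp add: m_assoc)
    qed
  qed
qed

text \<open>Consider sequences in which no positive power of a member lies in the subgroup generated
  by \<open>A\<close> and the earlier members. Such a sequence has length at most \<open>r\<close>,
  since \<open>cyclic_indices_le\<close> compares its chain with one generated by at most
  \<open>r\<close> elements. A longest one cannot be continued, so \<open>D\<close> is torsion over
  its last term.\<close>

lemma abelian_factor_chain:
  assumes r: "rank_at_most r" and D: "subgroup D G" and A: "subgroup A G" "A \<subseteq> D" "derived_set G D \<subseteq> A"
  obtains s B where "rank_chain s B" "B 0 = A" "B s \<subseteq> D" "\<forall>t<s. cyclic_factor (B t) (B (Suc t))" "torsion_factor (B s) D"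
proof -
  interpret D: subgroup D G by (rule D)
  define B where "B f t = generate G (A \<union> f ` {..<t})" for f :: "nat \<Rightarrow> 'a" and t :: nat
  define good where "good s f \<longleftrightarrow> (\<forall>t<s. f t \<in> D \<and> (\<forall>k>0. f t [^] (k::nat) \<notin> B f t))" for s f
  have bound: "s \<le> r" if g: "good s f" for s f
  proof -
    have fD: "f ` {..<s} \<subseteq> D" using g by (auto simp: good_def)
    note Bc = generated_chain[OF D A fD, folded B_def]
    have cyc: "cyclic_factor (B f t) (B f (Suc t))" if "t < s" for t
      using Bc(5)[OF that] g that by (simp add: good_def)
    define T where "T = f ` {..<s}"
    have TD: "T \<subseteq> D" unfolding T_def by (rule fD)
    have "finite T" "T \<subseteq> carrier G" using TD D.subset by (auto simp: T_def)
    then obtain S where S: "finite S" "card S \<le> r" "S \<subseteq> carrier G" "generate G S = generate G T"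
      using r unfolding rank_at_most_def by metis
    obtain ys where ys: "set ys = S" "distinct ys" using finite_distinct_list[OF S(1)] by blast
    have "generate G T \<subseteq> D" by (rule generate_subgroup_incl[OF TD D])
    then have SD: "S \<subseteq> D" using S(4) by (metis generate.incl subset_iff)
    have im: "(!) ys ` {..<length ys} = S" using ys(1) by (auto simp: set_conv_nth)
    then have yD: "(!) ys ` {..<length ys} \<subseteq> D" using SD by blast
    note Nc = generated_chain[OF D A yD, folded B_def]
    have "card (cyclic_indices s (B f)) \<le> card (cyclic_indices (length ys) (B ((!) ys)))"
    proof (rule cyclic_indices_le[OF Nc(1) Bc(1)])
      show "B f s \<subseteq> B ((!) ys) (length ys)"
      proof -
        have sN: "subgroup (B ((!) ys) (length ys)) G" using rank_chainD(1)[OF Nc(1)] by simp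
        have "S \<subseteq> B ((!) ys) (length ys)" unfolding B_def im by (auto intro: generate.incl)
        then have "generate G T \<subseteq> B ((!) ys) (length ys)" unfolding S(4)[symmetric] by (rule generate_subgroup_incl[OF _ sN])
        then have "T \<subseteq> B ((!) ys) (length ys)" by (metis generate.incl subset_iff)
        then have "A \<union> T \<subseteq> B ((!) ys) (length ys)" using Nc(4)[of "length ys"] by simp
        then show ?thesis unfolding B_def[of f] T_def by (rule generate_subgroup_incl[OF _ sN])
      qed
      show "B ((!) ys) 0 \<inter> B f s \<subseteq> B f 0" by (simp add: Nc(2) Bc(2))
    qed
    moreover have "cyclic_indices s (B f) = {..<s}" using cyc by (auto simp: cyclic_indices_def)
    moreover have "card (cyclic_indices (length ys) (B ((!) ys))) \<le> card {..<length ys}"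
      by (rule card_mono) (auto simp: cyclic_indices_def)
    moreover have "length ys \<le> r" using S(2) ys distinct_card by metis
    ultimately show ?thesis by simp
  qed
  define P where "P s \<longleftrightarrow> (\<exists>f. good s f)" for s
  have "P 0" by (simp add: P_def good_def)
  moreover have "\<forall>s. P s \<longrightarrow> s \<le> r" using bound by (auto simp: P_def)
  ultimately obtain s where s: "P s" "\<And>t. P t \<Longrightarrow> t \<le> s" using GreatestI_nat[of P 0 r] Greatest_le_nat[of P _ r] by blast
  obtain f where f: "good s f" using s(1) by (auto simp: P_def)
  have fD: "f ` {..<s} \<subseteq> D" using f by (auto simp: good_def)
  note Bc = generated_chain[OF D A fD, folded B_def]
  have cyc: "\<forall>t<s. cyclic_factor (B f t) (B f (Suc t))"
    using Bc(5) f by (simp add: good_def)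
  have "torsion_factor (B f s) D"
    unfolding torsion_factor_def
  proof (rule ballI, rule ccontr)
    fix x assume x: "x \<in> D" and n: "\<not> (\<exists>k>0. x [^] (k::nat) \<in> B f s)"
    define g where "g = f(s := x)"
    have Bg: "B g t = B f t" if "t \<le> s" for t
    proof -
      have "g ` {..<t} = f ` {..<t}" using that by (auto simp: g_def)
      then show ?thesis by (simp only: B_def)
    qed
    have "good (Suc s) g"
      unfolding good_def
    proof (intro allI impI)
      fix t assume t: "t < Suc s"
      show "g t \<in> D \<and> (\<forall>k>0. g t [^] (k::nat) \<notin> B g t)"
      proof (cases "t = s")
        case True
        have "\<forall>k>0. x [^] (k::nat) \<notin> B f s" using n by blast
        then show ?thesis using x Bg[of s] True by (simp add: g_def)
      next
        case False
        then have "t < s" using t by simp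
        moreover have "B g t = B f t" using Bg[of t] t by simp
        moreover have "g t = f t" using False by (simp add: g_def)
        ultimately show ?thesis using f unfolding good_def by metis
      qed
    qed
    then have "\<exists>f. good (Suc s) f" by (rule exI[of _ g])
    then have "P (Suc s)" by (simp only: P_def)
    then have "Suc s \<le> s" by (rule s(2))
    then show False by simp
  qed
  then show thesis using that[OF Bc(1,2) _ cyc] Bc(3)[of s] by simp
qed

lemma rank_chain_append:
  assumes N: "rank_chain m N" and L: "rank_chain k L" and NL: "N m = L 0"
  shows "rank_chain (m + k) (\<lambda>i. if i \<le> m then N i else L (i - m))" (is "rank_chain _ ?C")
proof -
  note N' = rank_chainD[OF N] and L' = rank_chainD[OF L]
  have lo: "?C i = N i" "?C (Suc i) = N (Suc i)" if "i < m" for i using that by simp_all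
  have hi: "?C i = L (i - m)" "?C (Suc i) = L (Suc (i - m))" if "\<not> i < m" for i
    using that NL Suc_diff_le[of m i] by (cases "i = m"; simp)+
  show ?thesis
    unfolding rank_chain_def
  proof (intro conjI allI impI)
    fix i assume "i \<le> m + k"
    then show "subgroup (?C i) G" using N'(1)[of i] L'(1)[of "i - m"] by auto
  next
    fix i assume i: "i < m + k"
    let ?factor = "\<lambda>A B. A \<subseteq> B \<and> normalized_by B A \<and> (torsion_factor A B \<or> cyclic_factor A B)"
    have all: "?factor (?C i) (?C (Suc i))"
    proof (cases "i < m")
      case True
      show ?thesis
        unfolding lo[OF True] using N'(2-4)[OF True] by blast
    next
      case False
      then have im: "i - m < k" using i by simp
      show ?thesis
        unfolding hi[OF False] using L'(2-4)[OF im] by blast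
    qed
    show "?C i \<subseteq> ?C (Suc i)" by (rule all[THEN conjunct1])
    show "normalized_by (?C (Suc i)) (?C i)" by (rule all[THEN conjunct2, THEN conjunct1])
    show "torsion_factor (?C i) (?C (Suc i)) \<or> cyclic_factor (?C i) (?C (Suc i))" by (rule all[THEN conjunct2, THEN conjunct2])
  qed
qed

lemma rank_chain_extend:
  assumes N: "rank_chain m N" and D: "subgroup D G" "N m \<subseteq> D" "normalized_by D (N m)" "torsion_factor (N m) D"
  shows "rank_chain (Suc m) (\<lambda>i. if i \<le> m then N i else D)"
proof -
  have "rank_chain 1 (\<lambda>i. if i = 0 then N m else D)"
    using D rank_chainD(1)[OF N, of m] by (simp add: rank_chain_def less_Suc_eq le_Suc_eq)
  from rank_chain_append[OF N this] have "rank_chain (m + 1) (\<lambda>i. if i \<le> m then N i else if i - m = 0 then N m else D)" by simp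
  moreover have "(\<lambda>i. if i \<le> m then N i else if i - m = 0 then N m else D) = (\<lambda>i. if i \<le> m then N i else D)" by (intro ext) simp
  ultimately show ?thesis by simp
qed

section \<open>Subgroups that meet every cyclic factor\<close>

definition meets_cyclic_factors :: "'a set \<Rightarrow> nat \<Rightarrow> (nat \<Rightarrow> 'a set) \<Rightarrow> bool"
  where "meets_cyclic_factors H m N \<longleftrightarrow> (\<forall>i<m. cyclic_factor (N i) (N (Suc i)) \<longrightarrow> \<not> H \<inter> N (Suc i) \<subseteq> N i)"

text \<open>Given \<open>y\<close> in \<open>B (Suc t)\<close>, take \<open>h\<close> in
  \<open>H\<close> there with non-zero exponent; then \<open>w = y^(e h) h^(- e y)\<close> lies in
  the lower term and by induction has a power in \<open>X\<close>. Modulo \<open>X\<close> the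
  factor from \<open>H\<close> disappears, so a power of \<open>y\<close> with non-zero exponent
  lies in \<open>X\<close>.\<close>

lemma meets_imp_torsion:
  assumes D: "subgroup D G" and A: "subgroup A G" "A \<subseteq> D" "derived_set G D \<subseteq> A"
    and B: "rank_chain s B" "B 0 = A" "B s \<subseteq> D" "torsion_factor (B s) D" "\<forall>t<s. cyclic_factor (B t) (B (Suc t))"
    and H: "subgroup H G" "meets_cyclic_factors H s B"
    and X: "subgroup X G" "A \<subseteq> X" "X \<subseteq> D" "H \<inter> D \<subseteq> X" and x: "x \<in> D"
  shows "\<exists>k>0. x [^] (k::nat) \<in> X"
proof -
  interpret D: subgroup D G by (rule D)
  have dX: "derived_set G D \<subseteq> X" using A(3) X(2) by blast
  obtain Q p where Q': "abelian_projection D X Q p"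
    by (rule abelian_quotient[OF D X(1,3) dX])
  note Q = abelian_projectionD(1)[OF Q'] and p = abelian_projectionD(2-)[OF Q']
  interpret Q: comm_group Q by (rule Q)
  have BD: "B t \<subseteq> D" and sB: "subgroup (B t) G" if "t \<le> s" for t
    using rank_chainD(1,5)[OF B(1)] that B(3) by blast+
  have step: "\<exists>k>0. y [^] (k::nat) \<in> X" if "t \<le> s" "y \<in> B t" for t y
    using that
  proof (induction t arbitrary: y)
    case 0
    then have "y \<in> X" "y \<in> carrier G" using B(2) X(2,3) D.subset by blast+
    then have "y [^] (1::nat) \<in> X" by simp
    then show ?case by (intro exI[of _ 1]) simp
  next
    case (Suc t)
    have t: "t < s" "t \<le> s" using Suc.prems(1) by simp_all
    note sS = sB[OF Suc.prems(1)]
    obtain e where e: "exponent_map (B t) (B (Suc t)) e" using B(5) t(1) unfolding cyclic_factor_def by blast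
    obtain h where h: "h \<in> H" "h \<in> B (Suc t)" "h \<notin> B t"
      using H(2) B(5) t(1) unfolding meets_cyclic_factors_def by blast
    have eh: "e h \<noteq> 0" using e h(2,3) by (simp add: exponent_map_def)
    define w where "w = y [^] e h \<otimes> h [^] (- e y)"
    have yh: "y [^] e h \<in> B (Suc t)" "h [^] (- e y) \<in> B (Suc t)"
      by (rule int_pow_in_subgroup[OF sS Suc.prems(2)], rule int_pow_in_subgroup[OF sS h(2)])
    have "e w = e h * e y + - e y * e h"
      unfolding w_def using e yh exponent_map_pow(4)[OF sS e Suc.prems(2)] exponent_map_pow(4)[OF sS e h(2)]
      by (simp add: exponent_map_def)
    moreover have wS: "w \<in> B (Suc t)" unfolding w_def by (rule subgroup.m_closed[OF sS yh])
    ultimately have "w \<in> B t" using e by (simp add: exponent_map_def)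
    then obtain k :: nat where k: "k > 0" "w [^] k \<in> X" using Suc.IH[OF t(2)] by blast
    have yD: "y \<in> D" and hD: "h \<in> D" and wD: "w \<in> D" using BD[OF Suc.prems(1)] Suc.prems(2) h(2) wS by blast+
    note D' = int_pow_in_subgroup[OF D]
    have py: "p y \<in> carrier Q" by (rule p(1)[OF yD])
    have "p h = \<one>\<^bsub>Q\<^esub>" using p(5)[OF hD] X(4) h(1) hD by blast
    then have "p (h [^] (- e y)) = \<one>\<^bsub>Q\<^esub>" using p(4)[OF hD, of "- e y"] by simp
    then have "p w = p y [^]\<^bsub>Q\<^esub> e h" unfolding w_def using p(2)[OF D'[OF yD] D'[OF hD], of "e h" "- e y"] p(4)[OF yD, of "e h"] py by simp
    moreover have "p w [^]\<^bsub>Q\<^esub> int k = \<one>\<^bsub>Q\<^esub>"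
      using p(3)[OF wD, of k] p(5)[OF pow_in_subgroup[OF D wD], of k] k(2) by (simp only: int_pow_int)
    ultimately have "p y [^]\<^bsub>Q\<^esub> (e h * int k) = \<one>\<^bsub>Q\<^esub>" by (simp only: Q.int_pow_pow[OF py])
    then have "y [^] (e h * int k) \<in> X" using p(4)[OF yD, of "e h * int k"] p(5)[OF D'[OF yD], of "e h * int k"] by simp
    then have "y [^] nat \<bar>e h * int k\<bar> \<in> X" by (rule int_pow_mem_imp_nat_pow_mem[OF X(1) D.mem_carrier[OF yD]])
    moreover have "nat \<bar>e h * int k\<bar> > 0" using eh k(1) by simp
    ultimately show ?case by blast
  qed
  obtain k :: nat where k: "k > 0" "x [^] k \<in> B s" using B(4) x unfolding torsion_factor_def by blast
  obtain l :: nat where l: "l > 0" "(x [^] k) [^] l \<in> X" using step[OF order_refl k(2)] by blast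
  have "x [^] (k * l) \<in> X" using l(2) nat_pow_pow[OF D.mem_carrier[OF x], of k l] by (simp only:)
  then show ?thesis using k(1) l(1) by (intro exI[of _ "k * l"]) simp
qed

text \<open>Each abelian factor contributes its cyclic steps and one torsion step on top. The
  conclusion about \<open>H\<close> is part of the induction, because one chain has to serve all
  subgroups \<open>H\<close> alike.\<close>

lemma solvable_chain:
  assumes r: "rank_at_most r" and A0: "A 0 = {\<one>}"
    and A: "\<And>j. j \<le> d \<Longrightarrow> A j \<lhd> G" "\<And>j. j < d \<Longrightarrow> A j \<subseteq> A (Suc j)" "\<And>j. j < d \<Longrightarrow> derived_set G (A (Suc j)) \<subseteq> A j"
  shows "\<exists>m N. rank_chain m N \<and> N 0 = {\<one>} \<and> N m = A d \<and>
    (\<forall>H. subgroup H G \<longrightarrow> meets_cyclic_factors H m N \<longrightarrow>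
      (\<forall>j<d. \<forall>x\<in>A (Suc j). \<exists>k>0. x [^] (k::nat) \<in> A j <#> (H \<inter> A (Suc j))))"
  using A
proof (induction d)
  case 0
  have "rank_chain 0 (\<lambda>_. {\<one>})" by (simp add: rank_chain_def triv_subgroup)
  then show ?case using A0 by (intro exI[of _ 0] exI[of _ "\<lambda>_. {\<one>}"]) simp
next
  case (Suc d)
  have "\<exists>m N. rank_chain m N \<and> N 0 = {\<one>} \<and> N m = A d \<and>
    (\<forall>H. subgroup H G \<longrightarrow> meets_cyclic_factors H m N \<longrightarrow>
      (\<forall>j<d. \<forall>x\<in>A (Suc j). \<exists>k>0. x [^] (k::nat) \<in> A j <#> (H \<inter> A (Suc j))))"
    by (rule Suc.IH) (use Suc.prems in simp_all)
  then obtain m N where N: "rank_chain m N" "N 0 = {\<one>}" "N m = A d"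
    and NH: "\<forall>H. subgroup H G \<longrightarrow> meets_cyclic_factors H m N \<longrightarrow>
      (\<forall>j<d. \<forall>x\<in>A (Suc j). \<exists>k>0. x [^] (k::nat) \<in> A j <#> (H \<inter> A (Suc j)))"
    by (elim exE conjE)
  let ?D = "A (Suc d)" and ?A = "A d"
  have nA: "?A \<lhd> G" and nD: "?D \<lhd> G" using Suc.prems(1) by simp_all
  have sA: "subgroup ?A G" and sD: "subgroup ?D G" by (rule normal_imp_subgroup, rule nA, rule normal_imp_subgroup, rule nD)
  have AD: "?A \<subseteq> ?D" and dA: "derived_set G ?D \<subseteq> ?A" using Suc.prems(2,3) by simp_all
  obtain s B where B: "rank_chain s B" "B 0 = ?A" "B s \<subseteq> ?D" "\<forall>t<s. cyclic_factor (B t) (B (Suc t))" "torsion_factor (B s) ?D"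
    by (rule abelian_factor_chain[OF r sD sA AD dA])
  have AB: "?A \<subseteq> B s" using rank_chainD(5)[OF B(1), of 0 s] B(2) by simp
  have "normalized_by ?D (B s)"
    unfolding normalized_by_def
  proof (intro ballI)
    fix g x assume g: "g \<in> ?D" and x: "x \<in> B s"
    have xD: "x \<in> ?D" using x B(3) by blast
    have c: "g \<in> carrier G" "x \<in> carrier G" using g xD subgroup.subset[OF sD] by blast+
    have "commutator g x \<in> B s" using dA AB g xD by blast
    then have "commutator g x \<otimes> x \<in> B s" using subgroup.m_closed[OF rank_chainD(1)[OF B(1) order_refl] _ x] by blast
    then show "conj_by g x \<in> B s" using c by (simp add: m_assoc)
  qed
  then have L: "rank_chain (Suc s) (\<lambda>i. if i \<le> s then B i else ?D)" (is "rank_chain _ ?L") by (rule rank_chain_extend[OF B(1) sD B(3) _ B(5)])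
  have NL: "N m = ?L 0" using N(3) B(2) by simp
  let ?C = "\<lambda>i. if i \<le> m then N i else ?L (i - m)"
  have C: "rank_chain (m + Suc s) ?C" by (rule rank_chain_append[OF N(1) L NL])
  have "\<exists>k>0. x [^] (k::nat) \<in> A j <#> (H \<inter> A (Suc j))"
    if H: "subgroup H G" "meets_cyclic_factors H (m + Suc s) ?C" and j: "j < Suc d" and x: "x \<in> A (Suc j)" for H j x
  proof (cases "j < d")
    case True
    have "meets_cyclic_factors H m N"
      unfolding meets_cyclic_factors_def
    proof (intro allI impI)
      fix i assume i: "i < m" and c: "cyclic_factor (N i) (N (Suc i))"
      then show "\<not> H \<inter> N (Suc i) \<subseteq> N i" using H(2)[unfolded meets_cyclic_factors_def, rule_format, of i] by simp
    qed
    then show ?thesis using NH H(1) True x by blast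
  next
    case False
    then have jd: "j = d" using j by simp
    have mB: "meets_cyclic_factors H s B"
      unfolding meets_cyclic_factors_def
    proof (intro allI impI)
      fix t assume t: "t < s" and c: "cyclic_factor (B t) (B (Suc t))"
      \<comment> \<open>At \<open>t = 0\<close> the joined chain takes the value \<open>N m\<close>,
        which is \<open>B 0\<close>.\<close>
      have e: "?C (m + t) = B t" using t N(3) B(2) by (cases "t = 0") simp_all
      have e': "?C (Suc (m + t)) = B (Suc t)" using t by simp
      have "\<not> H \<inter> ?C (Suc (m + t)) \<subseteq> ?C (m + t)"
      proof (rule H(2)[unfolded meets_cyclic_factors_def, rule_format])
        show "m + t < m + Suc s" using t by simp
        show "cyclic_factor (?C (m + t)) (?C (Suc (m + t)))" unfolding e e' by (rule c)
      qed
      then show "\<not> H \<inter> B (Suc t) \<subseteq> B t" unfolding e e' .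
    qed
    note X = set_mult_normal[OF nA subgroups_Inter_pair[OF H(1) sD]]
    have XD: "?A <#> (H \<inter> ?D) \<subseteq> ?D"
      unfolding set_mult_def using AD subgroup.m_closed[OF sD] by blast
    show ?thesis
      unfolding jd by (rule meets_imp_torsion[OF sD sA AD dA B(1,2,3,5,4) H(1) mB X(1,2) XD X(3)]) (use x jd in simp)
  qed
  moreover have "?C 0 = {\<one>}" "?C (m + Suc s) = ?D" using N(2) by simp_all
  ultimately show ?case using C by (intro exI[of _ "m + Suc s"] exI[of _ ?C]) blast
qed

lemma finite_index_imp_power_mem:
  assumes H: "subgroup H G" "finite (rcosets H)" and x: "x \<in> carrier G"
  shows "\<exists>k>0. x [^] (k::nat) \<in> H"
proof -
  have "(\<lambda>k::nat. H #> x [^] k) ` UNIV \<subseteq> rcosets H" using x by (auto simp: rcosets_eq_image)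
  then have "finite ((\<lambda>k::nat. H #> x [^] k) ` UNIV)" using H(2) by (rule finite_subset)
  then have "\<not> inj (\<lambda>k::nat. H #> x [^] k)" using finite_imageD infinite_UNIV_nat by blast
  then obtain i j :: nat where "i \<noteq> j" "H #> x [^] i = H #> x [^] j" unfolding inj_def by blast
  then obtain i j :: nat where ij: "i < j" "H #> x [^] j = H #> x [^] i" by (metis linorder_neqE_nat)
  have "x [^] j \<otimes> inv (x [^] i) \<in> H" using rcos_eq_iff[OF H(1), of "x [^] j" "x [^] i"] ij(2) x by simp
  moreover have "x [^] j = x [^] (j - i) \<otimes> x [^] i" using ij(1) x by (simp add: nat_pow_mult)
  ultimately have "x [^] (j - i) \<in> H" using x by (simp add: m_assoc)
  then show ?thesis using ij(1) by (intro exI[of _ "j - i"]) simp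
qed

text \<open>The cyclic indices of the chain cut down to \<open>H\<close> are among those of the
  chain itself, so the Hirsch numbers agree iff \<open>H\<close> meets every cyclic factor. Finite
  index implies this, as some positive power of every element is in \<open>H\<close> and keeps a
  non-zero exponent; the converse is the descent.\<close>

theorem finite_index_iff_Hirsch_number_eq:
  assumes S: "finite S" "S \<subseteq> carrier G" "generate G S = carrier G" and r: "rank_at_most r" and H: "subgroup H G"
    and A0: "A 0 = {\<one>}" and A: "\<And>j. j \<le> d \<Longrightarrow> A j \<lhd> G" "\<And>j. j < d \<Longrightarrow> A j \<subseteq> A (Suc j)"
    "\<And>j. j < d \<Longrightarrow> derived_set G (A (Suc j)) \<subseteq> A j" and fin: "finite (rcosets (A d))"
  shows "finite (rcosets H) \<longleftrightarrow> Hirsch_number (G\<lparr>carrier := H\<rparr>) = Hirsch_number G"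
proof -
  obtain m N where N: "rank_chain m N" "N 0 = {\<one>}" "N m = A d"
    and NH: "\<forall>H. subgroup H G \<longrightarrow> meets_cyclic_factors H m N \<longrightarrow>
      (\<forall>j<d. \<forall>x\<in>A (Suc j). \<exists>k>0. x [^] (k::nat) \<in> A j <#> (H \<inter> A (Suc j)))"
    using solvable_chain[where A = A and d = d, OF r A0 A(1) A(2) A(3)] by auto
  have nA: "A d \<lhd> G" by (rule A(1)) simp
  have sA: "subgroup (A d) G" by (rule normal_imp_subgroup[OF nA])
  \<comment> \<open>\<open>A d\<close> has finite index, so the step from it to the whole group is a
    torsion factor and does not count.\<close>
  let ?N = "\<lambda>i. if i \<le> m then N i else carrier G"
  have ch': "rank_chain (Suc m) ?N"
  proof (rule rank_chain_extend[OF N(1) subgroup_self])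
    show "N m \<subseteq> carrier G" unfolding N(3) by (rule subgroup.subset[OF sA])
    show "normalized_by (carrier G) (N m)"
      unfolding N(3) normalized_by_def by (intro ballI) (rule normal.inv_op_closed2[OF nA])
    show "torsion_factor (N m) (carrier G)"
      unfolding N(3) torsion_factor_def by (intro ballI) (rule finite_index_imp_power_mem[OF sA fin])
  qed
  define M where "M = ?N"
  have ch: "rank_chain (Suc m) M" unfolding M_def by (rule ch')
  have MN: "M i = N i" if "i \<le> m" for i using that by (simp add: M_def)
  have N0: "M 0 = {\<one>}" and Nm: "M (Suc m) = carrier G" using N(2) by (simp_all add: M_def)
  have hG: "Hirsch_number G = card (cyclic_indices (Suc m) M)"
    using Hirsch_number_eq[OF subgroup_self ch N0 Nm] by simp
  note I = rank_chain_Int[OF H ch]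
  have "H \<inter> M 0 = {\<one>}" "H \<inter> M (Suc m) = H" using N0 Nm subgroup.one_closed[OF H] subgroup.subset[OF H] by auto
  then have hH: "Hirsch_number (G\<lparr>carrier := H\<rparr>) = card (cyclic_indices (Suc m) (\<lambda>i. H \<inter> M i))"
    by (rule Hirsch_number_eq[OF H I(1)])
  have sub: "cyclic_indices (Suc m) (\<lambda>i. H \<inter> M i) \<subseteq> cyclic_indices (Suc m) M" unfolding I(2) by blast
  have eq: "Hirsch_number (G\<lparr>carrier := H\<rparr>) = Hirsch_number G \<longleftrightarrow> meets_cyclic_factors H (Suc m) M"
  proof
    assume "Hirsch_number (G\<lparr>carrier := H\<rparr>) = Hirsch_number G"
    then have "card (cyclic_indices (Suc m) (\<lambda>i. H \<inter> M i)) = card (cyclic_indices (Suc m) M)" by (simp only: hG hH)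
    then have e: "cyclic_indices (Suc m) (\<lambda>i. H \<inter> M i) = cyclic_indices (Suc m) M"
      by (rule card_subset_eq[OF finite_cyclic_indices sub])
    show "meets_cyclic_factors H (Suc m) M"
      unfolding meets_cyclic_factors_def
    proof (intro allI impI)
      fix i assume "i < Suc m" "cyclic_factor (M i) (M (Suc i))"
      then have "i \<in> cyclic_indices (Suc m) M" unfolding cyclic_indices_def by blast
      then have "i \<in> cyclic_indices (Suc m) (\<lambda>i. H \<inter> M i)" unfolding e .
      then show "\<not> H \<inter> M (Suc i) \<subseteq> M i" unfolding I(2) by blast
    qed
  next
    assume mt: "meets_cyclic_factors H (Suc m) M"
    have "cyclic_indices (Suc m) M \<subseteq> cyclic_indices (Suc m) (\<lambda>i. H \<inter> M i)"
    proof
      fix i assume i: "i \<in> cyclic_indices (Suc m) M"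
      then have "\<not> H \<inter> M (Suc i) \<subseteq> M i" using mt unfolding cyclic_indices_def meets_cyclic_factors_def by blast
      then show "i \<in> cyclic_indices (Suc m) (\<lambda>i. H \<inter> M i)" unfolding I(2) using i by blast
    qed
    then have "cyclic_indices (Suc m) (\<lambda>i. H \<inter> M i) = cyclic_indices (Suc m) M" using sub by blast
    then show "Hirsch_number (G\<lparr>carrier := H\<rparr>) = Hirsch_number G" by (simp only: hG hH)
  qed
  show ?thesis
    unfolding eq
  proof
    assume fH: "finite (rcosets H)"
    show "meets_cyclic_factors H (Suc m) M"
      unfolding meets_cyclic_factors_def
    proof (intro allI impI)
      fix i assume i: "i < Suc m" and c: "cyclic_factor (M i) (M (Suc i))"
      have s: "subgroup (M (Suc i)) G" by (rule rank_chainD(1)[OF ch]) (use i in simp)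
      obtain e x where e: "exponent_map (M i) (M (Suc i)) e" and x: "x \<in> M (Suc i)" "x \<notin> M i"
        using c unfolding cyclic_factor_def by blast
      obtain k :: nat where k: "k > 0" "x [^] k \<in> H"
        using finite_index_imp_power_mem[OF H fH subgroup.mem_carrier[OF s x(1)]] by blast
      have xk: "x [^] k \<in> M (Suc i)" by (rule pow_in_subgroup[OF s x(1)])
      have "e x \<noteq> 0" using e x unfolding exponent_map_def by blast
      then have "e (x [^] k) \<noteq> 0" using exponent_map_pow(3)[OF s e x(1), of k] k(1) by simp
      then have "x [^] k \<notin> M i" using e xk unfolding exponent_map_def by blast
      then show "\<not> H \<inter> M (Suc i) \<subseteq> M i" using k(2) xk by blast
    qed
  next
    assume mt: "meets_cyclic_factors H (Suc m) M"
    have "meets_cyclic_factors H m N"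
      unfolding meets_cyclic_factors_def
    proof (intro allI impI)
      fix i assume i: "i < m" and c: "cyclic_factor (N i) (N (Suc i))"
      then show "\<not> H \<inter> N (Suc i) \<subseteq> N i" using mt[unfolded meets_cyclic_factors_def, rule_format, of i] MN[of i] MN[of "Suc i"] by simp
    qed
    then have t: "\<forall>j<d. \<forall>x\<in>A (Suc j). \<exists>k>0. x [^] (k::nat) \<in> A j <#> (H \<inter> A (Suc j))" using NH H by blast
    show "finite (rcosets H)"
      by (rule finite_index_descent[OF S r H A A0 fin]) (use t in blast)+
  qed
qed

end

theorem corollary3p3:
  fixes n :: nat and G H :: "'f::field mat set"
  assumes "infinite (UNIV :: 'f set)"
    and "n > 0"
    and "subgroup G (GL n)"
    and "subgroup H (GL n\<lparr>carrier := G\<rparr>)"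
    and "finitely_generated_group (GL n\<lparr>carrier := G\<rparr>)"
    and "finite_Pruefer_rank (GL n\<lparr>carrier := G\<rparr>)"
  shows "finite (rcosets\<^bsub>GL n\<lparr>carrier := G\<rparr>\<^esub> H) \<longleftrightarrow>
    Hirsch_number (GL n\<lparr>carrier := H\<rparr>) = Hirsch_number (GL n\<lparr>carrier := G\<rparr>)"
proof -
  define K where "K = GL n\<lparr>carrier := G\<rparr>"
  interpret K: group K unfolding K_def by (rule group.subgroup_imp_group[OF group_GL assms(3)])
  have one: "\<one>\<^bsub>K\<^esub> = 1\<^sub>m n" by (simp add: K_def GL_simps)
  obtain S where S: "finite S" "S \<subseteq> carrier K" "generate K S = carrier K"
    using assms(5) unfolding finitely_generated_group_def K_def by blast
  obtain r where r: "K.rank_at_most r" by (rule K.rank_at_most_exists) (use assms(6) in \<open>simp only: K_def\<close>)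
  obtain V where V: "V \<lhd> K" "finite (rcosets\<^bsub>K\<^esub> V)" "(derived K ^^ (4 * n + 1)) V \<subseteq> {1\<^sub>m n}"
    by (rule linear_virtually_solvable[OF assms(3,5,6), folded K_def])
  define d where "d = 4 * n + 1"
  \<comment> \<open>The derived series of \<open>V\<close> numbered from below, with
    \<open>A 0\<close> trivial and \<open>A d = V\<close>; its terms are normal in the whole group
    because \<open>V\<close> is.\<close>
  define A where "A j = (derived K ^^ (d - j)) V" for j
  have nD: "(derived K ^^ k) V \<lhd> K" for k
    by (induction k) (simp_all add: V(1) K.derived_is_normal)
  have A: "A j \<lhd> K" for j unfolding A_def by (rule nD)
  have sA: "subgroup (A j) K" for j by (rule normal_imp_subgroup[OF A])
  have step: "A j = derived K (A (Suc j))" if "j < d" for j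
  proof -
    have "d - j = Suc (d - Suc j)" using that by simp
    then show ?thesis unfolding A_def by simp
  qed
  have A0: "A 0 = {\<one>\<^bsub>K\<^esub>}"
    using V(3) subgroup.one_closed[OF sA[of 0]] by (auto simp: A_def d_def one)
  have Ad: "A d = V" by (simp add: A_def)
  have "finite (rcosets\<^bsub>K\<^esub> H) \<longleftrightarrow> Hirsch_number (K\<lparr>carrier := H\<rparr>) = Hirsch_number K"
  proof (rule K.finite_index_iff_Hirsch_number_eq[where A = A and d = d, OF S r])
    show "subgroup H K" using assms(4) by (simp only: K_def)
    show "A 0 = {\<one>\<^bsub>K\<^esub>}" by (rule A0)
    show "A j \<lhd> K" for j by (rule A)
    show "A j \<subseteq> A (Suc j)" if "j < d" for j
      unfolding step[OF that] by (rule K.derived_incl[OF order_refl sA])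
    show "derived_set K (A (Suc j)) \<subseteq> A j" if "j < d" for j
      unfolding step[OF that] derived_def by (rule subsetI) (rule generate.incl)
    show "finite (rcosets\<^bsub>K\<^esub> (A d))" unfolding Ad by (rule V(2))
  qed
  moreover have "K\<lparr>carrier := H\<rparr> = GL n\<lparr>carrier := H\<rparr>" by (simp add: K_def)
  ultimately show ?thesis by (simp only: K_def)
qed

end
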